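(* Let $n\ge 2$. Let $m$ be a bounded function on $\mathbb{R}^n\times\mathbb{N}$ and assume that the Hermite pseudo-multiplier $m(x,H)$ is bounded on $L^2(\mathbb{R}^n)$. Suppose that for each $j=0,1,2,\ldots,n+1$ there is a constant $C_j$ such that for all $k$ $$\sup_{x\in\mathbb{R}^n}|\Delta^j m(x,k)|\le C_j(2k+n)^{-j}.$$ Then $m(x,H)$ is of weak type $(1,1)$ and consequently bounded on $L^p(\mathbb{R}^n)$ for $1<p<2$.
   Context: $H=-\Delta_{\mathbb{R}^n}+|x|^2$ is the Hermite operator on $\mathbb{R}^n$ (here $\Delta_{\mathbb{R}^n}$ is the Laplacian), with spectral resolution $H=\sum_{k=0}^\infty(2k+n)P_k$, where $P_k$ is the orthogonal projection of $L^2(\mathbb{R}^n)$ onto the $k$-th eigenspace of $H$, corresponding to the eigenvalue $2k+n$. For a bounded function $m$ on $\mathbb{R}^n\times\mathbb{N}$, the Hermite pseudo-multiplier is the densely defined operator $m(x,H)f(x)=\sum_{k=0}^\infty m(x,2k+n)P_kf(x)$. Finite differences act in the second variable: $\Delta m(x,k)=m(x,k+1)-m(x,k)$, $\Delta^0m=m$, and $\Delta^jm(x,k)=\Delta(\Delta^{j-1}m(x,k))$ for $j\ge 2$. *)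

theory Defs
  imports "HOL-Analysis.Analysis"
begin

text \<open>
  Functions on \<open>\<real>\<^sup>n\<close> are complex valued and Lebesgue measurable. Elements of \<open>L\<^sup>p\<close> are
  represented by functions, not by classes modulo null sets. Membership is always required
  next to a use of \<open>Lp_norm\<close>, since the integral of a non-integrable function is \<open>0\<close> in
  HOL-Analysis.
\<close>

definition Lp :: "real \<Rightarrow> ('a::euclidean_space \<Rightarrow> complex) set" where
  "Lp p = {f \<in> borel_measurable lebesgue. integrable lebesgue (\<lambda>x. norm (f x) powr p)}"

definition Lp_norm :: "real \<Rightarrow> ('a::euclidean_space \<Rightarrow> complex) \<Rightarrow> real" where
  "Lp_norm p f = (LINT x|lebesgue. norm (f x) powr p) powr (1 / p)"

definition L2_inner :: "('a::euclidean_space \<Rightarrow> complex) \<Rightarrow> ('a \<Rightarrow> complex) \<Rightarrow> complex" where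
  "L2_inner f g = (LINT x|lebesgue. f x * cnj (g x))"

definition partial_deriv :: "'a::euclidean_space \<Rightarrow> ('a \<Rightarrow> complex) \<Rightarrow> 'a \<Rightarrow> complex" where
  "partial_deriv b f x = frechet_derivative f (at x) b"

definition C2 :: "('a::euclidean_space \<Rightarrow> complex) \<Rightarrow> bool" where
  "C2 f \<longleftrightarrow> (\<forall>x. f differentiable (at x)) \<and>
     (\<forall>b\<in>Basis. (\<forall>x. partial_deriv b f differentiable (at x)) \<and>
        (\<forall>c\<in>Basis. continuous_on UNIV (partial_deriv c (partial_deriv b f))))"

definition laplacian :: "('a::euclidean_space \<Rightarrow> complex) \<Rightarrow> 'a \<Rightarrow> complex" where
  "laplacian f x = (\<Sum>b\<in>Basis. partial_deriv b (partial_deriv b f) x)"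

definition hermite_op :: "('a::euclidean_space \<Rightarrow> complex) \<Rightarrow> 'a \<Rightarrow> complex" where
  "hermite_op f x = - laplacian f x + of_real ((norm x)\<^sup>2) * f x"

text \<open>
  Every \<open>L\<^sup>2\<close> eigenfunction of \<open>H\<close> agrees almost everywhere with a unique continuous function,
  which is smooth, so the eigenspace is taken to consist of these classical eigenfunctions.
  This also makes the value of \<open>P\<^sub>k f\<close> at a point meaningful.
\<close>

definition hermite_eigenspace :: "nat \<Rightarrow> ('a::euclidean_space \<Rightarrow> complex) set" where
  "hermite_eigenspace k =
     {g \<in> Lp 2. C2 g \<and> (\<forall>x. hermite_op g x = of_nat (2 * k + DIM('a)) * g x)}"

definition hermite_proj :: "nat \<Rightarrow> ('a::euclidean_space \<Rightarrow> complex) \<Rightarrow> 'a \<Rightarrow> complex" where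
  "hermite_proj k f =
     (THE g. g \<in> hermite_eigenspace k \<and>
        (\<forall>h\<in>hermite_eigenspace k. L2_inner (\<lambda>x. f x - g x) h = 0))"

text \<open>
  A densely defined operator is given by its graph, which relates a function to every
  representative of its image. The operator \<open>m(x,H)\<close> has its maximal domain in \<open>L\<^sup>2\<close>: all \<open>f\<close>
  for which the partial sums of \<open>\<Sum>k. m(x,2k+n) P\<^sub>k f(x)\<close> lie in \<open>L\<^sup>2\<close> and converge there.
\<close>

definition pseudo_mult_sum ::
    "('a::euclidean_space \<Rightarrow> nat \<Rightarrow> complex) \<Rightarrow> nat \<Rightarrow> ('a \<Rightarrow> complex) \<Rightarrow> 'a \<Rightarrow> complex" where
  "pseudo_mult_sum m N f x = (\<Sum>k<N. m x (2 * k + DIM('a)) * hermite_proj k f x)"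

definition hermite_pseudo_multiplier ::
    "('a::euclidean_space \<Rightarrow> nat \<Rightarrow> complex) \<Rightarrow> (('a \<Rightarrow> complex) \<times> ('a \<Rightarrow> complex)) set" where
  "hermite_pseudo_multiplier m =
     {(f, g). f \<in> Lp 2 \<and> g \<in> Lp 2 \<and> (\<forall>N. pseudo_mult_sum m N f \<in> Lp 2) \<and>
        (\<lambda>N. Lp_norm 2 (\<lambda>x. pseudo_mult_sum m N f x - g x)) \<longlonglongrightarrow> 0}"

definition dense_in_Lp :: "real \<Rightarrow> ('a::euclidean_space \<Rightarrow> complex) set \<Rightarrow> bool" where
  "dense_in_Lp p D \<longleftrightarrow>
     (\<forall>f\<in>Lp p. \<forall>e>0. \<exists>h\<in>D \<inter> Lp p. Lp_norm p (\<lambda>x. f x - h x) < e)"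

text \<open>
  An operator is bounded on \<open>L\<^sup>p\<close>, or of weak type \<open>(1,1)\<close>, if it satisfies the estimate on its
  whole domain within \<open>L\<^sup>p\<close> (respectively \<open>L\<^sup>1\<close>) and this domain is dense there, so that the
  operator extends uniquely.
\<close>

definition bounded_on_Lp ::
    "real \<Rightarrow> (('a::euclidean_space \<Rightarrow> complex) \<times> ('a \<Rightarrow> complex)) set \<Rightarrow> bool" where
  "bounded_on_Lp p T \<longleftrightarrow> dense_in_Lp p (Domain T) \<and>
     (\<exists>C. \<forall>(f, g)\<in>T. f \<in> Lp p \<longrightarrow> g \<in> Lp p \<and> Lp_norm p g \<le> C * Lp_norm p f)"

definition weak_type_1_1 ::
    "(('a::euclidean_space \<Rightarrow> complex) \<times> ('a \<Rightarrow> complex)) set \<Rightarrow> bool" where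
  "weak_type_1_1 T \<longleftrightarrow> dense_in_Lp 1 (Domain T) \<and>
     (\<exists>C. \<forall>(f, g)\<in>T. f \<in> Lp 1 \<longrightarrow> g \<in> borel_measurable lebesgue \<and>
        (\<forall>t>0. emeasure lebesgue {x. norm (g x) > t} \<le> ennreal (C / t * Lp_norm 1 f)))"

definition fin_diff :: "('a \<Rightarrow> nat \<Rightarrow> complex) \<Rightarrow> 'a \<Rightarrow> nat \<Rightarrow> complex" where
  "fin_diff m x k = m x (k + 1) - m x k"

end

theory Submission
  imports Defs
begin

text \<open>
  Let \<open>h\<^sub>\<alpha>\<close> be the Hermite functions on \<open>\<real>\<^sup>n\<close>. The projection \<open>P\<^sub>k f\<close> is the finite sum of the
  \<open>\<langle>f, h\<^sub>\<alpha>\<rangle> h\<^sub>\<alpha>\<close> with \<open>\<bar>\<alpha>\<bar> = k\<close> (\<open>hermite_proj_eq\<close>), so a truncation of \<open>m(x,H)\<close> has the kernel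
  \<open>K(x,y) = \<Sum>\<^sub>\<alpha> G(\<bar>\<alpha>\<bar>) h\<^sub>\<alpha>(x) h\<^sub>\<alpha>(y)\<close> with \<open>G(k) = m(x,2k+n) \<phi>(k)\<close> for a cutoff \<open>\<phi>\<close>. The function
  \<open>G\<close> depends on \<open>x\<close>, and nothing is known about this dependence. The theory of Calderon and
  Zygmund still applies, because the weak type \<open>(1,1)\<close> bound requires only an \<open>L\<^sup>2\<close> bound, which is
  a hypothesis on \<open>m(x,H)\<close>, and the regularity of \<open>K\<close> in the variable \<open>y\<close>, in the form of
  Hoermander's condition.

  The regularity in \<open>y\<close> comes from \<open>hermite_kernel_bounds\<close>: if \<open>G\<close> vanishes on \<open>k \<ge> R\<close> and its
  differences satisfy \<open>\<bar>\<Delta>\<^sup>l G\<bar> \<le> A R\<^sup>-\<^sup>l\<close> for \<open>l \<le> n + 1\<close>, then \<open>\<bar>K(x,y)\<bar>\<close> is at most a constant times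
  \<open>A R\<^sup>n\<^sup>/\<^sup>2 / (1 + (\<surd>R \<bar>x - y\<bar>)\<^sup>n\<^sup>+\<^sup>1)\<close>, and a derivative in \<open>y\<close> costs a factor \<open>\<surd>R\<close>. The mechanism is
  a commutator identity. Multiplication by \<open>x\<^sub>i\<close> acts on \<open>h\<^sub>\<alpha>(x)\<close> as a sum of a raising and a lowering
  operator, so that multiplying \<open>K\<close> by \<open>x\<^sub>i - y\<^sub>i\<close> replaces \<open>G\<close> by \<open>\<Delta>G\<close> and applies one ladder
  operator. The difference gains \<open>R\<^sup>-\<^sup>1\<close> and the ladder operator loses \<open>\<surd>R\<close>. In later steps there are also
  commutators of ladder operators, which gain the same factor by removing an operator. In all, each
  of the \<open>n + 1\<close> repetitions gains \<open>1 / \<surd>R\<close>.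

  A smooth cutoff at height \<open>4\<^sup>J\<close> is a sum of pieces that live at height \<open>4\<^sup>p\<close>, \<open>p \<le> J\<close>, and the
  piece at height \<open>4\<^sup>p\<close> contributes at most a constant times \<open>min(2\<^sup>p r, 1 / (2\<^sup>p r))\<close> to Hoermander's
  condition at scale \<open>r\<close>. The sum over \<open>p\<close> is bounded, uniformly in \<open>J\<close> and \<open>r\<close>
  (\<open>kernel_Hoermander\<close>). The truncation \<open>T\<^sub>J\<close> is \<open>m(x,H)\<close> composed with a contraction of \<open>L\<^sup>2\<close>, whence
  its \<open>L\<^sup>2\<close> bound is uniform too, and \<open>Calderon_Zygmund_weak_type_Cc\<close> gives a uniform weak type
  bound. For a pair \<open>(f, g)\<close> in the graph of \<open>m(x,H)\<close> a summation by parts shows \<open>T\<^sub>J f \<longlonglongrightarrow> g\<close> in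
  \<open>L\<^sup>2\<close> (\<open>truncation_tendsto\<close>), so all bounds on level sets pass from \<open>T\<^sub>J f\<close> to \<open>g\<close>. The \<open>L\<^sup>p\<close> bound
  for \<open>1 < p < 2\<close> is Marcinkiewicz interpolation between weak type \<open>(1,1)\<close> and \<open>L\<^sup>2\<close>
  (\<open>Marcinkiewicz_dyadic\<close>).

  The domain is dense in \<open>L\<^sup>p\<close> because it contains the finite Hermite expansions, and the
  smoothly truncated Hermite expansions of a continuous function of compact support converge to it
  in every \<open>L\<^sup>p\<close>, \<open>p \<ge> 1\<close> (\<open>smooth_sum_tendsto\<close>). The same convergence shows that the Hermite
  functions are complete in \<open>L\<^sup>2\<close>, from which it follows that the classical eigenspaces are spanned by
  the \<open>h\<^sub>\<alpha>\<close>.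
\<close>

section \<open>Kernels of polynomial decay\<close>

text \<open>
  An \<open>L\<^sup>1\<close>-normalized bump of width \<open>1 / q\<close>. The exponent \<open>DIM('a) + 1\<close> is the smallest integer for which
  the tail is integrable, and it is the number of differences of the symbol that are controlled.
\<close>

definition bump :: "real \<Rightarrow> 'a::euclidean_space \<Rightarrow> real" where
  "bump q z = q ^ DIM('a) / (1 + (q * norm z) ^ (DIM('a) + 1))"

lemma bump_nonneg: "q \<ge> 0 \<Longrightarrow> bump q z \<ge> 0"
  by (simp add: bump_def)

lemma bump_measurable [measurable]: "bump q \<in> borel_measurable borel"
  unfolding bump_def[abs_def] by measurable

lemma bump_le_power: "q \<ge> 0 \<Longrightarrow> bump q (z::'a::euclidean_space) \<le> q ^ DIM('a)"
  unfolding bump_def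
  using divide_left_mono[of 1 "1 + (q * norm z) ^ (DIM('a) + 1)" "q ^ DIM('a)"]
  by (simp add: add_pos_nonneg)

lemma bump_le_tail:
  assumes "q > 0" "z \<noteq> 0"
  shows "bump q (z::'a::euclidean_space) \<le> 1 / (q * norm z ^ (DIM('a) + 1))"
proof -
  have "bump q z \<le> q ^ DIM('a) / ((q * norm z) ^ (DIM('a) + 1))"
    unfolding bump_def using assms by (intro divide_left_mono) (auto intro!: mult_pos_pos add_pos_nonneg)
  also have "\<dots> = 1 / (q * norm z ^ (DIM('a) + 1))"
    using assms by (simp add: power_mult_distrib field_simps)
  finally show ?thesis .
qed

text \<open>
  The domain is a union of dyadic shells with outer radius \<open>2\<^sup>i\<^sup>+\<^sup>1 r\<close>, in the \<open>i\<close>-th of which the integrand is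
  at most \<open>(2\<^sup>i r)\<^sup>-\<^sup>d\<^sup>-\<^sup>1\<close>. The volumes grow like \<open>(2\<^sup>i r)\<^sup>d\<close>, which leaves a geometric series.
\<close>

lemma nn_integral_power_tail:
  "\<exists>C>0. \<forall>r>0. \<forall>y::'a::euclidean_space.
     (\<integral>\<^sup>+x. ennreal (1 / norm (x - y) ^ (DIM('a) + 1)) * indicator {x. r < norm (x - y)} x \<partial>lborel) \<le> ennreal (C / r)"
proof -
  let ?d = "DIM('a)"
  define v where "v = unit_ball_vol (real ?d)"
  have v0: "v > 0" unfolding v_def by (rule unit_ball_vol_pos) simp
  have main: "(\<integral>\<^sup>+x. ennreal (1 / norm (x - y) ^ (?d + 1)) * indicator {x. r < norm (x - y)} x \<partial>lborel)
     \<le> ennreal (v * 2 ^ (?d + 1) / r)" if r: "r > 0" for r and y :: 'a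
  proof -
    define g where "g i x = ennreal (1 / (2 ^ i * r) ^ (?d + 1)) * indicator (cball y (2 ^ (i+1) * r)) x" for i x
    have meas: "g i \<in> borel_measurable lborel" for i unfolding g_def[abs_def]
      by (intro borel_measurable_times_ennreal borel_measurable_indicator borel_measurable_const) auto
    have pt: "ennreal (1 / norm (x - y) ^ (?d + 1)) * indicator {x. r < norm (x - y)} x \<le> (\<Sum>i. g i x)" for x
    proof (cases "r < norm (x - y)")
      case True
      define P where "P i \<longleftrightarrow> norm (x - y) \<le> 2 ^ (i+1) * r" for i :: nat
      obtain k where "norm (x - y) / r < 2 ^ k" using real_arch_pow[of 2 "norm (x-y)/r"] by auto
      then have "norm (x - y) < 2 ^ k * r" using r by (simp add: field_simps)
      also have "2 ^ k * r \<le> 2 ^ (k+1) * r" using r by simp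
      finally have "P k" unfolding P_def by simp
      define i where "i = (LEAST i. P i)"
      have Pi: "P i" unfolding i_def using \<open>P k\<close> by (rule LeastI)
      have low: "2 ^ i * r < norm (x - y)"
      proof (cases i)
        case 0 then show ?thesis using True by simp
      next
        case (Suc j)
        then have "\<not> P j" unfolding i_def by (metis lessI not_less_Least)
        then show ?thesis unfolding P_def Suc by simp
      qed
      have "ennreal (1 / norm (x - y) ^ (?d + 1)) \<le> ennreal (1 / (2 ^ i * r) ^ (?d + 1))"
        using low less_trans[OF r True] r
        by (intro ennreal_leI divide_left_mono power_mono mult_pos_pos zero_less_power) auto
      also have "\<dots> = g i x" using Pi unfolding g_def P_def by (simp add: dist_norm norm_minus_commute)
      also have "\<dots> = sum (\<lambda>i. g i x) {i}" by simp
      also have "\<dots> \<le> (\<Sum>i. g i x)" by (rule sum_le_suminf) auto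
      finally show ?thesis using True by simp
    qed simp
    have shell: "(\<integral>\<^sup>+x. g i x \<partial>lborel) = ennreal (v * 2 ^ ?d / r * (1/2) ^ i)" for i
    proof -
      have "(\<integral>\<^sup>+x. g i x \<partial>lborel) = ennreal (1 / (2 ^ i * r) ^ (?d + 1)) * emeasure lborel (cball y (2 ^ (i+1) * r))"
        unfolding g_def by (subst nn_integral_cmult_indicator) auto
      also have "emeasure lborel (cball y (2 ^ (i+1) * r)) = ennreal (v * (2 ^ (i+1) * r) ^ ?d)"
        unfolding v_def using r by (subst emeasure_cball) (auto simp: ennreal_mult')
      also have "ennreal (1 / (2 ^ i * r) ^ (?d + 1)) * \<dots> = ennreal (1 / (2 ^ i * r) ^ (?d + 1) * (v * (2 ^ (i+1) * r) ^ ?d))"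
        using r by (subst ennreal_mult'[symmetric]) auto
      also have "1 / (2 ^ i * r) ^ (?d + 1) * (v * (2 ^ (i+1) * r) ^ ?d) = v * 2 ^ ?d / r * (1/2) ^ i"
      proof -
        have "(2 ^ (i+1) * r) ^ ?d = 2 ^ ?d * (2 ^ i * r) ^ ?d" by (simp add: power_mult_distrib)
        moreover have "(2 ^ i * r) ^ ?d > 0" using r by simp
        ultimately show ?thesis using r by (simp add: field_simps)
      qed
      finally show ?thesis .
    qed
    have "(\<integral>\<^sup>+x. ennreal (1 / norm (x - y) ^ (?d + 1)) * indicator {x. r < norm (x - y)} x \<partial>lborel)
      \<le> (\<integral>\<^sup>+x. (\<Sum>i. g i x) \<partial>lborel)" by (intro nn_integral_mono pt)
    also have "\<dots> = (\<Sum>i. \<integral>\<^sup>+x. g i x \<partial>lborel)" by (rule nn_integral_suminf[OF meas])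
    also have "\<dots> = (\<Sum>i. ennreal (v * 2 ^ ?d / r * (1/2) ^ i))" unfolding shell ..
    also have "\<dots> = ennreal (v * 2 ^ ?d / r * 2)"
    proof (rule suminf_ennreal_eq)
      show "(\<lambda>i. v * 2 ^ ?d / r * (1/2) ^ i) sums (v * 2 ^ ?d / r * 2)"
        using sums_mult[OF geometric_sums[of "1/2::real"], of "v * 2 ^ ?d / r"] by simp
    qed (use v0 r in auto)
    finally show ?thesis by (simp add: mult_ac)
  qed
  show ?thesis by (intro exI[of _ "v * 2 ^ (?d + 1)"]) (use v0 main in auto)
qed

lemma bump_integrals:
  "\<exists>C>0. (\<forall>q>0. \<forall>y::'a::euclidean_space. (\<integral>\<^sup>+x. ennreal (bump q (x - y)) \<partial>lebesgue) \<le> ennreal C) \<and>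
     (\<forall>q>0. \<forall>r>0. \<forall>y::'a. (\<integral>\<^sup>+x. ennreal (bump q (x - y)) * indicator {x. r < norm (x - y)} x \<partial>lebesgue) \<le> ennreal (C / (q * r)))"
proof -
  let ?d = "DIM('a)"
  obtain C where C0: "C > 0" and C: "\<And>r y::'a. r > 0 \<Longrightarrow>
    (\<integral>\<^sup>+x. ennreal (1 / norm (x - y) ^ (?d + 1)) * indicator {x. r < norm (x - y)} x \<partial>lborel) \<le> ennreal (C / r)"
    using nn_integral_power_tail by blast
  define v where "v = unit_ball_vol (real ?d)"
  have v0: "v > 0" unfolding v_def by (rule unit_ball_vol_pos) simp
  have tail: "(\<integral>\<^sup>+x. ennreal (bump q (x - y)) * indicator {x. r < norm (x - y)} x \<partial>lborel) \<le> ennreal (C / (q * r))"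
    if "q > 0" "r > 0" for q r and y :: 'a
  proof -
    have "(\<integral>\<^sup>+x. ennreal (bump q (x - y)) * indicator {x. r < norm (x - y)} x \<partial>lborel)
       \<le> (\<integral>\<^sup>+x. ennreal (1/q) * (ennreal (1 / norm (x - y) ^ (?d + 1)) * indicator {x. r < norm (x - y)} x) \<partial>lborel)"
    proof (intro nn_integral_mono)
      fix x show "ennreal (bump q (x - y)) * indicator {x. r < norm (x - y)} x \<le>
         ennreal (1/q) * (ennreal (1 / norm (x - y) ^ (?d + 1)) * indicator {x. r < norm (x - y)} x)"
      proof (cases "r < norm (x - y)")
        case True
        then have "x - y \<noteq> 0" using that by auto
        from bump_le_tail[OF that(1) this] show ?thesis using True that
          by (auto simp: ennreal_mult'[symmetric] intro!: ennreal_leI)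
      qed simp
    qed
    also have "\<dots> = ennreal (1/q) * (\<integral>\<^sup>+x. (ennreal (1 / norm (x - y) ^ (?d + 1)) * indicator {x. r < norm (x - y)} x) \<partial>lborel)"
      by (rule nn_integral_cmult) measurable
    also have "\<dots> \<le> ennreal (1/q) * ennreal (C / r)" by (intro mult_left_mono C that) auto
    also have "\<dots> = ennreal (C / (q * r))" using that C0 by (subst ennreal_mult'[symmetric]) (auto simp: field_simps)
    finally show ?thesis .
  qed
  have full: "(\<integral>\<^sup>+x. ennreal (bump q (x - y)) \<partial>lborel) \<le> ennreal (v + C)" if q: "q > 0" for q and y :: 'a
  proof -
    have "(\<integral>\<^sup>+x. ennreal (bump q (x - y)) \<partial>lborel)
      \<le> (\<integral>\<^sup>+x. ennreal (q ^ ?d) * indicator (cball y (1/q)) x + ennreal (bump q (x - y)) * indicator {x. 1/q < norm (x - y)} x \<partial>lborel)"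
    proof (intro nn_integral_mono)
      fix x show "ennreal (bump q (x - y)) \<le> ennreal (q ^ ?d) * indicator (cball y (1/q)) x + ennreal (bump q (x - y)) * indicator {x. 1/q < norm (x - y)} x"
        using q bump_le_power[of q "x - y"] by (cases "1/q < norm (x-y)") (auto simp: dist_norm norm_minus_commute intro!: ennreal_leI)
    qed
    also have "\<dots> = ennreal (q ^ ?d) * emeasure lborel (cball y (1/q)) + (\<integral>\<^sup>+x. ennreal (bump q (x - y)) * indicator {x. 1/q < norm (x - y)} x \<partial>lborel)"
      by (subst nn_integral_add)
         (auto simp: nn_integral_cmult_indicator intro!: borel_measurable_times_ennreal borel_measurable_indicator)
    also have "ennreal (q ^ ?d) * emeasure lborel (cball y (1/q)) = ennreal v"
      unfolding v_def using q by (subst emeasure_cball) (auto simp: ennreal_mult'[symmetric] power_divide)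
    also have "ennreal v + (\<integral>\<^sup>+x. ennreal (bump q (x - y)) * indicator {x. 1/q < norm (x - y)} x \<partial>lborel) \<le> ennreal v + ennreal (C / (q * (1/q)))"
      by (intro add_left_mono tail) (use q in auto)
    also have "\<dots> = ennreal (v + C)" using q v0 C0 by (simp add: ennreal_plus)
    finally show ?thesis .
  qed
  show ?thesis
    apply (intro exI[of _ "v + C"] conjI allI impI)
    subgoal using v0 C0 by simp
    subgoal for q y using full[of q y] by (simp add: nn_integral_completion)
    subgoal for q r y using order_trans[OF tail[of q r y] ennreal_leI[of "C / (q*r)" "(v + C)/(q*r)"]] v0
      by (simp add: nn_integral_completion divide_right_mono)
    done
qed

lemma bump_integrable: "q > 0 \<Longrightarrow> integrable lborel (bump q :: 'a::euclidean_space \<Rightarrow> real)"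
proof (rule integrableI_nonneg)
  assume q: "q > 0"
  obtain C where "(\<integral>\<^sup>+x. ennreal (bump q (x - (0::'a))) \<partial>lebesgue) \<le> ennreal C" using bump_integrals q by blast
  then show "(\<integral>\<^sup>+ x. ennreal (bump q (x::'a)) \<partial>lborel) < \<infinity>"
    using le_less_trans[OF _ ennreal_less_top, of _ C] by (simp add: nn_integral_completion)
qed (auto simp: bump_nonneg)

lemma integrable_inverse_1_plus_square: "integrable lborel (\<lambda>u::real. 1 / (1 + u\<^sup>2))"
  using bump_integrable[of 1, where 'a = real] by (simp add: bump_def[abs_def] power2_eq_square)

section \<open>Hermite functions on the line\<close>

text \<open>
  The factor that gives the Gaussian \<open>exp (- u\<^sup>2 / 2)\<close> norm one in \<open>L\<^sup>2\<close>.
\<close>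

definition gauss_const :: real where
  "gauss_const = 1 / sqrt (LINT u|lborel. exp (- (u\<^sup>2)))"

text \<open>
  The \<open>L\<^sup>2\<close>-normalized Hermite functions, defined by their three-term recurrence: only the
  recurrence and the two ladder relations for the derivative are ever used, never the polynomials.
\<close>

fun hermite_fun :: "nat \<Rightarrow> real \<Rightarrow> real" where
  "hermite_fun 0 u = gauss_const * exp (- (u\<^sup>2) / 2)"
| "hermite_fun (Suc 0) u = sqrt 2 * u * hermite_fun 0 u"
| "hermite_fun (Suc (Suc a)) u =
     (sqrt 2 * u * hermite_fun (Suc a) u - sqrt (real (Suc a)) * hermite_fun a u) / sqrt (real (a + 2))"

lemma hermite_fun_rec:
  "sqrt (real (Suc a)) * hermite_fun (Suc a) u
     = sqrt 2 * u * hermite_fun a u - sqrt (real a) * hermite_fun (a - 1) u"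
  by (cases a) (auto simp: field_simps)

lemma hermite_fun_rec':
  "u * hermite_fun a u = (sqrt (real (Suc a)) * hermite_fun (Suc a) u
     + sqrt (real a) * hermite_fun (a - 1) u) / sqrt 2"
  using hermite_fun_rec[of a u] by (simp add: field_simps)

lemma hermite_fun_deriv_lower:
  "(hermite_fun a has_real_derivative
      (sqrt 2 * sqrt (real a) * hermite_fun (a - 1) u - u * hermite_fun a u)) (at u)"
proof (induction a arbitrary: u rule: less_induct)
  case (less a)
  show ?case
  proof (cases a)
    case 0
    show ?thesis unfolding 0
      by (rule DERIV_cong, (rule derivative_eq_intros refl | simp)+)
  next
    case (Suc b)
    let ?h = "hermite_fun"
    have eq: "?h a = (\<lambda>u. (sqrt 2 * u * ?h b u - sqrt (real b) * ?h (b - 1) u) / sqrt (real (Suc b)))"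
      using hermite_fun_rec[of b] by (auto simp: Suc field_simps fun_eq_iff)
    have d1: "(?h b has_real_derivative (sqrt 2 * sqrt (real b) * ?h (b - 1) u - u * ?h b u)) (at u)"
      using less Suc by simp
    have d2: "(?h (b-1) has_real_derivative (sqrt 2 * sqrt (real (b-1)) * ?h (b - 1 - 1) u - u * ?h (b-1) u)) (at u)"
      using less[of "b - 1" u] Suc by simp
    have D: "(?h a has_real_derivative
       (sqrt 2 * ?h b u + sqrt 2 * u * (sqrt 2 * sqrt (real b) * ?h (b - 1) u - u * ?h b u)
         - sqrt (real b) * (sqrt 2 * sqrt (real (b-1)) * ?h (b - 1 - 1) u - u * ?h (b-1) u)) / sqrt (real (Suc b))) (at u)"
      unfolding eq
      by (rule DERIV_cong[OF DERIV_cdivide[OF DERIV_diff[OF DERIV_mult[OF DERIV_cmult[OF DERIV_ident] d1]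
            DERIV_cmult[OF d2]]]]) (simp add: mult_ac)
    have E: "(sqrt 2 * ?h b u + sqrt 2 * u * (sqrt 2 * sqrt (real b) * ?h (b - 1) u - u * ?h b u)
         - sqrt (real b) * (sqrt 2 * sqrt (real (b-1)) * ?h (b - 1 - 1) u - u * ?h (b-1) u))
       = sqrt 2 * (real b + 1) * ?h b u - u * (sqrt (real (Suc b)) * ?h (Suc b) u)"
    proof (cases b)
      case 0 then show ?thesis using hermite_fun_rec[of 0 u] by (simp add: algebra_simps)
    next
      case (Suc c)
      have r1: "sqrt (real (Suc c)) * ?h (Suc c) u = sqrt 2 * u * ?h c u - sqrt (real c) * ?h (c - 1) u"
        by (rule hermite_fun_rec)
      have r2: "sqrt (real (Suc (Suc c))) * ?h (Suc (Suc c)) u = sqrt 2 * u * ?h (Suc c) u - sqrt (real (Suc c)) * ?h c u"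
        using hermite_fun_rec[of "Suc c" u] by simp
      have s: "sqrt (real c) * ?h (c - 1) u = sqrt 2 * u * ?h c u - sqrt (real (Suc c)) * ?h (Suc c) u"
        using r1 by simp
      have "sqrt (real b) * (sqrt 2 * sqrt (real (b-1)) * ?h (b - 1 - 1) u)
          = sqrt (real (Suc c)) * sqrt 2 * (sqrt (real c) * ?h (c - 1) u)"
        by (simp add: Suc)
      also have "\<dots> = sqrt (real (Suc c)) * sqrt 2 * (sqrt 2 * u * ?h c u) - sqrt 2 * (sqrt (real (Suc c)) * sqrt (real (Suc c))) * ?h (Suc c) u"
        unfolding s by (simp only: algebra_simps)
      also have "sqrt (real (Suc c)) * sqrt (real (Suc c)) = real (Suc c)" by simp
      also have "sqrt (real (Suc c)) * sqrt 2 * (sqrt 2 * u * ?h c u) = 2 * (sqrt (real (Suc c)) * u * ?h c u)"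
        by simp
      finally have t: "sqrt (real b) * (sqrt 2 * sqrt (real (b-1)) * ?h (b - 1 - 1) u)
         = 2 * (sqrt (real (Suc c)) * u * ?h c u) - sqrt 2 * real (Suc c) * ?h (Suc c) u" .
      show ?thesis unfolding right_diff_distrib t using r2 unfolding Suc
        apply (simp only: Suc diff_Suc_1)
        apply (simp add: algebra_simps)
        done
    qed
    have "(sqrt 2 * (real b + 1) * ?h b u - u * (sqrt (real (Suc b)) * ?h (Suc b) u)) / sqrt (real (Suc b))
       = sqrt 2 * ((real b + 1) / sqrt (real (Suc b))) * ?h b u - u * ?h (Suc b) u"
      by (simp add: diff_divide_distrib)
    also have "(real b + 1) / sqrt (real (Suc b)) = sqrt (real (Suc b))"
      by (simp add: real_div_sqrt add.commute)
    finally show ?thesis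
      by (intro DERIV_cong[OF D], unfold E) (simp add: Suc)
  qed
qed

lemma hermite_fun_deriv_raise:
  "(hermite_fun a has_real_derivative
      (u * hermite_fun a u - sqrt 2 * sqrt (real (Suc a)) * hermite_fun (Suc a) u)) (at u)"
proof (rule DERIV_cong[OF hermite_fun_deriv_lower])
  have "sqrt 2 * (sqrt (real (Suc a)) * hermite_fun (Suc a) u)
     = 2 * u * hermite_fun a u - sqrt 2 * sqrt (real a) * hermite_fun (a - 1) u"
    unfolding hermite_fun_rec by (simp add: algebra_simps)
  then show "sqrt 2 * sqrt (real a) * hermite_fun (a - 1) u - u * hermite_fun a u =
    u * hermite_fun a u - sqrt 2 * sqrt (real (Suc a)) * hermite_fun (Suc a) u" by simp
qed

definition hermite_fun' :: "nat \<Rightarrow> real \<Rightarrow> real" where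
  "hermite_fun' a u = (sqrt (real a) * hermite_fun (a - 1) u
      - sqrt (real (Suc a)) * hermite_fun (Suc a) u) / sqrt 2"

lemma hermite_fun_deriv: "(hermite_fun a has_real_derivative hermite_fun' a u) (at u)"
proof (rule DERIV_cong[OF hermite_fun_deriv_lower])
  have *: "sqrt (2::real) * (s / sqrt 2) = s" for s by simp
  show "sqrt 2 * sqrt (real a) * hermite_fun (a - 1) u - u * hermite_fun a u = hermite_fun' a u"
    unfolding hermite_fun'_def hermite_fun_rec' by (simp add: field_simps)
qed

text \<open>
  Each Hermite function is an eigenfunction of \<open>- d\<^sup>2/du\<^sup>2 + u\<^sup>2\<close> with eigenvalue \<open>2a + 1\<close>.
\<close>

lemma hermite_fun_deriv2:
  "(hermite_fun' a has_real_derivative (u\<^sup>2 - (2 * real a + 1)) * hermite_fun a u) (at u)"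
proof -
  have eq: "hermite_fun' a = (\<lambda>u. u * hermite_fun a u - sqrt 2 * sqrt (real (Suc a)) * hermite_fun (Suc a) u)"
    by (rule ext, rule DERIV_unique[OF hermite_fun_deriv hermite_fun_deriv_raise])
  have "(hermite_fun' a has_real_derivative hermite_fun a u
      + u * (u * hermite_fun a u - sqrt 2 * sqrt (real (Suc a)) * hermite_fun (Suc a) u)
      - sqrt 2 * sqrt (real (Suc a)) * (sqrt 2 * sqrt (real (Suc a)) * hermite_fun a u - u * hermite_fun (Suc a) u)) (at u)"
    unfolding eq
    using hermite_fun_deriv_lower[of "Suc a" u]
    by (intro DERIV_cong[OF DERIV_diff[OF DERIV_mult[OF DERIV_ident hermite_fun_deriv_raise]
          DERIV_cmult[OF hermite_fun_deriv_lower]]]) simp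
  moreover have "hermite_fun a u
      + u * (u * hermite_fun a u - sqrt 2 * sqrt (real (Suc a)) * hermite_fun (Suc a) u)
      - sqrt 2 * sqrt (real (Suc a)) * (sqrt 2 * sqrt (real (Suc a)) * hermite_fun a u - u * hermite_fun (Suc a) u)
    = hermite_fun a u + u * (u * hermite_fun a u)
       - (sqrt 2 * sqrt 2) * (sqrt (real (Suc a)) * sqrt (real (Suc a))) * hermite_fun a u"
    by (simp only: algebra_simps)
  ultimately show ?thesis
    by (elim DERIV_cong) (simp add: algebra_simps power2_eq_square)
qed

lemma continuous_hermite_fun [continuous_intros]: "continuous_on S (hermite_fun a)"
  by (meson DERIV_isCont continuous_at_imp_continuous_on hermite_fun_deriv)

lemma hermite_fun_measurable [measurable]: "hermite_fun a \<in> borel_measurable borel"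
  by (intro borel_measurable_continuous_onI continuous_hermite_fun)

lemma exp_dominates_power:
  "\<exists>C. \<forall>u::real. \<bar>u\<bar> ^ N * exp (- (u\<^sup>2) / 2) \<le> C"
proof -
  have "\<bar>u\<bar> ^ N * exp (- (u\<^sup>2) / 2) \<le> fact N * exp 1" for u :: real
  proof -
    have "\<bar>u\<bar> ^ N / fact N \<le> exp \<bar>u\<bar>"
    proof -
      have "(\<Sum>k\<in>{N}. \<bar>u\<bar> ^ k /\<^sub>R fact k) \<le> (\<Sum>k. \<bar>u\<bar> ^ k /\<^sub>R fact k)"
        by (rule sum_le_suminf) (use summable_exp_generic[of "\<bar>u\<bar>"] in \<open>auto simp: divide_inverse\<close>)
      then show ?thesis by (simp add: exp_def divide_inverse mult.commute)
    qed
    then have "\<bar>u\<bar> ^ N * exp (- (u\<^sup>2) / 2) \<le> fact N * exp \<bar>u\<bar> * exp (- (u\<^sup>2) / 2)"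
      by (simp add: field_simps)
    also have "\<dots> = fact N * exp (\<bar>u\<bar> - u\<^sup>2 / 2)" by (simp add: exp_add[symmetric] exp_diff exp_minus field_simps)
    also have "\<dots> \<le> fact N * exp 1"
    proof -
      have "(\<bar>u\<bar> - 1)\<^sup>2 \<ge> 0" by simp
      then have "\<bar>u\<bar> - u\<^sup>2 / 2 \<le> 1" by (simp add: power2_eq_square algebra_simps)
      then show ?thesis by simp
    qed
    finally show ?thesis .
  qed
  then show ?thesis by blast
qed

lemma hermite_fun_decay: "\<exists>C. \<forall>u. \<bar>u\<bar> ^ N * \<bar>hermite_fun a u\<bar> \<le> C"
proof (induction a arbitrary: N rule: less_induct)
  case (less a)
  show ?case
  proof (cases a)
    case 0
    obtain C where C: "\<And>u::real. \<bar>u\<bar> ^ N * exp (- (u\<^sup>2) / 2) \<le> C" using exp_dominates_power[of N] by blast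
    have "\<bar>u\<bar> ^ N * \<bar>hermite_fun a u\<bar> \<le> \<bar>gauss_const\<bar> * C" for u
      using mult_left_mono[OF C[of u], of "\<bar>gauss_const\<bar>"] by (simp add: 0 abs_mult mult_ac)
    then show ?thesis by blast
  next
    case (Suc b)
    obtain C where C: "\<And>u. \<bar>u\<bar> ^ (Suc N) * \<bar>hermite_fun b u\<bar> \<le> C" using less[of b "Suc N"] Suc by auto
    obtain D where D: "\<And>u. \<bar>u\<bar> ^ N * \<bar>hermite_fun (b-1) u\<bar> \<le> D" using less[of "b-1" N] Suc by fastforce
    have "\<bar>u\<bar> ^ N * \<bar>hermite_fun a u\<bar> \<le> (sqrt 2 * C + sqrt (real b) * D) / sqrt (real (Suc b))" for u
    proof -
      have eq: "sqrt (real (Suc b)) * hermite_fun a u = sqrt 2 * u * hermite_fun b u - sqrt (real b) * hermite_fun (b - 1) u"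
        unfolding Suc by (rule hermite_fun_rec)
      have "sqrt (real (Suc b)) * (\<bar>u\<bar> ^ N * \<bar>hermite_fun a u\<bar>) = \<bar>u\<bar> ^ N * \<bar>sqrt (real (Suc b)) * hermite_fun a u\<bar>"
        by (simp add: abs_mult)
      also have "\<dots> \<le> \<bar>u\<bar> ^ N * (sqrt 2 * \<bar>u\<bar> * \<bar>hermite_fun b u\<bar> + sqrt (real b) * \<bar>hermite_fun (b - 1) u\<bar>)"
        unfolding eq by (intro mult_left_mono order_trans[OF abs_triangle_ineq4]) (auto simp: abs_mult)
      also have "\<dots> = sqrt 2 * (\<bar>u\<bar> ^ (Suc N) * \<bar>hermite_fun b u\<bar>) + sqrt (real b) * (\<bar>u\<bar> ^ N * \<bar>hermite_fun (b-1) u\<bar>)"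
        by (simp add: algebra_simps)
      also have "\<dots> \<le> sqrt 2 * C + sqrt (real b) * D"
        by (intro add_mono mult_left_mono C D) auto
      finally show ?thesis by (simp add: field_simps)
    qed
    then show ?thesis by blast
  qed
qed

lemma hermite_fun_prod_integrable:
  "integrable lborel (\<lambda>u. hermite_fun a u * hermite_fun b u)"
proof -
  obtain C0 where C0: "\<And>u. \<bar>hermite_fun a u\<bar> \<le> C0" using hermite_fun_decay[of 0 a] by auto
  obtain C2 where C2: "\<And>u. \<bar>u\<bar> ^ 2 * \<bar>hermite_fun a u\<bar> \<le> C2" using hermite_fun_decay[of 2 a] by auto
  obtain D where D: "\<And>u. \<bar>hermite_fun b u\<bar> \<le> D" using hermite_fun_decay[of 0 b] by auto
  have "\<bar>hermite_fun a u * hermite_fun b u\<bar> \<le> ((C0 + C2) * D) * (1 / (1 + u\<^sup>2))" for u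
  proof -
    have "(1 + u\<^sup>2) * \<bar>hermite_fun a u\<bar> \<le> C0 + C2" using C0[of u] C2[of u] by (simp add: algebra_simps)
    then have "((1 + u\<^sup>2) * \<bar>hermite_fun a u\<bar>) * \<bar>hermite_fun b u\<bar> \<le> (C0 + C2) * D"
      using D[of u] by (intro mult_mono) (auto intro: order_trans[rotated])
    moreover have "1 + u\<^sup>2 > 0" by (simp add: add_pos_nonneg)
    ultimately show ?thesis by (simp add: abs_mult field_simps)
  qed
  then show ?thesis
    by (intro Bochner_Integration.integrable_bound[OF integrable_mult_right[OF integrable_inverse_1_plus_square, of "(C0 + C2) * D"]])
       (auto intro!: AE_I2 simp del: times_divide_eq_right intro: order_trans[OF _ abs_ge_self])
qed

lemma hermite_fun_tendsto_0:
  "(hermite_fun a \<longlongrightarrow> 0) at_top" "(hermite_fun a \<longlongrightarrow> 0) at_bot"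
proof -
  obtain C where C: "\<And>u. \<bar>u\<bar> ^ 1 * \<bar>hermite_fun a u\<bar> \<le> C" using hermite_fun_decay[of 1 a] by auto
  have ev: "norm (hermite_fun a u) \<le> C / \<bar>u\<bar>" if "u \<noteq> 0" for u
    using C[of u] that by (simp add: field_simps)
  show "(hermite_fun a \<longlongrightarrow> 0) at_top"
    apply (rule Lim_null_comparison[where g = "\<lambda>u. C / \<bar>u\<bar>"])
     apply (rule eventually_mono[OF eventually_gt_at_top[of 0]])
     apply (rule ev, simp)
    apply (rule tendsto_divide_0[OF tendsto_const])
    by (rule filterlim_at_top_imp_at_infinity, rule filterlim_abs_real)
  show "(hermite_fun a \<longlongrightarrow> 0) at_bot"
    apply (rule Lim_null_comparison[where g = "\<lambda>u. C / \<bar>u\<bar>"])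
     apply (rule eventually_mono[OF eventually_gt_at_bot[of 0]])
     apply (rule ev, simp)
    apply (rule tendsto_divide_0[OF tendsto_const])
    apply (rule filterlim_at_top_imp_at_infinity)
    by (metis (no_types, lifting) ext abs_minus_cancel filterlim_abs_real filterlim_compose filterlim_uminus_at_top_at_bot)
qed

text \<open>
  Orthogonality and normalization of the Hermite functions both come from the vanishing of the
  integral of a derivative.
\<close>

lemma integral_derivative_eq_0:
  fixes F f :: "real \<Rightarrow> real"
  assumes "\<And>x. (F has_real_derivative f x) (at x)" "continuous_on UNIV f" "integrable lborel f"
    "(F \<longlongrightarrow> 0) at_top" "(F \<longlongrightarrow> 0) at_bot"
  shows "(LINT x|lborel. f x) = 0"
proof -
  have "(LBINT x=-\<infinity>..\<infinity>. f x) = 0 - 0"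
    apply (rule interval_integral_FTC_integrable)
    using assms by (auto simp: has_real_derivative_iff_has_vector_derivative[symmetric] continuous_on_eq_continuous_at
        set_integrable_def ereal_tendsto_simps1)
  then show ?thesis by (simp add: interval_lebesgue_integral_def set_lebesgue_integral_def)
qed

lemma integrable_gauss: "integrable lborel (\<lambda>u::real. exp (- (u\<^sup>2)))"
proof (rule Bochner_Integration.integrable_bound[OF integrable_inverse_1_plus_square])
  have "exp (- (u\<^sup>2)) \<le> 1 / (1 + u\<^sup>2)" for u :: real
    using exp_ge_add_one_self[of "u\<^sup>2"] by (simp add: exp_minus field_simps add_pos_nonneg)
  then show "AE u::real in lborel. norm (exp (- (u\<^sup>2))) \<le> norm (1 / (1 + u\<^sup>2))"
    unfolding real_norm_def by (intro AE_I2 order_trans[OF _ abs_ge_self]) simp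
qed measurable

lemma gauss_integral_pos: "(LINT u|lborel. exp (- (u::real)\<^sup>2)) > 0"
proof -
  have "(LINT u|lborel. exp (- (u::real)\<^sup>2)) \<noteq> 0"
    using integral_nonneg_eq_0_iff_AE[OF integrable_gauss] AE_iff_null[of lborel "\<lambda>_. False"]
    by (auto simp: null_sets_def)
  moreover have "(LINT u|lborel. exp (- (u::real)\<^sup>2)) \<ge> 0"
    by (rule Bochner_Integration.integral_nonneg) simp
  ultimately show ?thesis by linarith
qed

lemma gauss_const_pos: "gauss_const > 0"
  unfolding gauss_const_def using gauss_integral_pos by simp

lemma hermite_fun_0_norm: "(LINT u|lborel. hermite_fun 0 u * hermite_fun 0 u) = 1"
proof -
  have "hermite_fun 0 u * hermite_fun 0 u = gauss_const\<^sup>2 * exp (- (u\<^sup>2))" for u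
    by (simp add: power2_eq_square exp_add[symmetric])
  then show ?thesis using gauss_integral_pos by (simp add: gauss_const_def power_divide)
qed

lemma hermite_fun'_tendsto_0:
  "(hermite_fun' a \<longlongrightarrow> 0) at_top" "(hermite_fun' a \<longlongrightarrow> 0) at_bot"
  unfolding hermite_fun'_def[abs_def]
  by (rule tendsto_eq_intros hermite_fun_tendsto_0 refl | simp)+

text \<open>
  The Wronskian \<open>h\<^sub>a h\<^sub>b' - h\<^sub>a' h\<^sub>b\<close> has derivative \<open>2 (a - b) h\<^sub>a h\<^sub>b\<close>.
\<close>

lemma hermite_fun_orthogonal:
  assumes "a \<noteq> b" shows "(LINT u|lborel. hermite_fun a u * hermite_fun b u) = 0"
proof -
  let ?c = "2 * (real a - real b)"
  have "(LINT u|lborel. ?c * (hermite_fun a u * hermite_fun b u)) = 0"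
  proof (rule integral_derivative_eq_0[where F = "\<lambda>u. hermite_fun a u * hermite_fun' b u - hermite_fun' a u * hermite_fun b u"])
    show "((\<lambda>u. hermite_fun a u * hermite_fun' b u - hermite_fun' a u * hermite_fun b u) has_real_derivative ?c * (hermite_fun a x * hermite_fun b x)) (at x)" for x
      by (rule DERIV_cong[OF DERIV_diff[OF DERIV_mult[OF hermite_fun_deriv hermite_fun_deriv2] DERIV_mult[OF hermite_fun_deriv2 hermite_fun_deriv]]])
         (simp add: algebra_simps)
    show "continuous_on UNIV (\<lambda>u. ?c * (hermite_fun a u * hermite_fun b u))" by (intro continuous_intros)
    show "integrable lborel (\<lambda>u. ?c * (hermite_fun a u * hermite_fun b u))"
      by (intro integrable_mult_right hermite_fun_prod_integrable)
  qed (rule tendsto_eq_intros hermite_fun_tendsto_0 hermite_fun'_tendsto_0 refl | simp)+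
  then show ?thesis using assms by simp
qed

text \<open>
  The norms of consecutive functions agree since, by the ladder relations, \<open>h\<^sub>a\<^sup>2 - h\<^sub>a\<^sub>+\<^sub>1\<^sup>2\<close> is a
  multiple of the derivative of \<open>h\<^sub>a\<^sub>+\<^sub>1 h\<^sub>a\<close>.
\<close>

lemma hermite_fun_norm: "(LINT u|lborel. hermite_fun a u * hermite_fun a u) = 1"
proof (induction a)
  case 0 then show ?case by (rule hermite_fun_0_norm)
next
  case (Suc a)
  let ?c = "sqrt 2 * sqrt (real (Suc a))"
  have "(LINT u|lborel. ?c * (hermite_fun a u * hermite_fun a u - hermite_fun (Suc a) u * hermite_fun (Suc a) u)) = 0"
  proof (rule integral_derivative_eq_0[where F = "\<lambda>u. hermite_fun (Suc a) u * hermite_fun a u"])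
    show "((\<lambda>u. hermite_fun (Suc a) u * hermite_fun a u) has_real_derivative
        ?c * (hermite_fun a x * hermite_fun a x - hermite_fun (Suc a) x * hermite_fun (Suc a) x)) (at x)" for x
      by (rule DERIV_cong[OF DERIV_mult[OF hermite_fun_deriv_lower hermite_fun_deriv_raise]])
         (simp add: algebra_simps)
    show "continuous_on UNIV (\<lambda>u. ?c * (hermite_fun a u * hermite_fun a u - hermite_fun (Suc a) u * hermite_fun (Suc a) u))" by (intro continuous_intros)
    show "integrable lborel (\<lambda>u. ?c * (hermite_fun a u * hermite_fun a u - hermite_fun (Suc a) u * hermite_fun (Suc a) u))"
      by (intro integrable_mult_right Bochner_Integration.integrable_diff hermite_fun_prod_integrable)
  qed (rule tendsto_eq_intros hermite_fun_tendsto_0 refl | simp)+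
  then show ?case using Suc by (simp add: Bochner_Integration.integral_diff hermite_fun_prod_integrable)
qed

lemma hermite_fun_orthonormal:
  "(LINT u|lborel. hermite_fun a u * hermite_fun b u) = (if a = b then 1 else 0)"
  by (simp add: hermite_fun_norm hermite_fun_orthogonal)

declare hermite_fun.simps [simp del]

text \<open>
  The derivatives of the squares telescope by the ladder relations. This plays the part of the
  Christoffel-Darboux formula.
\<close>

lemma hermite_fun_sum_deriv:
  "((\<lambda>u. \<Sum>a\<le>N. (hermite_fun a u)\<^sup>2) has_real_derivative
     - (sqrt 2 * sqrt (real (Suc N)) * (hermite_fun N u * hermite_fun (Suc N) u))) (at u)"
proof (induction N)
  case 0
  have "((\<lambda>u. (hermite_fun 0 u)\<^sup>2) has_real_derivative 2 * hermite_fun 0 u * hermite_fun' 0 u) (at u)"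
    by (rule DERIV_cong[OF DERIV_power[OF hermite_fun_deriv]]) simp
  moreover have "2 * x / sqrt 2 = sqrt 2 * x" for x :: real
    by (simp add: real_div_sqrt field_simps)
  from this[of "hermite_fun 0 u * hermite_fun (Suc 0) u"]
  have "2 * hermite_fun 0 u * hermite_fun' 0 u = - (sqrt 2 * sqrt (real (Suc 0)) * (hermite_fun 0 u * hermite_fun (Suc 0) u))"
    by (simp add: hermite_fun'_def)
  ultimately show ?case by simp
next
  case (Suc N)
  have "((\<lambda>u. (hermite_fun (Suc N) u)\<^sup>2) has_real_derivative 2 * hermite_fun (Suc N) u * hermite_fun' (Suc N) u) (at u)"
    by (rule DERIV_cong[OF DERIV_power[OF hermite_fun_deriv]]) simp
  from DERIV_add[OF Suc this]
  have D: "((\<lambda>u. \<Sum>a\<le>Suc N. (hermite_fun a u)\<^sup>2) has_real_derivative - (sqrt 2 * sqrt (real (Suc N)) * (hermite_fun N u * hermite_fun (Suc N) u))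
     + 2 * hermite_fun (Suc N) u * hermite_fun' (Suc N) u) (at u)" by simp
  have two: "2 * x / sqrt 2 = sqrt 2 * x" for x :: real
    by (simp add: real_div_sqrt field_simps)
  have "2 * hermite_fun (Suc N) u * hermite_fun' (Suc N) u = sqrt 2 * (hermite_fun (Suc N) u * (sqrt (real (Suc N)) * hermite_fun N u
      - sqrt (real (Suc (Suc N))) * hermite_fun (Suc (Suc N)) u))"
    unfolding hermite_fun'_def by (subst two[symmetric]) (simp add: mult_ac)
  then show ?case
    by (intro DERIV_cong[OF D]) (simp add: algebra_simps)
qed

text \<open>
  The sum \<open>\<Sum>\<^sub>a\<^sub>\<le>\<^sub>N h\<^sub>a\<^sup>2\<close> vanishes at infinity, and the integral of the absolute value of its derivative is
  at most \<open>\<surd>(2 (N + 1)) \<integral> \<bar>h\<^sub>N h\<^sub>N\<^sub>+\<^sub>1\<bar> \<le> \<surd>(2 (N + 1))\<close>. The power \<open>1/2\<close> of \<open>N\<close> is what leads to \<open>R\<^sup>n\<^sup>/\<^sup>2\<close>,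
  the correct size of the kernel on the diagonal in dimension \<open>n\<close>.
\<close>

lemma hermite_fun_sum_le: "(\<Sum>a\<le>N. (hermite_fun a u)\<^sup>2) \<le> sqrt 2 * sqrt (real (Suc N))"
proof -
  let ?S = "\<lambda>u. \<Sum>a\<le>N. (hermite_fun a u)\<^sup>2"
  let ?c = "sqrt 2 * sqrt (real (Suc N))"
  let ?p = "\<lambda>u. hermite_fun N u * hermite_fun (Suc N) u"
  have abs_p: "(LINT x|lborel. \<bar>?p x\<bar>) \<le> 1"
  proof -
    have "(LINT x|lborel. \<bar>?p x\<bar>) \<le> (LINT x|lborel. (hermite_fun N x * hermite_fun N x + hermite_fun (Suc N) x * hermite_fun (Suc N) x) / 2)"
    proof (rule integral_mono)
      fix x show "\<bar>?p x\<bar> \<le> (hermite_fun N x * hermite_fun N x + hermite_fun (Suc N) x * hermite_fun (Suc N) x) / 2"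
        using sum_squares_bound[of "\<bar>hermite_fun N x\<bar>" "\<bar>hermite_fun (Suc N) x\<bar>"]
        by (simp add: abs_mult power2_eq_square)
    qed (auto intro!: integrable_abs hermite_fun_prod_integrable Bochner_Integration.integrable_add integrable_divide)
    also have "\<dots> = 1"
      by (simp add: Bochner_Integration.integral_add hermite_fun_prod_integrable hermite_fun_norm)
    finally show ?thesis .
  qed
  have *: "?S u \<le> ?S k + ?c" if "u \<le> k" for k
  proof -
    have "integral\<^sup>L lborel (\<lambda>x. indicator {u..k} x *\<^sub>R (- (?c * ?p x))) = ?S k - ?S u"
      apply (rule integral_FTC_atLeastAtMost[OF that])
      subgoal for x
        unfolding has_real_derivative_iff_has_vector_derivative[symmetric]
        by (rule DERIV_subset[OF hermite_fun_sum_deriv]) simp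
      by (intro continuous_intros)
    moreover have "\<bar>integral\<^sup>L lborel (\<lambda>x. indicator {u..k} x *\<^sub>R (- (?c * ?p x)))\<bar> \<le> (LINT x|lborel. ?c * \<bar>?p x\<bar>)"
    proof (rule order_trans[OF integral_abs_bound integral_mono'])
      show "integrable lborel (\<lambda>x. ?c * \<bar>?p x\<bar>)"
        by (intro integrable_mult_right integrable_abs hermite_fun_prod_integrable)
    qed (auto simp: indicator_def abs_mult)
    moreover have "(LINT x|lborel. ?c * \<bar>?p x\<bar>) \<le> ?c * 1"
      using abs_p by (subst integral_mult_right_zero) (intro mult_left_mono, auto)
    ultimately show ?thesis by linarith
  qed
  have lim: "((\<lambda>k. ?S k + ?c) \<longlongrightarrow> (\<Sum>a\<le>N. 0\<^sup>2) + ?c) at_top"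
    by (intro tendsto_intros hermite_fun_tendsto_0)
  have "\<forall>\<^sub>F k in at_top. ?S u \<le> ?S k + ?c"
    by (rule eventually_mono[OF eventually_ge_at_top[of u]]) (rule *)
  from tendsto_lowerbound[OF lim this] show ?thesis by simp
qed

lemma hermite_fun'_ladder:
  "(sqrt (real a) * hermite_fun' (a - 1) u - sqrt (real (Suc a)) * hermite_fun' (Suc a) u) / sqrt 2
    = (u\<^sup>2 - (2 * real a + 1)) * hermite_fun a u"
proof (rule DERIV_unique[OF _ hermite_fun_deriv2])
  have eq: "hermite_fun' a = (\<lambda>u. (sqrt (real a) * hermite_fun (a - 1) u
      - sqrt (real (Suc a)) * hermite_fun (Suc a) u) / sqrt 2)"
    by (rule ext) (rule hermite_fun'_def)
  show "(hermite_fun' a has_real_derivative (sqrt (real a) * hermite_fun' (a - 1) u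
      - sqrt (real (Suc a)) * hermite_fun' (Suc a) u) / sqrt 2) (at u)"
    unfolding eq
    by (intro DERIV_cdivide DERIV_diff DERIV_cmult hermite_fun_deriv)
qed

section \<open>Hermite functions of several variables\<close>

lemma integral_prod_vec:
  fixes f :: "'n::finite \<Rightarrow> real \<Rightarrow> real"
  assumes int: "\<And>i. integrable lborel (f i)"
  shows "integrable lborel (\<lambda>x::real^'n. \<Prod>i\<in>UNIV. f i (x $ i))" (is ?A)
    and "(LINT x|lborel. (\<Prod>i\<in>UNIV. f i ((x::real^'n) $ i))) = (\<Prod>i\<in>UNIV. LINT u|lborel. f i u)" (is ?B)
proof -
  define e :: "'n \<Rightarrow> real^'n" where "e i = axis i 1" for i
  have inj: "inj e" by (auto simp: inj_def e_def axis_eq_axis)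
  have Basis: "(Basis :: (real^'n) set) = range e" by (auto simp: Basis_vec_def e_def)
  define g where "g b = f (inv e b)" for b
  have ge: "g (e i) = f i" for i unfolding g_def by (simp add: inv_f_f[OF inj])
  interpret product_sigma_finite "\<lambda>_::real^'n. lborel :: real measure"
    by standard
  let ?T = "\<lambda>y::real^'n\<Rightarrow>real. \<Sum>b\<in>Basis. y b *\<^sub>R b"
  have T: "?T \<in> measurable (\<Pi>\<^sub>M b\<in>Basis. lborel) borel" by measurable
  have lb: "(lborel :: (real^'n) measure) = distr (\<Pi>\<^sub>M b\<in>Basis. lborel) borel ?T"
    by (subst lborel_def) (simp add: lborel_eq_real)
  have meas: "(\<lambda>x::real^'n. \<Prod>i\<in>UNIV. f i (x $ i)) \<in> borel_measurable borel"
  proof (intro borel_measurable_prod)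
    fix i
    have [measurable]: "f i \<in> borel_measurable borel" using int[of i] by (simp add: integrable_iff_bounded)
    show "(\<lambda>x::real^'n. f i (x $ i)) \<in> borel_measurable borel"
      by (rule measurable_compose[of _ _ borel]) (auto intro!: borel_measurable_continuous_onI continuous_intros)
  qed
  have eq: "(\<Prod>i\<in>UNIV. f i (?T y $ i)) = (\<Prod>b\<in>Basis. g b (y b))" for y
  proof -
    have "?T y $ i = y (e i)" for i
    proof -
      have "?T y $ i = ?T y \<bullet> e i" by (simp add: e_def inner_axis)
      also have "\<dots> = y (e i)" by (rule inner_sum_left_Basis) (simp add: Basis)
      finally show ?thesis .
    qed
    then show ?thesis unfolding Basis by (subst prod.reindex[OF inj]) (simp add: ge)
  qed
  have gint: "integrable lborel (g b)" for b unfolding g_def by (rule int)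
  show ?A unfolding lb
    by (subst integrable_distr_eq[OF T meas], unfold eq) (intro product_integrable_prod gint finite_Basis)
  have "(LINT x|lborel. (\<Prod>i\<in>UNIV. f i ((x::real^'n) $ i))) = (LINT y|(\<Pi>\<^sub>M b\<in>Basis. lborel). (\<Prod>b\<in>Basis. g b (y b)))"
    unfolding lb by (subst integral_distr[OF T meas], unfold eq) (rule refl)
  also have "\<dots> = (\<Prod>b\<in>Basis. LINT u|lborel. g b u)"
    by (rule product_integral_prod[OF finite_Basis gint])
  also have "\<dots> = (\<Prod>i\<in>UNIV. LINT u|lborel. f i u)"
    unfolding Basis by (subst prod.reindex[OF inj]) (simp add: ge)
  finally show ?B .
qed

definition hermite :: "('n::finite \<Rightarrow> nat) \<Rightarrow> real^'n \<Rightarrow> real" where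
  "hermite \<alpha> x = (\<Prod>i\<in>UNIV. hermite_fun (\<alpha> i) (x $ i))"

text \<open>
  The partial derivative of \<open>h\<^sub>\<alpha>\<close> in direction \<open>i\<close>. At \<open>\<alpha> i = 0\<close> the factor \<open>sqrt 0\<close> removes the term
  with the truncated index \<open>\<alpha> i - 1\<close>; the same convention is used for all lowering operators.
\<close>

definition hermite_d :: "'n::finite \<Rightarrow> ('n \<Rightarrow> nat) \<Rightarrow> real^'n \<Rightarrow> real" where
  "hermite_d i \<alpha> x = (sqrt (real (\<alpha> i)) * hermite (\<alpha>(i := \<alpha> i - 1)) x
      - sqrt (real (Suc (\<alpha> i))) * hermite (\<alpha>(i := Suc (\<alpha> i))) x) / sqrt 2"

lemma hermite_split:
  "hermite (\<alpha>(i := a)) x = hermite_fun a (x $ i) * (\<Prod>j\<in>UNIV - {i}. hermite_fun (\<alpha> j) (x $ j))"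
  unfolding hermite_def by (subst prod.remove[of UNIV i]) (auto intro!: prod.cong)

lemma hermite_rec:
  "x $ i * hermite \<alpha> x = (sqrt (real (Suc (\<alpha> i))) * hermite (\<alpha>(i := Suc (\<alpha> i))) x
     + sqrt (real (\<alpha> i)) * hermite (\<alpha>(i := \<alpha> i - 1)) x) / sqrt 2"
proof -
  have "x $ i * hermite (\<alpha>(i := \<alpha> i)) x = (sqrt (real (Suc (\<alpha> i))) * hermite (\<alpha>(i := Suc (\<alpha> i))) x
     + sqrt (real (\<alpha> i)) * hermite (\<alpha>(i := \<alpha> i - 1)) x) / sqrt 2"
    unfolding hermite_split mult.assoc[symmetric] hermite_fun_rec'
    by (simp only: times_divide_eq_left distrib_right)
  then show ?thesis by simp
qed

lemma hermite_d_split: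
  "hermite_d i (\<alpha>(i := a)) x = hermite_fun' a (x $ i) * (\<Prod>j\<in>UNIV - {i}. hermite_fun (\<alpha> j) (x $ j))"
  unfolding hermite_d_def hermite_fun'_def fun_upd_upd fun_upd_same hermite_split
  by (simp only: times_divide_eq_left left_diff_distrib mult.assoc)

text \<open>
  The left-hand side is the form in which the second partial derivative arises from
  \<open>hermite_d\<close>, whose own definition has been differentiated.
\<close>

lemma hermite_d2:
  "(sqrt (real (\<alpha> i)) * hermite_d i (\<alpha>(i := \<alpha> i - 1)) x
      - sqrt (real (Suc (\<alpha> i))) * hermite_d i (\<alpha>(i := Suc (\<alpha> i))) x) / sqrt 2
    = ((x $ i)\<^sup>2 - (2 * real (\<alpha> i) + 1)) * hermite \<alpha> x"
proof -
  have "(sqrt (real (\<alpha> i)) * hermite_d i (\<alpha>(i := \<alpha> i - 1)) x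
      - sqrt (real (Suc (\<alpha> i))) * hermite_d i (\<alpha>(i := Suc (\<alpha> i))) x) / sqrt 2
    = ((x $ i)\<^sup>2 - (2 * real (\<alpha> i) + 1)) * hermite (\<alpha>(i := \<alpha> i)) x"
    unfolding hermite_d_split hermite_split mult.assoc[symmetric] hermite_fun'_ladder[symmetric]
    by (simp only: times_divide_eq_left left_diff_distrib)
  then show ?thesis by simp
qed

lemma hermite_has_derivative:
  "(hermite \<alpha> has_derivative (\<lambda>v. \<Sum>i\<in>UNIV. v $ i * hermite_d i \<alpha> x)) (at x)"
proof -
  have "((\<lambda>x. hermite_fun (\<alpha> i) (x $ i)) has_derivative (\<lambda>v. hermite_fun' (\<alpha> i) (x $ i) * v $ i)) (at x)" for i
    by (rule has_derivative_compose[OF bounded_linear.has_derivative[OF bounded_linear_vec_nth has_derivative_ident]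
        hermite_fun_deriv[unfolded has_field_derivative_def]])
  then have "((\<lambda>x. hermite_fun (\<alpha> i) (x $ i)) has_derivative (\<lambda>v. v $ i * hermite_fun' (\<alpha> i) (x $ i))) (at x)" for i
    by (simp add: mult.commute)
  then have "((\<lambda>x. \<Prod>i\<in>UNIV. hermite_fun (\<alpha> i) (x $ i)) has_derivative
     (\<lambda>v. \<Sum>i\<in>UNIV. v $ i * hermite_fun' (\<alpha> i) (x $ i) * (\<Prod>j\<in>UNIV - {i}. hermite_fun (\<alpha> j) (x $ j)))) (at x)"
    by (rule has_derivative_prod)
  moreover have "hermite_fun' (\<alpha> i) (x $ i) * (\<Prod>j\<in>UNIV - {i}. hermite_fun (\<alpha> j) (x $ j)) = hermite_d i \<alpha> x" for i
    using hermite_d_split[of i \<alpha> "\<alpha> i" x] by simp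
  ultimately show ?thesis unfolding hermite_def[abs_def] by (simp add: mult.assoc)
qed

lemma continuous_hermite [continuous_intros]: "continuous_on S (hermite \<alpha>)"
  by (meson continuous_at_imp_continuous_on has_derivative_continuous hermite_has_derivative)

lemma hermite_measurable [measurable]: "hermite \<alpha> \<in> borel_measurable borel"
  by (intro borel_measurable_continuous_onI continuous_hermite)

lemma hermite_prod_eq:
  "hermite \<alpha> x * hermite \<beta> x = (\<Prod>i\<in>UNIV. hermite_fun (\<alpha> i) (x $ i) * hermite_fun (\<beta> i) (x $ i))"
  by (simp add: hermite_def prod.distrib)

lemma hermite_prod_integrable: "integrable lborel (\<lambda>x. hermite \<alpha> x * hermite \<beta> x)"
  unfolding hermite_prod_eq by (rule integral_prod_vec(1)[OF hermite_fun_prod_integrable])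

lemma hermite_orthonormal:
  "(LINT x|lborel. hermite \<alpha> x * hermite \<beta> x) = (if \<alpha> = \<beta> then 1 else 0)"
  unfolding hermite_prod_eq integral_prod_vec(2)[OF hermite_fun_prod_integrable] hermite_fun_orthonormal
  by (auto simp: fun_eq_iff)

lemma finite_multiindices [simp]: "finite {\<alpha>::'n::finite \<Rightarrow> nat. sum \<alpha> UNIV < R}"
proof (rule finite_subset)
  show "{\<alpha>::'n \<Rightarrow> nat. sum \<alpha> UNIV < R} \<subseteq> PiE UNIV (\<lambda>_. {..<R})"
    by (auto intro: le_less_trans[OF member_le_sum[of _ UNIV]])
qed (simp add: finite_PiE)

lemma finite_multiindices_eq [simp]: "finite {\<alpha>::'n::finite \<Rightarrow> nat. sum \<alpha> UNIV = k}"
  by (rule finite_subset[OF _ finite_multiindices[of "Suc k"]]) auto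

text \<open>
  The simplex of multi-indices lies in a cube, over which the sum of squares is a product of
  one-dimensional sums.
\<close>

lemma hermite_sum_le:
  "(\<Sum>\<alpha> | sum \<alpha> UNIV < R. (hermite \<alpha> (x::real^'n))\<^sup>2) \<le> (sqrt 2 * sqrt (real R)) ^ CARD('n::finite)"
proof -
  have "(\<Sum>\<alpha> | sum \<alpha> UNIV < R. (hermite \<alpha> x)\<^sup>2) \<le> (\<Sum>\<alpha>\<in>PiE UNIV (\<lambda>_. {..<R}). (hermite \<alpha> x)\<^sup>2)"
    by (rule sum_mono2) (auto simp: finite_PiE intro: le_less_trans[OF member_le_sum[of _ UNIV]])
  also have "\<dots> = (\<Prod>i\<in>UNIV. \<Sum>a<R. (hermite_fun a (x $ i))\<^sup>2)"
    by (subst prod_sum_PiE) (auto simp: hermite_def prod_power_distrib)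
  also have "\<dots> \<le> (\<Prod>i\<in>(UNIV::'n set). sqrt 2 * sqrt (real R))"
  proof (intro prod_mono conjI)
    fix i :: 'n
    show "(\<Sum>a<R. (hermite_fun a (x $ i))\<^sup>2) \<le> sqrt 2 * sqrt (real R)"
    proof (cases R)
      case (Suc N) then show ?thesis using hermite_fun_sum_le[where N=N and u="x $ i"] by (simp add: lessThan_Suc_atMost)
    qed simp
  qed (simp add: sum_nonneg)
  finally show ?thesis by simp
qed

lemma hermite_bounded: "\<exists>C. \<forall>x::real^'n. \<bar>hermite \<alpha> x\<bar> \<le> C"
proof -
  let ?R = "Suc (sum \<alpha> UNIV)"
  have "\<bar>hermite \<alpha> x\<bar> \<le> sqrt ((sqrt 2 * sqrt (real ?R)) ^ CARD('n::finite))" for x :: "real^'n"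
  proof -
    have "(hermite \<alpha> x)\<^sup>2 \<le> (\<Sum>\<alpha> | sum \<alpha> UNIV < ?R. (hermite \<alpha> x)\<^sup>2)"
      by (rule member_le_sum) auto
    also have "\<dots> \<le> (sqrt 2 * sqrt (real ?R)) ^ CARD('n)" by (rule hermite_sum_le)
    finally show ?thesis by (metis real_sqrt_abs real_sqrt_le_iff)
  qed
  then show ?thesis by blast
qed

lemma hermite_d_has_derivative:
  "(hermite_d i \<alpha> has_derivative (\<lambda>v. \<Sum>j\<in>UNIV. v $ j *
     ((sqrt (real (\<alpha> i)) * hermite_d j (\<alpha>(i := \<alpha> i - 1)) x
      - sqrt (real (Suc (\<alpha> i))) * hermite_d j (\<alpha>(i := Suc (\<alpha> i))) x) / sqrt 2))) (at x)"
proof -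
  have eq: "hermite_d i \<alpha> = (\<lambda>x. (sqrt (real (\<alpha> i)) * hermite (\<alpha>(i := \<alpha> i - 1)) x
      - sqrt (real (Suc (\<alpha> i))) * hermite (\<alpha>(i := Suc (\<alpha> i))) x) * (1 / sqrt 2))"
    by (rule ext) (simp add: hermite_d_def)
  show ?thesis unfolding eq
    by (rule has_derivative_eq_rhs, rule has_derivative_mult_left, rule has_derivative_diff;
        (rule has_derivative_mult_right, rule hermite_has_derivative)?)
       (simp add: fun_eq_iff sum_distrib_left sum_distrib_right sum_subtractf[symmetric] sum_divide_distrib, intro allI sum.cong refl,
        simp add: algebra_simps diff_divide_distrib)
qed

lemma continuous_hermite_d [continuous_intros]: "continuous_on S (hermite_d i \<alpha>)"
  by (meson continuous_at_imp_continuous_on has_derivative_continuous hermite_d_has_derivative)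

section \<open>Finite differences and smooth cutoffs\<close>

definition fdiff :: "(nat \<Rightarrow> 'a::ab_group_add) \<Rightarrow> nat \<Rightarrow> 'a" where
  "fdiff f k = f (Suc k) - f k"

lemma fdiff_pow_add: "(fdiff ^^ l) (\<lambda>k. f k + g k) k = (fdiff ^^ l) f k + (fdiff ^^ l) g k"
  by (induction l arbitrary: k) (simp_all add: fdiff_def)

lemma fdiff_pow_diff: "(fdiff ^^ l) (\<lambda>k. f k - g k) k = (fdiff ^^ l) f k - (fdiff ^^ l) g k"
  by (induction l arbitrary: k) (simp_all add: fdiff_def)

lemma fdiff_pow_shift: "(fdiff ^^ l) (\<lambda>k. f (k + j)) k = (fdiff ^^ l) f (k + j)"
  by (induction l arbitrary: k) (simp_all add: fdiff_def)

lemma fdiff_pow_of_real: "(fdiff ^^ l) (\<lambda>k. of_real (f k) :: complex) k = of_real ((fdiff ^^ l) f k)"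
  by (induction l arbitrary: k) (simp_all add: fdiff_def)

lemma fdiff_pow_scale: "(fdiff ^^ l) (\<lambda>k. f k / (c::real)) k = (fdiff ^^ l) f k / c"
  by (induction l arbitrary: k) (simp_all add: fdiff_def diff_divide_distrib)

lemma fdiff_pow_Suc: "(fdiff ^^ Suc l) f = (fdiff ^^ l) (fdiff f)"
  by (simp add: funpow_swap1)

lemma fdiff_pow_eq_0:
  "(\<And>i. i \<le> l \<Longrightarrow> f (k + i) = 0) \<Longrightarrow> (fdiff ^^ l) f k = 0"
proof (induction l arbitrary: k)
  case (Suc l)
  have "(fdiff ^^ l) f k = 0" by (rule Suc.IH) (simp add: Suc.prems)
  moreover have "(fdiff ^^ l) f (Suc k) = 0"
    by (rule Suc.IH) (use Suc.prems[of "Suc i" for i] in simp)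
  ultimately show ?case using fdiff_def[of "(fdiff ^^ l) f" k] by simp
qed simp

text \<open>
  A product rule for iterated differences: if the differences of both factors decay geometrically in
  the order, so do those of the product. By restricting to \<open>k \<ge> k0\<close> it can be applied to symbols whose
  differences decay as \<open>k\<close> grows.
\<close>

lemma fdiff_pow_mult_bound:
  fixes a b :: "nat \<Rightarrow> complex"
  assumes "\<And>i k. i \<le> l \<Longrightarrow> k \<ge> k0 \<Longrightarrow> norm ((fdiff ^^ i) a k) \<le> A * \<rho> ^ i"
    and "\<And>i k. i \<le> l \<Longrightarrow> k \<ge> k0 \<Longrightarrow> norm ((fdiff ^^ i) b k) \<le> B * \<rho> ^ i"
    and "k \<ge> k0"
  shows "norm ((fdiff ^^ l) (\<lambda>k. a k * b k) k) \<le> 2 ^ l * (A * B) * \<rho> ^ l"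
  using assms
proof (induction l arbitrary: a b A B k)
  case 0
  have "norm (a k) * norm (b k) \<le> A * B"
    using 0(1)[of 0 k] 0(2)[of 0 k] 0(3) by (intro mult_mono) (auto intro: order_trans[OF norm_ge_zero])
  then show ?case by (simp add: norm_mult)
next
  case (Suc l)
  have eq: "fdiff (\<lambda>k. a k * b k) = (\<lambda>k. fdiff a k * b (k + 1) + a k * fdiff b k)"
    by (rule ext) (simp add: fdiff_def algebra_simps)
  have da: "norm ((fdiff ^^ i) (fdiff a) k) \<le> (A * \<rho>) * \<rho> ^ i" if "i \<le> l" "k \<ge> k0" for i k
    using Suc.prems(1)[of "Suc i" k] that by (simp add: fdiff_pow_Suc mult_ac del: funpow.simps)
  have db: "norm ((fdiff ^^ i) (fdiff b) k) \<le> (B * \<rho>) * \<rho> ^ i" if "i \<le> l" "k \<ge> k0" for i k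
    using Suc.prems(2)[of "Suc i" k] that by (simp add: fdiff_pow_Suc mult_ac del: funpow.simps)
  have sb: "norm ((fdiff ^^ i) (\<lambda>k. b (k + 1)) k) \<le> B * \<rho> ^ i" if "i \<le> l" "k \<ge> k0" for i k
    unfolding fdiff_pow_shift using Suc.prems(2)[of i "k + 1"] that by simp
  have 1: "norm ((fdiff ^^ l) (\<lambda>k. fdiff a k * b (k + 1)) k) \<le> 2 ^ l * ((A * \<rho>) * B) * \<rho> ^ l"
    by (rule Suc.IH[OF da sb Suc.prems(3)])
  have 2: "norm ((fdiff ^^ l) (\<lambda>k. a k * fdiff b k) k) \<le> 2 ^ l * (A * (B * \<rho>)) * \<rho> ^ l"
    by (rule Suc.IH[OF _ db Suc.prems(3)]) (use Suc.prems(1) in simp)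
  show ?case unfolding fdiff_pow_Suc eq fdiff_pow_add
    by (rule order_trans[OF norm_triangle_ineq order_trans[OF add_mono[OF 1 2]]]) (simp add: algebra_simps)
qed

text \<open>
  One averaging of width \<open>R\<close> makes a function one order smoother at scale \<open>R\<close>, since its difference is
  a difference quotient with step \<open>R\<close>.
\<close>

definition moving_avg :: "nat \<Rightarrow> (nat \<Rightarrow> real) \<Rightarrow> nat \<Rightarrow> real" where
  "moving_avg R f k = (\<Sum>i<R. f (k + i)) / real R"

text \<open>
  A discrete spline that is \<open>1\<close> below \<open>R\<close> and \<open>0\<close> from \<open>(M + 1) R\<close> on: \<open>M\<close>-fold averaging of a jump at
  \<open>(M + 1) R\<close> moves the lower edge down by less than \<open>M R\<close> and makes \<open>M\<close> differences as small as for
  a smooth function at scale \<open>R\<close>.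
\<close>

definition cutoff :: "nat \<Rightarrow> nat \<Rightarrow> nat \<Rightarrow> real" where
  "cutoff M R = (moving_avg R ^^ M) (\<lambda>k. if k < (M + 1) * R then 1 else 0)"

lemma fdiff_moving_avg: "fdiff (moving_avg R f) = (\<lambda>k. (f (k + R) - f k) / real R)"
proof
  fix k
  have "(\<Sum>i<R. f (Suc k + i)) - (\<Sum>i<R. f (k + i)) = f (k + R) - f k"
    using sum_lessThan_telescope[of "\<lambda>i. f (k + i)" R] by (simp add: sum_subtractf)
  then show "fdiff (moving_avg R f) k = (f (k + R) - f k) / real R"
    by (simp add: fdiff_def moving_avg_def diff_divide_distrib[symmetric])
qed

lemma moving_avg_bound:
  assumes "R > 0" "\<And>k. \<bar>f k\<bar> \<le> B" shows "\<bar>moving_avg R f k\<bar> \<le> B"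
proof -
  have "\<bar>\<Sum>i<R. f (k + i)\<bar> \<le> (\<Sum>i<R. B)"
    by (rule order_trans[OF sum_abs sum_mono]) (rule assms)
  then show ?thesis using assms(1) by (simp add: moving_avg_def field_simps)
qed

lemma fdiff_pow_moving_avg_bound:
  assumes "R > 0" "\<And>k. \<bar>f k\<bar> \<le> B" "l \<le> M"
  shows "\<bar>(fdiff ^^ l) ((moving_avg R ^^ M) f) k\<bar> \<le> B * (2 / real R) ^ l"
  using assms(3)
proof (induction M arbitrary: l k)
  case 0 then show ?case using assms by simp
next
  case (Suc M)
  let ?g = "(moving_avg R ^^ M) f"
  show ?case
  proof (cases l)
    case 0
    then show ?thesis using moving_avg_bound[OF assms(1), of ?g B k] Suc.IH[of 0] by simp
  next
    case (Suc j)
    then have j: "j \<le> M" using Suc.prems by simp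
    have "(fdiff ^^ l) ((moving_avg R ^^ Suc M) f) k = ((fdiff ^^ j) ?g (k + R) - (fdiff ^^ j) ?g k) / real R"
    proof -
      have "(moving_avg R ^^ Suc M) f = moving_avg R ?g" by simp
      then show ?thesis
        unfolding Suc fdiff_pow_Suc by (simp only: fdiff_moving_avg fdiff_pow_scale fdiff_pow_diff fdiff_pow_shift)
    qed
    also have "\<bar>\<dots>\<bar> \<le> (B * (2 / real R) ^ j + B * (2 / real R) ^ j) / real R"
      using Suc.IH[OF j, of "k + R"] Suc.IH[OF j, of k] assms(1)
      by (simp add: abs_divide divide_le_cancel)
    also have "\<dots> = B * (2 / real R) ^ l" by (simp add: Suc)
    finally show ?thesis .
  qed
qed

lemma cutoff_fdiff_bound:
  "R > 0 \<Longrightarrow> l \<le> M \<Longrightarrow> \<bar>(fdiff ^^ l) (cutoff M R) k\<bar> \<le> (2 / real R) ^ l"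
  unfolding cutoff_def
  using fdiff_pow_moving_avg_bound[of R "\<lambda>k. if k < (M + 1) * R then 1 else 0" 1 l M k] by simp

lemma cutoff_eq_1:
  assumes "R > 0" "k < R" shows "cutoff M R k = 1"
proof -
  have "(moving_avg R ^^ j) (\<lambda>k. if k < N then 1 else 0) k = 1" if "k + j * (R - 1) < N" for j N k
    using that
  proof (induction j arbitrary: k)
    case (Suc j)
    have "(\<Sum>i<R. (moving_avg R ^^ j) (\<lambda>k. if k < N then 1 else 0) (k + i)) = (\<Sum>i<R. 1)"
      using Suc.prems by (intro sum.cong refl Suc.IH) auto
    then show ?case
      using assms(1) moving_avg_def[of R "(moving_avg R ^^ j) (\<lambda>k. if k < N then 1 else 0)" k] by simp
  qed simp
  moreover have "k + M * (R - 1) < (M + 1) * R"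
  proof -
    have "M * (R - 1) \<le> M * R" by (rule mult_le_mono2) simp
    moreover have "(M + 1) * R = R + M * R" by simp
    ultimately show ?thesis using assms by linarith
  qed
  ultimately show ?thesis unfolding cutoff_def by blast
qed

lemma cutoff_eq_0:
  assumes "k \<ge> (M + 1) * R" shows "cutoff M R k = 0"
proof -
  have "(moving_avg R ^^ j) (\<lambda>k. if k < N then 1 else 0) k = 0" if "k \<ge> N" for j N k
    using that by (induction j arbitrary: k) (simp_all add: moving_avg_def)
  then show ?thesis unfolding cutoff_def using assms by blast
qed

lemma cutoff_antimono: "antimono (cutoff M R)"
proof -
  have "antimono ((moving_avg R ^^ j) f)" if "antimono f" for j f
    using that
    by (induction j) (auto simp: antimono_def moving_avg_def intro!: divide_right_mono sum_mono)
  then show ?thesis unfolding cutoff_def by (simp add: antimono_def)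
qed

lemma cutoff_range: "R > 0 \<Longrightarrow> 0 \<le> cutoff M R k" "R > 0 \<Longrightarrow> cutoff M R k \<le> 1"
  using antimonoD[OF cutoff_antimono, of k "k + (M + 1) * R" M R] cutoff_eq_0[of M R "k + (M + 1) * R"]
    cutoff_fdiff_bound[of R 0 M k] by auto

text \<open>
  The dyadic pieces use the ratio \<open>4\<close>, because the height \<open>R\<close> of a symbol corresponds to the length
  scale \<open>1 / \<surd>R\<close> of the kernel, which is thereby halved from piece to piece.
\<close>

definition cutoff_piece :: "nat \<Rightarrow> nat \<Rightarrow> nat \<Rightarrow> real" where
  "cutoff_piece M p k = (if p = 0 then cutoff M 1 k else cutoff M (4 ^ p) k - cutoff M (4 ^ (p - 1)) k)"

lemma sum_cutoff_piece: "(\<Sum>p\<le>J. cutoff_piece M p k) = cutoff M (4 ^ J) k"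
  by (induction J) (simp_all add: cutoff_piece_def)

lemma cutoff_piece_fdiff_bound:
  assumes "l \<le> M" shows "\<bar>(fdiff ^^ l) (cutoff_piece M p) k\<bar> \<le> 2 * (8 / 4 ^ p) ^ l"
proof (cases "p = 0")
  case True
  have "\<bar>(fdiff ^^ l) (cutoff M 1) k\<bar> \<le> 2 ^ l" using cutoff_fdiff_bound[of 1 l M k] assms by simp
  also have "\<dots> \<le> (8::real) ^ l" by (intro power_mono) auto
  also have "\<dots> \<le> 2 * 8 ^ l" by simp
  finally show ?thesis using True by (simp add: cutoff_piece_def[abs_def])
next
  case False
  then obtain r where p: "p = Suc r" by (cases p) auto
  have "(fdiff ^^ l) (cutoff_piece M p) k = (fdiff ^^ l) (cutoff M (4 ^ p)) k - (fdiff ^^ l) (cutoff M (4 ^ r)) k"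
    unfolding cutoff_piece_def[abs_def] by (simp add: p fdiff_pow_diff)
  also have "\<bar>\<dots>\<bar> \<le> (2 / real (4 ^ p)) ^ l + (2 / real (4 ^ r)) ^ l"
    using cutoff_fdiff_bound[of "4 ^ p" l M k] cutoff_fdiff_bound[of "4 ^ r" l M k] assms by auto
  also have "(2 / real (4 ^ p)) ^ l \<le> (8 / 4 ^ p) ^ l" by (intro power_mono) (auto simp: divide_simps)
  also have "(2 / real (4 ^ r)) ^ l = (8 / 4 ^ p) ^ l" by (simp add: p)
  finally show ?thesis by simp
qed

lemma cutoff_piece_eq_0:
  "k \<ge> (M + 1) * 4 ^ p \<Longrightarrow> cutoff_piece M p k = 0"
  "p > 0 \<Longrightarrow> 4 * k < 4 ^ p \<Longrightarrow> cutoff_piece M p k = 0"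
proof -
  assume k: "k \<ge> (M + 1) * 4 ^ p"
  have "(M + 1) * 4 ^ (p - 1) \<le> (M + 1) * 4 ^ p" by (intro mult_le_mono2 power_increasing) auto
  then have "cutoff M (4 ^ p) k = 0" "cutoff M (4 ^ (p - 1)) k = 0" using k by (intro cutoff_eq_0; linarith)+
  then show "cutoff_piece M p k = 0" using k by (auto simp: cutoff_piece_def)
next
  assume "p > 0" "4 * k < 4 ^ p"
  then obtain r where p: "p = Suc r" and k: "k < 4 ^ r" by (cases p) auto
  have "k < 4 ^ p" using k by (simp add: p)
  then show "cutoff_piece M p k = 0" using k by (simp add: cutoff_piece_def p cutoff_eq_1)
qed

text \<open>
  The differences of \<open>F\<close> decay like those of a homogeneous symbol of order zero, and on the support of the
  piece \<open>k + 1\<close> is comparable to \<open>4\<^sup>p\<close>. Hence the localized symbol has the differences of a smooth function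
  at scale \<open>4\<^sup>p\<close>, with a constant that does not depend on \<open>p\<close>.
\<close>

lemma cutoff_piece_mult:
  fixes F :: "nat \<Rightarrow> complex"
  assumes F: "\<And>l k. l \<le> M \<Longrightarrow> norm ((fdiff ^^ l) F k) \<le> A / real (k + 1) ^ l"
    and "l \<le> M"
  shows "norm ((fdiff ^^ l) (\<lambda>k. F k * of_real (cutoff_piece M p k)) k)
       \<le> 2 * A * (16 * real (M + 1) ^ 2) ^ M / (real ((M + 1) * 4 ^ p)) ^ l"
proof -
  let ?\<rho> = "8 * real (M + 1) / 4 ^ p"
  let ?c = "16 * real (M + 1) ^ 2"
  have A0: "A \<ge> 0" using F[of 0 0] by (auto intro: order_trans[OF norm_ge_zero])
  have c1: "?c \<ge> 1"
  proof -
    have "1 \<le> real (M + 1) ^ 2" by (rule one_le_power) simp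
    then show ?thesis by linarith
  qed
  have goal: "2 ^ l * (A * 2) * ?\<rho> ^ l \<le> 2 * A * ?c ^ M / (real ((M + 1) * 4 ^ p)) ^ l"
  proof -
    have "2 ^ l * (A * 2) * ?\<rho> ^ l = 2 * A * (2 * ?\<rho>) ^ l" by (subst power_mult_distrib) simp
    also have "2 * ?\<rho> = ?c / real ((M + 1) * 4 ^ p)"
    proof -
      have "2 * (8 * m / q) = 16 * m ^ 2 / (m * q)" if "m \<noteq> 0" for m q :: real
        using that by (simp add: power2_eq_square)
      from this[of "real (M + 1)" "4 ^ p"] show ?thesis unfolding of_nat_mult by simp
    qed
    also have "2 * A * (?c / real ((M + 1) * 4 ^ p)) ^ l = 2 * A * ?c ^ l / (real ((M + 1) * 4 ^ p)) ^ l"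
      by (simp add: power_divide)
    also have "\<dots> \<le> 2 * A * ?c ^ M / (real ((M + 1) * 4 ^ p)) ^ l"
      using A0 c1 assms(2) by (intro divide_right_mono mult_left_mono power_increasing) auto
    finally show ?thesis .
  qed
  \<comment> \<open>In the first case all values that enter the difference lie below the support of the piece.\<close>
  show ?thesis
  proof (cases "p > 0 \<and> 4 * (k + l) < 4 ^ p")
    case True
    have "(fdiff ^^ l) (\<lambda>k. F k * of_real (cutoff_piece M p k)) k = 0"
      by (rule fdiff_pow_eq_0) (use True cutoff_piece_eq_0(2)[of p "k + i" M for i] in auto)
    then show ?thesis using A0 by simp
  next
    case False
    have k: "4 ^ p \<le> 4 * real (M + 1) * real (k + 1)"
    proof (cases "p = 0")
      case False
      then have "4 ^ p \<le> 4 * (k + l)" using \<open>\<not> (p > 0 \<and> 4 * (k + l) < 4 ^ p)\<close> by simp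
      also have "\<dots> \<le> 4 * ((M + 1) * (k + 1))" using \<open>l \<le> M\<close> by (simp add: algebra_simps)
      finally have "real (4 ^ p) \<le> real (4 * ((M + 1) * (k + 1)))" by (rule of_nat_mono)
      then show ?thesis by (simp add: algebra_simps)
    next
      case True
      have "1 \<le> (1 + real M) * (1 + real k)" by (simp add: algebra_simps)
      then show ?thesis using True by (simp add: algebra_simps)
    qed
    have "norm ((fdiff ^^ l) (\<lambda>k. F k * of_real (cutoff_piece M p k)) k) \<le> 2 ^ l * (A * 2) * ?\<rho> ^ l"
    proof (rule fdiff_pow_mult_bound[where k0 = k])
      fix i k' assume i: "i \<le> l" and k': "k \<le> k'"
      have "A / real (k' + 1) ^ i = A * (1 / real (k' + 1)) ^ i" by (simp add: power_divide)
      also have "\<dots> \<le> A * ?\<rho> ^ i"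
      proof (intro mult_left_mono power_mono A0)
        have "4 ^ p \<le> 4 * real (M + 1) * real (k + 1)" by (rule k)
        also have "\<dots> \<le> 8 * real (M + 1) * real (k' + 1)" using k' by (intro mult_mono) auto
        finally show "1 / real (k' + 1) \<le> ?\<rho>" by (simp add: divide_simps mult_ac)
      qed auto
      finally show "norm ((fdiff ^^ i) F k') \<le> A * ?\<rho> ^ i" using F[of i k'] i assms(2) by (meson order_trans)
      have "2 * (8 / 4 ^ p) ^ i \<le> 2 * ?\<rho> ^ i"
        by (intro mult_left_mono power_mono divide_right_mono) auto
      then show "norm ((fdiff ^^ i) (\<lambda>k. complex_of_real (cutoff_piece M p k)) k') \<le> 2 * ?\<rho> ^ i"
        unfolding fdiff_pow_of_real norm_of_real
        using cutoff_piece_fdiff_bound[of i M p k'] i assms(2) by linarith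
    qed simp
    then show ?thesis using goal by linarith
  qed
qed

section \<open>Kernels of Hermite expansions\<close>

text \<open>
  The ladder operators act on functions of the multi-index: a letter \<open>(True, i)\<close> raises and
  \<open>(False, i)\<close> lowers the \<open>i\<close>-th entry. They are applied to \<open>\<alpha> \<mapsto> h\<^sub>\<alpha>(x)\<close> for fixed \<open>x\<close>.
\<close>

fun act :: "bool \<times> 'n \<Rightarrow> (('n::finite \<Rightarrow> nat) \<Rightarrow> real) \<Rightarrow> ('n \<Rightarrow> nat) \<Rightarrow> real" where
  "act (True, i) E \<alpha> = sqrt (real (Suc (\<alpha> i))) * E (\<alpha>(i := Suc (\<alpha> i)))"
| "act (False, i) E \<alpha> = sqrt (real (\<alpha> i)) * E (\<alpha>(i := \<alpha> i - 1))"

text \<open>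
  The position operator. On \<open>\<alpha> \<mapsto> h\<^sub>\<alpha>(x)\<close> it is multiplication by the coordinate \<open>x\<^sub>i\<close>
  (\<open>pos_op_hermite\<close>), which is the recurrence of the Hermite functions.
\<close>

definition pos_op :: "'n \<Rightarrow> (('n::finite \<Rightarrow> nat) \<Rightarrow> real) \<Rightarrow> ('n \<Rightarrow> nat) \<Rightarrow> real" where
  "pos_op i E \<alpha> = (act (True, i) E \<alpha> + act (False, i) E \<alpha>) / sqrt 2"

text \<open>
  The bilinear form with symbol \<open>G\<close>. Its value at \<open>\<alpha> \<mapsto> h\<^sub>\<alpha>(x)\<close> and \<open>\<alpha> \<mapsto> h\<^sub>\<alpha>(y)\<close> is the kernel; words of
  ladder operators in either argument arise from derivatives and from commutators.
\<close>

definition bform :: "nat \<Rightarrow> (nat \<Rightarrow> complex) \<Rightarrow> (('n::finite \<Rightarrow> nat) \<Rightarrow> real) \<Rightarrow> (('n \<Rightarrow> nat) \<Rightarrow> real) \<Rightarrow> complex" where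
  "bform R G E E' = (\<Sum>\<alpha> | sum \<alpha> UNIV < R. G (sum \<alpha> UNIV) * of_real (E \<alpha> * E' \<alpha>))"

lemma sum_fun_upd: "sum (\<alpha>(i := a)) UNIV + \<alpha> i = sum \<alpha> UNIV + (a::nat)" for \<alpha> :: "'n::finite \<Rightarrow> nat"
proof -
  have "sum (\<alpha>(i := a)) UNIV = a + sum \<alpha> (UNIV - {i})"
    by (subst sum.remove[of UNIV i]) auto
  moreover have "sum \<alpha> UNIV = \<alpha> i + sum \<alpha> (UNIV - {i})"
    by (rule sum.remove) auto
  ultimately show ?thesis by simp
qed

lemma bform_commute: "bform R G E E' = bform R G E' E"
  by (simp add: bform_def mult.commute)

text \<open>
  Raising and lowering are adjoint to each other, but they change \<open>\<bar>\<alpha>\<bar>\<close> by one, and so the symbol is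
  shifted. Since \<open>G\<close> vanishes from \<open>R\<close> on, the shift of the range of summation is harmless.
\<close>

lemma bform_adjoint:
  fixes i :: "'n::finite"
  assumes supp: "\<And>k. k \<ge> R \<Longrightarrow> G k = 0"
  shows "bform R (\<lambda>k. G (Suc k)) (act (True, i) E) E' = bform R G E (act (False, i) E')"
proof -
  let ?f = "\<lambda>\<alpha>. G (Suc (sum \<alpha> UNIV)) * of_real (act (True, i) E \<alpha> * E' \<alpha>)"
  let ?g = "\<lambda>\<gamma>. G (sum \<gamma> UNIV) * of_real (E \<gamma> * act (False, i) E' \<gamma>)"
  have "bform R (\<lambda>k. G (Suc k)) (act (True, i) E) E' = sum ?f {\<alpha>. sum \<alpha> UNIV < R}"
    by (simp add: bform_def)
  also have "\<dots> = sum ?f {\<alpha>. Suc (sum \<alpha> UNIV) < R}"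
    by (rule sum.mono_neutral_right) (auto simp: supp not_less)
  also have "\<dots> = sum ?g {\<gamma>. sum \<gamma> UNIV < R \<and> \<gamma> i > 0}"
  proof (rule sum.reindex_bij_witness[where i = "\<lambda>\<gamma>. \<gamma>(i := \<gamma> i - 1)" and j = "\<lambda>\<alpha>. \<alpha>(i := Suc (\<alpha> i))"])
    fix \<alpha> :: "'n \<Rightarrow> nat" assume "\<alpha> \<in> {\<alpha>. Suc (sum \<alpha> UNIV) < R}"
    moreover have s: "sum (\<alpha>(i := Suc (\<alpha> i))) UNIV = Suc (sum \<alpha> UNIV)" using sum_fun_upd[of \<alpha> i "Suc (\<alpha> i)"] by simp
    ultimately show "\<alpha>(i := Suc (\<alpha> i)) \<in> {\<gamma>. sum \<gamma> UNIV < R \<and> \<gamma> i > 0}" by simp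
    show "?g (\<alpha>(i := Suc (\<alpha> i))) = ?f \<alpha>" unfolding s by simp
  next
    fix \<gamma> :: "'n \<Rightarrow> nat" assume \<gamma>: "\<gamma> \<in> {\<gamma>. sum \<gamma> UNIV < R \<and> \<gamma> i > 0}"
    then have "\<gamma> i > 0" by simp
    then have "Suc (sum (\<gamma>(i := \<gamma> i - 1)) UNIV) = sum \<gamma> UNIV"
      using sum_fun_upd[of \<gamma> i "\<gamma> i - 1"] by linarith
    then show "\<gamma>(i := \<gamma> i - 1) \<in> {\<alpha>. Suc (sum \<alpha> UNIV) < R}" using \<gamma> by simp
  qed auto
  also have "\<dots> = sum ?g {\<gamma>. sum \<gamma> UNIV < R}"
    by (rule sum.mono_neutral_left) auto
  finally show ?thesis by (simp add: bform_def)
qed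

lemma bform_add_left: "bform R G (\<lambda>\<alpha>. E1 \<alpha> + E2 \<alpha>) E' = bform R G E1 E' + bform R G E2 E'"
  by (simp add: bform_def sum.distrib[symmetric] algebra_simps)

lemma bform_scale_left: "bform R G (\<lambda>\<alpha>. c * E \<alpha>) E' = of_real c * bform R G E E'"
  by (simp add: bform_def sum_distrib_left mult_ac)

lemma bform_fdiff: "bform R (fdiff G) E E' = bform R (\<lambda>k. G (Suc k)) E E' - bform R G E E'"
  by (simp add: bform_def fdiff_def sum_subtractf[symmetric] algebra_simps)

lemma bform_pos_op_left: "bform R G (pos_op i E) E' = (bform R G (act (True, i) E) E' + bform R G (act (False, i) E) E') / of_real (sqrt 2)"
proof -
  have "pos_op i E = (\<lambda>\<alpha>. (1 / sqrt 2) * (act (True, i) E \<alpha> + act (False, i) E \<alpha>))"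
    by (rule ext) (simp add: pos_op_def)
  then have "bform R G (pos_op i E) E' = of_real (1 / sqrt 2) * (bform R G (act (True, i) E) E' + bform R G (act (False, i) E) E')"
    by (simp only: bform_scale_left bform_add_left)
  then show ?thesis by (simp del: act.simps)
qed

text \<open>
  The source of decay: moving the position operator from one argument to the other costs only the two
  terms in which the symbol has been replaced by its difference.
\<close>

lemma bform_pos_op_commutator:
  assumes supp: "\<And>k. k \<ge> R \<Longrightarrow> G k = 0"
  shows "bform R G (pos_op i E) E' - bform R G E (pos_op i E')
     = (bform R (fdiff G) E (act (True, i) E') - bform R (fdiff G) (act (True, i) E) E') / of_real (sqrt 2)"
proof -
  have r: "bform R G E (pos_op i E') = bform R G (pos_op i E') E" by (rule bform_commute)
  have a: "bform R G (act (False, i) E) E' = bform R (\<lambda>k. G (Suc k)) E (act (True, i) E')"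
    by (metis bform_adjoint bform_commute supp)
  have b: "bform R G (act (False, i) E') E = bform R (\<lambda>k. G (Suc k)) (act (True, i) E) E'"
    by (metis bform_adjoint bform_commute supp)
  show ?thesis unfolding r bform_pos_op_left bform_fdiff a b
    by (simp add: bform_commute[of R G "act (True, i) E'"] diff_divide_distrib add_divide_distrib)
qed

definition word_act :: "(bool \<times> 'n) list \<Rightarrow> (('n::finite \<Rightarrow> nat) \<Rightarrow> real) \<Rightarrow> ('n \<Rightarrow> nat) \<Rightarrow> real" where
  "word_act w E = foldr act w E"

lemma word_act_simps [simp]: "word_act [] E = E" "word_act (l # w) E = act l (word_act w E)"
  by (simp_all add: word_act_def)

lemma act_add: "act l (\<lambda>\<alpha>. E \<alpha> + F \<alpha>) = (\<lambda>\<alpha>. act l E \<alpha> + act l F \<alpha>)"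
  by (rule ext, cases l, rename_tac b i, case_tac b) (simp_all add: distrib_left)

lemma act_scale: "act l (\<lambda>\<alpha>. c * E \<alpha>) = (\<lambda>\<alpha>. c * act l E \<alpha>)"
  by (rule ext, cases l, rename_tac b i, case_tac b) simp_all

lemma word_act_scale: "word_act w (\<lambda>\<alpha>. c * E \<alpha>) = (\<lambda>\<alpha>. c * word_act w E \<alpha>)"
  by (induction w) (simp_all add: act_scale)

text \<open>
  The scalar to which the commutator of the position operator with a letter reduces.
\<close>

definition comm_const :: "'n \<Rightarrow> bool \<times> 'n \<Rightarrow> real" where
  "comm_const i l = (if snd l = i then if fst l then - (1 / sqrt 2) else 1 / sqrt 2 else 0)"

lemma pos_op_act: "pos_op i (act l E) = (\<lambda>\<alpha>. act l (pos_op i E) \<alpha> + comm_const i l * E \<alpha>)"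
proof
  fix \<alpha> :: "'a \<Rightarrow> nat"
  obtain b j where l: "l = (b, j)" by force
  have s: "sqrt a * (sqrt a * x) = a * x" if "a \<ge> 0" for a x
    using that by (simp flip: mult.assoc)
  show "pos_op i (act l E) \<alpha> = act l (pos_op i E) \<alpha> + comm_const i l * E \<alpha>"
  proof (cases "j = i")
    case True
    show ?thesis unfolding l True
      by (cases b; cases "\<alpha> i") (simp_all add: pos_op_def comm_const_def s fun_upd_idem add_divide_distrib[symmetric] diff_divide_distrib[symmetric] algebra_simps)
  next
    case False
    then show ?thesis unfolding l
      by (cases b) (simp_all add: pos_op_def comm_const_def fun_upd_twist algebra_simps)
  qed
qed

text \<open>
  The commutator of the position operator with a word, as a list of coefficients and of words with one
  letter deleted.
\<close>

fun comm_terms :: "'n \<Rightarrow> (bool \<times> 'n) list \<Rightarrow> (real \<times> (bool \<times> 'n) list) list" where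
  "comm_terms i [] = []"
| "comm_terms i (l # w) = (comm_const i l, w) # map (\<lambda>(c, v). (c, l # v)) (comm_terms i w)"

lemma act_sum_list: "act l (\<lambda>\<alpha>. \<Sum>(c, v)\<leftarrow>xs. c * word_act v E \<alpha>) = (\<lambda>\<alpha>. \<Sum>(c, v)\<leftarrow>map (\<lambda>(c, v). (c, l # v)) xs. c * word_act v E \<alpha>)"
proof (induction xs)
  case Nil
  show ?case by (rule ext, cases l, rename_tac b i, case_tac b) simp_all
next
  case (Cons p xs)
  then show ?case by (cases p) (simp add: act_add act_scale)
qed

lemma pos_op_word_act:
  "pos_op i (word_act w E) = (\<lambda>\<alpha>. word_act w (pos_op i E) \<alpha> + (\<Sum>(c, v)\<leftarrow>comm_terms i w. c * word_act v E \<alpha>))"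
proof (induction w)
  case (Cons l w)
  show ?case
    by (simp only: word_act_simps pos_op_act Cons.IH act_add act_sum_list comm_terms.simps)
       (simp add: fun_eq_iff)
qed simp

lemma comm_terms_props:
  "(c, v) \<in> set (comm_terms i w) \<Longrightarrow> \<bar>c\<bar> \<le> 1 \<and> Suc (length v) = length w"
proof (induction w arbitrary: c v)
  case (Cons l w)
  have "\<bar>comm_const i l\<bar> \<le> 1" by (simp add: comm_const_def)
  with Cons show ?case by fastforce
qed simp

abbreviation herm_at :: "real^'n::finite \<Rightarrow> ('n \<Rightarrow> nat) \<Rightarrow> real" where
  "herm_at x \<equiv> (\<lambda>\<alpha>. hermite \<alpha> x)"

lemma pos_op_hermite: "pos_op i (herm_at x) = (\<lambda>\<alpha>. x $ i * hermite \<alpha> x)"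
  by (rule ext) (simp add: pos_op_def hermite_rec)

lemma bform_sum_list_left:
  "bform R G (\<lambda>\<alpha>. \<Sum>(c, v)\<leftarrow>xs. c * word_act v E \<alpha>) E' = (\<Sum>(c, v)\<leftarrow>xs. of_real c * bform R G (word_act v E) E')"
proof (induction xs)
  case Nil then show ?case by (simp add: bform_def)
next
  case (Cons p xs)
  then show ?case by (cases p) (simp add: bform_add_left bform_scale_left)
qed

text \<open>
  Multiplication by \<open>x\<^sub>i - y\<^sub>i\<close> either takes a difference of the symbol and adds one letter, or deletes one
  letter. At symbols of height \<open>R\<close> a letter has size \<open>\<surd>R\<close> and a difference has size \<open>1 / R\<close>, so that
  every term is smaller by the factor \<open>1 / \<surd>R\<close>.
\<close>

lemma bform_word_commutator:
  fixes i :: "'n::finite"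
  assumes supp: "\<And>k. k \<ge> R \<Longrightarrow> G k = 0"
  shows "of_real (x $ i - y $ i) * bform R G (word_act w (herm_at x)) (word_act w' (herm_at y)) =
     (bform R (fdiff G) (word_act w (herm_at x)) (word_act ((True, i) # w') (herm_at y))
       - bform R (fdiff G) (word_act ((True, i) # w) (herm_at x)) (word_act w' (herm_at y))) / of_real (sqrt 2)
     - (\<Sum>(c, v)\<leftarrow>comm_terms i w. of_real c * bform R G (word_act v (herm_at x)) (word_act w' (herm_at y)))
     + (\<Sum>(c, v)\<leftarrow>comm_terms i w'. of_real c * bform R G (word_act w (herm_at x)) (word_act v (herm_at y)))"
proof -
  have L: "bform R G (pos_op i (word_act w (herm_at x))) E' = of_real (x $ i) * bform R G (word_act w (herm_at x)) E'
     + (\<Sum>(c, v)\<leftarrow>comm_terms i w. of_real c * bform R G (word_act v (herm_at x)) E')" for w E' and x :: "real^'n"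
    unfolding pos_op_word_act bform_add_left bform_sum_list_left pos_op_hermite word_act_scale bform_scale_left ..
  have L1: "bform R G (word_act w (herm_at x)) (pos_op i (word_act w' (herm_at y))) = of_real (y $ i) * bform R G (word_act w (herm_at x)) (word_act w' (herm_at y))
     + (\<Sum>(c, v)\<leftarrow>comm_terms i w'. of_real c * bform R G (word_act w (herm_at x)) (word_act v (herm_at y)))"
    by (subst (1 2 3) bform_commute) (rule L)
  have C: "bform R G (pos_op i (word_act w (herm_at x))) (word_act w' (herm_at y))
      - bform R G (word_act w (herm_at x)) (pos_op i (word_act w' (herm_at y)))
     = (bform R (fdiff G) (word_act w (herm_at x)) (word_act ((True, i) # w') (herm_at y))
        - bform R (fdiff G) (word_act ((True, i) # w) (herm_at x)) (word_act w' (herm_at y))) / of_real (sqrt 2)"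
    unfolding word_act_simps by (rule bform_pos_op_commutator) (rule supp)
  show ?thesis using C unfolding L L1 by (simp add: algebra_simps del: word_act_simps)
qed

lemma act_sq_sum_le:
  fixes E :: "('n::finite \<Rightarrow> nat) \<Rightarrow> real"
  shows "(\<Sum>\<alpha> | sum \<alpha> UNIV < R. (act l E \<alpha>)\<^sup>2) \<le> real R * (\<Sum>\<alpha> | sum \<alpha> UNIV < Suc R. (E \<alpha>)\<^sup>2)"
proof -
  obtain b i where l: "l = (b, i)" by force
  have le: "\<alpha> i \<le> sum \<alpha> UNIV" for \<alpha> :: "'n \<Rightarrow> nat" by (rule member_le_sum) auto
  show ?thesis
  proof (cases b)
    case True
    have s: "sum (\<alpha>(i := Suc (\<alpha> i))) UNIV = Suc (sum \<alpha> UNIV)" for \<alpha> :: "'n \<Rightarrow> nat"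
      using sum_fun_upd[of \<alpha> i "Suc (\<alpha> i)"] by linarith
    let ?up = "\<lambda>\<alpha>::'n\<Rightarrow>nat. \<alpha>(i := Suc (\<alpha> i))"
    have inj: "inj_on ?up A" for A
    proof (rule inj_onI)
      fix \<alpha> \<beta> :: "'n \<Rightarrow> nat" assume e: "?up \<alpha> = ?up \<beta>"
      have "\<alpha> j = \<beta> j" for j
        using fun_cong[OF e, of j] by (cases "j = i") auto
      then show "\<alpha> = \<beta>" by (rule ext)
    qed
    have "(\<Sum>\<alpha> | sum \<alpha> UNIV < R. (act l E \<alpha>)\<^sup>2) \<le> (\<Sum>\<alpha> | sum \<alpha> UNIV < R. real R * (E (?up \<alpha>))\<^sup>2)"
    proof (rule sum_mono)
      fix \<alpha> :: "'n \<Rightarrow> nat" assume "\<alpha> \<in> {\<alpha>. sum \<alpha> UNIV < R}"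
      then have "Suc (\<alpha> i) \<le> R" using le[of \<alpha>] by simp
      then have "real (Suc (\<alpha> i)) \<le> real R" by (rule of_nat_mono)
      then show "(act l E \<alpha>)\<^sup>2 \<le> real R * (E (?up \<alpha>))\<^sup>2"
        unfolding l using True by (simp add: power_mult_distrib mult_right_mono)
    qed
    also have "\<dots> = real R * (\<Sum>\<alpha>\<in>?up ` {\<alpha>. sum \<alpha> UNIV < R}. (E \<alpha>)\<^sup>2)"
      by (simp add: sum.reindex[OF inj] sum_distrib_left)
    also have "\<dots> \<le> real R * (\<Sum>\<alpha> | sum \<alpha> UNIV < Suc R. (E \<alpha>)\<^sup>2)"
      using s by (intro mult_left_mono sum_mono2) auto
    finally show ?thesis .
  next
    case False
    let ?down = "\<lambda>\<alpha>::'n\<Rightarrow>nat. \<alpha>(i := \<alpha> i - 1)"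
    let ?A = "{\<alpha>. sum \<alpha> UNIV < R \<and> \<alpha> i > 0}"
    have s: "sum (?down \<alpha>) UNIV \<le> sum \<alpha> UNIV" for \<alpha> :: "'n \<Rightarrow> nat"
      using sum_fun_upd[of \<alpha> i "\<alpha> i - 1"] by linarith
    have inj: "inj_on ?down ?A"
    proof (rule inj_onI)
      fix \<alpha> \<beta> :: "'n \<Rightarrow> nat" assume A: "\<alpha> \<in> ?A" "\<beta> \<in> ?A" and e: "?down \<alpha> = ?down \<beta>"
      have "\<alpha> j = \<beta> j" for j
        using fun_cong[OF e, of j] A by (cases "j = i") auto
      then show "\<alpha> = \<beta>" by (rule ext)
    qed
    have "(\<Sum>\<alpha> | sum \<alpha> UNIV < R. (act l E \<alpha>)\<^sup>2) = (\<Sum>\<alpha>\<in>?A. (act l E \<alpha>)\<^sup>2)"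
      unfolding l using False by (intro sum.mono_neutral_right) auto
    also have "\<dots> \<le> (\<Sum>\<alpha>\<in>?A. real R * (E (?down \<alpha>))\<^sup>2)"
    proof (rule sum_mono)
      fix \<alpha> :: "'n \<Rightarrow> nat" assume "\<alpha> \<in> ?A"
      then have "\<alpha> i \<le> R" using le[of \<alpha>] by simp
      then show "(act l E \<alpha>)\<^sup>2 \<le> real R * (E (?down \<alpha>))\<^sup>2"
        unfolding l using False by (simp add: power_mult_distrib mult_right_mono)
    qed
    also have "\<dots> = real R * (\<Sum>\<alpha>\<in>?down ` ?A. (E \<alpha>)\<^sup>2)"
      by (subst sum.reindex[OF inj]) (simp add: sum_distrib_left)
    also have "\<dots> \<le> real R * (\<Sum>\<alpha> | sum \<alpha> UNIV < Suc R. (E \<alpha>)\<^sup>2)"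
    proof (intro mult_left_mono sum_mono2)
      show "?down ` ?A \<subseteq> {\<alpha>. sum \<alpha> UNIV < Suc R}"
      proof (rule image_subsetI)
        fix \<alpha> assume "\<alpha> \<in> ?A"
        then have "sum \<alpha> UNIV < R" by simp
        then have "sum (?down \<alpha>) UNIV < Suc R" using s[of \<alpha>] by linarith
        then show "?down \<alpha> \<in> {\<alpha>. sum \<alpha> UNIV < Suc R}" unfolding mem_Collect_eq .
      qed
    qed auto
    finally show ?thesis .
  qed
qed

lemma word_sq_sum_le:
  "(\<Sum>\<alpha> | sum \<alpha> UNIV < R. (word_act w E \<alpha>)\<^sup>2)
     \<le> real (R + length w) ^ length w * (\<Sum>\<alpha> | sum \<alpha> UNIV < R + length w. (E \<alpha>)\<^sup>2)"
proof (induction w arbitrary: R)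
  case (Cons l w)
  let ?S = "\<Sum>\<alpha> | sum \<alpha> UNIV < R + length (l # w). (E \<alpha>)\<^sup>2"
  have "(\<Sum>\<alpha> | sum \<alpha> UNIV < R. (word_act (l # w) E \<alpha>)\<^sup>2)
      \<le> real R * (\<Sum>\<alpha> | sum \<alpha> UNIV < Suc R. (word_act w E \<alpha>)\<^sup>2)"
    unfolding word_act_simps by (rule act_sq_sum_le)
  also have "\<dots> \<le> real R * (real (Suc R + length w) ^ length w * ?S)"
    using Cons.IH[of "Suc R"] by (intro mult_left_mono) auto
  also have "\<dots> \<le> real (R + length (l # w)) * (real (R + length (l # w)) ^ length w * ?S)"
    by (intro mult_mono) (auto intro!: mult_nonneg_nonneg sum_nonneg)
  finally show ?case by (simp add: mult.assoc)
qed simp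

text \<open>
  A letter maps the indices below \<open>R\<close> to indices below \<open>R + 1\<close> and multiplies by at most \<open>\<surd>R\<close>. The
  remaining sum of \<open>h\<^sub>\<alpha>(x)\<^sup>2\<close> is bounded by \<open>hermite_sum_le\<close>.
\<close>

lemma word_hermite_sq_sum_le:
  "\<exists>C\<ge>0. \<forall>R\<ge>1. \<forall>x::real^'n. (\<Sum>\<alpha> | sum \<alpha> UNIV < R. (word_act w (herm_at x) \<alpha>)\<^sup>2)
      \<le> C * sqrt (real R) ^ (CARD('n::finite) + 2 * length w)"
proof -
  let ?L = "length w" and ?n = "CARD('n)"
  let ?C = "real (1 + ?L) ^ ?L * (sqrt 2 * sqrt (real (1 + ?L))) ^ ?n"
  have "(\<Sum>\<alpha> | sum \<alpha> UNIV < R. (word_act w (herm_at x) \<alpha>)\<^sup>2) \<le> ?C * sqrt (real R) ^ (?n + 2 * ?L)"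
    if R: "R \<ge> 1" for R and x :: "real^'n"
  proof -
    have "R + ?L \<le> (1 + ?L) * R" using R by (simp add: algebra_simps)
    then have RL: "real (R + ?L) \<le> real (1 + ?L) * real R" by (metis of_nat_mono of_nat_mult)
    have "(\<Sum>\<alpha> | sum \<alpha> UNIV < R. (word_act w (herm_at x) \<alpha>)\<^sup>2)
       \<le> real (R + ?L) ^ ?L * (\<Sum>\<alpha> | sum \<alpha> UNIV < R + ?L. (hermite \<alpha> x)\<^sup>2)"
      by (rule word_sq_sum_le)
    also have "\<dots> \<le> (real (1 + ?L) * real R) ^ ?L * (sqrt 2 * sqrt (real (1 + ?L) * real R)) ^ ?n"
    proof (intro mult_mono)
      show "real (R + ?L) ^ ?L \<le> (real (1 + ?L) * real R) ^ ?L" by (intro power_mono RL) simp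
      have "(\<Sum>\<alpha> | sum \<alpha> UNIV < R + ?L. (hermite \<alpha> x)\<^sup>2) \<le> (sqrt 2 * sqrt (real (R + ?L))) ^ ?n"
        by (rule hermite_sum_le)
      also have "\<dots> \<le> (sqrt 2 * sqrt (real (1 + ?L) * real R)) ^ ?n"
        by (intro power_mono mult_left_mono real_sqrt_le_mono RL) auto
      finally show "(\<Sum>\<alpha> | sum \<alpha> UNIV < R + ?L. (hermite \<alpha> x)\<^sup>2) \<le> (sqrt 2 * sqrt (real (1 + ?L) * real R)) ^ ?n" .
    qed (auto intro: sum_nonneg)
    also have "real R = (sqrt (real R))\<^sup>2" by simp
    also have "(real (1 + ?L) * (sqrt (real R))\<^sup>2) ^ ?L * (sqrt 2 * sqrt (real (1 + ?L) * (sqrt (real R))\<^sup>2)) ^ ?n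
       = ?C * sqrt (real R) ^ (?n + 2 * ?L)"
    proof -
      have *: "(a * q\<^sup>2) ^ ?L * (sqrt 2 * sqrt (a * q\<^sup>2)) ^ ?n = a ^ ?L * (sqrt 2 * sqrt a) ^ ?n * q ^ (?n + 2 * ?L)"
        if "q \<ge> 0" for a q :: real
      proof -
        have "sqrt (a * q\<^sup>2) = sqrt a * q" using that by (simp add: real_sqrt_mult)
        then show ?thesis by (simp add: power_mult_distrib power_add power_mult)
      qed
      show ?thesis by (rule *) simp
    qed
    finally show ?thesis .
  qed
  then show ?thesis by (intro exI[of _ ?C]) auto
qed

lemma bform_word_bound:
  "\<exists>C\<ge>0. \<forall>R\<ge>1. \<forall>A G. (\<forall>k. norm (G k) \<le> A) \<longrightarrow> (\<forall>x y :: real^'n.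
     norm (bform R G (word_act w (herm_at x)) (word_act w' (herm_at y)))
       \<le> C * A * sqrt (real R) ^ (CARD('n::finite) + length w + length w'))"
proof -
  obtain C1 where C1: "C1 \<ge> 0" "\<And>R (x::real^'n). R \<ge> 1 \<Longrightarrow> (\<Sum>\<alpha> | sum \<alpha> UNIV < R. (word_act w (herm_at x) \<alpha>)\<^sup>2)
      \<le> C1 * sqrt (real R) ^ (CARD('n) + 2 * length w)" using word_hermite_sq_sum_le[of w] by blast
  obtain C2 where C2: "C2 \<ge> 0" "\<And>R (x::real^'n). R \<ge> 1 \<Longrightarrow> (\<Sum>\<alpha> | sum \<alpha> UNIV < R. (word_act w' (herm_at x) \<alpha>)\<^sup>2)
      \<le> C2 * sqrt (real R) ^ (CARD('n) + 2 * length w')" using word_hermite_sq_sum_le[of w'] by blast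
  have "norm (bform R G (word_act w (herm_at x)) (word_act w' (herm_at y)))
       \<le> sqrt (C1 * C2) * A * sqrt (real R) ^ (CARD('n) + length w + length w')"
    if R: "R \<ge> 1" and G: "\<And>k. norm (G k) \<le> A" for R A G and x y :: "real^'n"
  proof -
    let ?S = "{\<alpha>::'n\<Rightarrow>nat. sum \<alpha> UNIV < R}"
    let ?a = "word_act w (herm_at x)" and ?b = "word_act w' (herm_at y)"
    let ?q = "sqrt (real R)"
    have A0: "A \<ge> 0" using G[of 0] by (rule order_trans[OF norm_ge_zero])
    have "norm (bform R G ?a ?b) \<le> (\<Sum>\<alpha>\<in>?S. A * (\<bar>?a \<alpha>\<bar> * \<bar>?b \<alpha>\<bar>))"
      unfolding bform_def
      by (rule order_trans[OF norm_sum sum_mono]) (auto simp: norm_mult abs_mult intro!: mult_right_mono G)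
    also have "\<dots> = A * (\<Sum>\<alpha>\<in>?S. \<bar>?a \<alpha>\<bar> * \<bar>?b \<alpha>\<bar>)" by (simp add: sum_distrib_left)
    also have "\<dots> \<le> A * (sqrt (C1 * C2) * ?q ^ (CARD('n) + length w + length w'))"
    proof (intro mult_left_mono A0)
      show "(\<Sum>\<alpha>\<in>?S. \<bar>?a \<alpha>\<bar> * \<bar>?b \<alpha>\<bar>) \<le> sqrt (C1 * C2) * ?q ^ (CARD('n) + length w + length w')"
    proof (rule power2_le_imp_le)
      have "(\<Sum>\<alpha>\<in>?S. \<bar>?a \<alpha>\<bar> * \<bar>?b \<alpha>\<bar>)\<^sup>2 \<le> (\<Sum>\<alpha>\<in>?S. (?a \<alpha>)\<^sup>2) * (\<Sum>\<alpha>\<in>?S. (?b \<alpha>)\<^sup>2)"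
        using Cauchy_Schwarz_ineq_sum[of "\<lambda>\<alpha>. \<bar>?a \<alpha>\<bar>" "\<lambda>\<alpha>. \<bar>?b \<alpha>\<bar>" ?S] by simp
      also have "\<dots> \<le> (C1 * ?q ^ (CARD('n) + 2 * length w)) * (C2 * ?q ^ (CARD('n) + 2 * length w'))"
        using C1 C2 R by (intro mult_mono) (auto intro!: sum_nonneg)
      also have "\<dots> = (sqrt (C1 * C2) * ?q ^ (CARD('n) + length w + length w'))\<^sup>2"
      proof -
        have "?q ^ (CARD('n) + 2 * length w) * ?q ^ (CARD('n) + 2 * length w') = (?q ^ (CARD('n) + length w + length w'))\<^sup>2"
          unfolding power_mult[symmetric] power_add[symmetric] by (rule arg_cong[where f = "\<lambda>k. ?q ^ k"]) simp
        moreover have "(sqrt (C1 * C2))\<^sup>2 = C1 * C2" using C1 C2 by simp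
        ultimately show ?thesis unfolding power_mult_distrib by (simp only: mult_ac)
      qed
      finally show "(\<Sum>\<alpha>\<in>?S. \<bar>?a \<alpha>\<bar> * \<bar>?b \<alpha>\<bar>)\<^sup>2 \<le> (sqrt (C1 * C2) * ?q ^ (CARD('n) + length w + length w'))\<^sup>2" .
      qed (use C1 C2 in auto)
    qed
    finally show ?thesis by (simp add: mult_ac)
  qed
  then show ?thesis by (intro exI[of _ "sqrt (C1 * C2)"]) (use C1 C2 in auto)
qed

text \<open>
  The bound for the form weighted with \<open>\<bar>x\<^sub>i - y\<^sub>i\<bar>\<^sup>s\<close>. It is stated for all pairs of words, since the
  induction on \<open>s\<close> lengthens and shortens the words.
\<close>

definition decay_const :: "'n::finite \<Rightarrow> nat \<Rightarrow> (bool \<times> 'n) list \<Rightarrow> (bool \<times> 'n) list \<Rightarrow> real \<Rightarrow> bool" where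
  "decay_const i s w w' C \<longleftrightarrow> C \<ge> 0 \<and> (\<forall>R\<ge>1. \<forall>A G. (\<forall>k\<ge>R. G k = 0) \<longrightarrow>
     (\<forall>l\<le>s. \<forall>k. norm ((fdiff ^^ l) G k) \<le> A / real R ^ l) \<longrightarrow>
     (\<forall>x y :: real^'n. \<bar>x $ i - y $ i\<bar> ^ s * norm (bform R G (word_act w (herm_at x)) (word_act w' (herm_at y)))
       \<le> C * A * sqrt (real R) ^ (CARD('n) + length w + length w') / sqrt (real R) ^ s))"

lemma norm_sum_list_le:
  fixes f :: "'a \<Rightarrow> 'b::real_normed_vector"
  assumes "\<And>p. p \<in> set xs \<Longrightarrow> norm (f p) \<le> g p"
  shows "norm (\<Sum>p\<leftarrow>xs. f p) \<le> (\<Sum>p\<leftarrow>xs. g p)"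
  using assms by (induction xs) (auto intro!: order_trans[OF norm_triangle_ineq] add_mono)

lemma ex_decay_const: "\<exists>C. decay_const i s w w' C"
proof (induction s arbitrary: w w')
  case 0
  obtain C where C: "C \<ge> 0" "\<And>R A G (x::real^'a) y. R \<ge> 1 \<Longrightarrow> (\<forall>k. norm (G k) \<le> A) \<Longrightarrow>
     norm (bform R G (word_act w (herm_at x)) (word_act w' (herm_at y)))
       \<le> C * A * sqrt (real R) ^ (CARD('a) + length w + length w')"
    using bform_word_bound[of w w'] by blast
  then show ?case unfolding decay_const_def by (intro exI[of _ C]) auto
next
  case (Suc s)
  obtain Cf where Cf: "\<And>w w'. decay_const i s w w' (Cf w w')" using Suc by metis
  define U where "U = (True, i)"
  define S1 where "S1 = (\<Sum>(c, v)\<leftarrow>comm_terms i w. Cf v w')"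
  define S2 where "S2 = (\<Sum>(c, v)\<leftarrow>comm_terms i w'. Cf w v)"
  have Cf0: "Cf w w' \<ge> 0" for w w' using Cf unfolding decay_const_def by blast
  have S0: "S1 \<ge> 0" "S2 \<ge> 0" unfolding S1_def S2_def by (auto intro!: sum_list_nonneg simp: Cf0)
  have bound: "\<bar>x $ i - y $ i\<bar> ^ s * norm (bform R G (word_act w (herm_at x)) (word_act w' (herm_at y)))
       \<le> Cf w w' * A * sqrt (real R) ^ (CARD('a) + length w + length w') / sqrt (real R) ^ s"
    if "R \<ge> 1" "\<And>k. k \<ge> R \<Longrightarrow> G k = 0" "\<And>l k. l \<le> s \<Longrightarrow> norm ((fdiff ^^ l) G k) \<le> A / real R ^ l"
    for R A G w w' and x y :: "real^'a"
    using Cf[of w w'] that unfolding decay_const_def by blast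
  have "\<bar>x $ i - y $ i\<bar> ^ Suc s * norm (bform R G (word_act w (herm_at x)) (word_act w' (herm_at y)))
       \<le> (Cf w (U # w') + Cf (U # w) w' + S1 + S2) * A * sqrt (real R) ^ (CARD('a) + length w + length w') / sqrt (real R) ^ Suc s"
    if R: "R \<ge> 1" and supp: "\<And>k. k \<ge> R \<Longrightarrow> G k = 0"
      and G: "\<And>l k. l \<le> Suc s \<Longrightarrow> norm ((fdiff ^^ l) G k) \<le> A / real R ^ l"
    for R A G and x y :: "real^'a"
  proof -
    let ?q = "sqrt (real R)" and ?\<delta> = "\<bar>x $ i - y $ i\<bar>"
    let ?N = "CARD('a) + length w + length w'"
    define T where "T = A * ?q ^ ?N / ?q ^ Suc s"
    have q: "?q > 0" using R by simp
    let ?B = "\<lambda>G w w'. bform R G (word_act w (herm_at x)) (word_act w' (herm_at y))"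
    have suppD: "fdiff G k = 0" if "k \<ge> R" for k using supp that by (simp add: fdiff_def)
    have GD: "norm ((fdiff ^^ l) (fdiff G) k) \<le> (A / real R) / real R ^ l" if "l \<le> s" for l k
      using G[of "Suc l" k] that by (simp add: fdiff_pow_Suc del: funpow.simps)
    have A0: "A \<ge> 0" using G[of 0 0] by (auto intro: order_trans[OF norm_ge_zero])
    \<comment> \<open>One letter more and one difference more: the net gain is a factor \<open>\<surd>R\<close> in the denominator.\<close>
    have shift_up: "c * (A / real R) * ?q ^ (?N + 1) / ?q ^ s = c * T" for c
    proof -
      have "c * (A / (r * r)) * r ^ (?N + 1) / r ^ s = c * (A * r ^ ?N / r ^ Suc s)" if "r > 0" for r
        using that by (simp add: field_simps)
      from this[OF q] show ?thesis unfolding T_def by simp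
    qed
    have b1: "?\<delta> ^ s * norm (?B (fdiff G) w (U # w')) \<le> Cf w (U # w') * T"
      using bound[OF R suppD GD, where w=w and w'="U # w'" and x = x and y = y] shift_up[of "Cf w (U # w')"] by simp
    have b2: "?\<delta> ^ s * norm (?B (fdiff G) (U # w) w') \<le> Cf (U # w) w' * T"
      using bound[OF R suppD GD, where w="U # w" and w'=w' and x = x and y = y] shift_up[of "Cf (U # w) w'"] by simp
    \<comment> \<open>One letter less has the same effect.\<close>
    have shift_down: "c * A * ?q ^ m / ?q ^ s = c * T" if "Suc m = ?N" for c m
    proof -
      have "c * A * r ^ m / r ^ s = c * (A * r ^ Suc m / r ^ Suc s)" if "r > 0" for r
        using that by (simp add: field_simps)
      from this[OF q] show ?thesis unfolding T_def that[symmetric] .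
    qed
    have G': "norm ((fdiff ^^ l) G k) \<le> A / real R ^ l" if "l \<le> s" for l k using G that by simp
    have b3: "?\<delta> ^ s * norm (\<Sum>(c, v)\<leftarrow>comm_terms i w. of_real c * ?B G v w') \<le> S1 * T"
    proof -
      have "norm (\<Sum>(c, v)\<leftarrow>comm_terms i w. of_real (?\<delta> ^ s) * (of_real c * ?B G v w')) \<le> (\<Sum>(c, v)\<leftarrow>comm_terms i w. Cf v w' * T)"
      proof (rule norm_sum_list_le, clarify)
        fix c v assume "(c, v) \<in> set (comm_terms i w)"
        from comm_terms_props[OF this] have c: "\<bar>c\<bar> \<le> 1" and v: "Suc (length v) = length w" by auto
        have "?\<delta> ^ s * norm (?B G v w') \<le> Cf v w' * T"
          using bound[OF R supp G', where w=v and w'=w' and x=x and y=y]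
            shift_down[of "CARD('a) + length v + length w'" "Cf v w'"] v by simp
        moreover have "\<bar>c\<bar> * (?\<delta> ^ s * norm (?B G v w')) \<le> 1 * (?\<delta> ^ s * norm (?B G v w'))"
          by (rule mult_right_mono[OF c]) simp
        ultimately show "norm (of_real (?\<delta> ^ s) * (of_real c * ?B G v w')) \<le> Cf v w' * T"
          by (simp add: norm_mult norm_power mult_ac)
      qed
      then show ?thesis unfolding S1_def
        by (simp add: case_prod_unfold sum_list_const_mult sum_list_mult_const norm_mult norm_power)
    qed
    have b4: "?\<delta> ^ s * norm (\<Sum>(c, v)\<leftarrow>comm_terms i w'. of_real c * ?B G w v) \<le> S2 * T"
    proof -
      have "norm (\<Sum>(c, v)\<leftarrow>comm_terms i w'. of_real (?\<delta> ^ s) * (of_real c * ?B G w v)) \<le> (\<Sum>(c, v)\<leftarrow>comm_terms i w'. Cf w v * T)"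
      proof (rule norm_sum_list_le, clarify)
        fix c v assume "(c, v) \<in> set (comm_terms i w')"
        from comm_terms_props[OF this] have c: "\<bar>c\<bar> \<le> 1" and v: "Suc (length v) = length w'" by auto
        have "?\<delta> ^ s * norm (?B G w v) \<le> Cf w v * T"
          using bound[OF R supp G', where w=w and w'=v and x=x and y=y]
            shift_down[of "CARD('a) + length w + length v" "Cf w v"] v by simp
        moreover have "\<bar>c\<bar> * (?\<delta> ^ s * norm (?B G w v)) \<le> 1 * (?\<delta> ^ s * norm (?B G w v))"
          by (rule mult_right_mono[OF c]) simp
        ultimately show "norm (of_real (?\<delta> ^ s) * (of_real c * ?B G w v)) \<le> Cf w v * T"
          by (simp add: norm_mult norm_power mult_ac)
      qed
      then show ?thesis unfolding S2_def
        by (simp add: case_prod_unfold sum_list_const_mult sum_list_mult_const norm_mult norm_power)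
    qed
    have "?\<delta> ^ Suc s * norm (?B G w w') = ?\<delta> ^ s * norm (of_real (x $ i - y $ i) * ?B G w w')"
      by (simp add: norm_mult flip: of_real_diff)
    also have "\<dots> \<le> ?\<delta> ^ s * (norm (?B (fdiff G) w (U # w')) + norm (?B (fdiff G) (U # w) w')
        + norm (\<Sum>(c, v)\<leftarrow>comm_terms i w. of_real c * ?B G v w') + norm (\<Sum>(c, v)\<leftarrow>comm_terms i w'. of_real c * ?B G w v))"
    proof (rule mult_left_mono)
      have n: "norm ((a - b) / of_real (sqrt 2) - c + d) \<le> norm a + norm b + norm c + norm d" for a b c d :: complex
      proof -
        have "norm ((a - b) / of_real (sqrt 2)) = norm (a - b) / sqrt 2" by (simp add: norm_divide)
        also have "\<dots> \<le> norm (a - b) / 1" by (intro divide_left_mono) auto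
        also have "\<dots> \<le> norm a + norm b" by (simp add: norm_triangle_ineq4)
        finally show ?thesis
          using norm_triangle_ineq4[of "(a - b) / of_real (sqrt 2)" c] norm_triangle_ineq[of "(a - b) / of_real (sqrt 2) - c" d]
          by linarith
      qed
      show "norm (of_real (x $ i - y $ i) * ?B G w w') \<le> norm (?B (fdiff G) w (U # w')) + norm (?B (fdiff G) (U # w) w')
        + norm (\<Sum>(c, v)\<leftarrow>comm_terms i w. of_real c * ?B G v w') + norm (\<Sum>(c, v)\<leftarrow>comm_terms i w'. of_real c * ?B G w v)"
        unfolding U_def by (subst bform_word_commutator) (rule n | erule supp)+
    qed simp
    also have "\<dots> \<le> (Cf w (U # w') + Cf (U # w) w' + S1 + S2) * T"
      using b1 b2 b3 b4 by (simp add: distrib_left distrib_right)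
    finally show ?thesis unfolding T_def by (simp add: mult.assoc)
  qed
  then have "decay_const i (Suc s) w w' (Cf w (U # w') + Cf (U # w) w' + S1 + S2)"
    unfolding decay_const_def using Cf0 S0 by (auto intro!: add_nonneg_nonneg)
  then show ?case ..
qed

text \<open>
  The trivial bound and the bound with weight \<open>\<bar>x\<^sub>i - y\<^sub>i\<bar>\<^sup>n\<^sup>+\<^sup>1\<close> are added, for the coordinate in which
  \<open>x - y\<close> is largest.
\<close>

lemma bform_word_bump:
  "\<exists>C\<ge>0. \<forall>R\<ge>1. \<forall>A G. (\<forall>k\<ge>R. G k = 0) \<longrightarrow>
     (\<forall>l\<le>CARD('n) + 1. \<forall>k. norm ((fdiff ^^ l) G k) \<le> A / real R ^ l) \<longrightarrow>
     (\<forall>x y :: real^'n::finite. norm (bform R G (word_act w (herm_at x)) (word_act w' (herm_at y)))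
        \<le> C * A * sqrt (real R) ^ (length w + length w') * bump (sqrt (real R)) (x - y))"
proof -
  let ?n = "CARD('n)"
  obtain C0 where C0: "C0 \<ge> 0" "\<And>R A G (x::real^'n) y. R \<ge> 1 \<Longrightarrow> (\<forall>k. norm (G k) \<le> A) \<Longrightarrow>
     norm (bform R G (word_act w (herm_at x)) (word_act w' (herm_at y)))
       \<le> C0 * A * sqrt (real R) ^ (?n + length w + length w')"
    using bform_word_bound[of w w'] by blast
  have "\<forall>i. \<exists>C. decay_const i (?n + 1) w w' C" using ex_decay_const by blast
  then obtain Cf where "\<And>i. decay_const i (?n + 1) w w' (Cf i)" by metis
  then have Cf: "\<And>i. Cf i \<ge> 0" "\<And>i R A G (x::real^'n) y. R \<ge> 1 \<Longrightarrow> (\<forall>k\<ge>R. G k = 0) \<Longrightarrow>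
     (\<forall>l\<le>?n + 1. \<forall>k. norm ((fdiff ^^ l) G k) \<le> A / real R ^ l) \<Longrightarrow>
     \<bar>x $ i - y $ i\<bar> ^ (?n + 1) * norm (bform R G (word_act w (herm_at x)) (word_act w' (herm_at y)))
       \<le> Cf i * A * sqrt (real R) ^ (?n + length w + length w') / sqrt (real R) ^ (?n + 1)"
    unfolding decay_const_def by blast+
  define C where "C = C0 + real ?n ^ (?n + 1) * (\<Sum>i\<in>UNIV. Cf i)"
  have "norm (bform R G (word_act w (herm_at x)) (word_act w' (herm_at y)))
        \<le> C * A * sqrt (real R) ^ (length w + length w') * bump (sqrt (real R)) (x - y)"
    if R: "R \<ge> 1" and supp: "\<forall>k\<ge>R. G k = 0"
      and G: "\<forall>l\<le>?n + 1. \<forall>k. norm ((fdiff ^^ l) G k) \<le> A / real R ^ l" for R A G and x y :: "real^'n"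
  proof -
    let ?q = "sqrt (real R)" and ?B = "norm (bform R G (word_act w (herm_at x)) (word_act w' (herm_at y)))"
    let ?L = "length w + length w'"
    have q: "?q > 0" using R by simp
    have A0: "A \<ge> 0" using G[rule_format, of 0 0] by (auto intro: order_trans[OF norm_ge_zero])
    have b0: "?B \<le> C0 * A * ?q ^ (?n + ?L)"
      using C0(2)[OF R, of G A x y] G[rule_format, of 0] by (simp add: add.assoc)
    obtain i where i: "\<And>j. \<bar>(x - y) $ j\<bar> \<le> \<bar>(x - y) $ i\<bar>"
    proof -
      have "Max (range (\<lambda>i. \<bar>(x - y) $ i\<bar>)) \<in> range (\<lambda>i. \<bar>(x - y) $ i\<bar>)" by (rule Max_in) auto
      then obtain i where "Max (range (\<lambda>i. \<bar>(x - y) $ i\<bar>)) = \<bar>(x - y) $ i\<bar>" by (elim imageE)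
      then have "\<bar>(x - y) $ j\<bar> \<le> \<bar>(x - y) $ i\<bar>" for j by (metis Max_ge finite finite_imageI rangeI)
      then show ?thesis by (rule that)
    qed
    have "norm (x - y) \<le> (\<Sum>j\<in>UNIV. \<bar>(x - y) $ j\<bar>)" by (rule norm_le_l1_cart)
    also have "\<dots> \<le> (\<Sum>j\<in>(UNIV::'n set). \<bar>(x - y) $ i\<bar>)" by (intro sum_mono i)
    finally have nz: "norm (x - y) \<le> real ?n * \<bar>x $ i - y $ i\<bar>" by simp
    have "(?q * norm (x - y)) ^ (?n + 1) * ?B \<le> (?q * (real ?n * \<bar>x $ i - y $ i\<bar>)) ^ (?n + 1) * ?B"
      using nz q by (intro mult_right_mono power_mono mult_left_mono) auto
    also have "\<dots> = ?q ^ (?n + 1) * real ?n ^ (?n + 1) * (\<bar>x $ i - y $ i\<bar> ^ (?n + 1) * ?B)"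
      by (simp add: power_mult_distrib)
    also have "\<dots> \<le> ?q ^ (?n + 1) * real ?n ^ (?n + 1) * (Cf i * A * ?q ^ (?n + ?L) / ?q ^ (?n + 1))"
      using Cf(2)[OF R supp G, of x i y] by (intro mult_left_mono) (auto simp: add.assoc)
    also have "\<dots> = real ?n ^ (?n + 1) * Cf i * A * ?q ^ (?n + ?L)"
    proof -
      have "Q * N * (c * A * p / Q) = N * c * A * p" if "Q \<noteq> 0" for Q N c p :: real
        using that by simp
      then show ?thesis using q by (metis less_irrefl zero_less_power)
    qed
    also have "\<dots> \<le> real ?n ^ (?n + 1) * (\<Sum>i\<in>UNIV. Cf i) * A * ?q ^ (?n + ?L)"
      using A0 by (intro mult_right_mono mult_left_mono member_le_sum) (auto simp: Cf)
    finally have b1: "(?q * norm (x - y)) ^ (?n + 1) * ?B \<le> real ?n ^ (?n + 1) * (\<Sum>i\<in>UNIV. Cf i) * A * ?q ^ (?n + ?L)" .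
    have "(1 + (?q * norm (x - y)) ^ (?n + 1)) * ?B \<le> C * A * ?q ^ (?n + ?L)"
      using b0 b1 unfolding C_def by (simp add: algebra_simps)
    moreover have "1 + (?q * norm (x - y)) ^ (?n + 1) > 0" using q by (intro add_pos_nonneg) auto
    ultimately have "?B \<le> C * A * ?q ^ (?n + ?L) / (1 + (?q * norm (x - y)) ^ (?n + 1))"
      by (simp add: field_simps)
    also have "\<dots> = C * A * ?q ^ ?L * bump ?q (x - y)"
      by (simp add: bump_def power_add)
    finally show ?thesis .
  qed
  moreover have "C \<ge> 0" unfolding C_def using C0 Cf by (auto intro!: add_nonneg_nonneg mult_nonneg_nonneg sum_nonneg)
  ultimately show ?thesis by blast
qed

definition hermite_kernel :: "nat \<Rightarrow> (nat \<Rightarrow> complex) \<Rightarrow> real^'n::finite \<Rightarrow> real^'n \<Rightarrow> complex" where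
  "hermite_kernel R G x y = (\<Sum>\<alpha> | sum \<alpha> UNIV < R. G (sum \<alpha> UNIV) * of_real (hermite \<alpha> x * hermite \<alpha> y))"

text \<open>
  The bump does not change much as long as the distance to the origin is not more than halved.
\<close>

lemma bump_half:
  fixes z z' :: "'a::euclidean_space"
  assumes "norm z \<le> 2 * norm z'" "q > 0"
  shows "bump q z' \<le> 2 ^ (DIM('a) + 1) * bump q z"
proof -
  let ?d = "DIM('a) + 1"
  have "1 + (q * norm z) ^ ?d \<le> 1 + (q * (2 * norm z')) ^ ?d"
    using assms by (intro add_left_mono power_mono mult_left_mono) auto
  also have "\<dots> = 1 + 2 ^ ?d * (q * norm z') ^ ?d" by (simp add: power_mult_distrib)
  also have "\<dots> \<le> 2 ^ ?d * (1 + (q * norm z') ^ ?d)"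
    using one_le_power[of "2::real" ?d] by (simp add: algebra_simps)
  finally have *: "1 + (q * norm z) ^ ?d \<le> 2 ^ ?d * (1 + (q * norm z') ^ ?d)" .
  have p: "1 + (q * norm v) ^ ?d > 0" for v :: 'a using assms by (intro add_pos_nonneg) auto
  have "1 / (1 + (q * norm z') ^ ?d) \<le> 2 ^ ?d / (1 + (q * norm z) ^ ?d)"
    using * p[of z] p[of z'] by (simp add: divide_simps mult_ac)
  then have "q ^ DIM('a) * (1 / (1 + (q * norm z') ^ ?d)) \<le> q ^ DIM('a) * (2 ^ ?d / (1 + (q * norm z) ^ ?d))"
    using assms by (intro mult_left_mono) auto
  then show ?thesis by (simp add: bump_def mult_ac)
qed

text \<open>
  The first bound is \<open>bform_word_bump\<close> for empty words. For the second, the derivative of the kernel in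
  \<open>y\<close> is a combination of forms with one letter in the second argument, and on the segment from \<open>y\<close> to
  \<open>y'\<close> the distance to \<open>x\<close> is at least half of \<open>\<bar>x - y\<bar>\<close>.
\<close>

theorem hermite_kernel_bounds:
  "\<exists>C\<ge>0. \<forall>R\<ge>1. \<forall>A G. (\<forall>k\<ge>R. G k = 0) \<longrightarrow>
     (\<forall>l\<le>CARD('n) + 1. \<forall>k. norm ((fdiff ^^ l) G k) \<le> A / real R ^ l) \<longrightarrow>
     (\<forall>x y :: real^'n::finite. norm (hermite_kernel R G x y) \<le> C * A * bump (sqrt (real R)) (x - y)) \<and>
     (\<forall>(x :: real^'n) y y' r. norm (y' - y) \<le> r \<longrightarrow> 2 * r < norm (x - y) \<longrightarrow>
        norm (hermite_kernel R G x y' - hermite_kernel R G x y) \<le> C * A * (sqrt (real R) * r) * bump (sqrt (real R)) (x - y))"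
proof -
  let ?n = "CARD('n)"
  let ?hyp = "\<lambda>R A G. (\<forall>k\<ge>R. G k = 0) \<and> (\<forall>l\<le>CARD('n) + 1. \<forall>k. norm ((fdiff ^^ l) G k) \<le> A / real R ^ l)"
  obtain C0 where C0: "C0 \<ge> 0" "\<And>R A G (x::real^'n) y. R \<ge> 1 \<Longrightarrow> ?hyp R A G \<Longrightarrow>
     norm (bform R G (herm_at x) (herm_at y)) \<le> C0 * A * bump (sqrt (real R)) (x - y)"
    using bform_word_bump[of "[] :: (bool \<times> 'n) list" "[]"] by auto
  have "\<exists>C\<ge>0. \<forall>R A G (x::real^'n) y. R \<ge> 1 \<longrightarrow> ?hyp R A G \<longrightarrow>
     norm (bform R G (herm_at x) (act l (herm_at y))) \<le> C * A * sqrt (real R) * bump (sqrt (real R)) (x - y)" for l :: "bool \<times> 'n"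
    using bform_word_bump[of "[]" "[l]"] by auto
  then obtain Cl where Cl: "\<And>l. Cl l \<ge> 0" "\<And>l R A G (x::real^'n) y. R \<ge> 1 \<Longrightarrow> ?hyp R A G \<Longrightarrow>
     norm (bform R G (herm_at x) (act l (herm_at y))) \<le> Cl l * A * sqrt (real R) * bump (sqrt (real R)) (x - y)"
    by metis
  define D where "D = (\<Sum>i\<in>UNIV. Cl (False, i) + Cl (True, i))"
  have D0: "D \<ge> 0" unfolding D_def by (intro sum_nonneg add_nonneg_nonneg Cl)
  define C where "C = C0 + 2 ^ (?n + 1) * D"
  have "C \<ge> 0" unfolding C_def using C0 D0 by simp
  moreover have "norm (hermite_kernel R G x y) \<le> C * A * bump (sqrt (real R)) (x - y)"
    if R: "R \<ge> 1" and h: "?hyp R A G" for R A G and x y :: "real^'n"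
  proof -
    have A0: "A \<ge> 0" using h[THEN conjunct2, rule_format, of 0 0] by (auto intro: order_trans[OF norm_ge_zero])
    have "norm (hermite_kernel R G x y) \<le> C0 * A * bump (sqrt (real R)) (x - y)"
      using C0(2)[OF R h, of x y] by (simp add: hermite_kernel_def bform_def)
    also have "\<dots> \<le> C * A * bump (sqrt (real R)) (x - y)"
      unfolding C_def using A0 D0 by (intro mult_right_mono bump_nonneg) auto
    finally show ?thesis .
  qed
  moreover have "norm (hermite_kernel R G x y' - hermite_kernel R G x y) \<le> C * A * (sqrt (real R) * r) * bump (sqrt (real R)) (x - y)"
    if R: "R \<ge> 1" and h: "?hyp R A G" and yy: "norm (y' - y) \<le> r" and far: "2 * r < norm (x - y)"
    for R A G r and x y y' :: "real^'n"
  proof -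
    let ?q = "sqrt (real R)"
    have A0: "A \<ge> 0" using h[THEN conjunct2, rule_format, of 0 0] by (auto intro: order_trans[OF norm_ge_zero])
    define B where "B = 2 ^ (?n + 1) * D * A * ?q * bump ?q (x - y)"
    define K' where "K' z v = (\<Sum>\<alpha> | sum \<alpha> UNIV < R. G (sum \<alpha> UNIV) * of_real (hermite \<alpha> x * (\<Sum>i\<in>UNIV. v $ i * hermite_d i \<alpha> z)))" for z v
    have der: "(hermite_kernel R G x has_derivative K' z) (at z within S)" for z S
      unfolding hermite_kernel_def[abs_def] K'_def
      by (intro derivative_intros has_derivative_at_withinI[OF hermite_has_derivative])
    have K'_eq: "K' z v = (\<Sum>i\<in>UNIV. of_real (v $ i / sqrt 2) * (bform R G (herm_at x) (act (False, i) (herm_at z)) - bform R G (herm_at x) (act (True, i) (herm_at z))))" for z v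
    proof -
      have "K' z v = (\<Sum>\<alpha> | sum \<alpha> UNIV < R. \<Sum>i\<in>UNIV. of_real (v $ i / sqrt 2) * (G (sum \<alpha> UNIV) * of_real (hermite \<alpha> x * act (False, i) (herm_at z) \<alpha>) - G (sum \<alpha> UNIV) * of_real (hermite \<alpha> x * act (True, i) (herm_at z) \<alpha>)))"
        unfolding K'_def
      proof (intro sum.cong refl)
        fix \<alpha> :: "'n \<Rightarrow> nat"
        show "G (sum \<alpha> UNIV) * of_real (hermite \<alpha> x * (\<Sum>i\<in>UNIV. v $ i * hermite_d i \<alpha> z)) =
          (\<Sum>i\<in>UNIV. of_real (v $ i / sqrt 2) * (G (sum \<alpha> UNIV) * of_real (hermite \<alpha> x * act (False, i) (herm_at z) \<alpha>) - G (sum \<alpha> UNIV) * of_real (hermite \<alpha> x * act (True, i) (herm_at z) \<alpha>)))"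
          unfolding of_real_mult of_real_sum sum_distrib_left
          by (intro sum.cong refl) (simp add: hermite_d_def algebra_simps diff_divide_distrib)
      qed
      also have "\<dots> = (\<Sum>i\<in>UNIV. \<Sum>\<alpha> | sum \<alpha> UNIV < R. of_real (v $ i / sqrt 2) * (G (sum \<alpha> UNIV) * of_real (hermite \<alpha> x * act (False, i) (herm_at z) \<alpha>) - G (sum \<alpha> UNIV) * of_real (hermite \<alpha> x * act (True, i) (herm_at z) \<alpha>)))"
        by (rule sum.swap)
      finally show ?thesis
        by (simp only: bform_def sum_distrib_left sum_subtractf right_diff_distrib)
    qed
    have on: "onorm (K' z) \<le> B" if z: "z \<in> closed_segment y y'" for z
    proof (rule onorm_le)
      fix v
      have "norm (y - z) \<le> norm (y' - y)" using segment_bound1[of z y y'] z by (simp add: norm_minus_commute)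
      then have "norm (y - z) \<le> r" using yy by linarith
      moreover have "norm (x - y) \<le> norm (x - z) + norm (y - z)"
        using norm_triangle_ineq4[of "x - z" "y - z"] by simp
      ultimately have "norm (x - y) \<le> 2 * norm (x - z)" using far by linarith
      then have bh: "bump ?q (x - z) \<le> 2 ^ (?n + 1) * bump ?q (x - y)"
        using bump_half[of "x - y" "x - z" ?q] R by simp
      have "norm (K' z v) \<le> (\<Sum>i\<in>UNIV. norm v * ((Cl (False, i) + Cl (True, i)) * (A * ?q * bump ?q (x - z))))"
        unfolding K'_eq
      proof (rule sum_norm_le)
        fix i
        let ?a = "bform R G (herm_at x) (act (False, i) (herm_at z))" and ?b = "bform R G (herm_at x) (act (True, i) (herm_at z))"
        have "\<bar>v $ i / sqrt 2\<bar> \<le> \<bar>v $ i\<bar> / 1" unfolding abs_divide by (intro divide_left_mono) auto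
        also have "\<dots> \<le> norm v" using component_le_norm_cart[of v i] by simp
        finally have vi: "\<bar>v $ i / sqrt 2\<bar> \<le> norm v" .
        have "norm (?a - ?b) \<le> norm ?a + norm ?b" by (rule norm_triangle_ineq4)
        also have "\<dots> \<le> Cl (False, i) * A * ?q * bump ?q (x - z) + Cl (True, i) * A * ?q * bump ?q (x - z)"
          by (intro add_mono Cl(2) R h)
        finally have ab: "norm (?a - ?b) \<le> (Cl (False, i) + Cl (True, i)) * (A * ?q * bump ?q (x - z))" by (simp add: algebra_simps)
        have "norm (of_real (v $ i / sqrt 2) * (?a - ?b)) = \<bar>v $ i / sqrt 2\<bar> * norm (?a - ?b)"
          by (simp only: norm_mult norm_of_real)
        also have "\<dots> \<le> norm v * ((Cl (False, i) + Cl (True, i)) * (A * ?q * bump ?q (x - z)))"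
          by (intro mult_mono vi ab) auto
        finally show "norm (of_real (v $ i / sqrt 2) * (?a - ?b)) \<le> norm v * ((Cl (False, i) + Cl (True, i)) * (A * ?q * bump ?q (x - z)))" .
      qed
      also have "\<dots> = D * A * ?q * norm v * bump ?q (x - z)"
        unfolding D_def by (simp add: sum_distrib_left[symmetric] sum_distrib_right[symmetric])
      also have "\<dots> \<le> D * A * ?q * norm v * (2 ^ (?n + 1) * bump ?q (x - y))"
        by (intro mult_left_mono bh mult_nonneg_nonneg) (use D0 A0 in auto)
      finally show "norm (K' z v) \<le> B * norm v" unfolding B_def by (simp add: mult_ac)
    qed
    have "norm (hermite_kernel R G x y' - hermite_kernel R G x y) \<le> B * norm (y' - y)"
      by (rule differentiable_bound[OF convex_closed_segment der on]) auto
    also have "\<dots> \<le> B * r"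
      using yy unfolding B_def by (intro mult_left_mono mult_nonneg_nonneg bump_nonneg) (use D0 A0 in auto)
    also have "B * r = (2 ^ (?n + 1) * D) * A * (?q * r) * bump ?q (x - y)" unfolding B_def by (simp add: mult_ac)
    also have "\<dots> \<le> C * A * (?q * r) * bump ?q (x - y)"
    proof -
      have "r \<ge> 0" using yy by (rule order_trans[OF norm_ge_zero])
      then show ?thesis unfolding C_def using A0 C0 by (intro mult_right_mono bump_nonneg) auto
    qed
    finally show ?thesis .
  qed
  ultimately show ?thesis by (intro exI[of _ C]) blast
qed

section \<open>Lebesgue spaces\<close>

lemma Lp_2_iff: "f \<in> Lp 2 \<longleftrightarrow> f \<in> borel_measurable lebesgue \<and> integrable lebesgue (\<lambda>x. (norm (f x))\<^sup>2)"
  by (simp add: Lp_def)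

lemma Lp_1_iff: "f \<in> Lp 1 \<longleftrightarrow> f \<in> borel_measurable lebesgue \<and> integrable lebesgue (\<lambda>x. norm (f x))"
  by (simp add: Lp_def)

lemma Lp_1_iff': "f \<in> Lp 1 \<longleftrightarrow> integrable lebesgue f"
  unfolding Lp_1_iff using integrable_norm_iff[of f lebesgue] borel_measurable_integrable by blast

lemma Lp_measurable: "f \<in> Lp p \<Longrightarrow> f \<in> borel_measurable lebesgue"
  by (simp add: Lp_def)

lemma borel_imp_lebesgue: "f \<in> borel_measurable borel \<Longrightarrow> f \<in> borel_measurable lebesgue"
  by (simp add: measurable_completion)

lemma add_powr_le:
  fixes a b p :: real
  assumes "a \<ge> 0" "b \<ge> 0" "p \<ge> 0"
  shows "(a + b) powr p \<le> 2 powr p * (a powr p + b powr p)"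
proof -
  have "(a + b) powr p \<le> (2 * max a b) powr p" using assms by (intro powr_mono2) auto
  also have "\<dots> = 2 powr p * max a b powr p" using assms by (simp add: powr_mult)
  also have "max a b powr p \<le> a powr p + b powr p" by (simp add: max_def)
  finally show ?thesis by simp
qed

lemma Lp_add:
  assumes "f \<in> Lp p" "g \<in> Lp p" "p \<ge> 0" shows "(\<lambda>x. f x + g x) \<in> Lp p"
proof -
  note [measurable] = assms(1,2)[THEN Lp_measurable]
  have "integrable lebesgue (\<lambda>x. norm (f x + g x) powr p)"
  proof (rule Bochner_Integration.integrable_bound)
    show "integrable lebesgue (\<lambda>x. 2 powr p * (norm (f x) powr p + norm (g x) powr p))"
      using assms by (auto simp: Lp_def)
    have "norm (f x + g x) powr p \<le> 2 powr p * (norm (f x) powr p + norm (g x) powr p)" for x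
      by (rule order_trans[OF powr_mono2[OF assms(3) _ norm_triangle_ineq] add_powr_le]) (use assms in auto)
    then show "AE x in lebesgue. norm (norm (f x + g x) powr p) \<le> norm (2 powr p * (norm (f x) powr p + norm (g x) powr p))"
      by (intro AE_I2) simp
  qed measurable
  then show ?thesis by (simp add: Lp_def)
qed

lemma Lp_cmult: assumes "f \<in> Lp p" shows "(\<lambda>x. c * f x) \<in> Lp p"
proof -
  note [measurable] = assms(1)[THEN Lp_measurable]
  have "integrable lebesgue (\<lambda>x. norm c powr p * norm (f x) powr p)" using assms by (simp add: Lp_def)
  then show ?thesis by (simp add: Lp_def norm_mult powr_mult)
qed

lemma Lp_diff: "f \<in> Lp p \<Longrightarrow> g \<in> Lp p \<Longrightarrow> p \<ge> 0 \<Longrightarrow> (\<lambda>x. f x - g x) \<in> Lp p"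
  using Lp_add[of f p "\<lambda>x. (-1) * g x"] Lp_cmult[of g p "-1"] by simp

lemma Lp_zero: "p > 0 \<Longrightarrow> (\<lambda>x. 0) \<in> Lp p"
  by (simp add: Lp_def)

lemma Lp_sum: "(\<And>i. i \<in> A \<Longrightarrow> f i \<in> Lp p) \<Longrightarrow> p > 0 \<Longrightarrow> (\<lambda>x. \<Sum>i\<in>A. f i x) \<in> Lp p"
  by (induction A rule: infinite_finite_induct) (auto simp: Lp_zero intro!: Lp_add)

lemma Lp_bound:
  assumes "g \<in> Lp p" "f \<in> borel_measurable lebesgue" "\<And>x. norm (f x) \<le> norm (g x)" "p \<ge> 0"
  shows "f \<in> Lp p"
proof -
  note [measurable] = assms(2)
  have "integrable lebesgue (\<lambda>x. norm (f x) powr p)"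
    by (rule Bochner_Integration.integrable_bound[of _ "\<lambda>x. norm (g x) powr p"])
       (use assms in \<open>auto simp: Lp_def intro!: AE_I2 powr_mono2\<close>)
  then show ?thesis using assms by (simp add: Lp_def)
qed

lemma L2_prod_integrable:
  assumes "f \<in> Lp 2" "g \<in> Lp 2" shows "integrable lebesgue (\<lambda>x. f x * g x)"
proof (rule Bochner_Integration.integrable_bound)
  note [measurable] = assms[THEN Lp_measurable]
  show "integrable lebesgue (\<lambda>x. (norm (f x))\<^sup>2 + (norm (g x))\<^sup>2)" using assms by (simp add: Lp_2_iff)
  have "norm (f x) * norm (g x) \<le> (norm (f x))\<^sup>2 + (norm (g x))\<^sup>2" for x
    using sum_squares_bound[of "norm (f x)" "norm (g x)"] mult_nonneg_nonneg[OF norm_ge_zero norm_ge_zero, of "f x" "g x"] by linarith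
  then show "AE x in lebesgue. norm (f x * g x) \<le> norm ((norm (f x))\<^sup>2 + (norm (g x))\<^sup>2)"
    by (intro AE_I2) (simp add: norm_mult)
  show "(\<lambda>x. f x * g x) \<in> borel_measurable lebesgue" by measurable
qed

abbreviation L2_sq :: "('a::euclidean_space \<Rightarrow> complex) \<Rightarrow> real" where
  "L2_sq f \<equiv> (LINT x|lebesgue. (norm (f x))\<^sup>2)"

lemma nn_integral_L2_sq: "f \<in> Lp 2 \<Longrightarrow> (\<integral>\<^sup>+x. ennreal ((norm (f x))\<^sup>2) \<partial>lebesgue) = ennreal (L2_sq f)"
  by (rule nn_integral_eq_integral) (auto simp: Lp_2_iff)

lemma L2_sq_nonneg: "L2_sq f \<ge> 0"
  by (rule Bochner_Integration.integral_nonneg) simp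

lemma L2_Cauchy_Schwarz:
  assumes "f \<in> Lp 2" "g \<in> Lp 2"
  shows "(norm (LINT x|lebesgue. f x * g x))\<^sup>2 \<le> L2_sq f * L2_sq g"
proof -
  note [measurable] = assms[THEN Lp_measurable]
  have "ennreal ((norm (LINT x|lebesgue. f x * g x))\<^sup>2) = (ennreal (norm (LINT x|lebesgue. f x * g x)))\<^sup>2"
    by (simp add: ennreal_power)
  also have "\<dots> \<le> (\<integral>\<^sup>+x. ennreal (norm (f x)) * ennreal (norm (g x)) \<partial>lebesgue)\<^sup>2"
    using integral_norm_bound_ennreal[OF L2_prod_integrable[OF assms]]
    by (intro power_mono) (auto simp: norm_mult ennreal_mult)
  also have "\<dots> \<le> (\<integral>\<^sup>+x. (ennreal (norm (f x)))\<^sup>2 \<partial>lebesgue) * (\<integral>\<^sup>+x. (ennreal (norm (g x)))\<^sup>2 \<partial>lebesgue)"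
    by (rule Cauchy_Schwarz_nn_integral) measurable
  also have "\<dots> = ennreal (L2_sq f) * ennreal (L2_sq g)"
    using assms by (simp add: ennreal_power nn_integral_L2_sq)
  also have "\<dots> = ennreal (L2_sq f * L2_sq g)" by (rule ennreal_mult[symmetric]) (rule L2_sq_nonneg)+
  finally show ?thesis by (subst (asm) ennreal_le_iff) (auto intro: mult_nonneg_nonneg L2_sq_nonneg)
qed

lemma Lp_norm_2: "Lp_norm 2 f = sqrt (L2_sq f)"
  by (simp add: Lp_norm_def powr_half_sqrt)

definition Cc :: "('a::euclidean_space \<Rightarrow> complex) \<Rightarrow> bool" where
  "Cc f \<longleftrightarrow> continuous_on UNIV f \<and> (\<exists>\<rho>. \<forall>x. norm x > \<rho> \<longrightarrow> f x = 0)"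

lemma Cc_measurable: "Cc f \<Longrightarrow> f \<in> borel_measurable borel"
  by (simp add: Cc_def borel_measurable_continuous_onI)

lemma Cc_bounded:
  assumes "Cc f" shows "\<exists>B\<ge>0. \<exists>\<rho>\<ge>0. \<forall>x. norm (f x) \<le> B * indicator (cball 0 \<rho>) x"
proof -
  obtain \<rho> where \<rho>: "\<And>x. norm x > \<rho> \<Longrightarrow> f x = 0" and c: "continuous_on UNIV f" using assms by (auto simp: Cc_def)
  let ?\<rho> = "max 0 \<rho>"
  have "compact (f ` cball 0 ?\<rho>)" using c by (intro compact_continuous_image) (auto intro: continuous_on_subset)
  then obtain B where B: "\<forall>z\<in>f ` cball 0 ?\<rho>. norm z \<le> B" using compact_imp_bounded bounded_iff by blast
  have "norm (f x) \<le> max 0 B * indicator (cball 0 ?\<rho>) x" for x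
  proof (cases "norm x \<le> ?\<rho>")
    case True
    then have "norm (f x) \<le> B" using B by simp
    then show ?thesis using True by simp
  next
    case False
    then show ?thesis using \<rho>[of x] by simp
  qed
  then show ?thesis by (intro exI[of _ "max 0 B"] conjI exI[of _ ?\<rho>]) auto
qed

lemma integrable_indicator_cball: "integrable lebesgue (indicator (cball a r) :: 'a::euclidean_space \<Rightarrow> real)"
  using emeasure_bounded_finite[of "cball a r"] by simp

lemma Cc_Lp:
  assumes "Cc f" "p > 0" shows "f \<in> Lp p"
proof -
  obtain B \<rho> where B: "B \<ge> 0" "\<And>x. norm (f x) \<le> B * indicator (cball 0 \<rho>) x" using Cc_bounded[OF assms(1)] by blast
  note [measurable] = borel_imp_lebesgue[OF Cc_measurable[OF assms(1)]]
  have "integrable lebesgue (\<lambda>x. norm (f x) powr p)"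
  proof (rule Bochner_Integration.integrable_bound)
    show "integrable lebesgue (\<lambda>x. B powr p * indicator (cball 0 \<rho>) x :: real)"
      by (intro integrable_mult_right integrable_indicator_cball)
    have "norm (f x) powr p \<le> B powr p * indicator (cball 0 \<rho>) x" for x
      using B(2)[of x] assms by (auto simp: indicator_def intro!: powr_mono2 split: if_splits)
    then show "AE x in lebesgue. norm (norm (f x) powr p) \<le> norm (B powr p * indicator (cball 0 \<rho>) x :: real)"
      by (intro AE_I2) simp
  qed measurable
  then show ?thesis by (simp add: Lp_def)
qed

definition truncate :: "nat \<Rightarrow> ('a::euclidean_space \<Rightarrow> complex) \<Rightarrow> 'a \<Rightarrow> complex" where
  "truncate N f x = (if norm (f x) \<le> real N \<and> norm x \<le> real N then f x else 0)"

lemma truncate_measurable [measurable]: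
  assumes [measurable]: "f \<in> borel_measurable lebesgue" shows "truncate N f \<in> borel_measurable lebesgue"
proof -
  have [measurable]: "(norm :: 'a \<Rightarrow> real) \<in> borel_measurable lebesgue" by (intro borel_imp_lebesgue) measurable
  show ?thesis unfolding truncate_def[abs_def] by measurable
qed

lemma truncate_tendsto:
  fixes f :: "'a::euclidean_space \<Rightarrow> complex"
  assumes f: "f \<in> Lp p" and p: "p > 0"
  shows "(\<lambda>N. LINT x|lebesgue. norm (f x - truncate N f x) powr p) \<longlonglongrightarrow> 0"
proof -
  note [measurable] = Lp_measurable[OF f]
  have "(\<lambda>N. LINT x|lebesgue. norm (f x - truncate N f x) powr p) \<longlonglongrightarrow> (LINT x|(lebesgue :: 'a measure). 0)"
  proof (rule integral_dominated_convergence)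
    show "integrable lebesgue (\<lambda>x. norm (f x) powr p)" using f by (simp add: Lp_def)
    show "AE x in lebesgue. (\<lambda>N. norm (f x - truncate N f x) powr p) \<longlonglongrightarrow> 0"
    proof (rule AE_I2)
      fix x
      have "\<forall>\<^sub>F N in sequentially. norm (f x) \<le> real N \<and> norm x \<le> real N"
        using eventually_ge_at_top[of "nat \<lceil>max (norm (f x)) (norm x)\<rceil>"]
        by (rule eventually_mono) linarith
      then have "\<forall>\<^sub>F N in sequentially. norm (f x - truncate N f x) powr p = 0"
        by (rule eventually_mono) (simp add: truncate_def)
      then show "(\<lambda>N. norm (f x - truncate N f x) powr p) \<longlonglongrightarrow> 0" by (rule tendsto_eventually)
    qed
    show "AE x in lebesgue. norm (norm (f x - truncate N f x) powr p) \<le> norm (f x) powr p" for N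
      by (rule AE_I2) (simp add: truncate_def)
  qed measurable
  then show ?thesis by simp
qed

text \<open>
  Lebesgue measurability provides continuous functions \<open>g k\<close> with limit \<open>f\<close> almost everywhere. Multiplied
  by a cutoff and retracted to the ball of radius \<open>N\<close>, they are dominated, and one sequence serves all
  exponents.
\<close>

lemma bounded_approx_Cc:
  fixes f :: "'a::euclidean_space \<Rightarrow> complex"
  assumes f: "f \<in> borel_measurable lebesgue" and N: "N > 0" "\<And>x. norm (f x) \<le> N" "\<And>x. norm x > N \<Longrightarrow> f x = 0"
  obtains \<phi> where "\<And>k. Cc (\<phi> k)" "\<And>p. p > 0 \<Longrightarrow> (\<lambda>k. LINT x|lebesgue. norm (f x - \<phi> k x) powr p) \<longlonglongrightarrow> 0"
proof -
  have "f measurable_on UNIV" using f by (subst measurable_on_iff_borel_measurable) auto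
  then obtain Z g where Z: "negligible Z" and g: "\<And>n::nat. continuous_on UNIV (g n)"
    and lim: "\<And>x. x \<notin> Z \<Longrightarrow> (\<lambda>n. g n x) \<longlonglongrightarrow> f x" unfolding measurable_on_def by auto
  \<comment> \<open>The factor \<open>N / max N \<bar>g k x\<bar>\<close> retracts to the ball of radius \<open>N\<close>, which contains the values of \<open>f\<close>.\<close>
  define bmp :: "'a \<Rightarrow> real" where "bmp x = max 0 (min 1 (N + 1 - norm x))" for x
  define \<phi> where "\<phi> k x = (bmp x * (N / max N (norm (g k x)))) *\<^sub>R g k x" for k x
  have cont: "continuous_on UNIV (\<phi> k)" for k unfolding \<phi>_def bmp_def
    by (intro continuous_intros g) (use N in auto)
  have supp: "\<phi> k x = 0" if "norm x > N + 1" for k x using that by (simp add: \<phi>_def bmp_def)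
  have Cc: "Cc (\<phi> k)" for k unfolding Cc_def using cont supp by blast
  have bd: "norm (\<phi> k x) \<le> N * indicator (cball 0 (N + 1)) x" for k x
  proof (cases "norm x \<le> N + 1")
    case True
    have "norm (\<phi> k x) = bmp x * (N / max N (norm (g k x)) * norm (g k x))"
      using N by (simp add: \<phi>_def bmp_def abs_mult)
    also have "\<dots> \<le> 1 * N"
    proof (intro mult_mono)
      show "N / max N (norm (g k x)) * norm (g k x) \<le> N" using N(1) by (simp add: field_simps max_def)
    qed (use N in \<open>auto simp: bmp_def\<close>)
    finally show ?thesis using True by simp
  qed (simp add: supp)
  note [measurable] = f borel_imp_lebesgue[OF Cc_measurable[OF Cc]]
  have "(\<lambda>k. LINT x|lebesgue. norm (f x - \<phi> k x) powr p) \<longlonglongrightarrow> 0" if p: "p > 0" for p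
  proof -
    have "(\<lambda>k. LINT x|lebesgue. norm (f x - \<phi> k x) powr p) \<longlonglongrightarrow> (LINT x|(lebesgue :: 'a measure). 0)"
    proof (rule integral_dominated_convergence)
      show "integrable lebesgue (\<lambda>x. (2 * N) powr p * indicator (cball 0 (N + 1)) x :: real)"
        by (intro integrable_mult_right integrable_indicator_cball)
      have "norm (f x - \<phi> k x) powr p \<le> (2 * N) powr p * indicator (cball 0 (N + 1)) x" for k x
      proof (cases "norm x \<le> N + 1")
        case True
        have "norm (f x - \<phi> k x) \<le> norm (f x) + norm (\<phi> k x)" by (rule norm_triangle_ineq4)
        also have "\<dots> \<le> 2 * N" using N(2)[of x] bd[of k x] True by simp
        finally show ?thesis using True p by (simp add: powr_mono2)
      qed (simp add: supp N(3))
      then show "AE x in lebesgue. norm (norm (f x - \<phi> k x) powr p) \<le> (2 * N) powr p * indicator (cball 0 (N + 1)) x" for k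
        by (intro AE_I2) simp
      have conv: "(\<lambda>k. norm (f x - \<phi> k x) powr p) \<longlonglongrightarrow> 0" if x: "x \<notin> Z" for x
      proof -
        have "(\<lambda>k. \<phi> k x) \<longlonglongrightarrow> (bmp x * (N / max N (norm (f x)))) *\<^sub>R f x"
          unfolding \<phi>_def using N(1) by (intro tendsto_intros lim x) auto
        also have "(bmp x * (N / max N (norm (f x)))) *\<^sub>R f x = f x"
          using N(1) N(2)[of x] N(3)[of x] by (cases "norm x \<le> N") (auto simp: bmp_def max_def)
        finally have "(\<lambda>k. norm (f x - \<phi> k x)) \<longlonglongrightarrow> norm (f x - f x)"
          by (intro tendsto_intros)
        then show ?thesis using tendsto_powr2[of "\<lambda>k. norm (f x - \<phi> k x)" 0 sequentially "\<lambda>_. p" p] p by simp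
      qed
      show "AE x in lebesgue. (\<lambda>k. norm (f x - \<phi> k x) powr p) \<longlonglongrightarrow> 0"
        using Z conv by (intro AE_I'[of Z]) (auto simp: negligible_iff_null_sets)
    qed measurable
    then show ?thesis by simp
  qed
  then show thesis using that[of \<phi>] Cc by blast
qed

text \<open>
  Simultaneous approximation for finitely many exponents: in the extension of a weak type bound from
  \<open>C\<^sub>c\<close> to \<open>L\<^sup>1 \<inter> L\<^sup>2\<close> the same approximation has to be good in both norms.
\<close>

theorem Cc_dense:
  fixes f :: "'a::euclidean_space \<Rightarrow> complex"
  assumes P: "finite P" "\<And>p. p \<in> P \<Longrightarrow> p > 0" and f: "\<And>p. p \<in> P \<Longrightarrow> f \<in> Lp p" "f \<in> borel_measurable lebesgue" and e: "e > 0"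
  shows "\<exists>\<phi>. Cc \<phi> \<and> (\<forall>p\<in>P. (LINT x|lebesgue. norm (f x - \<phi> x) powr p) < e)"
proof -
  note [measurable] = f(2)
  define d where "d p = e / (2 * 2 powr p)" for p :: real
  have d: "d p > 0" for p using e by (simp add: d_def)
  have "\<forall>\<^sub>F N in sequentially. \<forall>p\<in>P. (LINT x|lebesgue. norm (f x - truncate N f x) powr p) < d p"
    using P by (intro eventually_ball_finite ballI order_tendstoD(2)[OF truncate_tendsto] f d) auto
  then have "\<forall>\<^sub>F N in sequentially. N > 0 \<and> (\<forall>p\<in>P. (LINT x|lebesgue. norm (f x - truncate N f x) powr p) < d p)"
    using eventually_gt_at_top[of 0] by eventually_elim simp
  then obtain N :: nat where N: "N > 0" "\<And>p. p \<in> P \<Longrightarrow> (LINT x|lebesgue. norm (f x - truncate N f x) powr p) < d p"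
    unfolding eventually_sequentially by blast
  obtain \<psi> where \<psi>: "\<And>k. Cc (\<psi> k)" "\<And>p. p > 0 \<Longrightarrow> (\<lambda>k. LINT x|lebesgue. norm (truncate N f x - \<psi> k x) powr p) \<longlonglongrightarrow> 0"
    by (rule bounded_approx_Cc[of "truncate N f" "real N"]) (use N in \<open>auto simp: truncate_def\<close>)
  have "\<forall>\<^sub>F k in sequentially. \<forall>p\<in>P. (LINT x|lebesgue. norm (truncate N f x - \<psi> k x) powr p) < d p"
    using P by (intro eventually_ball_finite ballI order_tendstoD(2)[OF \<psi>(2)] d) auto
  then obtain k where k: "\<And>p. p \<in> P \<Longrightarrow> (LINT x|lebesgue. norm (truncate N f x - \<psi> k x) powr p) < d p"
    unfolding eventually_sequentially by blast
  have "(LINT x|lebesgue. norm (f x - \<psi> k x) powr p) < e" if p: "p \<in> P" for p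
  proof -
    have p0: "p > 0" using P p by simp
    have tr: "truncate N f \<in> Lp p" by (rule Lp_bound[OF f(1)[OF p]]) (use p0 in \<open>auto simp: truncate_def\<close>)
    have ps: "\<psi> k \<in> Lp p" by (rule Cc_Lp[OF \<psi>(1) p0])
    have i: "integrable lebesgue (\<lambda>x. norm (f x - truncate N f x) powr p)" "integrable lebesgue (\<lambda>x. norm (truncate N f x - \<psi> k x) powr p)"
      "integrable lebesgue (\<lambda>x. norm (f x - \<psi> k x) powr p)"
      using Lp_diff[OF f(1)[OF p] tr] Lp_diff[OF tr ps] Lp_diff[OF f(1)[OF p] ps] p0 by (simp_all add: Lp_def)
    have "(LINT x|lebesgue. norm (f x - \<psi> k x) powr p) \<le> (LINT x|lebesgue. 2 powr p * (norm (f x - truncate N f x) powr p + norm (truncate N f x - \<psi> k x) powr p))"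
    proof (rule integral_mono)
      fix x
      have "norm (f x - \<psi> k x) powr p \<le> (norm (f x - truncate N f x) + norm (truncate N f x - \<psi> k x)) powr p"
        using norm_triangle_ineq[of "f x - truncate N f x" "truncate N f x - \<psi> k x"] p0 by (intro powr_mono2) auto
      also have "\<dots> \<le> 2 powr p * (norm (f x - truncate N f x) powr p + norm (truncate N f x - \<psi> k x) powr p)"
        by (rule add_powr_le) (use p0 in auto)
      finally show "norm (f x - \<psi> k x) powr p \<le> 2 powr p * (norm (f x - truncate N f x) powr p + norm (truncate N f x - \<psi> k x) powr p)" .
    qed (use i in auto)
    also have "\<dots> = 2 powr p * ((LINT x|lebesgue. norm (f x - truncate N f x) powr p) + (LINT x|lebesgue. norm (truncate N f x - \<psi> k x) powr p))"
      using i by simp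
    also have "\<dots> < 2 powr p * (d p + d p)" using N(2)[OF p] k[OF p] by simp
    also have "\<dots> = e" by (simp add: d_def field_simps)
    finally show ?thesis .
  qed
  then show ?thesis using \<psi>(1) by blast
qed

section \<open>Smoothly truncated Hermite expansions\<close>

lemma bump_shift_measurable [measurable]:
  "(\<lambda>y. ennreal (bump q (y - x))) \<in> borel_measurable lebesgue"
  "(\<lambda>y. ennreal (bump q (y - x)) * indicator {y. r < norm (y - x)} y) \<in> borel_measurable lebesgue"
  by (intro measurable_completion; measurable)+

text \<open>
  The bounds of \<open>hermite_kernel_bounds\<close> and, below, of \<open>bump_integrals\<close> in a form from which the constants can be
  obtained.
\<close>

lemma hermite_kernel_boundsE:
  obtains C where "C \<ge> 0"
     "\<And>R A G x y :: real^'n::finite. R \<ge> 1 \<Longrightarrow> (\<And>k. k \<ge> R \<Longrightarrow> G k = 0) \<Longrightarrow>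
       (\<And>l k. l \<le> CARD('n) + 1 \<Longrightarrow> norm ((fdiff ^^ l) G k) \<le> A / real R ^ l) \<Longrightarrow>
       norm (hermite_kernel R G x y) \<le> C * A * bump (sqrt (real R)) (x - y)"
     "\<And>R A G x y y' r. R \<ge> 1 \<Longrightarrow> (\<And>k. k \<ge> R \<Longrightarrow> G k = 0) \<Longrightarrow>
       (\<And>l k. l \<le> CARD('n) + 1 \<Longrightarrow> norm ((fdiff ^^ l) G k) \<le> A / real R ^ l) \<Longrightarrow>
       norm (y' - y) \<le> r \<Longrightarrow> 2 * r < norm (x - y) \<Longrightarrow>
        norm (hermite_kernel R G x y' - hermite_kernel R G x y) \<le> C * A * (sqrt (real R) * r) * bump (sqrt (real R)) (x - (y :: real^'n))"
proof (rule exE[OF hermite_kernel_bounds[where 'n = 'n]])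
  fix C :: real
  assume *: "C \<ge> 0 \<and> (\<forall>R\<ge>1. \<forall>A G. (\<forall>k\<ge>R. G k = 0) \<longrightarrow>
     (\<forall>l\<le>CARD('n) + 1. \<forall>k. norm ((fdiff ^^ l) G k) \<le> A / real R ^ l) \<longrightarrow>
     (\<forall>x y :: real^'n::finite. norm (hermite_kernel R G x y) \<le> C * A * bump (sqrt (real R)) (x - y)) \<and>
     (\<forall>(x :: real^'n) y y' r. norm (y' - y) \<le> r \<longrightarrow> 2 * r < norm (x - y) \<longrightarrow>
        norm (hermite_kernel R G x y' - hermite_kernel R G x y) \<le> C * A * (sqrt (real R) * r) * bump (sqrt (real R)) (x - y)))"
  note main = *[THEN conjunct2, rule_format]
  show thesis
    by (rule that[of C, OF *[THEN conjunct1] main[THEN conjunct1, rule_format] main[THEN conjunct2, rule_format]])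
qed

lemma bump_integralsE:
  obtains C where "C > 0" "\<And>q y::'a::euclidean_space. q > 0 \<Longrightarrow> (\<integral>\<^sup>+x. ennreal (bump q (x - y)) \<partial>lebesgue) \<le> ennreal C"
     "\<And>q r y::'a. q > 0 \<Longrightarrow> r > 0 \<Longrightarrow> (\<integral>\<^sup>+x. ennreal (bump q (x - y)) * indicator {x. r < norm (x - y)} x \<partial>lebesgue) \<le> ennreal (C / (q * r))"
proof (rule exE[OF bump_integrals])
  fix C :: real
  assume *: "C>0 \<and> (\<forall>q>0. \<forall>y::'a::euclidean_space. (\<integral>\<^sup>+x. ennreal (bump q (x - y)) \<partial>lebesgue) \<le> ennreal C) \<and>
     (\<forall>q>0. \<forall>r>0. \<forall>y::'a. (\<integral>\<^sup>+x. ennreal (bump q (x - y)) * indicator {x. r < norm (x - y)} x \<partial>lebesgue) \<le> ennreal (C / (q * r)))"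
  show thesis
    by (rule that[of C, OF *[THEN conjunct1] *[THEN conjunct2, THEN conjunct1, rule_format]
          *[THEN conjunct2, THEN conjunct2, rule_format]])
qed

lemma hermite_Lp2: "(\<lambda>x. complex_of_real (hermite \<alpha> x)) \<in> Lp 2"
proof -
  have "integrable lborel (\<lambda>x. (hermite \<alpha> x)\<^sup>2)"
    using hermite_prod_integrable[of \<alpha> \<alpha>] by (simp add: power2_eq_square)
  then have "integrable lebesgue (\<lambda>x. (hermite \<alpha> x)\<^sup>2)" by (subst integrable_completion) auto
  moreover have "(\<lambda>x. complex_of_real (hermite \<alpha> x)) \<in> borel_measurable lebesgue" by (intro borel_imp_lebesgue) measurable
  ultimately show ?thesis by (simp add: Lp_2_iff)
qed

definition hermite_coeff :: "('n::finite \<Rightarrow> nat) \<Rightarrow> (real^'n \<Rightarrow> complex) \<Rightarrow> complex" where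
  "hermite_coeff \<alpha> f = (LINT x|lebesgue. f x * of_real (hermite \<alpha> x))"

definition hermite_sum :: "nat \<Rightarrow> (nat \<Rightarrow> complex) \<Rightarrow> (real^'n::finite \<Rightarrow> complex) \<Rightarrow> real^'n \<Rightarrow> complex" where
  "hermite_sum R G f x = (\<Sum>\<alpha> | sum \<alpha> UNIV < R. G (sum \<alpha> UNIV) * hermite_coeff \<alpha> f * of_real (hermite \<alpha> x))"

lemma hermite_coeff_hermite:
  "hermite_coeff \<alpha> (\<lambda>x. of_real (hermite \<beta> x)) = (if \<alpha> = \<beta> then 1 else 0)"
proof -
  have "hermite_coeff \<alpha> (\<lambda>x. of_real (hermite \<beta> x)) = of_real (LINT x|lebesgue. hermite \<beta> x * hermite \<alpha> x)"
    unfolding hermite_coeff_def by (subst integral_complex_of_real[symmetric]) simp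
  also have "(LINT x|lebesgue. hermite \<beta> x * hermite \<alpha> x) = (LINT x|lborel. hermite \<beta> x * hermite \<alpha> x)"
    by (rule integral_completion) simp
  finally show ?thesis by (simp add: hermite_orthonormal)
qed

lemma hermite_coeff_integrable: "f \<in> Lp 2 \<Longrightarrow> integrable lebesgue (\<lambda>x. f x * of_real (hermite \<alpha> x))"
  by (rule L2_prod_integrable[OF _ hermite_Lp2])

lemma hermite_coeff_diff: "f \<in> Lp 2 \<Longrightarrow> g \<in> Lp 2 \<Longrightarrow> hermite_coeff \<alpha> (\<lambda>x. f x - g x) = hermite_coeff \<alpha> f - hermite_coeff \<alpha> g"
  by (simp add: hermite_coeff_def left_diff_distrib hermite_coeff_integrable)

lemma hermite_coeff_cmult: "hermite_coeff \<alpha> (\<lambda>x. c * f x) = c * hermite_coeff \<alpha> f"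
  by (simp add: hermite_coeff_def mult.assoc)

lemma hermite_coeff_sum:
  "(\<And>i. i \<in> A \<Longrightarrow> f i \<in> Lp 2) \<Longrightarrow> hermite_coeff \<alpha> (\<lambda>x. \<Sum>i\<in>A. f i x) = (\<Sum>i\<in>A. hermite_coeff \<alpha> (f i))"
  unfolding hermite_coeff_def sum_distrib_right
  by (rule Bochner_Integration.integral_sum) (rule hermite_coeff_integrable)

lemma hermite_comb_Lp2: "(\<lambda>x. \<Sum>\<alpha>\<in>A. c \<alpha> * of_real (hermite \<alpha> x)) \<in> Lp 2"
  by (intro Lp_sum Lp_cmult hermite_Lp2) simp

lemma hermite_coeff_comb:
  assumes "finite A"
  shows "hermite_coeff \<alpha> (\<lambda>x. \<Sum>\<beta>\<in>A. c \<beta> * of_real (hermite \<beta> x)) = (if \<alpha> \<in> A then c \<alpha> else 0)"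
  using assms by (simp add: hermite_coeff_sum Lp_cmult hermite_Lp2 hermite_coeff_cmult hermite_coeff_hermite mult_delta_right)

lemma hermite_sum_Lp2: "hermite_sum R G f \<in> Lp 2"
  unfolding hermite_sum_def[abs_def] by (rule hermite_comb_Lp2)

lemma hermite_sum_eq_kernel:
  assumes "f \<in> Lp 2"
  shows "integrable lebesgue (\<lambda>y. hermite_kernel R G x y * f y)"
    and "hermite_sum R G f x = (LINT y|lebesgue. hermite_kernel R G x y * f y)"
proof -
  have eq: "hermite_kernel R G x y * f y = (\<Sum>\<alpha> | sum \<alpha> UNIV < R. (G (sum \<alpha> UNIV) * of_real (hermite \<alpha> x)) * (f y * of_real (hermite \<alpha> y)))" for y
    unfolding hermite_kernel_def sum_distrib_right by (intro sum.cong refl) (simp add: mult_ac)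
  show "integrable lebesgue (\<lambda>y. hermite_kernel R G x y * f y)"
    unfolding eq by (intro Bochner_Integration.integrable_sum integrable_mult_right hermite_coeff_integrable assms)
  show "hermite_sum R G f x = (LINT y|lebesgue. hermite_kernel R G x y * f y)"
    unfolding eq hermite_sum_def
    by (subst Bochner_Integration.integral_sum)
       (intro integrable_mult_right hermite_coeff_integrable assms, unfold integral_mult_right_zero hermite_coeff_def, simp add: mult_ac)
qed

definition smooth_symbol :: "nat \<Rightarrow> nat \<Rightarrow> nat \<Rightarrow> complex" where
  "smooth_symbol M R k = of_real (cutoff M R k)"

text \<open>
  A cutoff is a symbol to which the kernel bounds apply, so the kernels of the smoothly truncated
  expansions are dominated by \<open>L\<^sup>1\<close>-normalized bumps.
\<close>

lemma smooth_kernel_bound: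
  obtains C where "C \<ge> 0" "\<And>R (x :: real^'n::finite) y. R \<ge> 1 \<Longrightarrow>
     norm (hermite_kernel ((CARD('n) + 2) * R) (smooth_symbol (CARD('n) + 1) R) x y) \<le> C * bump (sqrt (real ((CARD('n) + 2) * R))) (x - y)"
proof -
  let ?M = "CARD('n) + 1"
  obtain C where C: "C \<ge> 0" "\<And>R A G (x::real^'n) y. R \<ge> 1 \<Longrightarrow> (\<And>k. k \<ge> R \<Longrightarrow> G k = 0) \<Longrightarrow>
     (\<And>l k. l \<le> CARD('n) + 1 \<Longrightarrow> norm ((fdiff ^^ l) G k) \<le> A / real R ^ l) \<Longrightarrow>
     norm (hermite_kernel R G x y) \<le> C * A * bump (sqrt (real R)) (x - y)"
    apply (rule hermite_kernel_boundsE[where 'n = 'n])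
    subgoal premises p for C by (rule p(1)[OF p(2)], rule p(3); blast)
    done
  let ?A = "(2 * real (?M + 1)) ^ ?M"
  have "norm (hermite_kernel ((CARD('n) + 2) * R) (smooth_symbol ?M R) x y) \<le> C * ?A * bump (sqrt (real ((CARD('n) + 2) * R))) (x - y)"
    if R: "R \<ge> 1" for R and x y :: "real^'n"
  proof (rule C(2))
    show "1 \<le> (CARD('n) + 2) * R" using R by (simp add: algebra_simps)
    show "smooth_symbol ?M R k = 0" if "k \<ge> (CARD('n) + 2) * R" for k
      using cutoff_eq_0[of ?M R k] that by (simp add: smooth_symbol_def)
    show "norm ((fdiff ^^ l) (smooth_symbol ?M R) k) \<le> ?A / real ((CARD('n) + 2) * R) ^ l" if l: "l \<le> ?M" for l k
    proof -
      have "norm ((fdiff ^^ l) (smooth_symbol ?M R) k) = \<bar>(fdiff ^^ l) (cutoff ?M R) k\<bar>"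
        unfolding smooth_symbol_def[abs_def] fdiff_pow_of_real norm_of_real ..
      also have "\<dots> \<le> (2 / real R) ^ l" using R l by (intro cutoff_fdiff_bound) auto
      also have "2 / real R = (2 * real (?M + 1)) / real ((CARD('n) + 2) * R)"
      proof -
        have *: "2 / r = (2 * m) / (m * r)" if "m > 0" "r > 0" for m r :: real using that by simp
        have "(CARD('n) + 2) * R = (?M + 1) * R" by simp
        then show ?thesis using *[of "real (?M + 1)" "real R"] R by (simp only: of_nat_mult)
      qed
      also have "\<dots> ^ l = (2 * real (?M + 1)) ^ l / real ((CARD('n) + 2) * R) ^ l" by (simp add: power_divide)
      also have "\<dots> \<le> ?A / real ((CARD('n) + 2) * R) ^ l"
        using l by (intro divide_right_mono power_increasing) auto
      finally show "norm ((fdiff ^^ l) (smooth_symbol ?M R) k) \<le> ?A / real ((CARD('n) + 2) * R) ^ l" .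
    qed
  qed
  moreover have "C * ?A \<ge> 0" using C(1) by simp
  ultimately show thesis by (intro that[of "C * ?A"])
qed

definition smooth_sum :: "nat \<Rightarrow> (real^'n::finite \<Rightarrow> complex) \<Rightarrow> real^'n \<Rightarrow> complex" where
  "smooth_sum R f = hermite_sum ((CARD('n) + 2) * R) (smooth_symbol (CARD('n) + 1) R) f"

lemma hermite_zero_pos: "hermite (\<lambda>_. 0) x > 0"
  unfolding hermite_def by (intro prod_pos) (simp add: hermite_fun.simps gauss_const_pos)

text \<open>
  The ground state is reproduced exactly. Being positive, it replaces the constant function in the proof
  that the truncations form an approximate identity.
\<close>

lemma smooth_sum_hermite_0:
  assumes "R \<ge> 1"
  shows "smooth_sum R (\<lambda>x. of_real (hermite (\<lambda>_. 0) x)) (x :: real^'n::finite) = of_real (hermite (\<lambda>_. 0) x)"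
proof -
  let ?R = "(CARD('n) + 2) * R"
  have "smooth_sum R (\<lambda>x. of_real (hermite (\<lambda>_. 0) x)) x =
     (\<Sum>\<alpha>::'n \<Rightarrow> nat | sum \<alpha> UNIV < ?R. if \<alpha> = (\<lambda>_. 0) then smooth_symbol (CARD('n) + 1) R 0 * of_real (hermite (\<lambda>_. 0) x) else 0)"
    unfolding smooth_sum_def hermite_sum_def by (intro sum.cong) (auto simp: hermite_coeff_hermite)
  also have "\<dots> = smooth_symbol (CARD('n) + 1) R 0 * of_real (hermite (\<lambda>_. 0) x)"
    using assms by (subst sum.delta) auto
  also have "smooth_symbol (CARD('n) + 1) R 0 = 1" using assms by (simp add: smooth_symbol_def cutoff_eq_1)
  finally show ?thesis by simp
qed

lemma smooth_sum_bound:
  obtains C where "C \<ge> 0" "\<And>R f (x :: real^'n::finite). R \<ge> 1 \<Longrightarrow> f \<in> Lp 2 \<Longrightarrow>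
     ennreal (norm (smooth_sum R f x)) \<le> ennreal C * (\<integral>\<^sup>+y. ennreal (bump (sqrt (real ((CARD('n) + 2) * R))) (y - x)) * ennreal (norm (f y)) \<partial>lebesgue)"
proof -
  obtain C where C: "C \<ge> 0" "\<And>R (x::real^'n) y. R \<ge> 1 \<Longrightarrow>
     norm (hermite_kernel ((CARD('n) + 2) * R) (smooth_symbol (CARD('n) + 1) R) x y) \<le> C * bump (sqrt (real ((CARD('n) + 2) * R))) (x - y)"
    by (rule smooth_kernel_bound[where 'n = 'n]) (rule that, assumption+)
  have "ennreal (norm (smooth_sum R f x)) \<le> ennreal C * (\<integral>\<^sup>+y. ennreal (bump (sqrt (real ((CARD('n) + 2) * R))) (y - x)) * ennreal (norm (f y)) \<partial>lebesgue)"
    if R: "R \<ge> 1" and f: "f \<in> Lp 2" for R f and x :: "real^'n"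
  proof -
    let ?K = "hermite_kernel ((CARD('n) + 2) * R) (smooth_symbol (CARD('n) + 1) R) x"
    let ?b = "\<lambda>y. bump (sqrt (real ((CARD('n) + 2) * R))) (y - x)"
    note [measurable] = Lp_measurable[OF f]
    have [measurable]: "?b \<in> borel_measurable lebesgue" by (intro borel_imp_lebesgue) measurable
    have "ennreal (norm (smooth_sum R f x)) \<le> (\<integral>\<^sup>+y. ennreal (norm (?K y * f y)) \<partial>lebesgue)"
      unfolding smooth_sum_def hermite_sum_eq_kernel(2)[OF f]
      by (rule integral_norm_bound_ennreal[OF hermite_sum_eq_kernel(1)[OF f]])
    also have "\<dots> \<le> (\<integral>\<^sup>+y. ennreal C * (ennreal (?b y) * ennreal (norm (f y))) \<partial>lebesgue)"
    proof (rule nn_integral_mono)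
      fix y
      have "norm (?K y) \<le> C * ?b y" using C(2)[OF R, of x y] by (simp add: bump_def norm_minus_commute)
      then have "norm (?K y * f y) \<le> C * (?b y * norm (f y))"
        by (simp add: norm_mult mult_right_mono flip: mult.assoc)
      then show "ennreal (norm (?K y * f y)) \<le> ennreal C * (ennreal (?b y) * ennreal (norm (f y)))"
        using C(1) by (simp add: ennreal_mult[symmetric] bump_nonneg ennreal_leI)
    qed
    also have "\<dots> = ennreal C * (\<integral>\<^sup>+y. ennreal (?b y) * ennreal (norm (f y)) \<partial>lebesgue)"
      by (rule nn_integral_cmult) measurable
    finally show ?thesis .
  qed
  with C(1) show thesis by (rule that)
qed

text \<open>
  Subtracting a multiple of the ground state from \<open>\<phi>\<close>, one may assume that \<open>\<phi>\<close> vanishes at \<open>x\<close>. Then the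
  part of the integral near \<open>x\<close> is small by continuity and the part away from \<open>x\<close> is small by the decay
  of the kernel.
\<close>

lemma smooth_sum_pointwise:
  fixes \<phi> :: "real^'n::finite \<Rightarrow> complex"
  assumes \<phi>: "Cc \<phi>"
  shows "(\<lambda>R. smooth_sum (Suc R) \<phi> x) \<longlonglongrightarrow> \<phi> x"
proof -
  let ?q = "\<lambda>R. sqrt (real ((CARD('n) + 2) * Suc R))"
  obtain C where C: "C \<ge> 0" "\<And>R f (x::real^'n). R \<ge> 1 \<Longrightarrow> f \<in> Lp 2 \<Longrightarrow>
     ennreal (norm (smooth_sum R f x)) \<le> ennreal C * (\<integral>\<^sup>+y. ennreal (bump (sqrt (real ((CARD('n) + 2) * R))) (y - x)) * ennreal (norm (f y)) \<partial>lebesgue)"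
    by (rule smooth_sum_bound[where 'n = 'n]) (rule that, assumption+)
  obtain D where D: "D > 0" "\<And>q y::real^'n. q > 0 \<Longrightarrow> (\<integral>\<^sup>+x. ennreal (bump q (x - y)) \<partial>lebesgue) \<le> ennreal D"
     "\<And>q r y::real^'n. q > 0 \<Longrightarrow> r > 0 \<Longrightarrow> (\<integral>\<^sup>+x. ennreal (bump q (x - y)) * indicator {x. r < norm (x - y)} x \<partial>lebesgue) \<le> ennreal (D / (q * r))"
    by (rule bump_integralsE[where 'a = "real^'n"]) (rule that, assumption+)
  let ?h = "\<lambda>y::real^'n. complex_of_real (hermite (\<lambda>_. 0) y)"
  \<comment> \<open>With this multiple of the ground state, \<open>e\<close> vanishes at \<open>x\<close>.\<close>
  define c where "c = \<phi> x / ?h x"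
  define e where "e y = \<phi> y - c * ?h y" for y
  have ex: "e x = 0" using hermite_zero_pos[of x] by (simp add: e_def c_def)
  have phi2: "\<phi> \<in> Lp 2" by (rule Cc_Lp[OF \<phi>]) simp
  have e2: "e \<in> Lp 2" unfolding e_def[abs_def] by (intro Lp_diff phi2 Lp_cmult hermite_Lp2) simp
  have econt: "continuous_on UNIV e" unfolding e_def using \<phi> by (intro continuous_intros) (auto simp: Cc_def)
  obtain E where E: "E \<ge> 0" "\<And>y. norm (e y) \<le> E"
  proof -
    obtain B \<rho> where B: "B \<ge> 0" "\<And>x. norm (\<phi> x) \<le> B * indicator (cball 0 \<rho>) x" using Cc_bounded[OF \<phi>] by blast
    obtain H where H: "\<And>y::real^'n. \<bar>hermite (\<lambda>_. 0) y\<bar> \<le> H" using hermite_bounded by blast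
    have "norm (e y) \<le> B + norm c * H" for y
    proof -
      have "norm (e y) \<le> norm (\<phi> y) + norm (c * ?h y)" unfolding e_def by (rule norm_triangle_ineq4)
      also have "norm (\<phi> y) \<le> B" by (rule order_trans[OF B(2)]) (use B(1) in \<open>simp add: indicator_def\<close>)
      also have "norm (c * ?h y) \<le> norm c * H" using H[of y] by (simp add: norm_mult mult_left_mono)
      finally show ?thesis by simp
    qed
    moreover have "0 \<le> B + norm c * H" by (rule order_trans[OF norm_ge_zero]) fact
    ultimately show ?thesis using that by blast
  qed
  have diff: "smooth_sum (Suc R) \<phi> x - \<phi> x = smooth_sum (Suc R) e x" for R
  proof -
    have ce: "hermite_coeff \<alpha> e = hermite_coeff \<alpha> \<phi> - c * hermite_coeff \<alpha> ?h" for \<alpha>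
      unfolding e_def[abs_def] by (simp add: hermite_coeff_diff phi2 Lp_cmult hermite_Lp2 hermite_coeff_cmult)
    have "smooth_sum (Suc R) e x = smooth_sum (Suc R) \<phi> x - c * smooth_sum (Suc R) ?h x"
      unfolding smooth_sum_def hermite_sum_def sum_distrib_left sum_subtractf[symmetric]
      by (intro sum.cong refl) (simp only: ce algebra_simps)
    also have "smooth_sum (Suc R) ?h x = ?h x" by (rule smooth_sum_hermite_0) simp
    also have "c * ?h x = \<phi> x" using hermite_zero_pos[of x] by (simp add: c_def)
    finally show ?thesis by simp
  qed
  have main: "norm (smooth_sum (Suc R) e x) \<le> C * (\<epsilon> * D + E * (D / (?q R * \<delta>)))"
    if \<epsilon>: "\<epsilon> > 0" and \<delta>: "\<delta> > 0" "\<And>y. norm (y - x) \<le> \<delta> \<Longrightarrow> norm (e y) \<le> \<epsilon>" for \<epsilon> \<delta> R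
  proof -
    have q: "?q R > 0" by (simp only: real_sqrt_gt_0_iff of_nat_0_less_iff) simp
    let ?b = "\<lambda>y. ennreal (bump (?q R) (y - x))"
    have "ennreal (norm (smooth_sum (Suc R) e x)) \<le> ennreal C * (\<integral>\<^sup>+y. ?b y * ennreal (norm (e y)) \<partial>lebesgue)"
      by (rule C(2)) (use e2 in auto)
    also have "\<dots> \<le> ennreal C * (\<integral>\<^sup>+y. ennreal \<epsilon> * ?b y + ennreal E * (?b y * indicator {y. \<delta> < norm (y - x)} y) \<partial>lebesgue)"
    proof (intro mult_left_mono nn_integral_mono)
      fix y
      show "?b y * ennreal (norm (e y)) \<le> ennreal \<epsilon> * ?b y + ennreal E * (?b y * indicator {y. \<delta> < norm (y - x)} y)"
      proof (cases "norm (y - x) \<le> \<delta>")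
        case True
        have "?b y * ennreal (norm (e y)) \<le> ?b y * ennreal \<epsilon>" by (intro mult_left_mono ennreal_leI \<delta>(2) True) simp
        then show ?thesis by (simp add: mult.commute add_increasing2)
      next
        case False
        have "?b y * ennreal (norm (e y)) \<le> ?b y * ennreal E" by (intro mult_left_mono ennreal_leI E(2)) simp
        then show ?thesis using False by (simp add: mult.commute add_increasing)
      qed
    qed simp
    also have "(\<integral>\<^sup>+y. ennreal \<epsilon> * ?b y + ennreal E * (?b y * indicator {y. \<delta> < norm (y - x)} y) \<partial>lebesgue)
      = ennreal \<epsilon> * (\<integral>\<^sup>+y. ?b y \<partial>lebesgue) + ennreal E * (\<integral>\<^sup>+y. ?b y * indicator {y. \<delta> < norm (y - x)} y \<partial>lebesgue)"
      by (subst nn_integral_add)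
         (auto simp: nn_integral_cmult bump_shift_measurable intro!: borel_measurable_times_ennreal bump_shift_measurable)
    also have "ennreal C * (ennreal \<epsilon> * (\<integral>\<^sup>+y. ?b y \<partial>lebesgue) + ennreal E * (\<integral>\<^sup>+y. ?b y * indicator {y. \<delta> < norm (y - x)} y \<partial>lebesgue))
       \<le> ennreal C * (ennreal \<epsilon> * ennreal D + ennreal E * ennreal (D / (?q R * \<delta>)))"
      by (intro add_mono mult_left_mono D(2) D(3) q \<delta>(1)) auto
    also have "ennreal \<epsilon> * ennreal D + ennreal E * ennreal (D / (?q R * \<delta>)) = ennreal (\<epsilon> * D + E * (D / (?q R * \<delta>)))"
      using \<epsilon> \<delta>(1) D(1) E(1) q by (subst (1 2) ennreal_mult[symmetric]) (auto simp flip: ennreal_plus)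
    also have "ennreal C * ennreal (\<epsilon> * D + E * (D / (?q R * \<delta>))) = ennreal (C * (\<epsilon> * D + E * (D / (?q R * \<delta>))))"
      using C(1) \<epsilon> \<delta>(1) D(1) E(1) q by (intro ennreal_mult[symmetric]) auto
    finally show ?thesis
      using C(1) \<epsilon> \<delta>(1) D(1) E(1) q by (subst (asm) ennreal_le_iff) auto
  qed
  have "(\<lambda>R. smooth_sum (Suc R) e x) \<longlonglongrightarrow> 0"
  proof (rule LIMSEQ_I)
    fix r :: real assume r: "r > 0"
    define \<epsilon> where "\<epsilon> = r / (2 * (C * D + 1))"
    have CD: "C * D \<ge> 0" using C D by simp
    have \<epsilon>: "\<epsilon> > 0" unfolding \<epsilon>_def using r CD by simp
    have "C * (\<epsilon> * D) = r / 2 * (C * D / (C * D + 1))" by (simp add: \<epsilon>_def)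
    also have "\<dots> \<le> r / 2 * 1" using r CD by (intro mult_left_mono) (auto simp: divide_simps)
    finally have half: "C * (\<epsilon> * D) \<le> r / 2" by simp
    obtain \<delta>' where \<delta>': "\<delta>' > 0" "\<And>y. dist y x < \<delta>' \<Longrightarrow> dist (e y) (e x) < \<epsilon>"
      using econt \<epsilon> unfolding continuous_on_iff by (metis UNIV_I)
    define \<delta> where "\<delta> = \<delta>' / 2"
    have \<delta>: "\<delta> > 0" "\<And>y. norm (y - x) \<le> \<delta> \<Longrightarrow> norm (e y) \<le> \<epsilon>"
      using \<delta>' ex by (auto simp: \<delta>_def dist_norm intro!: less_imp_le)
    have "(\<lambda>R. C * (E * (D / (?q R * \<delta>)))) \<longlonglongrightarrow> 0"
    proof -
      have "R \<le> (CARD('n) + 2) * Suc R" for R by simp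
      then have "real R \<le> real ((CARD('n) + 2) * Suc R)" for R by (rule of_nat_mono)
      then have lim: "filterlim (\<lambda>R. real ((CARD('n) + 2) * Suc R)) at_top sequentially"
        by (intro filterlim_at_top_mono[OF filterlim_real_sequentially] always_eventually allI)
      have "filterlim (\<lambda>R. ?q R * \<delta>) at_top sequentially"
        by (rule filterlim_at_top_mult_tendsto_pos[OF tendsto_const \<delta>(1)],
            rule filterlim_compose[OF sqrt_at_top], rule lim)
      from tendsto_divide_0[OF tendsto_const filterlim_at_top_imp_at_infinity[OF this], of "C * (E * D)"]
      show ?thesis by simp
    qed
    from order_tendstoD(2)[OF this, of "r/2"] r
    obtain R0 where R0: "\<And>R. R \<ge> R0 \<Longrightarrow> C * (E * (D / (?q R * \<delta>))) < r / 2"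
      by (auto simp: eventually_sequentially)
    show "\<exists>R0. \<forall>R\<ge>R0. norm (smooth_sum (Suc R) e x - 0) < r"
    proof (intro exI allI impI)
      fix R assume "R \<ge> R0"
      from R0[OF this] half main[OF \<epsilon> \<delta>, of R] show "norm (smooth_sum (Suc R) e x - 0) < r"
        unfolding distrib_left diff_zero by linarith
    qed
  qed
  then have "(\<lambda>R. smooth_sum (Suc R) \<phi> x - \<phi> x) \<longlonglongrightarrow> 0" unfolding diff .
  then show ?thesis by (rule LIM_zero_cancel)
qed

text \<open>
  Near the support of \<open>\<phi>\<close> the expansions are bounded because the kernels are bounded in \<open>L\<^sup>1\<close>; far from it
  they are bounded by the tail of the kernel, in which \<open>R\<close> appears with a negative power.
\<close>

lemma smooth_sum_dominated:
  fixes \<phi> :: "real^'n::finite \<Rightarrow> complex"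
  assumes \<phi>: "Cc \<phi>"
  shows "\<exists>K\<ge>0. \<forall>R\<ge>1. \<forall>x. norm (smooth_sum R \<phi> x) \<le> K * bump 1 x"
proof -
  let ?d = "CARD('n) + 1"
  obtain C where C: "C \<ge> 0" "\<And>R f (x::real^'n). R \<ge> 1 \<Longrightarrow> f \<in> Lp 2 \<Longrightarrow>
     ennreal (norm (smooth_sum R f x)) \<le> ennreal C * (\<integral>\<^sup>+y. ennreal (bump (sqrt (real ((CARD('n) + 2) * R))) (y - x)) * ennreal (norm (f y)) \<partial>lebesgue)"
    by (rule smooth_sum_bound[where 'n = 'n]) (rule that, assumption+)
  obtain D where D: "D > 0" "\<And>q y::real^'n. q > 0 \<Longrightarrow> (\<integral>\<^sup>+x. ennreal (bump q (x - y)) \<partial>lebesgue) \<le> ennreal D"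
    by (rule bump_integralsE[where 'a = "real^'n"]) (rule that, assumption+)
  obtain B \<rho> where B: "B \<ge> 0" "\<rho> \<ge> 0" "\<And>x. norm (\<phi> x) \<le> B * indicator (cball 0 \<rho>) x" using Cc_bounded[OF \<phi>] by blast
  have B': "norm (\<phi> y) \<le> B" for y by (rule order_trans[OF B(3)]) (use B(1) in \<open>simp add: indicator_def\<close>)
  define V where "V = measure lebesgue (cball (0::real^'n) \<rho>)"
  have V: "V \<ge> 0" by (simp add: V_def)
  have Ve: "emeasure lebesgue (cball (0::real^'n) \<rho>) = ennreal V"
    unfolding V_def using emeasure_bounded_finite[of "cball (0::real^'n) \<rho>"] by (subst emeasure_eq_ennreal_measure) auto
  define r where "r = max 1 \<rho>"
  define K1 where "K1 = C * (D * B) * (1 + (2 * r) ^ ?d)"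
  define K2 where "K2 = C * (2 ^ ?d * B * V) * 2"
  have phi2: "\<phi> \<in> Lp 2" by (rule Cc_Lp[OF \<phi>]) simp
  have "norm (smooth_sum R \<phi> x) \<le> (K1 + K2) * bump 1 x" if R: "R \<ge> 1" for R x
  proof (cases "norm x \<le> 2 * r")
    case True
    let ?q = "sqrt (real ((CARD('n) + 2) * R))"
    have "0 < (CARD('n) + 2) * R" using R by simp
    then have q: "?q > 0" by (simp only: real_sqrt_gt_0_iff of_nat_0_less_iff)
    have "ennreal (norm (smooth_sum R \<phi> x)) \<le> ennreal C * (\<integral>\<^sup>+y. ennreal (bump ?q (y - x)) * ennreal (norm (\<phi> y)) \<partial>lebesgue)"
      by (rule C(2)[OF R phi2])
    also have "\<dots> \<le> ennreal C * (\<integral>\<^sup>+y. ennreal (bump ?q (y - x)) * ennreal B \<partial>lebesgue)"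
      by (intro mult_left_mono nn_integral_mono ennreal_leI B') auto
    also have "\<dots> = ennreal C * ((\<integral>\<^sup>+y. ennreal (bump ?q (y - x)) \<partial>lebesgue) * ennreal B)"
      by (subst nn_integral_multc) (rule bump_shift_measurable, rule refl)
    also have "\<dots> \<le> ennreal C * (ennreal D * ennreal B)"
      by (intro mult_left_mono mult_right_mono D(2) q) auto
    also have "\<dots> = ennreal (C * (D * B))" using C(1) D(1) B(1) by (simp add: ennreal_mult)
    finally have "norm (smooth_sum R \<phi> x) \<le> C * (D * B)" using C(1) D(1) B(1) by (subst (asm) ennreal_le_iff) auto
    also have "\<dots> = K1 * (1 / (1 + (2 * r) ^ ?d))"
    proof -
      have "1 + (2 * r) ^ ?d > 0" by (intro add_pos_nonneg) (auto simp: r_def)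
      then show ?thesis unfolding K1_def by simp
    qed
    also have "\<dots> \<le> K1 * bump 1 x"
    proof (intro mult_left_mono)
      have "(norm x) ^ ?d \<le> (2 * r) ^ ?d" using True by (intro power_mono) auto
      then show "1 / (1 + (2 * r) ^ ?d) \<le> bump 1 x" by (auto simp: bump_def intro!: divide_left_mono mult_pos_pos add_pos_nonneg) (auto simp: r_def)
      show "K1 \<ge> 0" unfolding K1_def using C(1) D(1) B(1) by (intro mult_nonneg_nonneg add_nonneg_nonneg) (auto simp: r_def)
    qed
    also have "\<dots> \<le> (K1 + K2) * bump 1 x"
      unfolding K2_def using C(1) B V by (intro mult_right_mono bump_nonneg) auto
    finally show ?thesis .
  next
    case False
    let ?q = "sqrt (real ((CARD('n) + 2) * R))"
    have q: "?q \<ge> 1"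
    proof -
      have "1 \<le> (CARD('n) + 2) * R" using R by (simp add: algebra_simps)
      then have "1 \<le> real ((CARD('n) + 2) * R)" by (metis of_nat_1 of_nat_mono)
      then show ?thesis by simp
    qed
    have x2: "norm x > 2 * \<rho>" "norm x > 2" using False B(2) by (auto simp: r_def)
    let ?t = "2 ^ ?d / norm x ^ ?d"
    have "ennreal (norm (smooth_sum R \<phi> x)) \<le> ennreal C * (\<integral>\<^sup>+y. ennreal (bump ?q (y - x)) * ennreal (norm (\<phi> y)) \<partial>lebesgue)"
      by (rule C(2)[OF R phi2])
    also have "\<dots> \<le> ennreal C * (\<integral>\<^sup>+y. ennreal (?t * B) * indicator (cball (0::real^'n) \<rho>) y \<partial>lebesgue)"
    proof (intro mult_left_mono nn_integral_mono)
      fix y :: "real^'n"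
      show "ennreal (bump ?q (y - x)) * ennreal (norm (\<phi> y)) \<le> ennreal (?t * B) * indicator (cball 0 \<rho>) y"
      proof (cases "norm y \<le> \<rho>")
        case True
        have "norm x \<le> norm (y - x) + norm y" using norm_triangle_ineq4[of y "y - x"] by simp
        then have yx: "norm x / 2 \<le> norm (y - x)" using True x2 by simp
        then have "y - x \<noteq> 0" using x2 by auto
        then have "bump ?q (y - x) \<le> 1 / (?q * norm (y - x) ^ ?d)" using bump_le_tail[of ?q "y - x"] q by simp
        also have "\<dots> \<le> 1 / (1 * (norm x / 2) ^ ?d)"
          using yx q x2 \<open>y - x \<noteq> 0\<close> by (intro divide_left_mono mult_mono power_mono) (auto intro!: mult_pos_pos zero_less_power)
        also have "\<dots> = ?t" by (simp add: power_divide)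
        finally have "bump ?q (y - x) * norm (\<phi> y) \<le> ?t * B"
          using B' by (intro mult_mono) auto
        then show ?thesis using True by (simp add: ennreal_mult'[symmetric] bump_nonneg ennreal_leI)
      next
        case False
        then show ?thesis using B(3)[of y] by simp
      qed
    qed simp
    also have "\<dots> = ennreal C * (ennreal (?t * B) * ennreal V)"
      by (subst nn_integral_cmult_indicator) (auto simp: Ve)
    also have "\<dots> = ennreal (C * (?t * B * V))"
    proof -
      have "?t * B \<ge> 0" using B(1) by (intro mult_nonneg_nonneg) auto
      then show ?thesis using ennreal_mult[of C "?t * B * V"] ennreal_mult[of "?t * B" V] C(1) V
        by (simp only: mult_nonneg_nonneg)
    qed
    finally have "norm (smooth_sum R \<phi> x) \<le> C * (?t * B * V)"
      using C(1) B(1) V by (subst (asm) ennreal_le_iff) (auto intro!: mult_nonneg_nonneg)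
    also have "\<dots> = K2 * (1 / (2 * norm x ^ ?d))" unfolding K2_def by simp
    also have "\<dots> \<le> K2 * bump 1 x"
    proof (intro mult_left_mono)
      have "1 \<le> norm x ^ ?d" using x2 by (intro one_le_power) simp
      then show "1 / (2 * norm x ^ ?d) \<le> bump 1 x"
        unfolding bump_def by (simp del: power_Suc) (intro divide_left_mono mult_pos_pos, auto simp del: power_Suc)
      show "K2 \<ge> 0" unfolding K2_def using C(1) B(1) V by simp
    qed
    also have "\<dots> \<le> (K1 + K2) * bump 1 x"
      unfolding K1_def using C(1) D(1) B(1) by (intro mult_right_mono bump_nonneg) (auto intro!: mult_nonneg_nonneg add_nonneg_nonneg simp: r_def)
    finally show ?thesis .
  qed
  moreover have "K1 + K2 \<ge> 0" unfolding K1_def K2_def using C(1) D(1) B V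
    by (intro add_nonneg_nonneg mult_nonneg_nonneg) (auto simp: r_def)
  ultimately show ?thesis by blast
qed

lemma smooth_sum_measurable: "smooth_sum R f \<in> borel_measurable lebesgue"
  unfolding smooth_sum_def by (rule Lp_measurable[OF hermite_sum_Lp2])

lemma Cc_le_bump:
  fixes \<phi> :: "'a::euclidean_space \<Rightarrow> complex"
  assumes "Cc \<phi>" shows "\<exists>K\<ge>0. \<forall>x. norm (\<phi> x) \<le> K * bump 1 x"
proof -
  obtain B \<rho> where B: "B \<ge> 0" "\<rho> \<ge> 0" "\<And>x. norm (\<phi> x) \<le> B * indicator (cball 0 \<rho>) x"
    using Cc_bounded[OF assms] by blast
  let ?K = "B * (1 + \<rho> ^ (DIM('a) + 1))"
  have "norm (\<phi> x) \<le> ?K * bump 1 x" for x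
  proof (cases "norm x \<le> \<rho>")
    case True
    have p: "1 + norm x ^ (DIM('a) + 1) > 0" by (intro add_pos_nonneg) auto
    have "1 + norm x ^ (DIM('a) + 1) \<le> 1 + \<rho> ^ (DIM('a) + 1)" using True by (intro add_left_mono power_mono) auto
    then have "1 \<le> (1 + \<rho> ^ (DIM('a) + 1)) * bump 1 x" using p by (simp add: bump_def divide_simps)
    then have "B * 1 \<le> B * ((1 + \<rho> ^ (DIM('a) + 1)) * bump 1 x)" using B(1) by (rule mult_left_mono)
    then show ?thesis using B(3)[of x] True by simp
  next
    case False
    have "bump 1 x \<ge> 0" by (rule bump_nonneg) simp
    then show ?thesis using B False B(3)[of x] by simp
  qed
  moreover have "?K \<ge> 0" using B by simp
  ultimately show ?thesis by blast
qed

lemma bump_1_le_1: "bump 1 x \<le> 1"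
  using bump_le_power[of 1 x] by simp

text \<open>
  Since \<open>bump 1\<close> is at most \<open>1\<close>, its powers are dominated by itself.
\<close>

lemma bump_powr_integrable:
  fixes K p :: real
  assumes "p \<ge> 1" "K \<ge> 0"
  shows "integrable lebesgue (\<lambda>x::'a::euclidean_space. (K * bump 1 x) powr p)"
proof (rule Bochner_Integration.integrable_bound)
  show "integrable lebesgue (\<lambda>x::'a. K powr p * bump 1 x)"
    using bump_integrable[of 1, where 'a = 'a] by (intro integrable_mult_right) (subst integrable_completion, auto)
  have "(K * bump 1 x) powr p \<le> K powr p * bump 1 x" for x :: 'a
  proof -
    have b: "0 \<le> bump 1 x" "bump 1 x \<le> 1" by (auto intro: bump_nonneg bump_1_le_1)
    have "bump 1 x powr p \<le> bump 1 x powr 1" using b assms by (intro powr_mono') auto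
    then show ?thesis using b assms by (simp add: powr_mult mult_left_mono)
  qed
  then show "AE x::'a in lebesgue. norm ((K * bump 1 x) powr p) \<le> norm (K powr p * bump 1 x)"
    by (intro AE_I2) (simp add: abs_mult bump_nonneg)
  show "(\<lambda>x::'a. (K * bump 1 x) powr p) \<in> borel_measurable lebesgue"
    by (intro borel_imp_lebesgue) measurable
qed

theorem smooth_sum_tendsto:
  fixes \<phi> :: "real^'n::finite \<Rightarrow> complex"
  assumes \<phi>: "Cc \<phi>" and p: "p \<ge> 1"
  shows "(\<lambda>R. LINT x|lebesgue. norm (\<phi> x - smooth_sum (Suc R) \<phi> x) powr p) \<longlonglongrightarrow> 0"
    and "smooth_sum (Suc R) \<phi> \<in> Lp p"
proof -
  obtain K1 where K1: "K1 \<ge> 0" "\<And>R x. R \<ge> 1 \<Longrightarrow> norm (smooth_sum R \<phi> x) \<le> K1 * bump 1 x"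
    using smooth_sum_dominated[OF \<phi>] by blast
  obtain K2 where K2: "K2 \<ge> 0" "\<And>x. norm (\<phi> x) \<le> K2 * bump 1 x"
    using Cc_le_bump[OF \<phi>] by blast
  note [measurable] = smooth_sum_measurable borel_imp_lebesgue[OF Cc_measurable[OF \<phi>]]
  have "(\<lambda>R. LINT x|lebesgue. norm (\<phi> x - smooth_sum (Suc R) \<phi> x) powr p) \<longlonglongrightarrow> (LINT x|(lebesgue :: (real^'n) measure). 0)"
  proof (rule integral_dominated_convergence)
    show "integrable lebesgue (\<lambda>x::real^'n. ((K2 + K1) * bump 1 x) powr p)"
      using K1 K2 p by (intro bump_powr_integrable) auto
    have "norm (\<phi> x - smooth_sum (Suc R) \<phi> x) powr p \<le> ((K2 + K1) * bump 1 x) powr p" for R x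
    proof (rule powr_mono2)
      show "norm (\<phi> x - smooth_sum (Suc R) \<phi> x) \<le> (K2 + K1) * bump 1 x"
        using norm_triangle_ineq4[of "\<phi> x" "smooth_sum (Suc R) \<phi> x"] K1(2)[of "Suc R" x] K2(2)[of x]
        by (simp add: distrib_right)
    qed (use p in auto)
    then show "AE x in lebesgue. norm (norm (\<phi> x - smooth_sum (Suc R) \<phi> x) powr p) \<le> ((K2 + K1) * bump 1 x) powr p" for R
      by (intro AE_I2) simp
    have conv: "(\<lambda>R. norm (\<phi> x - smooth_sum (Suc R) \<phi> x) powr p) \<longlonglongrightarrow> 0" for x
    proof -
      have "(\<lambda>R. norm (\<phi> x - smooth_sum (Suc R) \<phi> x)) \<longlonglongrightarrow> norm (\<phi> x - \<phi> x)"
        by (intro tendsto_intros smooth_sum_pointwise \<phi>)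
      then show ?thesis
        using tendsto_powr2[of "\<lambda>R. norm (\<phi> x - smooth_sum (Suc R) \<phi> x)" 0 sequentially "\<lambda>_. p" p] p by simp
    qed
    show "AE x in lebesgue. (\<lambda>R. norm (\<phi> x - smooth_sum (Suc R) \<phi> x) powr p) \<longlonglongrightarrow> 0"
      by (intro AE_I2 conv)
  qed measurable
  then show "(\<lambda>R. LINT x|lebesgue. norm (\<phi> x - smooth_sum (Suc R) \<phi> x) powr p) \<longlonglongrightarrow> 0" by simp
  have "(\<lambda>x. complex_of_real (K1 * bump 1 x)) \<in> (Lp p :: (real^'n \<Rightarrow> complex) set)"
    unfolding Lp_def using bump_powr_integrable[of p K1, where 'a = "real^'n"] p K1(1)
    by (auto intro!: borel_imp_lebesgue simp: norm_mult bump_nonneg)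
  then show "smooth_sum (Suc R) \<phi> \<in> Lp p"
    by (rule Lp_bound) (use K1 p in \<open>auto simp: smooth_sum_measurable norm_mult bump_nonneg\<close>)
qed

text \<open>
  A function that is orthogonal to all Hermite functions is orthogonal to the smoothly truncated
  expansions of any \<open>\<phi> \<in> C\<^sub>c\<close>, hence to \<open>\<phi>\<close>, hence to itself.
\<close>

theorem hermite_complete:
  fixes f :: "real^'n::finite \<Rightarrow> complex"
  assumes f: "f \<in> Lp 2" and orth: "\<And>\<alpha>. hermite_coeff \<alpha> f = 0"
  shows "AE x in lebesgue. f x = 0"
proof -
  note [measurable] = Lp_measurable[OF f]
  have smooth0: "(LINT x|lebesgue. f x * smooth_sum R \<phi> x) = 0" for R \<phi>
  proof -
    let ?c = "\<lambda>\<alpha>. smooth_symbol (CARD('n) + 1) R (sum \<alpha> UNIV) * hermite_coeff \<alpha> \<phi>"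
    have "(LINT x|lebesgue. f x * smooth_sum R \<phi> x) = (LINT x|lebesgue. (\<Sum>\<alpha> | sum \<alpha> UNIV < (CARD('n) + 2) * R. ?c \<alpha> * (f x * of_real (hermite \<alpha> x))))"
      unfolding smooth_sum_def hermite_sum_def sum_distrib_left
      by (rule arg_cong[where f = "integral\<^sup>L lebesgue"], rule ext, rule sum.cong[OF refl], simp only: mult_ac)
    also have "\<dots> = (\<Sum>\<alpha> | sum \<alpha> UNIV < (CARD('n) + 2) * R. (LINT x|lebesgue. ?c \<alpha> * (f x * of_real (hermite \<alpha> x))))"
      by (rule Bochner_Integration.integral_sum) (intro integrable_mult_right hermite_coeff_integrable f)
    also have "\<dots> = 0"
      by (rule sum.neutral) (use orth in \<open>auto simp: hermite_coeff_def simp del: mult_eq_0_iff\<close>)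
    finally show ?thesis .
  qed
  have Cc0: "(LINT x|lebesgue. f x * \<phi> x) = 0" if \<phi>: "Cc \<phi>" for \<phi>
  proof -
    have phi2: "\<phi> \<in> Lp 2" by (rule Cc_Lp[OF \<phi>]) simp
    have s2: "smooth_sum R \<phi> \<in> Lp 2" for R unfolding smooth_sum_def by (rule hermite_sum_Lp2)
    have le: "(norm (LINT x|lebesgue. f x * \<phi> x))\<^sup>2 \<le> L2_sq f * (LINT x|lebesgue. norm (\<phi> x - smooth_sum (Suc R) \<phi> x) powr 2)" for R
    proof -
      have "(LINT x|lebesgue. f x * (\<phi> x - smooth_sum (Suc R) \<phi> x)) = (LINT x|lebesgue. f x * \<phi> x) - (LINT x|lebesgue. f x * smooth_sum (Suc R) \<phi> x)"
        unfolding right_diff_distrib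
        by (rule Bochner_Integration.integral_diff) (intro L2_prod_integrable f phi2 s2)+
      then have "(LINT x|lebesgue. f x * \<phi> x) = (LINT x|lebesgue. f x * (\<phi> x - smooth_sum (Suc R) \<phi> x))" using smooth0 by simp
      then show ?thesis using L2_Cauchy_Schwarz[OF f Lp_diff[OF phi2 s2], of "Suc R"] by simp
    qed
    have lim: "(\<lambda>R. L2_sq f * (LINT x|lebesgue. norm (\<phi> x - smooth_sum (Suc R) \<phi> x) powr 2)) \<longlonglongrightarrow> L2_sq f * 0"
      by (intro tendsto_intros smooth_sum_tendsto \<phi>) simp
    have "(norm (LINT x|lebesgue. f x * \<phi> x))\<^sup>2 \<le> L2_sq f * 0"
      by (rule LIMSEQ_le_const[OF lim]) (use le in blast)
    then show ?thesis by simp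
  qed
  have "(\<lambda>x. cnj (f x)) \<in> borel_measurable lebesgue"
    by (rule measurable_compose[OF Lp_measurable[OF f] borel_measurable_continuous_onI[OF continuous_on_cnj[OF continuous_on_id]]])
  then have cf: "(\<lambda>x. cnj (f x)) \<in> Lp 2" using f by (simp add: Lp_2_iff)
  have small: "(L2_sq f)\<^sup>2 \<le> L2_sq f * e" if e: "e > 0" for e
  proof -
    have "\<exists>\<phi>. Cc \<phi> \<and> (\<forall>p\<in>{2}. (LINT x|lebesgue. norm (cnj (f x) - \<phi> x) powr p) < e)"
      by (rule Cc_dense) (use cf e Lp_measurable[OF cf] in auto)
    then obtain \<phi> where \<phi>: "Cc \<phi>" "L2_sq (\<lambda>x. cnj (f x) - \<phi> x) < e" by auto
    have phi2: "\<phi> \<in> Lp 2" by (rule Cc_Lp[OF \<phi>(1)]) simp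
    have "(LINT x|lebesgue. f x * (cnj (f x) - \<phi> x)) = (LINT x|lebesgue. f x * cnj (f x)) - (LINT x|lebesgue. f x * \<phi> x)"
      unfolding right_diff_distrib
      by (rule Bochner_Integration.integral_diff) (intro L2_prod_integrable f phi2 cf)+
    also have "(LINT x|lebesgue. f x * cnj (f x)) = of_real (L2_sq f)"
      unfolding complex_norm_square[symmetric] of_real_power[symmetric] by (rule integral_complex_of_real)
    finally have "(L2_sq f)\<^sup>2 = (norm (LINT x|lebesgue. f x * (cnj (f x) - \<phi> x)))\<^sup>2"
      using Cc0[OF \<phi>(1)] by (simp add: norm_power)
    also have "\<dots> \<le> L2_sq f * L2_sq (\<lambda>x. cnj (f x) - \<phi> x)" by (rule L2_Cauchy_Schwarz[OF f Lp_diff[OF cf phi2]]) simp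
    also have "\<dots> \<le> L2_sq f * e" using \<phi>(2) by (intro mult_left_mono L2_sq_nonneg) simp
    finally show ?thesis .
  qed
  have "L2_sq f = 0"
  proof (rule ccontr)
    assume "L2_sq f \<noteq> 0"
    then have "L2_sq f > 0" using L2_sq_nonneg[of f] by linarith
    then show False using small[of "L2_sq f / 2"] by (simp add: power2_eq_square)
  qed
  then have "AE x in lebesgue. (norm (f x))\<^sup>2 = 0"
    using f by (subst (asm) integral_nonneg_eq_0_iff_AE) (auto simp: Lp_2_iff)
  then show ?thesis by simp
qed

section \<open>Eigenspaces of the Hermite operator\<close>

lemma sum_Basis_vec: "(\<Sum>b\<in>(Basis :: (real^'n::finite) set). f b) = (\<Sum>i\<in>UNIV. f (axis i 1))"
proof -
  have "inj (\<lambda>i::'n. axis i (1::real))" by (auto simp: inj_def axis_eq_axis)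
  moreover have "(Basis :: (real^'n) set) = range (\<lambda>i. axis i 1)" by (auto simp: Basis_vec_def)
  ultimately show ?thesis by (metis (no_types, lifting) comp_apply sum.cong sum.reindex)
qed

lemma partial_deriv_eq: "(f has_derivative f') (at x) \<Longrightarrow> partial_deriv b f x = f' b"
  unfolding partial_deriv_def by (simp add: frechet_derivative_at[symmetric])

lemma sum_axis_nth: "(\<Sum>i\<in>UNIV. axis j (1::real) $ i * f i) = f j" for j :: "'n::finite"
  by (simp add: axis_def if_distrib[of "\<lambda>z. z * _"] cong: if_cong)

definition hermite_comb :: "('n::finite \<Rightarrow> nat) set \<Rightarrow> (('n \<Rightarrow> nat) \<Rightarrow> complex) \<Rightarrow> real^'n \<Rightarrow> complex" where
  "hermite_comb A c x = (\<Sum>\<alpha>\<in>A. c \<alpha> * of_real (hermite \<alpha> x))"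

lemma hermite_comb_partial:
  "(hermite_comb A c has_derivative (\<lambda>v. \<Sum>\<alpha>\<in>A. c \<alpha> * of_real (\<Sum>i\<in>UNIV. v $ i * hermite_d i \<alpha> x))) (at x)"
  "partial_deriv (axis i 1) (hermite_comb A c) = (\<lambda>x. \<Sum>\<alpha>\<in>A. c \<alpha> * of_real (hermite_d i \<alpha> x))"
proof -
  show D: "(hermite_comb A c has_derivative (\<lambda>v. \<Sum>\<alpha>\<in>A. c \<alpha> * of_real (\<Sum>i\<in>UNIV. v $ i * hermite_d i \<alpha> x))) (at x)" for x
    unfolding hermite_comb_def[abs_def] by (intro derivative_intros hermite_has_derivative)
  show "partial_deriv (axis i 1) (hermite_comb A c) = (\<lambda>x. \<Sum>\<alpha>\<in>A. c \<alpha> * of_real (hermite_d i \<alpha> x))"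
    by (rule ext) (simp only: partial_deriv_eq[OF D] sum_axis_nth)
qed

text \<open>
  The second partial derivatives are continuous since they are combinations of Hermite functions
  again.
\<close>

lemma hermite_comb_partial2:
  fixes c :: "('n::finite \<Rightarrow> nat) \<Rightarrow> complex" and A :: "('n \<Rightarrow> nat) set"
  defines "g \<equiv> \<lambda>i x. \<Sum>\<alpha>\<in>A. c \<alpha> * of_real (hermite_d i \<alpha> x)"
  defines "h \<equiv> \<lambda>j i x. \<Sum>\<alpha>\<in>A. c \<alpha> * of_real ((sqrt (real (\<alpha> i)) * hermite_d j (\<alpha>(i := \<alpha> i - 1)) x
      - sqrt (real (Suc (\<alpha> i))) * hermite_d j (\<alpha>(i := Suc (\<alpha> i))) x) / sqrt 2)"
  shows "g i differentiable (at x)" "partial_deriv (axis j 1) (g i) = h j i" "continuous_on UNIV (h j i)"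
proof -
  have D: "(g i has_derivative (\<lambda>v. \<Sum>\<alpha>\<in>A. c \<alpha> * of_real (\<Sum>j\<in>UNIV. v $ j *
     ((sqrt (real (\<alpha> i)) * hermite_d j (\<alpha>(i := \<alpha> i - 1)) x
      - sqrt (real (Suc (\<alpha> i))) * hermite_d j (\<alpha>(i := Suc (\<alpha> i))) x) / sqrt 2)))) (at x)" for x
    unfolding g_def by (intro derivative_intros hermite_d_has_derivative)
  show "g i differentiable (at x)" using D by (rule differentiableI)
  show "partial_deriv (axis j 1) (g i) = h j i"
    by (rule ext) (simp only: partial_deriv_eq[OF D] sum_axis_nth h_def)
  show "continuous_on UNIV (h j i)" unfolding h_def by (intro continuous_intros) auto
qed

lemma hermite_comb_C2: "C2 (hermite_comb A c)"
  unfolding C2_def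
proof (intro conjI allI ballI)
  fix x show "hermite_comb A c differentiable at x" by (rule differentiableI[OF hermite_comb_partial(1)])
next
  fix b :: "real^'a" and x assume "b \<in> Basis"
  then obtain i where b: "b = axis i 1" by (auto simp: Basis_vec_def)
  show "partial_deriv b (hermite_comb A c) differentiable at x"
    unfolding b hermite_comb_partial by (rule hermite_comb_partial2)
next
  fix b d :: "real^'a" assume "b \<in> Basis" "d \<in> Basis"
  then obtain i j where b: "b = axis i 1" and d: "d = axis j 1" by (auto simp: Basis_vec_def)
  show "continuous_on UNIV (partial_deriv d (partial_deriv b (hermite_comb A c)))"
    unfolding b d hermite_comb_partial hermite_comb_partial2(2) by (rule hermite_comb_partial2)
qed

lemma norm_sq_vec: "(norm (x :: real^'n::finite))\<^sup>2 = (\<Sum>i\<in>UNIV. (x $ i)\<^sup>2)"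
  unfolding power2_norm_eq_inner inner_vec_def by (simp add: power2_eq_square)

lemma hermite_comb_laplacian:
  fixes c :: "('n::finite \<Rightarrow> nat) \<Rightarrow> complex" and A :: "('n \<Rightarrow> nat) set"
  shows "laplacian (hermite_comb A c) x = (\<Sum>\<alpha>\<in>A. of_real ((norm x)\<^sup>2 - (2 * real (sum \<alpha> UNIV) + CARD('n))) * (c \<alpha> * of_real (hermite \<alpha> x)))"
proof -
  have "laplacian (hermite_comb A c) x = (\<Sum>i\<in>UNIV. \<Sum>\<alpha>\<in>A. c \<alpha> * of_real (((x $ i)\<^sup>2 - (2 * real (\<alpha> i) + 1)) * hermite \<alpha> x))"
    unfolding laplacian_def sum_Basis_vec hermite_comb_partial hermite_comb_partial2(2) hermite_d2 ..
  also have "\<dots> = (\<Sum>\<alpha>\<in>A. \<Sum>i\<in>UNIV. c \<alpha> * of_real (((x $ i)\<^sup>2 - (2 * real (\<alpha> i) + 1)) * hermite \<alpha> x))"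
    by (rule sum.swap)
  also have "\<dots> = (\<Sum>\<alpha>\<in>A. of_real ((norm x)\<^sup>2 - (2 * real (sum \<alpha> UNIV) + CARD('n))) * (c \<alpha> * of_real (hermite \<alpha> x)))"
  proof (intro sum.cong refl)
    fix \<alpha> :: "'n \<Rightarrow> nat"
    have "(\<Sum>i\<in>UNIV. ((x $ i)\<^sup>2 - (2 * real (\<alpha> i) + 1)) * hermite \<alpha> x) = ((norm x)\<^sup>2 - (2 * real (sum \<alpha> UNIV) + CARD('n))) * hermite \<alpha> x"
      unfolding norm_sq_vec by (simp add: sum_distrib_right[symmetric] sum_subtractf sum.distrib sum_distrib_left)
    then show "(\<Sum>i\<in>UNIV. c \<alpha> * of_real (((x $ i)\<^sup>2 - (2 * real (\<alpha> i) + 1)) * hermite \<alpha> x))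
        = of_real ((norm x)\<^sup>2 - (2 * real (sum \<alpha> UNIV) + CARD('n))) * (c \<alpha> * of_real (hermite \<alpha> x))"
      unfolding sum_distrib_left[symmetric] of_real_sum[symmetric] by simp
  qed
  finally show ?thesis .
qed

lemma hermite_comb_eigenspace:
  "hermite_comb {\<alpha>. sum \<alpha> UNIV = k} c \<in> hermite_eigenspace k"
proof -
  have "hermite_op (hermite_comb {\<alpha>. sum \<alpha> UNIV = k} c) x = of_nat (2 * k + DIM(real^'a)) * hermite_comb {\<alpha>. sum \<alpha> UNIV = k} c x" for x :: "real^'a"
  proof -
    have "laplacian (hermite_comb {\<alpha>. sum \<alpha> UNIV = k} c) x = of_real ((norm x)\<^sup>2 - (2 * real k + CARD('a))) * hermite_comb {\<alpha>. sum \<alpha> UNIV = k} c x"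
      unfolding hermite_comb_laplacian unfolding hermite_comb_def sum_distrib_left by (intro sum.cong) auto
    then show ?thesis by (simp add: hermite_op_def algebra_simps)
  qed
  then show ?thesis
    by (simp add: hermite_eigenspace_def hermite_comb_C2) (simp add: hermite_comb_def[abs_def] hermite_comb_Lp2)
qed

lemma integral_translate:
  fixes u :: "'a::euclidean_space \<Rightarrow> complex"
  assumes [measurable]: "u \<in> borel_measurable borel"
  shows "(LINT x|lborel. u (c + x)) = (LINT x|lborel. u x)"
proof -
  have "(LINT x|lborel. u x) = (LINT x|distr lborel borel ((+) c). u x)" by (simp add: lborel_distr_plus)
  also have "\<dots> = (LINT x|lborel. u (c + x))" by (rule integral_distr) measurable
  finally show ?thesis ..
qed

lemma Cc_integrable: "Cc u \<Longrightarrow> integrable lborel u"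
  using Cc_Lp[of u 1] Cc_measurable[of u] unfolding Lp_1_iff' by (simp add: integrable_completion)

text \<open>
  The integral of a difference quotient vanishes by translation invariance, and the difference quotients
  converge boundedly on a fixed ball.
\<close>

theorem integral_directional_derivative_eq_0:
  fixes u :: "'a::euclidean_space \<Rightarrow> complex"
  assumes D: "\<And>x. (u has_derivative u' x) (at x)" and cont: "continuous_on UNIV (\<lambda>x. u' x b)"
    and supp: "\<And>x. norm x > \<rho> \<Longrightarrow> u x = 0" and b: "norm b \<le> 1"
  shows "(LINT x|lborel. u' x b) = 0"
proof -
  have ucont: "continuous_on UNIV u"
    using D by (meson continuous_at_imp_continuous_on has_derivative_continuous)
  have u: "Cc u" unfolding Cc_def using ucont supp by blast
  have supp': "u' x b = 0" if "norm x > \<rho>" for x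
  proof -
    have "open {x. norm x > \<rho>}" by (intro open_Collect_less continuous_intros)
    then have "((\<lambda>x. 0) has_derivative u' x) (at x)"
      using that supp by (intro has_derivative_transform_within_open[OF D]) auto
    then have "u' x = (\<lambda>_. 0)" by (rule has_derivative_unique) simp
    then show ?thesis by simp
  qed
  have u'c: "Cc (\<lambda>x. u' x b)" unfolding Cc_def using cont supp' by blast
  obtain B \<rho>' where B: "B \<ge> 0" "\<And>x. norm (u' x b) \<le> B * indicator (cball 0 \<rho>') x" using Cc_bounded[OF u'c] by blast
  have B': "norm (u' x b) \<le> B" for x by (rule order_trans[OF B(2)]) (use B(1) in \<open>simp add: indicator_def\<close>)
  define t where "t k = 1 / real (Suc k)" for k
  have t: "0 < t k" "t k \<le> 1" for k by (auto simp: t_def)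
  have t0: "t \<longlonglongrightarrow> 0" unfolding t_def by (rule LIMSEQ_inverse_real_of_nat[unfolded inverse_eq_divide])
  define Q where "Q k x = (u (t k *\<^sub>R b + x) - u x) / of_real (t k)" for k x
  note [measurable] = Cc_measurable[OF u] Cc_measurable[OF u'c]
  have Qint: "(LINT x|lborel. Q k x) = 0" for k
  proof -
    have "integrable lborel (\<lambda>x. u (t k *\<^sub>R b + x))"
      using integrable_distr_eq[of "(+) (t k *\<^sub>R b)" lborel borel u] Cc_integrable[OF u]
      by (simp add: lborel_distr_plus)
    then have "(LINT x|lborel. Q k x) = ((LINT x|lborel. u (t k *\<^sub>R b + x)) - (LINT x|lborel. u x)) / of_real (t k)"
      unfolding Q_def by (subst integral_divide_zero, subst Bochner_Integration.integral_diff) (auto intro: Cc_integrable[OF u])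
    then show ?thesis by (simp add: integral_translate)
  qed
  have line: "((\<lambda>s. u (s *\<^sub>R b + x)) has_derivative (\<lambda>s. s *\<^sub>R u' (s0 *\<^sub>R b + x) b)) (at s0 within S)" for s0 S x
  proof -
    have "((\<lambda>s. s *\<^sub>R b + x) has_derivative (\<lambda>s. s *\<^sub>R b)) (at s0 within S)" by (auto intro!: derivative_eq_intros)
    from has_derivative_compose[OF this D]
    have "((\<lambda>s. u (s *\<^sub>R b + x)) has_derivative (\<lambda>s. u' (s0 *\<^sub>R b + x) (s *\<^sub>R b))) (at s0 within S)" .
    moreover have "u' (s0 *\<^sub>R b + x) (s *\<^sub>R b) = s *\<^sub>R u' (s0 *\<^sub>R b + x) b" for s
      using D[THEN has_derivative_linear] by (rule linear_cmul)
    ultimately show ?thesis by simp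
  qed
  have Qb: "norm (Q k x) \<le> B * indicator (cball 0 (max 0 \<rho> + 1)) x" for k x
  proof (cases "norm x \<le> max 0 \<rho> + 1")
    case True
    have "norm (u (t k *\<^sub>R b + x) - u (0 *\<^sub>R b + x)) \<le> B * norm (t k - 0)"
    proof (rule differentiable_bound[OF convex_closed_segment line])
      show "onorm (\<lambda>r. r *\<^sub>R u' (s *\<^sub>R b + x) b) \<le> B" for s
      proof (rule onorm_le)
        fix r :: real
        have "\<bar>r\<bar> * norm (u' (s *\<^sub>R b + x) b) \<le> \<bar>r\<bar> * B" by (intro mult_left_mono B') simp
        then show "norm (r *\<^sub>R u' (s *\<^sub>R b + x) b) \<le> B * norm r" by (simp add: mult.commute)
      qed
    qed auto
    then show ?thesis using True t[of k] by (simp add: Q_def norm_divide divide_simps)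
  next
    case False
    have "norm (t k *\<^sub>R b) \<le> 1" using t[of k] b by (simp add: mult_le_one)
    then have "norm (t k *\<^sub>R b + x) \<ge> norm x - 1" using norm_triangle_ineq4[of "t k *\<^sub>R b + x" "t k *\<^sub>R b"] by simp
    then have "u (t k *\<^sub>R b + x) = 0" "u x = 0" using False by (auto intro!: supp)
    then show ?thesis using B(1) by (simp add: Q_def)
  qed
  have Qlim: "(\<lambda>k. Q k x) \<longlonglongrightarrow> u' x b" for x
  proof -
    have "((\<lambda>s. norm (u (s *\<^sub>R b + x) - u (0 *\<^sub>R b + x) - (s - 0) *\<^sub>R u' (0 *\<^sub>R b + x) b) / norm (s - 0)) \<longlongrightarrow> 0) (at 0)"
      using line[of x 0 UNIV] unfolding has_derivative_iff_norm by simp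
    moreover have "filterlim t (at 0) sequentially"
      unfolding filterlim_at using t0 t(1) by (auto intro!: always_eventually simp: less_imp_neq[symmetric])
    ultimately have "(\<lambda>k. norm (u (t k *\<^sub>R b + x) - u (0 *\<^sub>R b + x) - (t k - 0) *\<^sub>R u' (0 *\<^sub>R b + x) b) / norm (t k - 0)) \<longlonglongrightarrow> 0"
      by (rule filterlim_compose)
    moreover have "norm (u (t k *\<^sub>R b + x) - u (0 *\<^sub>R b + x) - (t k - 0) *\<^sub>R u' (0 *\<^sub>R b + x) b) / norm (t k - 0) = norm (Q k x - u' x b)" for k
    proof -
      have "Q k x - u' x b = (u (t k *\<^sub>R b + x) - u x - t k *\<^sub>R u' x b) / of_real (t k)"
        using t(1)[of k] by (simp add: Q_def diff_divide_distrib scaleR_conv_of_real)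
      then show ?thesis by (simp add: norm_divide)
    qed
    ultimately have "(\<lambda>k. norm (Q k x - u' x b)) \<longlonglongrightarrow> 0" by simp
    then show ?thesis by (rule LIM_zero_cancel[OF tendsto_norm_zero_cancel])
  qed
  have "(\<lambda>k. LINT x|lborel. Q k x) \<longlonglongrightarrow> (LINT x|lborel. u' x b)"
  proof (rule integral_dominated_convergence)
    show "integrable lborel (\<lambda>x. B * indicator (cball 0 (max 0 \<rho> + 1)) x :: real)"
      by (intro integrable_mult_right integrable_completion[THEN iffD1, OF _ integrable_indicator_cball]
            borel_measurable_indicator) simp
    show "AE x in lborel. norm (Q k x) \<le> B * indicator (cball 0 (max 0 \<rho> + 1)) x" for k by (intro AE_I2 Qb)
    show "AE x in lborel. (\<lambda>k. Q k x) \<longlonglongrightarrow> u' x b" by (intro AE_I2 Qlim)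
    show "Q k \<in> borel_measurable lborel" for k unfolding Q_def[abs_def] by measurable
  qed measurable
  then have "(\<lambda>k. 0::complex) \<longlonglongrightarrow> (LINT x|lborel. u' x b)" unfolding Qint .
  then show ?thesis by (simp add: LIMSEQ_const_iff)
qed

text \<open>
  A directional derivative of a Frechet differentiable function. Differentiability in the full sense is
  kept in order that the chain rule and the product rule hold.
\<close>

definition has_dir_deriv :: "('a::real_normed_vector \<Rightarrow> 'b::real_normed_vector) \<Rightarrow> 'b \<Rightarrow> 'a \<Rightarrow> 'a \<Rightarrow> bool" where
  "has_dir_deriv f d b x \<longleftrightarrow> (\<exists>f'. (f has_derivative f') (at x) \<and> f' b = d)"

lemma has_dir_derivI: "(f has_derivative f') (at x) \<Longrightarrow> f' b = d \<Longrightarrow> has_dir_deriv f d b x"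
  by (auto simp: has_dir_deriv_def)

lemma has_dir_deriv_mult:
  fixes f g :: "'a::real_normed_vector \<Rightarrow> 'b::real_normed_algebra"
  assumes "has_dir_deriv f d b x" "has_dir_deriv g e b x"
  shows "has_dir_deriv (\<lambda>x. f x * g x) (f x * e + d * g x) b x"
proof -
  obtain f' g' where "(f has_derivative f') (at x)" "f' b = d" "(g has_derivative g') (at x)" "g' b = e"
    using assms unfolding has_dir_deriv_def by metis
  note D = this
  show ?thesis by (rule has_dir_derivI[OF has_derivative_mult[OF D(1) D(3)]]) (simp add: D(2,4))
qed

lemma has_dir_deriv_add:
  assumes "has_dir_deriv f d b x" "has_dir_deriv g e b x"
  shows "has_dir_deriv (\<lambda>x. f x + g x) (d + e) b x"
proof -
  obtain f' g' where "(f has_derivative f') (at x)" "f' b = d" "(g has_derivative g') (at x)" "g' b = e"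
    using assms unfolding has_dir_deriv_def by metis
  note D = this
  show ?thesis by (rule has_dir_derivI[OF has_derivative_add[OF D(1) D(3)]]) (simp add: D(2,4))
qed

lemma has_dir_deriv_diff:
  assumes "has_dir_deriv f d b x" "has_dir_deriv g e b x"
  shows "has_dir_deriv (\<lambda>x. f x - g x) (d - e) b x"
proof -
  obtain f' g' where "(f has_derivative f') (at x)" "f' b = d" "(g has_derivative g') (at x)" "g' b = e"
    using assms unfolding has_dir_deriv_def by metis
  note D = this
  show ?thesis by (rule has_dir_derivI[OF has_derivative_diff[OF D(1) D(3)]]) (simp add: D(2,4))
qed

lemma has_dir_deriv_of_real:
  assumes "has_dir_deriv f d b x"
  shows "has_dir_deriv (\<lambda>x. complex_of_real (f x)) (of_real d) b x"
proof -
  obtain f' where "(f has_derivative f') (at x)" "f' b = d" using assms unfolding has_dir_deriv_def by metis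
  note D = this
  show ?thesis by (rule has_dir_derivI[OF has_derivative_of_real[OF D(1)]]) (simp add: D(2))
qed

lemma has_dir_deriv_compose:
  assumes "(P has_real_derivative p) (at (f x))" "has_dir_deriv f d b x"
  shows "has_dir_deriv (\<lambda>x. P (f x)) (p * d) b x"
proof -
  obtain f' where f': "(f has_derivative f') (at x)" "f' b = d" using assms(2) unfolding has_dir_deriv_def by metis
  show ?thesis
    by (rule has_dir_derivI[OF has_derivative_compose[OF f'(1) assms(1)[unfolded has_field_derivative_def]]]) (simp add: f'(2))
qed

lemma has_dir_deriv_continuous: "(\<And>x. has_dir_deriv f (d x) b x) \<Longrightarrow> continuous_on UNIV f"
proof (rule continuous_at_imp_continuous_on, rule ballI)
  fix x assume "\<And>x. has_dir_deriv f (d x) b x"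
  then obtain f' where "(f has_derivative f') (at x)" unfolding has_dir_deriv_def by blast
  then show "isCont f x" by (rule has_derivative_continuous)
qed

text \<open>
  The third power of the positive part has two continuous derivatives, which is all the smoothness that
  Green's formula demands of a cutoff.
\<close>

lemma pos_part_power_deriv:
  "((\<lambda>s::real. max 0 s ^ Suc (Suc m)) has_real_derivative real (Suc (Suc m)) * max 0 s ^ Suc m) (at s)"
proof (cases s "0::real" rule: linorder_cases)
  case less
  have "((\<lambda>s::real. 0) has_real_derivative 0) (at s)" by simp
  then have "((\<lambda>s::real. max 0 s ^ Suc (Suc m)) has_real_derivative 0) (at s)"
    by (rule has_field_derivative_transform_within_open[where S = "{..<0}"]) (use less in auto)
  then show ?thesis using less by simp
next
  case greater
  have "((\<lambda>s::real. s ^ Suc (Suc m)) has_real_derivative real (Suc (Suc m)) * s ^ Suc m) (at s)"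
    by (rule DERIV_cong[OF DERIV_pow]) simp
  then have "((\<lambda>s::real. max 0 s ^ Suc (Suc m)) has_real_derivative real (Suc (Suc m)) * s ^ Suc m) (at s)"
    by (rule has_field_derivative_transform_within_open[where S = "{0<..}"]) (use greater in auto)
  then show ?thesis using greater by simp
next
  case equal
  have "((\<lambda>h::real. (max 0 (0 + h) ^ Suc (Suc m) - max 0 0 ^ Suc (Suc m)) / h) \<longlongrightarrow> 0) (at 0)"
  proof (rule Lim_null_comparison)
    show "\<forall>\<^sub>F h::real in at 0. norm ((max 0 (0 + h) ^ Suc (Suc m) - max 0 0 ^ Suc (Suc m)) / h) \<le> \<bar>h\<bar> ^ Suc m"
    proof (rule always_eventually, rule allI)
      fix h :: real
      show "norm ((max 0 (0 + h) ^ Suc (Suc m) - max 0 0 ^ Suc (Suc m)) / h) \<le> \<bar>h\<bar> ^ Suc m"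
      proof (cases "h > 0")
        case False
        then have "(max 0 (0 + h) ^ Suc (Suc m) - max 0 0 ^ Suc (Suc m)) / h = 0" by simp
        then show ?thesis by (simp only: norm_zero) (rule zero_le_power, simp)
      qed (simp add: abs_mult)
    qed
    have "((\<lambda>h::real. \<bar>h\<bar> ^ Suc m) \<longlongrightarrow> \<bar>0\<bar> ^ Suc m) (at 0)" by (intro tendsto_intros)
    then show "((\<lambda>h::real. \<bar>h\<bar> ^ Suc m) \<longlongrightarrow> 0) (at 0)" by simp
  qed
  then show ?thesis using equal by (simp add: DERIV_def)
qed

lemma pos_part_cube_deriv: "((\<lambda>s::real. max 0 s ^ 3) has_real_derivative 3 * max 0 s ^ 2) (at s)"
proof -
  have e: "Suc (Suc 1) = (3::nat)" "Suc 1 = (2::nat)" by simp_all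
  show ?thesis using pos_part_power_deriv[of 1 s] unfolding e by simp
qed

lemma pos_part_square_deriv: "((\<lambda>s::real. max 0 s ^ 2) has_real_derivative 2 * max 0 s) (at s)"
proof -
  have e: "Suc (Suc 0) = (2::nat)" by simp
  show ?thesis using pos_part_power_deriv[of 0 s] unfolding e by simp
qed

text \<open>
  A cutoff with compact support in the ball of radius \<open>\<rho>\<close> and with its first two derivatives along the
  coordinate axes, built from the third power of the positive part of \<open>1 - \<bar>x\<bar>\<^sup>2 / \<rho>\<^sup>2\<close>.
\<close>

definition bubble :: "real \<Rightarrow> real^'n::finite \<Rightarrow> real" where
  "bubble \<rho> x = 1 - (x \<bullet> x) / \<rho>\<^sup>2"

definition bcut :: "real \<Rightarrow> real^'n::finite \<Rightarrow> real" where
  "bcut \<rho> x = max 0 (bubble \<rho> x) ^ 3"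

definition bcut_d :: "real \<Rightarrow> 'n \<Rightarrow> real^'n::finite \<Rightarrow> real" where
  "bcut_d \<rho> i x = 3 * max 0 (bubble \<rho> x) ^ 2 * (- 2 * x $ i / \<rho>\<^sup>2)"

definition bcut_dd :: "real \<Rightarrow> 'n \<Rightarrow> real^'n::finite \<Rightarrow> real" where
  "bcut_dd \<rho> i x = 3 * max 0 (bubble \<rho> x) ^ 2 * (- 2 / \<rho>\<^sup>2)
      + 3 * (2 * max 0 (bubble \<rho> x) * (- 2 * x $ i / \<rho>\<^sup>2)) * (- 2 * x $ i / \<rho>\<^sup>2)"

lemma bubble_dir_deriv: "has_dir_deriv (bubble \<rho>) (- 2 * x $ i / \<rho>\<^sup>2) (axis i 1) x"
proof (rule has_dir_derivI)
  show "(bubble \<rho> has_derivative (\<lambda>v. 0 - (x \<bullet> v + v \<bullet> x) / \<rho>\<^sup>2)) (at x)"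
    unfolding bubble_def[abs_def]
    by (intro has_derivative_diff has_derivative_const has_derivative_inner has_derivative_ident
        bounded_linear.has_derivative[OF bounded_linear_divide])
  have "x \<bullet> axis i 1 = x $ i" "axis i 1 \<bullet> x = x $ i" by (simp_all add: inner_axis inner_axis')
  then show "0 - (x \<bullet> axis i 1 + axis i 1 \<bullet> x) / \<rho>\<^sup>2 = - 2 * x $ i / \<rho>\<^sup>2" by simp
qed

lemma cut_dir_deriv: "has_dir_deriv (bcut \<rho>) (bcut_d \<rho> i x) (axis i 1) x"
  unfolding bcut_def[abs_def] bcut_d_def
  by (rule has_dir_deriv_compose[where P = "\<lambda>s. max 0 s ^ 3" and f = "bubble \<rho>", OF pos_part_cube_deriv bubble_dir_deriv])

lemma cut_d_dir_deriv: "has_dir_deriv (bcut_d \<rho> i) (bcut_dd \<rho> i x) (axis i 1) x"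
proof -
  have 1: "has_dir_deriv (\<lambda>x. 3 * max 0 (bubble \<rho> x) ^ 2) (3 * (2 * max 0 (bubble \<rho> x) * (- 2 * x $ i / \<rho>\<^sup>2))) (axis i 1) x"
  proof -
    have "((\<lambda>s::real. 3 * max 0 s ^ 2) has_real_derivative 3 * (2 * max 0 s)) (at s)" for s
      by (rule DERIV_cmult[OF pos_part_square_deriv])
    from has_dir_deriv_compose[where P = "\<lambda>s. 3 * max 0 s ^ 2" and f = "bubble \<rho>", OF this bubble_dir_deriv[of \<rho> x i]]
    show ?thesis by (simp only: mult.assoc)
  qed
  have 2: "has_dir_deriv (\<lambda>x. - 2 * x $ i / \<rho>\<^sup>2) (- 2 / \<rho>\<^sup>2) (axis i 1) x"
  proof (rule has_dir_derivI)
    show "((\<lambda>x. - 2 * x $ i / \<rho>\<^sup>2) has_derivative (\<lambda>v. - 2 * v $ i / \<rho>\<^sup>2)) (at x)"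
      by (intro bounded_linear.has_derivative[OF bounded_linear_divide] has_derivative_mult_right
           bounded_linear.has_derivative[OF bounded_linear_vec_nth] has_derivative_ident)
  qed (simp add: axis_def)
  show ?thesis unfolding bcut_d_def[abs_def] bcut_dd_def by (rule has_dir_deriv_mult[OF 1 2])
qed

lemma bubble_continuous: "continuous_on UNIV (bubble \<rho>)"
  by (rule has_dir_deriv_continuous[OF bubble_dir_deriv])

lemma cut_dd_continuous: "continuous_on UNIV (bcut_dd \<rho> i)"
  unfolding bcut_dd_def[abs_def]
  by (intro continuous_on_add continuous_on_mult continuous_on_const continuous_on_power continuous_on_max bubble_continuous
      bounded_linear.continuous_on[OF bounded_linear_divide] bounded_linear.continuous_on[OF bounded_linear_vec_nth] continuous_on_id)

lemma bubble_le_0: "\<rho> > 0 \<Longrightarrow> norm x \<ge> \<rho> \<Longrightarrow> bubble \<rho> x \<le> 0"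
  using power_mono[of \<rho> "norm x" 2] by (simp add: bubble_def power2_norm_eq_inner[symmetric])

lemma bubble_le_1: "bubble \<rho> x \<le> 1"
  by (simp add: bubble_def)

lemma cut_bounds:
  assumes \<rho>: "\<rho> \<ge> 1"
  shows "0 \<le> bcut \<rho> x" "bcut \<rho> x \<le> 1" "\<bar>bcut_d \<rho> i x\<bar> \<le> 6 / \<rho>" "\<bar>bcut_dd \<rho> i x\<bar> \<le> 30 / \<rho>"
proof -
  let ?w = "max 0 (bubble \<rho> x)"
  have w: "0 \<le> ?w" "?w \<le> 1" using bubble_le_1[of \<rho> x] by auto
  show "0 \<le> bcut \<rho> x" "bcut \<rho> x \<le> 1" unfolding bcut_def using w by (auto intro: power_le_one)
  show "\<bar>bcut_d \<rho> i x\<bar> \<le> 6 / \<rho>" "\<bar>bcut_dd \<rho> i x\<bar> \<le> 30 / \<rho>"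
  proof -
    have "\<bar>bcut_d \<rho> i x\<bar> \<le> 6 / \<rho> \<and> \<bar>bcut_dd \<rho> i x\<bar> \<le> 30 / \<rho>"
    proof (cases "norm x \<ge> \<rho>")
      case True
      then have "?w = 0" using bubble_le_0[of \<rho> x] \<rho> by simp
      then show ?thesis using \<rho> by (simp add: bcut_d_def bcut_dd_def)
    next
      case False
      then have xi: "\<bar>x $ i\<bar> \<le> \<rho>" using component_le_norm_cart[of x i] by linarith
      define a where "a = - 2 * x $ i / \<rho>\<^sup>2"
      have a: "\<bar>a\<bar> \<le> 2 / \<rho>"
      proof -
        have "\<bar>a\<bar> = 2 * \<bar>x $ i\<bar> / \<rho>\<^sup>2" by (simp add: a_def abs_mult)
        also have "\<dots> \<le> 2 * \<rho> / \<rho>\<^sup>2" using xi by (intro divide_right_mono mult_left_mono) auto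
        also have "\<dots> = 2 / \<rho>" using \<rho> by (simp add: power2_eq_square)
        finally show ?thesis .
      qed
      have "2 / \<rho> \<le> 2" using \<rho> by (simp add: divide_simps)
      then have a2: "\<bar>a\<bar> \<le> 2" using a by linarith
      have w2: "?w ^ 2 \<le> 1" "0 \<le> ?w ^ 2" using w by (auto intro: power_le_one)
      have r: "1 / \<rho>\<^sup>2 \<le> 1 / \<rho>" "1 / \<rho> \<le> 1" using \<rho> by (auto simp: power2_eq_square divide_simps)
      have d: "\<bar>bcut_d \<rho> i x\<bar> \<le> 3 * 1 * (2 / \<rho>)"
        unfolding bcut_d_def a_def[symmetric] abs_mult using w2 a by (intro mult_mono) auto
      have "\<bar>3 * ?w ^ 2 * (- 2 / \<rho>\<^sup>2)\<bar> \<le> 3 * 1 * (2 / \<rho>)"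
        unfolding abs_mult using w2 r by (intro mult_mono) auto
      moreover have "\<bar>3 * (2 * ?w * a) * a\<bar> \<le> 3 * (2 * 1 * (2 / \<rho>)) * 2"
        unfolding abs_mult using w a a2 \<rho> by (intro mult_mono) auto
      ultimately have "\<bar>bcut_dd \<rho> i x\<bar> \<le> 3 * 1 * (2 / \<rho>) + 3 * (2 * 1 * (2 / \<rho>)) * 2"
        unfolding bcut_dd_def a_def[symmetric] by linarith
      then show ?thesis using d by simp
    qed
    then show "\<bar>bcut_d \<rho> i x\<bar> \<le> 6 / \<rho>" "\<bar>bcut_dd \<rho> i x\<bar> \<le> 30 / \<rho>" by auto
  qed
qed

lemma hermite_dir_deriv: "has_dir_deriv (hermite \<alpha>) (hermite_d i \<alpha> x) (axis i 1) x"
  by (rule has_dir_derivI[OF hermite_has_derivative sum_axis_nth])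

lemma hermite_d_dir_deriv: "has_dir_deriv (hermite_d i \<alpha>) (((x $ i)\<^sup>2 - (2 * real (\<alpha> i) + 1)) * hermite \<alpha> x) (axis i 1) x"
  by (rule has_dir_derivI[OF hermite_d_has_derivative]) (simp only: sum_axis_nth hermite_d2)

lemma C2_dir_deriv:
  fixes g :: "real^'n::finite \<Rightarrow> complex"
  assumes "C2 g"
  shows "has_dir_deriv g (partial_deriv (axis i 1) g x) (axis i 1) x"
    "has_dir_deriv (partial_deriv (axis i 1) g) (partial_deriv (axis i 1) (partial_deriv (axis i 1) g) x) (axis i 1) x"
    "continuous_on UNIV (partial_deriv (axis i 1) (partial_deriv (axis i 1) g))"
proof -
  have B: "axis i 1 \<in> (Basis :: (real^'n) set)" by simp
  show "has_dir_deriv g (partial_deriv (axis i 1) g x) (axis i 1) x"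
    unfolding partial_deriv_def[of _ g]
    by (rule has_dir_derivI[OF frechet_derivative_works[THEN iffD1] refl]) (use assms in \<open>simp add: C2_def\<close>)
  show "has_dir_deriv (partial_deriv (axis i 1) g) (partial_deriv (axis i 1) (partial_deriv (axis i 1) g) x) (axis i 1) x"
    unfolding partial_deriv_def[of _ "partial_deriv (axis i 1) g"]
    by (rule has_dir_derivI[OF frechet_derivative_works[THEN iffD1] refl]) (use assms B in \<open>simp add: C2_def\<close>)
  show "continuous_on UNIV (partial_deriv (axis i 1) (partial_deriv (axis i 1) g))"
    using assms B unfolding C2_def by blast
qed

text \<open>
  With \<open>\<psi> = bcut \<rho> \<sqdot> h\<^sub>\<alpha>\<close> the function \<open>w i\<close> is \<open>g \<partial>\<^sub>i\<^sup>2 \<psi> - \<psi> \<partial>\<^sub>i\<^sup>2 g\<close>, the derivative in direction \<open>i\<close>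
  of \<open>g \<partial>\<^sub>i \<psi> - \<psi> \<partial>\<^sub>i g\<close>.
\<close>

lemma Green_cut:
  fixes g :: "real^'n::finite \<Rightarrow> complex" and \<alpha> :: "'n \<Rightarrow> nat" and \<rho> :: real
  assumes g: "C2 g" and \<rho>: "\<rho> > 0"
  defines "w \<equiv> \<lambda>i x. g x * of_real (bcut_dd \<rho> i x * hermite \<alpha> x + 2 * (bcut_d \<rho> i x * hermite_d i \<alpha> x)
        + bcut \<rho> x * (((x $ i)\<^sup>2 - (2 * real (\<alpha> i) + 1)) * hermite \<alpha> x))
      - of_real (bcut \<rho> x * hermite \<alpha> x) * partial_deriv (axis i 1) (partial_deriv (axis i 1) g) x"
  shows "Cc (w i)" "(LINT x|lborel. w i x) = 0"
proof -
  let ?b = "axis i (1::real) :: real^'n"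
  let ?gb = "partial_deriv ?b g"
  define u where "u x = g x * of_real (bcut_d \<rho> i x * hermite \<alpha> x + bcut \<rho> x * hermite_d i \<alpha> x) - of_real (bcut \<rho> x * hermite \<alpha> x) * ?gb x" for x
  have D: "has_dir_deriv u (w i x) ?b x" for x
  proof -
    have 1: "has_dir_deriv (\<lambda>x. bcut \<rho> x * hermite \<alpha> x) (bcut \<rho> x * hermite_d i \<alpha> x + bcut_d \<rho> i x * hermite \<alpha> x) ?b x"
      by (rule has_dir_deriv_mult[OF cut_dir_deriv hermite_dir_deriv])
    have 2: "has_dir_deriv (\<lambda>x. bcut_d \<rho> i x * hermite \<alpha> x + bcut \<rho> x * hermite_d i \<alpha> x)
       ((bcut_d \<rho> i x * hermite_d i \<alpha> x + bcut_dd \<rho> i x * hermite \<alpha> x) +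
        (bcut \<rho> x * (((x $ i)\<^sup>2 - (2 * real (\<alpha> i) + 1)) * hermite \<alpha> x) + bcut_d \<rho> i x * hermite_d i \<alpha> x)) ?b x"
      by (intro has_dir_deriv_add has_dir_deriv_mult cut_d_dir_deriv cut_dir_deriv hermite_d_dir_deriv hermite_dir_deriv)
    have 3: "has_dir_deriv u ((g x * of_real ((bcut_d \<rho> i x * hermite_d i \<alpha> x + bcut_dd \<rho> i x * hermite \<alpha> x) +
        (bcut \<rho> x * (((x $ i)\<^sup>2 - (2 * real (\<alpha> i) + 1)) * hermite \<alpha> x) + bcut_d \<rho> i x * hermite_d i \<alpha> x))
        + ?gb x * of_real (bcut_d \<rho> i x * hermite \<alpha> x + bcut \<rho> x * hermite_d i \<alpha> x))
       - (of_real (bcut \<rho> x * hermite \<alpha> x) * partial_deriv ?b ?gb x + of_real (bcut \<rho> x * hermite_d i \<alpha> x + bcut_d \<rho> i x * hermite \<alpha> x) * ?gb x)) ?b x"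
      unfolding u_def[abs_def]
      by (intro has_dir_deriv_diff has_dir_deriv_mult C2_dir_deriv[OF g] has_dir_deriv_of_real 1 2)
    have "w i x = (g x * of_real ((bcut_d \<rho> i x * hermite_d i \<alpha> x + bcut_dd \<rho> i x * hermite \<alpha> x) +
        (bcut \<rho> x * (((x $ i)\<^sup>2 - (2 * real (\<alpha> i) + 1)) * hermite \<alpha> x) + bcut_d \<rho> i x * hermite_d i \<alpha> x))
        + ?gb x * of_real (bcut_d \<rho> i x * hermite \<alpha> x + bcut \<rho> x * hermite_d i \<alpha> x))
       - (of_real (bcut \<rho> x * hermite \<alpha> x) * partial_deriv ?b ?gb x + of_real (bcut \<rho> x * hermite_d i \<alpha> x + bcut_d \<rho> i x * hermite \<alpha> x) * ?gb x)"
      unfolding w_def of_real_add of_real_mult of_real_numeral by algebra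
    then show ?thesis using 3 by simp
  qed
  have cg: "continuous_on UNIV g" by (rule has_dir_deriv_continuous[OF C2_dir_deriv(1)[OF g]])
  have cont: "continuous_on UNIV (w i)" unfolding w_def
    by (intro continuous_intros cg cut_dd_continuous C2_dir_deriv(3)[OF g]
        has_dir_deriv_continuous[OF cut_d_dir_deriv] has_dir_deriv_continuous[OF cut_dir_deriv])
  have z: "bcut \<rho> x = 0" "bcut_d \<rho> i x = 0" "bcut_dd \<rho> i x = 0" if "norm x > \<rho>" for x
  proof -
    have "max 0 (bubble \<rho> x) = 0" using bubble_le_0[OF \<rho>, of x] that by simp
    then show "bcut \<rho> x = 0" "bcut_d \<rho> i x = 0" "bcut_dd \<rho> i x = 0" by (simp_all add: bcut_def bcut_d_def bcut_dd_def)
  qed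
  have "w i x = 0" if "norm x > \<rho>" for x using z[OF that] by (simp add: w_def)
  then show "Cc (w i)" unfolding Cc_def using cont by blast
  obtain u' where u': "\<And>x. (u has_derivative u' x) (at x)" "\<And>x. u' x ?b = w i x"
    using D unfolding has_dir_deriv_def by metis
  have "(LINT x|lborel. u' x ?b) = 0"
    by (rule integral_directional_derivative_eq_0[OF u'(1), where \<rho> = \<rho>]) (use z u'(2) cont in \<open>auto simp: u_def\<close>)
  then show "(LINT x|lborel. w i x) = 0" unfolding u'(2) .
qed

text \<open>
  For an eigenfunction nothing is known about the derivatives at infinity, and so the symmetry of \<open>H\<close> is
  proved with a cutoff that falls on \<open>h\<^sub>\<alpha>\<close> alone: after Green's formula the difference of the eigenvalues
  times \<open>\<langle>bcut \<rho> \<sqdot> g, h\<^sub>\<alpha>\<rangle>\<close> is the integral of \<open>g\<close> against terms that contain a derivative of \<open>bcut \<rho>\<close>, and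
  this is \<open>O(1 / \<rho>)\<close>.
\<close>

lemma hermite_eigenspace_orthogonal:
  fixes g :: "real^'n::finite \<Rightarrow> complex"
  assumes g: "g \<in> hermite_eigenspace k" and \<alpha>: "sum \<alpha> UNIV \<noteq> k"
  shows "hermite_coeff \<alpha> g = 0"
proof -
  have g2: "g \<in> Lp 2" and C2: "C2 g" and eig: "\<And>x. hermite_op g x = of_nat (2 * k + CARD('n)) * g x"
    using g by (auto simp: hermite_eigenspace_def)
  let ?h = "hermite \<alpha>"
  define \<mu> where "\<mu> = 2 * (real k - real (sum \<alpha> UNIV))"
  have \<mu>: "\<mu> \<noteq> 0" using \<alpha> by (simp add: \<mu>_def del: of_nat_sum)
  define E where "E \<rho> x = (\<Sum>i\<in>UNIV. bcut_dd \<rho> i x * ?h x + 2 * (bcut_d \<rho> i x * hermite_d i \<alpha> x))" for \<rho> x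
  define W where "W x = (\<Sum>i\<in>(UNIV::'n set). \<bar>?h x\<bar> + \<bar>hermite_d i \<alpha> x\<bar>)" for x
  have lap: "laplacian g x = of_real ((norm x)\<^sup>2 - (2 * real k + CARD('n))) * g x" for x
  proof -
    have *: "L = a - b" if "- L + a = b" for L a b :: complex using that[symmetric] by simp
    have "laplacian g x = of_real ((norm x)\<^sup>2) * g x - of_nat (2 * k + CARD('n)) * g x"
      by (rule *) (rule eig[unfolded hermite_op_def])
    then show ?thesis by (simp add: left_diff_distrib)
  qed
  have hd2: "(\<lambda>x. complex_of_real (hermite_d i \<alpha> x)) \<in> Lp 2" for i
  proof -
    have "(\<lambda>x. complex_of_real (hermite_d i \<alpha> x)) = (\<lambda>x. of_real (sqrt (real (\<alpha> i)) / sqrt 2) * of_real (hermite (\<alpha>(i := \<alpha> i - 1)) x)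
       - of_real (sqrt (real (Suc (\<alpha> i))) / sqrt 2) * of_real (hermite (\<alpha>(i := Suc (\<alpha> i))) x))"
      by (rule ext) (simp add: hermite_d_def diff_divide_distrib)
    then show ?thesis by (simp only:) (intro Lp_diff Lp_cmult hermite_Lp2, simp)
  qed
  have gc: "continuous_on UNIV g" by (rule has_dir_deriv_continuous[OF C2_dir_deriv(1)[OF C2]])
  have gm [measurable]: "g \<in> borel_measurable borel" by (rule borel_measurable_continuous_onI[OF gc])
  have W0: "W x \<ge> 0" for x unfolding W_def by (intro sum_nonneg) auto
  have gWint: "integrable lebesgue (\<lambda>x. norm (g x) * W x)"
  proof -
    have "integrable lebesgue (\<lambda>x. \<Sum>i\<in>(UNIV::'n set). norm (g x * of_real (?h x)) + norm (g x * of_real (hermite_d i \<alpha> x)))"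
      by (intro Bochner_Integration.integrable_sum Bochner_Integration.integrable_add integrable_norm L2_prod_integrable g2 hermite_Lp2 hd2)
    then show ?thesis by (simp add: W_def sum_distrib_left norm_mult distrib_left)
  qed
  have key: "norm (LINT x|lebesgue. of_real (bcut \<rho> x) * (g x * of_real (?h x))) \<le> 30 / \<bar>\<mu>\<bar> / \<rho> * (LINT x|lebesgue. norm (g x) * W x)"
    if \<rho>: "\<rho> \<ge> 1" for \<rho>
  proof -
    have \<rho>0: "\<rho> > 0" using \<rho> by simp
    define w where "w i x = g x * of_real (bcut_dd \<rho> i x * ?h x + 2 * (bcut_d \<rho> i x * hermite_d i \<alpha> x)
        + bcut \<rho> x * (((x $ i)\<^sup>2 - (2 * real (\<alpha> i) + 1)) * ?h x))
      - of_real (bcut \<rho> x * ?h x) * partial_deriv (axis i 1) (partial_deriv (axis i 1) g) x" for i x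
    have wc: "Cc (w i)" and wi: "(LINT x|lborel. w i x) = 0" for i
      using Green_cut[OF C2 \<rho>0, where \<alpha> = \<alpha> and i = i] unfolding w_def[abs_def] by auto
    have sumw: "(\<Sum>i\<in>UNIV. w i x) = of_real \<mu> * (of_real (bcut \<rho> x) * (g x * of_real (?h x))) + g x * of_real (E \<rho> x)" for x
    proof -
      have "(\<Sum>i\<in>UNIV. bcut \<rho> x * (((x $ i)\<^sup>2 - (2 * real (\<alpha> i) + 1)) * ?h x))
         = bcut \<rho> x * (((norm x)\<^sup>2 - (2 * real (sum \<alpha> UNIV) + CARD('n))) * ?h x)"
        unfolding norm_sq_vec sum_distrib_left[symmetric] sum_distrib_right[symmetric]
        by (simp add: sum_subtractf sum.distrib sum_distrib_left)
      then have s1: "(\<Sum>i\<in>UNIV. bcut_dd \<rho> i x * ?h x + 2 * (bcut_d \<rho> i x * hermite_d i \<alpha> x) + bcut \<rho> x * (((x $ i)\<^sup>2 - (2 * real (\<alpha> i) + 1)) * ?h x))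
          = E \<rho> x + bcut \<rho> x * (((norm x)\<^sup>2 - (2 * real (sum \<alpha> UNIV) + CARD('n))) * ?h x)"
        unfolding E_def by (subst sum.distrib) simp
      have s2: "(\<Sum>i\<in>UNIV. partial_deriv (axis i 1) (partial_deriv (axis i 1) g) x) = of_real ((norm x)\<^sup>2 - (2 * real k + CARD('n))) * g x"
        using lap[of x] by (simp add: laplacian_def sum_Basis_vec)
      have "(\<Sum>i\<in>UNIV. w i x) = g x * of_real (E \<rho> x + bcut \<rho> x * (((norm x)\<^sup>2 - (2 * real (sum \<alpha> UNIV) + CARD('n))) * ?h x))
          - of_real (bcut \<rho> x * ?h x) * (of_real ((norm x)\<^sup>2 - (2 * real k + CARD('n))) * g x)"
        unfolding w_def sum_subtractf sum_distrib_left[symmetric] of_real_sum[symmetric] s1 s2 ..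
      also have "\<dots> = of_real \<mu> * (of_real (bcut \<rho> x) * (g x * of_real (?h x))) + g x * of_real (E \<rho> x)"
        unfolding \<mu>_def of_real_add of_real_mult of_real_diff of_real_numeral by (simp add: algebra_simps)
      finally show ?thesis .
    qed
    have "(LINT x|lborel. (\<Sum>i\<in>UNIV. w i x)) = 0"
      by (subst Bochner_Integration.integral_sum) (auto simp: wi intro: Cc_integrable wc)
    then have "(LINT x|lebesgue. (\<Sum>i\<in>UNIV. w i x)) = 0"
    proof (subst integral_completion)
      show "(\<lambda>x. \<Sum>i\<in>UNIV. w i x) \<in> borel_measurable lborel"
        using Cc_measurable[OF wc] by (intro borel_measurable_sum) simp
    qed
    then have z: "(LINT x|lebesgue. of_real \<mu> * (of_real (bcut \<rho> x) * (g x * of_real (?h x))) + g x * of_real (E \<rho> x)) = 0"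
      unfolding sumw .
    have E: "norm (g x * of_real (E \<rho> x)) \<le> 30 / \<rho> * (norm (g x) * W x)" for x
    proof -
      have "\<bar>E \<rho> x\<bar> \<le> (\<Sum>i\<in>(UNIV::'n set). 30 / \<rho> * (\<bar>?h x\<bar> + \<bar>hermite_d i \<alpha> x\<bar>))"
        unfolding E_def
      proof (rule order_trans[OF sum_abs sum_mono])
        fix i
        have "\<bar>bcut_dd \<rho> i x * ?h x\<bar> \<le> 30 / \<rho> * \<bar>?h x\<bar>"
          unfolding abs_mult by (intro mult_right_mono cut_bounds \<rho>) simp
        moreover have "\<bar>bcut_d \<rho> i x * hermite_d i \<alpha> x\<bar> \<le> 6 / \<rho> * \<bar>hermite_d i \<alpha> x\<bar>"
          unfolding abs_mult by (intro mult_right_mono cut_bounds \<rho>) simp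
        moreover have "12 / \<rho> * \<bar>hermite_d i \<alpha> x\<bar> \<le> 30 / \<rho> * \<bar>hermite_d i \<alpha> x\<bar>"
          using \<rho> by (intro mult_right_mono divide_right_mono) auto
        ultimately show "\<bar>bcut_dd \<rho> i x * ?h x + 2 * (bcut_d \<rho> i x * hermite_d i \<alpha> x)\<bar> \<le> 30 / \<rho> * (\<bar>?h x\<bar> + \<bar>hermite_d i \<alpha> x\<bar>)"
          by (simp add: distrib_left)
      qed
      also have "\<dots> = 30 / \<rho> * W x" unfolding W_def sum_distrib_left ..
      finally show ?thesis using mult_left_mono[of "\<bar>E \<rho> x\<bar>" "30 / \<rho> * W x" "norm (g x)"]
        by (simp add: norm_mult mult_ac)
    qed
    have bm [measurable]: "bcut \<rho> \<in> borel_measurable borel"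
      by (rule borel_measurable_continuous_onI[OF has_dir_deriv_continuous[OF cut_dir_deriv]])
    have i1: "integrable lebesgue (\<lambda>x. of_real (bcut \<rho> x) * (g x * of_real (?h x)))"
    proof (rule Bochner_Integration.integrable_bound[OF L2_prod_integrable[OF g2 hermite_Lp2]])
      show "(\<lambda>x. of_real (bcut \<rho> x) * (g x * of_real (?h x))) \<in> borel_measurable lebesgue"
        by (intro borel_imp_lebesgue) measurable
      have "\<bar>bcut \<rho> x\<bar> * norm (g x * of_real (?h x)) \<le> 1 * norm (g x * of_real (?h x))" for x
        using cut_bounds(1,2)[OF \<rho>, of x] by (intro mult_right_mono) auto
      then show "AE x in lebesgue. norm (of_real (bcut \<rho> x) * (g x * of_real (?h x))) \<le> norm (g x * of_real (?h x))"
        by (intro AE_I2) (simp add: norm_mult)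
    qed
    have Ec: "continuous_on UNIV (E \<rho>)" unfolding E_def[abs_def]
      by (intro continuous_intros cut_dd_continuous has_dir_deriv_continuous[OF cut_d_dir_deriv])
    have i2: "integrable lebesgue (\<lambda>x. g x * of_real (E \<rho> x))"
    proof (rule Bochner_Integration.integrable_bound[OF integrable_mult_right[OF gWint, of "30 / \<rho>"]])
      show "(\<lambda>x. g x * of_real (E \<rho> x)) \<in> borel_measurable lebesgue"
        by (intro borel_imp_lebesgue borel_measurable_continuous_onI continuous_intros gc Ec)
      show "AE x in lebesgue. norm (g x * of_real (E \<rho> x)) \<le> norm (30 / \<rho> * (norm (g x) * W x))"
        by (intro AE_I2 order_trans[OF E]) (simp only: real_norm_def abs_ge_self)
    qed
    have "of_real \<mu> * (LINT x|lebesgue. of_real (bcut \<rho> x) * (g x * of_real (?h x))) + (LINT x|lebesgue. g x * of_real (E \<rho> x)) = 0"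
      using z Bochner_Integration.integral_add[OF integrable_mult_right[OF i1, of "of_real \<mu>"] i2]
      by (simp only: integral_mult_right_zero)
    then have "norm (of_real \<mu> * (LINT x|lebesgue. of_real (bcut \<rho> x) * (g x * of_real (?h x)))) = norm (LINT x|lebesgue. g x * of_real (E \<rho> x))"
      by (simp only: eq_neg_iff_add_eq_0[symmetric] norm_minus_cancel)
    then have "\<bar>\<mu>\<bar> * norm (LINT x|lebesgue. of_real (bcut \<rho> x) * (g x * of_real (?h x))) = norm (LINT x|lebesgue. g x * of_real (E \<rho> x))"
      by (simp only: norm_mult norm_of_real)
    also have "\<dots> \<le> (LINT x|lebesgue. norm (g x * of_real (E \<rho> x)))" by (rule integral_norm_bound)
    also have "\<dots> \<le> (LINT x|lebesgue. 30 / \<rho> * (norm (g x) * W x))"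
      by (intro integral_mono integrable_norm i2 integrable_mult_right gWint E)
    also have "\<dots> = 30 / \<rho> * (LINT x|lebesgue. norm (g x) * W x)" by simp
    finally have fin: "\<bar>\<mu>\<bar> * norm (LINT x|lebesgue. of_real (bcut \<rho> x) * (g x * of_real (?h x))) \<le> 30 / \<rho> * (LINT x|lebesgue. norm (g x) * W x)" .
    have "norm (LINT x|lebesgue. of_real (bcut \<rho> x) * (g x * of_real (?h x))) \<le> 30 / \<rho> * (LINT x|lebesgue. norm (g x) * W x) / \<bar>\<mu>\<bar>"
    proof -
      have *: "n \<le> K / m" if "m * n \<le> K" "m > 0" for n K m :: real using that by (simp add: field_simps)
      show ?thesis by (rule *[OF fin]) (use \<mu> in simp)
    qed
    then show ?thesis by (simp add: mult_ac)
  qed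
  have lim1: "(\<lambda>N. LINT x|lebesgue. of_real (bcut (real (Suc N)) x) * (g x * of_real (?h x))) \<longlonglongrightarrow> (LINT x|lebesgue. g x * of_real (?h x))"
  proof (rule integral_dominated_convergence[where w = "\<lambda>x. norm (g x * of_real (?h x))"])
    show "integrable lebesgue (\<lambda>x. norm (g x * of_real (?h x)))" by (intro integrable_norm L2_prod_integrable g2 hermite_Lp2)
    show "(\<lambda>x. g x * of_real (?h x)) \<in> borel_measurable lebesgue" by (intro borel_imp_lebesgue) measurable
    show "(\<lambda>x. of_real (bcut (real (Suc N)) x) * (g x * of_real (?h x))) \<in> borel_measurable lebesgue" for N
    proof -
      have [measurable]: "bcut (real (Suc N)) \<in> borel_measurable (borel :: (real^'n) measure)"
        by (rule borel_measurable_continuous_onI[OF has_dir_deriv_continuous[OF cut_dir_deriv]])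
      show ?thesis by (intro borel_imp_lebesgue) measurable
    qed
    have "norm (of_real (bcut (real (Suc N)) x) * (g x * of_real (?h x))) \<le> norm (g x * of_real (?h x))" for N x
    proof -
      have "\<bar>bcut (real (Suc N)) x\<bar> * norm (g x * of_real (?h x)) \<le> 1 * norm (g x * of_real (?h x))"
        using cut_bounds(1,2)[of "real (Suc N)" x] by (intro mult_right_mono) auto
      then show ?thesis by (simp add: norm_mult)
    qed
    then show "AE x in lebesgue. norm (of_real (bcut (real (Suc N)) x) * (g x * of_real (?h x))) \<le> norm (g x * of_real (?h x))" for N
      by (intro AE_I2)
    have "(\<lambda>N. of_real (bcut (real (Suc N)) x) * (g x * of_real (?h x))) \<longlonglongrightarrow> of_real 1 * (g x * of_real (?h x))" for x
    proof (intro tendsto_intros)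
      have s0: "(\<lambda>N. 1 / real (Suc N)) \<longlonglongrightarrow> 0" by (rule LIMSEQ_inverse_real_of_nat[unfolded inverse_eq_divide])
      have "(\<lambda>N. max 0 (1 - (x \<bullet> x) * (1 / real (Suc N))\<^sup>2) ^ 3) \<longlonglongrightarrow> max 0 (1 - (x \<bullet> x) * 0\<^sup>2) ^ 3"
        by (intro tendsto_intros s0)
      then show "(\<lambda>N. bcut (real (Suc N)) x) \<longlonglongrightarrow> 1"
        by (simp add: bcut_def bubble_def power_divide)
    qed
    then show "AE x in lebesgue. (\<lambda>N. of_real (bcut (real (Suc N)) x) * (g x * of_real (?h x))) \<longlonglongrightarrow> g x * of_real (?h x)"
      by (intro AE_I2) simp
  qed
  have lim2: "(\<lambda>N. 30 / \<bar>\<mu>\<bar> / real (Suc N) * (LINT x|lebesgue. norm (g x) * W x)) \<longlonglongrightarrow> 0"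
  proof -
    have s0: "(\<lambda>N. 1 / real (Suc N)) \<longlonglongrightarrow> 0" by (rule LIMSEQ_inverse_real_of_nat[unfolded inverse_eq_divide])
    have "(\<lambda>N. 30 / \<bar>\<mu>\<bar> * (1 / real (Suc N)) * (LINT x|lebesgue. norm (g x) * W x)) \<longlonglongrightarrow> 30 / \<bar>\<mu>\<bar> * 0 * (LINT x|lebesgue. norm (g x) * W x)"
      by (intro tendsto_intros s0)
    then show ?thesis by simp
  qed
  have "norm (LINT x|lebesgue. g x * of_real (?h x)) \<le> 0"
    by (rule LIMSEQ_le[OF tendsto_norm[OF lim1] lim2]) (use key[of "real (Suc N)" for N] in auto)
  then show ?thesis by (simp add: hermite_coeff_def)
qed

lemma AE_zero_continuous_imp_zero:
  fixes e :: "'a::euclidean_space \<Rightarrow> complex"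
  assumes "continuous_on UNIV e" "AE x in lebesgue. e x = 0"
  shows "e x = 0"
proof -
  have o: "open {x. e x \<noteq> 0}" by (intro open_Collect_neq assms(1) continuous_intros)
  have "{x. e x \<noteq> 0} \<in> sets lebesgue" using o by simp
  then have "{x. e x \<noteq> 0} \<in> null_sets lebesgue" using assms(2) by (subst (asm) AE_iff_null) auto
  then have "negligible {x. e x \<noteq> 0}" by (simp add: negligible_iff_null_sets)
  then have "{x. e x \<noteq> 0} = {}" using open_not_negligible[OF o] by blast
  then show ?thesis by blast
qed

text \<open>
  The difference of the two sides has vanishing Hermite coefficients, thus it is zero almost
  everywhere, and by continuity everywhere.
\<close>

theorem hermite_eigenspace_expansion:
  fixes g :: "real^'n::finite \<Rightarrow> complex"
  assumes g: "g \<in> hermite_eigenspace k"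
  shows "g = hermite_comb {\<alpha>. sum \<alpha> UNIV = k} (\<lambda>\<alpha>. hermite_coeff \<alpha> g)"
proof -
  let ?S = "hermite_comb {\<alpha>. sum \<alpha> UNIV = k} (\<lambda>\<alpha>. hermite_coeff \<alpha> g)"
  have g2: "g \<in> Lp 2" and C2: "C2 g" using g by (auto simp: hermite_eigenspace_def)
  have S2: "?S \<in> Lp 2" unfolding hermite_comb_def[abs_def] by (rule hermite_comb_Lp2)
  have "hermite_coeff \<alpha> (\<lambda>x. g x - ?S x) = 0" for \<alpha>
  proof -
    have "hermite_coeff \<alpha> ?S = (if sum \<alpha> UNIV = k then hermite_coeff \<alpha> g else 0)"
      unfolding hermite_comb_def[abs_def] by (subst hermite_coeff_comb) auto
    then show ?thesis using hermite_eigenspace_orthogonal[OF g, of \<alpha>] by (simp add: hermite_coeff_diff g2 S2)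
  qed
  then have ae: "AE x in lebesgue. g x - ?S x = 0" by (intro hermite_complete Lp_diff g2 S2) auto
  have "continuous_on UNIV (\<lambda>x. g x - ?S x)"
    by (intro continuous_intros has_dir_deriv_continuous[OF C2_dir_deriv(1)[OF C2]]
        has_dir_deriv_continuous[OF C2_dir_deriv(1)[OF hermite_comb_C2]])
  from AE_zero_continuous_imp_zero[OF this ae] show ?thesis by (intro ext) simp
qed

lemma L2_inner_hermite_comb:
  fixes f :: "real^'n::finite \<Rightarrow> complex"
  assumes f: "f \<in> Lp 2"
  shows "L2_inner f (hermite_comb A c) = (\<Sum>\<alpha>\<in>A. cnj (c \<alpha>) * hermite_coeff \<alpha> f)"
proof -
  have "L2_inner f (hermite_comb A c) = (LINT x|lebesgue. (\<Sum>\<alpha>\<in>A. cnj (c \<alpha>) * (f x * of_real (hermite \<alpha> x))))"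
    unfolding L2_inner_def hermite_comb_def by (simp add: cnj_sum sum_distrib_left mult_ac)
  also have "\<dots> = (\<Sum>\<alpha>\<in>A. (LINT x|lebesgue. cnj (c \<alpha>) * (f x * of_real (hermite \<alpha> x))))"
    by (rule Bochner_Integration.integral_sum) (intro integrable_mult_right hermite_coeff_integrable f)
  finally show ?thesis by (simp add: hermite_coeff_def)
qed

text \<open>
  The description of the projection as a definite description requires existence and uniqueness, and both
  rest on the expansion of eigenfunctions: membership in the eigenspace and orthogonality to it become
  conditions on finitely many coefficients.
\<close>

theorem hermite_proj_eq:
  fixes f :: "real^'n::finite \<Rightarrow> complex"
  assumes f: "f \<in> Lp 2"
  shows "hermite_proj k f = hermite_comb {\<alpha>. sum \<alpha> UNIV = k} (\<lambda>\<alpha>. hermite_coeff \<alpha> f)"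
  unfolding hermite_proj_def
proof (rule the_equality)
  let ?A = "{\<alpha>::'n\<Rightarrow>nat. sum \<alpha> UNIV = k}"
  let ?S = "hermite_comb ?A (\<lambda>\<alpha>. hermite_coeff \<alpha> f)"
  have S2: "?S \<in> Lp 2" unfolding hermite_comb_def[abs_def] by (rule hermite_comb_Lp2)
  have coeff: "hermite_coeff \<alpha> (hermite_comb ?A c) = c \<alpha>" if "sum \<alpha> UNIV = k" for \<alpha> c
    unfolding hermite_comb_def[abs_def] using that by (subst hermite_coeff_comb) auto
  have "L2_inner (\<lambda>x. f x - ?S x) h = 0" if h: "h \<in> hermite_eigenspace k" for h
  proof -
    have "L2_inner (\<lambda>x. f x - ?S x) h = L2_inner (\<lambda>x. f x - ?S x) (hermite_comb ?A (\<lambda>\<alpha>. hermite_coeff \<alpha> h))"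
      using hermite_eigenspace_expansion[OF h] by simp
    also have "\<dots> = (\<Sum>\<alpha>\<in>?A. cnj (hermite_coeff \<alpha> h) * hermite_coeff \<alpha> (\<lambda>x. f x - ?S x))"
      by (rule L2_inner_hermite_comb[OF Lp_diff[OF f S2]]) simp
    also have "\<dots> = 0"
      by (rule sum.neutral) (simp add: hermite_coeff_diff[OF f S2] coeff)
    finally show ?thesis .
  qed
  then show "?S \<in> hermite_eigenspace k \<and> (\<forall>h\<in>hermite_eigenspace k. L2_inner (\<lambda>x. f x - ?S x) h = 0)"
    using hermite_comb_eigenspace by blast
  fix g assume g: "g \<in> hermite_eigenspace k \<and> (\<forall>h\<in>hermite_eigenspace k. L2_inner (\<lambda>x. f x - g x) h = 0)"
  then have g2: "g \<in> Lp 2" by (simp add: hermite_eigenspace_def)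
  have "hermite_coeff \<alpha> g = hermite_coeff \<alpha> f" if \<alpha>: "sum \<alpha> UNIV = k" for \<alpha>
  proof -
    let ?h = "hermite_comb ?A (\<lambda>\<beta>. if \<beta> = \<alpha> then 1 else 0)"
    have "0 = L2_inner (\<lambda>x. f x - g x) ?h" using g hermite_comb_eigenspace by metis
    also have "\<dots> = (\<Sum>\<beta>\<in>?A. cnj (if \<beta> = \<alpha> then 1 else 0) * hermite_coeff \<beta> (\<lambda>x. f x - g x))"
      by (rule L2_inner_hermite_comb[OF Lp_diff[OF f g2]]) simp
    also have "\<dots> = (\<Sum>\<beta>\<in>?A. if \<beta> = \<alpha> then hermite_coeff \<beta> (\<lambda>x. f x - g x) else 0)"
      by (rule sum.cong) auto
    also have "\<dots> = hermite_coeff \<alpha> (\<lambda>x. f x - g x)" using \<alpha> by (subst sum.delta) auto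
    finally show ?thesis by (simp add: hermite_coeff_diff[OF f g2])
  qed
  then have "hermite_comb ?A (\<lambda>\<alpha>. hermite_coeff \<alpha> g) = ?S"
    unfolding hermite_comb_def by (intro ext sum.cong) auto
  then show "g = ?S" using hermite_eigenspace_expansion[of g k] g by simp
qed

section \<open>Calderon-Zygmund theory\<close>

text \<open>
  Half-open cubes with lower corner \<open>a\<close> and side \<open>s\<close>, so that the \<open>2\<^sup>n\<close> children partition a cube exactly.
\<close>

definition cube :: "real^'n::finite \<Rightarrow> real \<Rightarrow> (real^'n) set" where
  "cube a s = {x. \<forall>i. a $ i \<le> x $ i \<and> x $ i < a $ i + s}"

lemma cube_borel: "cube a s \<in> sets borel"
proof -
  have "cube a s = (\<Inter>i. {x. a $ i \<le> x $ i} \<inter> {x. x $ i < a $ i + s})" by (auto simp: cube_def)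
  moreover have "{x. a $ i \<le> x $ i} \<in> sets borel" "{x. x $ i < a $ i + s} \<in> sets borel" for i
    by (auto intro!: borel_closed borel_open closed_Collect_le open_Collect_less continuous_intros)
  ultimately show ?thesis by (auto intro!: sets.countable_INT')
qed

lemma cube_lebesgue: "cube a s \<in> sets lebesgue"
  by (rule sets_completionI_sets) (simp add: cube_borel)

lemma emeasure_cube:
  assumes s: "s > 0"
  shows "emeasure lebesgue (cube (a :: real^'n::finite) s) = ennreal (s ^ CARD('n))"
proof -
  let ?u = "a + (\<chi> i. s)"
  have p: "(\<Prod>b\<in>Basis. (?u - a) \<bullet> b) = s ^ CARD('n)"
  proof -
    have "(?u - a) \<bullet> b = s" if "b \<in> Basis" for b
      using that by (auto simp: Basis_vec_def inner_axis)
    then have "(\<Prod>b\<in>Basis. (?u - a) \<bullet> b) = (\<Prod>b\<in>(Basis :: (real^'n) set). s)" by (rule prod.cong[OF refl])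
    then show ?thesis by simp
  qed
  have le: "a \<bullet> b \<le> ?u \<bullet> b" if "b \<in> Basis" for b
    using that s by (auto simp: Basis_vec_def inner_axis)
  have "box a ?u \<subseteq> cube a s" "cube a s \<subseteq> cbox a ?u"
    by (auto simp: cube_def mem_box_cart less_imp_le)
  then have "emeasure lborel (box a ?u) \<le> emeasure lborel (cube a s)" "emeasure lborel (cube a s) \<le> emeasure lborel (cbox a ?u)"
    using cube_borel by (auto intro!: emeasure_mono)
  moreover have "emeasure lborel (box a ?u) = ennreal (s ^ CARD('n))" "emeasure lborel (cbox a ?u) = ennreal (s ^ CARD('n))"
    using emeasure_lborel_box[of a ?u] emeasure_lborel_cbox[of a ?u] le p by simp_all
  moreover have "cube a s \<in> sets lborel" by (simp add: cube_borel)
  ultimately show ?thesis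
    using antisym by (simp add: emeasure_completion[OF cube_lebesgue] main_part_sets)
qed

text \<open>
  The lower corner of the child that lies in the upper half in the directions belonging to \<open>A\<close>.
\<close>

definition child :: "(real^'n::finite) \<Rightarrow> real \<Rightarrow> 'n set \<Rightarrow> real^'n" where
  "child a s A = (\<chi> i. a $ i + (if i \<in> A then s / 2 else 0))"

lemma child_cube_subset: "s > 0 \<Longrightarrow> cube (child a s A) (s / 2) \<subseteq> cube a s"
proof
  fix x assume s: "s > 0" and x: "x \<in> cube (child a s A) (s / 2)"
  have "a $ i \<le> x $ i \<and> x $ i < a $ i + s" for i
  proof -
    have "child a s A $ i \<le> x $ i \<and> x $ i < child a s A $ i + s / 2" using x by (simp add: cube_def)
    then show ?thesis using s by (cases "i \<in> A") (auto simp: child_def)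
  qed
  then show "x \<in> cube a s" by (simp add: cube_def)
qed

lemma child_cube_cover: "x \<in> cube a s \<Longrightarrow> \<exists>A. x \<in> cube (child a s A) (s / 2)"
proof (intro exI[of _ "{i. x $ i \<ge> a $ i + s / 2}"])
  assume "x \<in> cube a s"
  then have *: "a $ i \<le> x $ i \<and> x $ i < a $ i + s" for i by (simp add: cube_def)
  have "child a s {i. x $ i \<ge> a $ i + s / 2} $ i \<le> x $ i \<and> x $ i < child a s {i. x $ i \<ge> a $ i + s / 2} $ i + s / 2" for i
    using *[of i] by (cases "x $ i \<ge> a $ i + s / 2") (simp_all add: child_def not_le)
  then show "x \<in> cube (child a s {i. x $ i \<ge> a $ i + s / 2}) (s / 2)" by (simp add: cube_def)
qed

lemma child_cube_disjoint:
  assumes "x \<in> cube (child a s A) (s / 2)" "x \<in> cube (child a s B) (s / 2)" shows "A = B"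
proof (rule set_eqI)
  fix i
  have "child a s A $ i \<le> x $ i \<and> x $ i < child a s A $ i + s / 2" "child a s B $ i \<le> x $ i \<and> x $ i < child a s B $ i + s / 2"
    using assms by (simp_all add: cube_def)
  then show "i \<in> A \<longleftrightarrow> i \<in> B" by (cases "i \<in> A"; cases "i \<in> B") (auto simp: child_def)
qed

abbreviation mass :: "(real^'n::finite \<Rightarrow> complex) \<Rightarrow> real^'n \<Rightarrow> real \<Rightarrow> real" where
  "mass f a s \<equiv> (LINT x|lebesgue. norm (f x) * indicator (cube a s) x)"

lemma mass_integrable: "f \<in> Lp 1 \<Longrightarrow> integrable lebesgue (\<lambda>x. norm (f x) * indicator (cube a s) x)"
  using cube_lebesgue[of a s] by (intro integrable_real_mult_indicator) (auto simp: Lp_1_iff)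

text \<open>
  The stopping-time argument to depth \<open>L\<close>. A child in which the mean of \<open>\<bar>f\<bar>\<close> exceeds \<open>t\<close> is selected, and
  its mean is at most \<open>2\<^sup>n t\<close> because its parent was not selected; the other children are subdivided
  further. A point that is never selected lies in a small cube with mean at most \<open>t\<close>.
\<close>

lemma dyadic_decomposition:
  fixes f :: "real^'n::finite \<Rightarrow> complex"
  assumes f: "f \<in> Lp 1"
  shows "s > 0 \<Longrightarrow> mass f a s \<le> t * s ^ CARD('n) \<Longrightarrow>
    \<exists>F. finite F \<and> (\<forall>(b, r)\<in>F. r > 0 \<and> cube b r \<subseteq> cube a s \<and> t * r ^ CARD('n) < mass f b r \<and> mass f b r \<le> 2 ^ CARD('n) * t * r ^ CARD('n))
      \<and> (\<forall>p\<in>F. \<forall>q\<in>F. \<forall>x. x \<in> cube (fst p) (snd p) \<longrightarrow> x \<in> cube (fst q) (snd q) \<longrightarrow> p = q)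
      \<and> (\<forall>x\<in>cube a s. (\<forall>p\<in>F. x \<notin> cube (fst p) (snd p)) \<longrightarrow> (\<exists>b. x \<in> cube b (s / 2 ^ L) \<and> mass f b (s / 2 ^ L) \<le> t * (s / 2 ^ L) ^ CARD('n)))"
proof (induction L arbitrary: a s)
  case 0
  then show ?case by (intro exI[of _ "{}"]) auto
next
  case (Suc L)
  let ?n = "CARD('n)"
  let ?P = "\<lambda>A F. finite F \<and> (\<forall>(b, r)\<in>F. r > 0 \<and> cube b r \<subseteq> cube (child a s A) (s / 2) \<and> t * r ^ ?n < mass f b r \<and> mass f b r \<le> 2 ^ ?n * t * r ^ ?n)
      \<and> (\<forall>p\<in>F. \<forall>q\<in>F. \<forall>x. x \<in> cube (fst p) (snd p) \<longrightarrow> x \<in> cube (fst q) (snd q) \<longrightarrow> p = q)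
      \<and> (\<forall>x\<in>cube (child a s A) (s / 2). (\<forall>p\<in>F. x \<notin> cube (fst p) (snd p)) \<longrightarrow> (\<exists>b. x \<in> cube b (s / 2 ^ Suc L) \<and> mass f b (s / 2 ^ Suc L) \<le> t * (s / 2 ^ Suc L) ^ ?n))"
  have "\<exists>F. ?P A F" for A
  proof (cases "mass f (child a s A) (s / 2) \<le> t * (s / 2) ^ ?n")
    case True
    have eq: "s / 2 / 2 ^ L = s / 2 ^ Suc L" by simp
    have half: "s / 2 > 0" using Suc.prems(1) by simp
    show ?thesis by (rule Suc.IH[OF half True, unfolded eq])
  next
    case False
    have "mass f (child a s A) (s / 2) \<le> mass f a s"
    proof (rule integral_mono[OF mass_integrable[OF f] mass_integrable[OF f]])
      fix x show "norm (f x) * indicator (cube (child a s A) (s / 2)) x \<le> norm (f x) * indicator (cube a s) x"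
        using child_cube_subset[OF Suc.prems(1), of a A] by (auto simp: indicator_def)
    qed
    also have "\<dots> \<le> t * s ^ ?n" by (rule Suc.prems)
    also have "\<dots> = 2 ^ ?n * t * (s / 2) ^ ?n" by (simp add: power_divide)
    finally have "?P A {(child a s A, s / 2)}" using False Suc.prems(1) by auto
    then show ?thesis by blast
  qed
  then have "\<forall>A. \<exists>F. ?P A F" by blast
  from choice[OF this] obtain G where G: "\<forall>A. ?P A (G A)" by (rule exE)
  note G1 = G[rule_format, THEN conjunct1]
  note G2 = G[THEN spec, THEN conjunct2, THEN conjunct1]
  note G3 = G[THEN spec, THEN conjunct2, THEN conjunct2, THEN conjunct1]
  note G4 = G[THEN spec, THEN conjunct2, THEN conjunct2, THEN conjunct2]
  let ?F = "\<Union>A. G A"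
  have sub: "x \<in> cube (child a s A) (s / 2)" if "p \<in> G A" "x \<in> cube (fst p) (snd p)" for p A x
    using bspec[OF G2 that(1)] that(2) by (cases p) auto
  show ?case
  proof (intro exI[of _ ?F] conjI)
    show "finite ?F" using G1 by auto
    show "\<forall>(b, r)\<in>?F. r > 0 \<and> cube b r \<subseteq> cube a s \<and> t * r ^ ?n < mass f b r \<and> mass f b r \<le> 2 ^ ?n * t * r ^ ?n"
    proof (clarsimp simp del: power_divide)
      fix b r A assume br: "(b, r) \<in> G A"
      have "r > 0 \<and> cube b r \<subseteq> cube (child a s A) (s / 2) \<and> t * r ^ ?n < mass f b r \<and> mass f b r \<le> 2 ^ ?n * t * r ^ ?n"
        using bspec[OF G2 br] by simp
      then show "r > 0 \<and> cube b r \<subseteq> cube a s \<and> t * r ^ ?n < mass f b r \<and> mass f b r \<le> 2 ^ ?n * t * r ^ ?n"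
        using child_cube_subset[OF Suc.prems(1), of a A] by blast
    qed
    show "\<forall>p\<in>?F. \<forall>q\<in>?F. \<forall>x. x \<in> cube (fst p) (snd p) \<longrightarrow> x \<in> cube (fst q) (snd q) \<longrightarrow> p = q"
    proof (intro ballI allI impI)
      fix p q x assume p: "p \<in> ?F" and q: "q \<in> ?F" and x: "x \<in> cube (fst p) (snd p)" "x \<in> cube (fst q) (snd q)"
      from p q obtain A B where A: "p \<in> G A" and B: "q \<in> G B" by auto
      have "A = B" by (rule child_cube_disjoint[OF sub[OF A x(1)] sub[OF B x(2)]])
      then show "p = q" using G3[of B] A B x by blast
    qed
    show "\<forall>x\<in>cube a s. (\<forall>p\<in>?F. x \<notin> cube (fst p) (snd p)) \<longrightarrow> (\<exists>b. x \<in> cube b (s / 2 ^ Suc L) \<and> mass f b (s / 2 ^ Suc L) \<le> t * (s / 2 ^ Suc L) ^ ?n)"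
    proof (intro ballI impI)
      fix x assume x: "x \<in> cube a s" and nx: "\<forall>p\<in>?F. x \<notin> cube (fst p) (snd p)"
      obtain A where A: "x \<in> cube (child a s A) (s / 2)" using child_cube_cover[OF x] by blast
      have "\<forall>p\<in>G A. x \<notin> cube (fst p) (snd p)" using nx by blast
      then show "\<exists>b. x \<in> cube b (s / 2 ^ Suc L) \<and> mass f b (s / 2 ^ Suc L) \<le> t * (s / 2 ^ Suc L) ^ ?n"
        using bspec[OF G4 A] by (rule mp[rotated])
    qed
  qed
qed

lemma norm_le_cube: "x \<in> cube a s \<Longrightarrow> y \<in> cube a s \<Longrightarrow> norm (x - y) \<le> real CARD('n) * s" for x :: "real^'n::finite"
proof -
  assume x: "x \<in> cube a s" and y: "y \<in> cube a s"
  have "norm (x - y) \<le> (\<Sum>i\<in>UNIV. \<bar>(x - y) $ i\<bar>)" by (rule norm_le_l1_cart)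
  also have "\<dots> \<le> (\<Sum>i\<in>(UNIV :: 'n set). s)"
  proof (rule sum_mono)
    fix i
    have "a $ i \<le> x $ i \<and> x $ i < a $ i + s" "a $ i \<le> y $ i \<and> y $ i < a $ i + s" using x y by (simp_all add: cube_def)
    then show "\<bar>(x - y) $ i\<bar> \<le> s" by auto
  qed
  finally show ?thesis by simp
qed

lemma corner_in_cube: "s > 0 \<Longrightarrow> a \<in> cube a s"
  by (simp add: cube_def)

text \<open>
  For \<open>f \<in> C\<^sub>c\<close> finitely many subdivisions suffice: as soon as \<open>f\<close> oscillates by at most \<open>t\<close> on the smallest
  cubes, a mean of at most \<open>t\<close> yields the pointwise bound \<open>2 t\<close>. So the differentiation theorem can be
  avoided, and the family of cubes is finite.
\<close>

lemma Calderon_Zygmund_cubes: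
  fixes f :: "real^'n::finite \<Rightarrow> complex"
  assumes f: "Cc f" and t: "t > 0"
  obtains F where "finite F" "\<And>b r. (b, r) \<in> F \<Longrightarrow> r > 0"
    "\<And>b r. (b, r) \<in> F \<Longrightarrow> t * r ^ CARD('n) < mass f b r"
    "\<And>b r. (b, r) \<in> F \<Longrightarrow> mass f b r \<le> 2 ^ CARD('n) * t * r ^ CARD('n)"
    "\<And>p q x. p \<in> F \<Longrightarrow> q \<in> F \<Longrightarrow> x \<in> cube (fst p) (snd p) \<Longrightarrow> x \<in> cube (fst q) (snd q) \<Longrightarrow> p = q"
    "\<And>x. \<forall>p\<in>F. x \<notin> cube (fst p) (snd p) \<Longrightarrow> norm (f x) \<le> 2 * t"
proof -
  let ?n = "CARD('n)"
  have f1: "f \<in> Lp 1" by (rule Cc_Lp[OF f]) simp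
  have cont: "continuous_on UNIV f" using f by (simp add: Cc_def)
  obtain \<rho> where \<rho>: "\<And>x. norm x > \<rho> \<Longrightarrow> f x = 0" using f by (auto simp: Cc_def)
  define N where "N = (LINT x|lebesgue. norm (f x))"
  \<comment> \<open>The first cube contains the support and is so large that the mean of \<open>\<bar>f\<bar>\<close> over it is at most \<open>t\<close>.\<close>
  define S where "S = max (max 1 (\<rho> + 1)) (N / t)"
  define a :: "real^'n" where "a = (\<chi> i. - S)"
  have S: "S \<ge> 1" "S > \<rho>" "N / t \<le> S" by (auto simp: S_def)
  have out: "f x = 0" if "x \<notin> cube a (2 * S)" for x
  proof -
    from that obtain i where i: "\<not> (- S \<le> x $ i \<and> x $ i < S)" by (auto simp: cube_def a_def)
    then have "\<bar>x $ i\<bar> \<ge> S" by auto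
    then have "norm x > \<rho>" using component_le_norm_cart[of x i] S(2) by linarith
    then show ?thesis by (rule \<rho>)
  qed
  have "mass f a (2 * S) \<le> N" unfolding N_def
    using f1 by (intro integral_mono mass_integrable[OF f1]) (auto simp: indicator_def Lp_1_iff)
  also have "N \<le> t * S" using S(3) t by (simp add: field_simps)
  also have "\<dots> \<le> t * (2 * S) ^ ?n"
  proof (intro mult_left_mono)
    have "S \<le> 2 * S" using S by simp
    also have "\<dots> = (2 * S) ^ 1" by simp
    also have "\<dots> \<le> (2 * S) ^ ?n" using S by (intro power_increasing) auto
    finally show "S \<le> (2 * S) ^ ?n" .
  qed (use t in simp)
  finally have big: "mass f a (2 * S) \<le> t * (2 * S) ^ ?n" .
  obtain \<delta> where \<delta>: "\<delta> > 0" "\<And>x y. norm (x - y) < \<delta> \<Longrightarrow> norm (f x - f y) \<le> t"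
  proof -
    have "uniformly_continuous_on (cball 0 (\<rho> + 2)) f"
      using cont by (intro compact_uniformly_continuous) (auto intro: continuous_on_subset)
    then obtain d where d: "d > 0" "\<And>x y. x \<in> cball 0 (\<rho> + 2) \<Longrightarrow> y \<in> cball 0 (\<rho> + 2) \<Longrightarrow> dist y x < d \<Longrightarrow> dist (f y) (f x) < t"
      unfolding uniformly_continuous_on_def using t by metis
    have "norm (f x - f y) \<le> t" if xy: "norm (x - y) < min d 1" for x y
    proof (cases "norm x \<le> \<rho> + 2 \<and> norm y \<le> \<rho> + 2")
      case True
      then show ?thesis using d(2)[of y x] xy by (auto simp: dist_norm intro: less_imp_le)
    next
      case False
      have "norm x \<le> norm y + norm (x - y)" using norm_triangle_ineq[of y "x - y"] by simp
      moreover have "norm y \<le> norm x + norm (x - y)" using norm_triangle_ineq4[of x "x - y"] by simp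
      ultimately have "norm x > \<rho>" "norm y > \<rho>" using False xy by auto
      then show ?thesis using \<rho> t by simp
    qed
    then show ?thesis using that[of "min d 1"] d(1) by simp
  qed
  obtain L where L: "real ?n * (2 * S) / \<delta> < 2 ^ L" using real_arch_pow[of 2] by auto
  have Ls: "real ?n * (2 * S / 2 ^ L) < \<delta>"
    using L \<delta>(1) by (simp add: field_simps)
  let ?r = "2 * S / 2 ^ L"
  have r0: "?r > 0" using S by simp
  have "2 * S > 0" using S by simp
  from dyadic_decomposition[OF f1 this big, of L] obtain F where F: "finite F"
      "\<forall>(b, r)\<in>F. r > 0 \<and> cube b r \<subseteq> cube a (2 * S) \<and> t * r ^ ?n < mass f b r \<and> mass f b r \<le> 2 ^ ?n * t * r ^ ?n"
      "\<forall>p\<in>F. \<forall>q\<in>F. \<forall>x. x \<in> cube (fst p) (snd p) \<longrightarrow> x \<in> cube (fst q) (snd q) \<longrightarrow> p = q"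
      "\<forall>x\<in>cube a (2 * S). (\<forall>p\<in>F. x \<notin> cube (fst p) (snd p)) \<longrightarrow> (\<exists>b. x \<in> cube b ?r \<and> mass f b ?r \<le> t * ?r ^ ?n)"
    by (elim exE conjE)
  have small: "norm (f x) \<le> 2 * t" if nx: "\<forall>p\<in>F. x \<notin> cube (fst p) (snd p)" for x
  proof (cases "x \<in> cube a (2 * S)")
    case True
    then obtain b where b: "x \<in> cube b ?r" "mass f b ?r \<le> t * ?r ^ ?n" using F(4) nx by blast
    have ci: "integrable lebesgue (indicator (cube b ?r) :: _ \<Rightarrow> real)"
      using emeasure_cube[OF r0, of b] cube_lebesgue[of b ?r] by simp
    have mc: "(LINT y|lebesgue. indicator (cube b ?r) y :: real) = ?r ^ ?n"
      using emeasure_cube[OF r0, of b] cube_lebesgue[of b ?r] r0 by (simp add: measure_def)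
    have "norm (f x) * ?r ^ ?n = (LINT y|lebesgue. norm (f x) * indicator (cube b ?r) y)" using mc by simp
    also have "\<dots> \<le> (LINT y|lebesgue. norm (f y) * indicator (cube b ?r) y + t * indicator (cube b ?r) y)"
    proof (rule integral_mono)
      fix y show "norm (f x) * indicator (cube b ?r) y \<le> norm (f y) * indicator (cube b ?r) y + t * indicator (cube b ?r) y"
      proof (cases "y \<in> cube b ?r")
        case True
        have "norm (x - y) < \<delta>" using norm_le_cube[OF b(1) True] Ls by linarith
        from \<delta>(2)[OF this] show ?thesis using True norm_triangle_ineq2[of "f x" "f y"] by simp
      qed simp
    qed (auto intro!: Bochner_Integration.integrable_add mass_integrable f1 integrable_mult_right ci)
    also have "\<dots> = mass f b ?r + t * ?r ^ ?n"
      using mc by (subst Bochner_Integration.integral_add) (auto intro!: mass_integrable f1 integrable_mult_right ci)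
    also have "\<dots> \<le> 2 * t * ?r ^ ?n" using b(2) by simp
    finally have "norm (f x) * ?r ^ ?n \<le> (2 * t) * ?r ^ ?n" .
    moreover have "?r ^ ?n > 0" using r0 by (rule zero_less_power)
    ultimately show ?thesis by (rule mult_right_le_imp_le)
  next
    case False
    then show ?thesis using out t by simp
  qed
  show thesis
  proof (rule that[of F])
    show "finite F" by (rule F(1))
    show "r > 0" "t * r ^ ?n < mass f b r" "mass f b r \<le> 2 ^ ?n * t * r ^ ?n" if "(b, r) \<in> F" for b r
      using F(2) that by blast+
    show "p = q" if "p \<in> F" "q \<in> F" "x \<in> cube (fst p) (snd p)" "x \<in> cube (fst q) (snd q)" for p q x
      using F(3) that by blast
  qed (rule small)
qed

text \<open>
  The kernel is only Lebesgue measurable in \<open>x\<close>, so Fubini's theorem has to be applied to the completed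
  measure itself.
\<close>

lemma sigma_finite_lebesgue: "sigma_finite_measure (lebesgue :: 'a::euclidean_space measure)"
proof
  show "\<exists>A::'a set set. countable A \<and> A \<subseteq> sets lebesgue \<and> \<Union> A = space lebesgue \<and> (\<forall>a\<in>A. emeasure lebesgue a \<noteq> \<infinity>)"
  proof (intro exI[of _ "range (\<lambda>k::nat. cball 0 (real k))"] conjI ballI)
    show "\<Union> (range (\<lambda>k::nat. cball (0::'a) (real k))) = space lebesgue"
      using real_arch_simple by auto
    fix a :: "'a set" assume "a \<in> range (\<lambda>k::nat. cball 0 (real k))"
    then show "emeasure lebesgue a \<noteq> \<infinity>" using emeasure_bounded_finite[of a] by (auto simp: less_top)
  qed auto
qed

lemma level_set_measurable:
  fixes h :: "'a::euclidean_space \<Rightarrow> complex"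
  assumes "h \<in> borel_measurable lebesgue" "A \<in> sets lebesgue"
  shows "{x \<in> A. c < norm (h x)} \<in> sets lebesgue"
proof -
  have "{x \<in> space lebesgue. c < norm (h x)} \<in> sets lebesgue" using assms(1) by measurable
  moreover have "{x \<in> A. c < norm (h x)} = A \<inter> {x \<in> space lebesgue. c < norm (h x)}" by auto
  ultimately show ?thesis using assms(2) by auto
qed

lemma weak_Markov:
  fixes h :: "'a::euclidean_space \<Rightarrow> complex"
  assumes [measurable]: "h \<in> borel_measurable lebesgue" "A \<in> sets lebesgue" and t: "t > 0" and p: "p \<noteq> 0"
  shows "emeasure lebesgue {x \<in> A. t < norm (h x)} \<le> ennreal (1 / t ^ p) * (\<integral>\<^sup>+x. ennreal (norm (h x) ^ p) * indicator A x \<partial>lebesgue)"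
proof -
  have "emeasure lebesgue {x \<in> A. t < norm (h x)} \<le> emeasure lebesgue {x \<in> A. 1 \<le> ennreal (1 / t ^ p) * ennreal (norm (h x) ^ p)}"
  proof (rule emeasure_mono)
    show "{x \<in> A. t < norm (h x)} \<subseteq> {x \<in> A. 1 \<le> ennreal (1 / t ^ p) * ennreal (norm (h x) ^ p)}"
    proof safe
      fix x assume x: "t < norm (h x)"
      have "t ^ p \<le> norm (h x) ^ p" using x t by (intro power_mono) auto
      then have "1 \<le> 1 / t ^ p * norm (h x) ^ p" using t by (simp add: field_simps)
      then show "1 \<le> ennreal (1 / t ^ p) * ennreal (norm (h x) ^ p)"
        using t by (simp only: ennreal_mult''[symmetric] zero_le_power norm_ge_zero) (simp add: ennreal_ge_1)
    qed
  qed measurable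
  also have "\<dots> \<le> ennreal (1 / t ^ p) * (\<integral>\<^sup>+x. ennreal (norm (h x) ^ p) * indicator A x \<partial>lebesgue)"
    by (rule nn_integral_Markov_inequality) measurable
  finally show ?thesis .
qed

text \<open>
  The function is split as \<open>f = g + \<Sum> b\<^sub>p\<close> into a good part bounded by a multiple of \<open>t\<close>, to which the \<open>L\<^sup>2\<close> bound
  is applied, and bad parts \<open>b\<^sub>p\<close> with integral zero on the cubes. Outside enlarged cubes, whose total
  volume is under control, \<open>T b\<^sub>p\<close> is estimated by Hoermander's condition after subtracting the kernel at the
  corner of the cube. The kernel has finite rank, so that no question arises about the convergence of the
  integrals.
\<close>

theorem Calderon_Zygmund_weak_type_Cc:
  fixes K :: "real^'n::finite \<Rightarrow> real^'n \<Rightarrow> complex" and A1 A2 :: real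
  assumes K: "\<And>x y. K x y = (\<Sum>i\<in>I. u i x * v i y)"
    and u: "\<And>i. i \<in> I \<Longrightarrow> u i \<in> borel_measurable lebesgue" and v: "\<And>i. i \<in> I \<Longrightarrow> v i \<in> Lp 2"
    and A: "A1 \<ge> 0" "A2 \<ge> 0"
    and L2: "\<And>f. f \<in> Lp 2 \<Longrightarrow> (\<lambda>x. LINT y|lebesgue. K x y * f y) \<in> Lp 2 \<and> L2_sq (\<lambda>x. LINT y|lebesgue. K x y * f y) \<le> A2 * L2_sq f"
    and Hoer: "\<And>y y' r. r > 0 \<Longrightarrow> norm (y' - y) \<le> r \<Longrightarrow>
       (\<integral>\<^sup>+x. ennreal (norm (K x y' - K x y)) * indicator {x. 2 * r < norm (x - y)} x \<partial>lebesgue) \<le> ennreal A1"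
    and f: "Cc f" and t: "t > 0"
  shows "emeasure lebesgue {x. t < norm (LINT y|lebesgue. K x y * f y)}
     \<le> ennreal ((24 * 2 ^ CARD('n) * A2 + unit_ball_vol (real CARD('n)) * (2 * real CARD('n)) ^ CARD('n) + 4 * A1) / t * (LINT x|lebesgue. norm (f x)))"
proof -
  let ?n = "CARD('n)"
  define T where "T f x = (LINT y|lebesgue. K x y * f y)" for f x
  define N where "N = (LINT x|lebesgue. norm (f x))"
  have f1: "f \<in> Lp 1" and f2: "f \<in> Lp 2" by (auto intro: Cc_Lp[OF f])
  have fint: "integrable lebesgue (\<lambda>x. norm (f x))" using f1 by (simp add: Lp_1_iff)
  have N0: "N \<ge> 0" unfolding N_def by simp
  have K2: "K x \<in> Lp 2" for x
    unfolding K[abs_def] by (intro Lp_sum Lp_cmult v) auto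
  have Kint: "integrable lebesgue (\<lambda>y. K x y * g y)" if "g \<in> Lp 2" for x g
    by (rule L2_prod_integrable[OF K2 that])
  obtain F where F: "finite F" and Fpos: "\<And>b r. (b, r) \<in> F \<Longrightarrow> r > 0"
    and Flow: "\<And>b r. (b, r) \<in> F \<Longrightarrow> t * r ^ ?n < mass f b r"
    and Fup: "\<And>b r. (b, r) \<in> F \<Longrightarrow> mass f b r \<le> 2 ^ ?n * t * r ^ ?n"
    and Fdisj: "\<And>p q x. p \<in> F \<Longrightarrow> q \<in> F \<Longrightarrow> x \<in> cube (fst p) (snd p) \<Longrightarrow> x \<in> cube (fst q) (snd q) \<Longrightarrow> p = q"
    and Fsmall: "\<And>x. \<forall>p\<in>F. x \<notin> cube (fst p) (snd p) \<Longrightarrow> norm (f x) \<le> 2 * t"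
    by (rule Calderon_Zygmund_cubes[OF f t]) (rule that; assumption)
  define Q where "Q p = cube (fst p) (snd p)" for p :: "(real^'n) \<times> real"
  define M where "M p = mass f (fst p) (snd p)" for p
  define avg where "avg p = (LINT x|lebesgue. f x * indicator (Q p) x) / of_real (snd p ^ ?n)" for p
  define b where "b p x = (f x - avg p) * indicator (Q p) x" for p x
  define g where "g x = f x - (\<Sum>p\<in>F. b p x)" for x
  have Qm [measurable]: "Q p \<in> sets lebesgue" for p unfolding Q_def by (rule cube_lebesgue)
  have pos: "snd p > 0" if "p \<in> F" for p using Fpos[of "fst p" "snd p"] that by simp
  have Qe: "emeasure lebesgue (Q p) = ennreal (snd p ^ ?n)" if "p \<in> F" for p
    unfolding Q_def by (rule emeasure_cube[OF pos[OF that]])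
  have Qint: "integrable lebesgue (indicator (Q p) :: _ \<Rightarrow> real)" "(LINT x|lebesgue. indicator (Q p) x :: real) = snd p ^ ?n" if "p \<in> F" for p
    using Qe[OF that] Qm[of p] pos[OF that] by (simp_all add: measure_def)
  have Mint: "integrable lebesgue (\<lambda>x. norm (f x) * indicator (Q p) x)" for p
    unfolding Q_def by (rule mass_integrable[OF f1])
  have M_eq: "M p = (LINT x|lebesgue. norm (f x) * indicator (Q p) x)" for p by (simp add: M_def Q_def)
  have Mup: "M p \<le> 2 ^ ?n * t * snd p ^ ?n" and Mlow: "t * snd p ^ ?n < M p" if "p \<in> F" for p
    using Fup[of "fst p" "snd p"] Flow[of "fst p" "snd p"] that by (simp_all add: M_def)
  have sum_ind: "(\<Sum>p\<in>F. indicator (Q p) x) \<le> (1::real)" for x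
  proof (cases "\<exists>p\<in>F. x \<in> Q p")
    case True
    then obtain p where p: "p \<in> F" "x \<in> Q p" by blast
    have nq: "x \<notin> Q q" if "q \<in> F" "q \<noteq> p" for q
      using Fdisj[OF that(1) p(1)] p(2) that(2) unfolding Q_def by blast
    have "(\<Sum>q\<in>F. indicator (Q q) x) = (\<Sum>q\<in>F. if q = p then 1 else (0::real))"
      by (intro sum.cong) (use nq p in \<open>auto simp: indicator_def\<close>)
    also have "\<dots> = 1" using p F by simp
    finally show ?thesis by simp
  next
    case False
    then have "(\<Sum>q\<in>F. indicator (Q q) x) = (0::real)" by (intro sum.neutral) (auto simp: indicator_def)
    then show ?thesis by simp
  qed
  have sumM: "(\<Sum>p\<in>F. M p) \<le> N"
  proof -
    have "(\<Sum>p\<in>F. M p) = (LINT x|lebesgue. (\<Sum>p\<in>F. norm (f x) * indicator (Q p) x))"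
      unfolding M_eq by (rule Bochner_Integration.integral_sum[symmetric]) (rule Mint)
    also have "\<dots> \<le> N" unfolding N_def
    proof (rule integral_mono)
      show "(\<Sum>p\<in>F. norm (f x) * indicator (Q p) x) \<le> norm (f x)" for x
        using mult_left_mono[OF sum_ind[of x] norm_ge_zero[of "f x"]] by (simp add: sum_distrib_left)
    qed (auto intro!: Mint fint)
    finally show ?thesis .
  qed
  have avg: "norm (avg p) * snd p ^ ?n \<le> M p" if "p \<in> F" for p
  proof -
    have "norm (avg p) * snd p ^ ?n = norm (LINT x|lebesgue. f x * indicator (Q p) x)"
      using pos[OF that] by (simp add: avg_def norm_divide norm_power)
    also have "\<dots> \<le> (LINT x|lebesgue. norm (f x * indicator (Q p) x))" by (rule integral_norm_bound)
    also have "\<dots> = M p" unfolding M_eq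
      by (intro Bochner_Integration.integral_cong) (auto simp: norm_mult indicator_def)
    finally show ?thesis .
  qed
  have avg_le: "norm (avg p) \<le> 2 ^ ?n * t" if "p \<in> F" for p
  proof (rule mult_right_le_imp_le)
    show "norm (avg p) * snd p ^ ?n \<le> 2 ^ ?n * t * snd p ^ ?n" using avg[OF that] Mup[OF that] by linarith
    show "0 < snd p ^ ?n" using pos[OF that] by simp
  qed
  have ind2: "(\<lambda>x. indicator (Q p) x :: complex) \<in> Lp q" if "p \<in> F" "q > 0" for p q
  proof -
    have "(\<lambda>x. norm (indicator (Q p) x :: complex) powr q) = indicator (Q p)"
      using that by (auto simp: fun_eq_iff indicator_def)
    then show ?thesis using Qint(1)[OF that(1)] by (simp add: Lp_def)
  qed
  have fQ: "(\<lambda>x. f x * indicator (Q p) x) \<in> Lp q" if "q > 0" for p q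
    by (rule Lp_bound[OF Cc_Lp[OF f that]]) (use that borel_imp_lebesgue[OF Cc_measurable[OF f]] in \<open>auto simp: indicator_def\<close>)
  have bLp: "b p \<in> Lp q" if "p \<in> F" "q > 0" for p q
  proof -
    have "b p = (\<lambda>x. f x * indicator (Q p) x - avg p * indicator (Q p) x)" by (rule ext) (simp add: b_def left_diff_distrib)
    then show ?thesis using that by (simp only:) (intro Lp_diff Lp_cmult fQ ind2, auto)
  qed
  have b2: "b p \<in> Lp 2" and b1: "b p \<in> Lp 1" if "p \<in> F" for p using bLp[OF that] by auto
  have bint: "integrable lebesgue (\<lambda>x. norm (b p x))" if "p \<in> F" for p using b1[OF that] by (simp add: Lp_1_iff)
  have b0: "(LINT x|lebesgue. b p x) = 0" if "p \<in> F" for p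
  proof -
    have "(LINT x|lebesgue. b p x) = (LINT x|lebesgue. f x * indicator (Q p) x) - (LINT x|lebesgue. avg p * indicator (Q p) x)"
      unfolding b_def left_diff_distrib
      by (rule Bochner_Integration.integral_diff)
         (use fQ[of 1 p] Lp_cmult[OF ind2[OF that, of 1], of "avg p"] in \<open>auto simp: Lp_1_iff'\<close>)
    also have "(LINT x|lebesgue. avg p * indicator (Q p) x) = avg p * of_real (LINT x|lebesgue. indicator (Q p) x)"
    proof -
      have "(LINT x|lebesgue. complex_of_real (indicator (Q p) x)) = of_real (LINT x|lebesgue. indicator (Q p) x)"
        by (rule integral_complex_of_real)
      then show ?thesis by (simp only: of_real_indicator integral_mult_right_zero)
    qed
    also have "\<dots> = (LINT x|lebesgue. f x * indicator (Q p) x)"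
      using pos[OF that] unfolding Qint(2)[OF that] avg_def by simp
    finally show ?thesis by simp
  qed
  have bnorm: "(LINT x|lebesgue. norm (b p x)) \<le> 2 * M p" if "p \<in> F" for p
  proof -
    have "(LINT x|lebesgue. norm (b p x)) \<le> (LINT x|lebesgue. norm (f x) * indicator (Q p) x + norm (avg p) * indicator (Q p) x)"
    proof (rule integral_mono)
      show "norm (b p x) \<le> norm (f x) * indicator (Q p) x + norm (avg p) * indicator (Q p) x" for x
        using norm_triangle_ineq4[of "f x" "avg p"] by (auto simp: b_def indicator_def)
    qed (auto intro!: bint that Mint Qint)
    also have "\<dots> = M p + norm (avg p) * snd p ^ ?n"
      unfolding M_eq using Qint[OF that] Mint[of p] by simp
    finally show ?thesis using avg[OF that] by simp
  qed
  have g2: "g \<in> Lp 2" unfolding g_def[abs_def] by (intro Lp_diff f2 Lp_sum b2) auto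
  have gb: "norm (g x) \<le> 2 ^ (?n + 1) * t" for x
  proof (cases "\<exists>p\<in>F. x \<in> Q p")
    case True
    then obtain p where p: "p \<in> F" "x \<in> Q p" by blast
    have nq: "x \<notin> Q q" if "q \<in> F" "q \<noteq> p" for q
      using Fdisj[OF that(1) p(1)] p(2) that(2) unfolding Q_def by blast
    have "(\<Sum>q\<in>F. b q x) = (\<Sum>q\<in>F. if q = p then b p x else 0)"
      by (intro sum.cong) (use nq p in \<open>auto simp: b_def indicator_def\<close>)
    also have "\<dots> = f x - avg p" using p F by (simp add: b_def)
    finally have "g x = avg p" by (simp add: g_def)
    then have "norm (g x) \<le> 2 ^ ?n * t" using avg_le[OF p(1)] by simp
    also have "\<dots> \<le> 2 ^ (?n + 1) * t" using t by simp
    finally show ?thesis .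
  next
    case False
    then have "(\<Sum>q\<in>F. b q x) = 0" by (intro sum.neutral) (auto simp: b_def indicator_def)
    then have "norm (g x) \<le> 2 * t" using Fsmall[of x] False by (auto simp: g_def Q_def)
    also have "\<dots> \<le> 2 ^ (?n + 1) * t" using t one_le_power[of "2::real" ?n] by simp
    finally show ?thesis .
  qed
  have g1: "integrable lebesgue (\<lambda>x. norm (g x))"
  proof -
    have "g \<in> Lp 1" unfolding g_def[abs_def] by (intro Lp_diff f1 Lp_sum b1) auto
    then show ?thesis by (simp add: Lp_1_iff)
  qed
  have gN: "(LINT x|lebesgue. norm (g x)) \<le> 3 * N"
  proof -
    have "(LINT x|lebesgue. norm (g x)) \<le> (LINT x|lebesgue. norm (f x) + (\<Sum>p\<in>F. norm (b p x)))"
    proof (rule integral_mono)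
      show "norm (g x) \<le> norm (f x) + (\<Sum>p\<in>F. norm (b p x))" for x
        unfolding g_def by (rule order_trans[OF norm_triangle_ineq4 add_left_mono[OF norm_sum]])
    qed (auto intro!: g1 fint Bochner_Integration.integrable_add Bochner_Integration.integrable_sum bint)
    also have "\<dots> = N + (\<Sum>p\<in>F. LINT x|lebesgue. norm (b p x))"
      unfolding N_def using bint fint by (subst Bochner_Integration.integral_add) (auto intro!: Bochner_Integration.integrable_sum)
    also have "\<dots> \<le> N + (\<Sum>p\<in>F. 2 * M p)" by (intro add_left_mono sum_mono bnorm)
    also have "\<dots> \<le> 3 * N" using sumM by (simp add: sum_distrib_left[symmetric])
    finally show ?thesis .
  qed
  have gL2: "L2_sq g \<le> 2 ^ (?n + 1) * t * (3 * N)"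
  proof -
    have "L2_sq g \<le> (LINT x|lebesgue. 2 ^ (?n + 1) * t * norm (g x))"
    proof (rule integral_mono)
      show "(norm (g x))\<^sup>2 \<le> 2 ^ (?n + 1) * t * norm (g x)" for x
        using mult_right_mono[OF gb[of x] norm_ge_zero[of "g x"]] by (simp add: power2_eq_square)
    qed (use g2 g1 in \<open>auto simp: Lp_2_iff\<close>)
    also have "\<dots> = 2 ^ (?n + 1) * t * (LINT x|lebesgue. norm (g x))" by simp
    also have "\<dots> \<le> 2 ^ (?n + 1) * t * (3 * N)" using t by (intro mult_left_mono gN) auto
    finally show ?thesis .
  qed
  have Tsplit: "T f x = T g x + (\<Sum>p\<in>F. T (b p) x)" for x
  proof -
    have "T f x = (LINT y|lebesgue. K x y * g y + (\<Sum>p\<in>F. K x y * b p y))"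
      unfolding T_def g_def by (simp add: right_diff_distrib sum_distrib_left)
    also have "\<dots> = T g x + (\<Sum>p\<in>F. T (b p) x)"
      unfolding T_def
      by (subst Bochner_Integration.integral_add)
         (auto intro!: Kint g2 b2 Bochner_Integration.integrable_sum simp: Bochner_Integration.integral_sum[OF Kint[OF b2]])
    finally show ?thesis .
  qed
  have Tm: "T h \<in> borel_measurable lebesgue" if "h \<in> Lp 2" for h
    unfolding T_def[abs_def] using L2[OF that] Lp_measurable by blast
  note [measurable] = Tm[OF g2] Tm[OF f2] Tm[OF b2]
  have good: "emeasure lebesgue {x \<in> UNIV. t / 2 < norm (T g x)} \<le> ennreal (24 * 2 ^ ?n * A2 * N / t)"
  proof -
    have "emeasure lebesgue {x \<in> UNIV. t / 2 < norm (T g x)} \<le> ennreal (1 / (t / 2) ^ 2) * (\<integral>\<^sup>+x. ennreal (norm (T g x) ^ 2) * indicator UNIV x \<partial>lebesgue)"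
      by (rule weak_Markov) (use t Tm[OF g2] in auto)
    also have "(\<integral>\<^sup>+x. ennreal (norm (T g x) ^ 2) * indicator UNIV x \<partial>lebesgue) = ennreal (L2_sq (T g))"
      using nn_integral_L2_sq[of "T g"] L2[OF g2] by (simp add: T_def[abs_def])
    also have "ennreal (1 / (t / 2) ^ 2) * ennreal (L2_sq (T g)) = ennreal (1 / (t / 2) ^ 2 * L2_sq (T g))"
      using L2_sq_nonneg by (intro ennreal_mult[symmetric]) auto
    also have "\<dots> \<le> ennreal (24 * 2 ^ ?n * A2 * N / t)"
    proof (rule ennreal_leI)
      have "L2_sq (T g) \<le> A2 * L2_sq g" using L2[OF g2] by (simp add: T_def[abs_def])
      also have "\<dots> \<le> A2 * (2 ^ (?n + 1) * t * (3 * N))" by (intro mult_left_mono gL2 A)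
      finally have "1 / (t / 2) ^ 2 * L2_sq (T g) \<le> 1 / (t / 2) ^ 2 * (A2 * (2 ^ (?n + 1) * t * (3 * N)))"
        by (intro mult_left_mono) auto
      also have "\<dots> = 24 * 2 ^ ?n * A2 * N / t" using t by (simp add: power2_eq_square field_simps)
      finally show "1 / (t / 2) ^ 2 * L2_sq (T g) \<le> 24 * 2 ^ ?n * A2 * N / t" .
    qed
    finally show ?thesis .
  qed
  \<comment> \<open>A cube of side \<open>s\<close> has diameter at most \<open>n s\<close> (bounded through the \<open>\<ell>\<^sup>1\<close> norm), which serves as the radius in Hoermander's condition.\<close>
  define r where "r p = real ?n * snd p" for p :: "(real^'n) \<times> real"
  have r: "r p > 0" if "p \<in> F" for p using pos[OF that] by (simp add: r_def)
  define \<Omega> where "\<Omega> = (\<Union>p\<in>F. cball (fst p) (2 * r p))"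
  have \<Omega>m [measurable]: "\<Omega> \<in> sets lebesgue" unfolding \<Omega>_def using F by (intro sets.finite_UN) auto
  let ?v = "unit_ball_vol (real ?n) * (2 * real ?n) ^ ?n"
  have v0: "?v \<ge> 0" by (intro mult_nonneg_nonneg unit_ball_vol_nonneg) auto
  have exc: "emeasure lebesgue \<Omega> \<le> ennreal (?v * N / t)"
  proof -
    have "emeasure lebesgue \<Omega> \<le> (\<Sum>p\<in>F. emeasure lebesgue (cball (fst p) (2 * r p)))"
      unfolding \<Omega>_def using F by (intro emeasure_subadditive_finite) auto
    also have "\<dots> \<le> (\<Sum>p\<in>F. ennreal (?v / t * M p))"
    proof (rule sum_mono)
      fix p assume p: "p \<in> F"
      have "emeasure lebesgue (cball (fst p) (2 * r p)) = ennreal (unit_ball_vol (real ?n) * (2 * r p) ^ ?n)"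
        using r[OF p] by (subst emeasure_completion) (simp_all add: emeasure_cball main_part_sets ennreal_mult')
      also have "unit_ball_vol (real ?n) * (2 * r p) ^ ?n = ?v / t * (t * snd p ^ ?n)"
        using t by (simp add: r_def power_mult_distrib)
      also have "ennreal (?v / t * (t * snd p ^ ?n)) \<le> ennreal (?v / t * M p)"
        using Mlow[OF p] t v0 by (intro ennreal_leI mult_left_mono) auto
      finally show "emeasure lebesgue (cball (fst p) (2 * r p)) \<le> ennreal (?v / t * M p)" .
    qed
    also have "\<dots> = ennreal (\<Sum>p\<in>F. ?v / t * M p)"
      using t v0 by (intro sum_ennreal) (auto simp: M_def intro!: mult_nonneg_nonneg)
    also have "\<dots> \<le> ennreal (?v * N / t)"
    proof (rule ennreal_leI)
      have "(\<Sum>p\<in>F. ?v / t * M p) = ?v / t * (\<Sum>p\<in>F. M p)" by (simp only: sum_distrib_left)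
      also have "\<dots> \<le> ?v / t * N" using t v0 by (intro mult_left_mono sumM) auto
      finally show "(\<Sum>p\<in>F. ?v / t * M p) \<le> ?v * N / t" by simp
    qed
    finally show ?thesis .
  qed
  interpret L: sigma_finite_measure "lebesgue :: (real^'n) measure" by (rule sigma_finite_lebesgue)
  interpret LL: pair_sigma_finite "lebesgue :: (real^'n) measure" "lebesgue :: (real^'n) measure" ..
  have badp: "(\<integral>\<^sup>+x. ennreal (norm (T (b p) x)) * indicator {x. 2 * r p < norm (x - fst p)} x \<partial>lebesgue) \<le> ennreal (2 * A1 * M p)" if p: "p \<in> F" for p
  proof -
    let ?S = "{x. 2 * r p < norm (x - fst p)}"
    let ?D = "\<lambda>x y. ennreal (norm (K x y - K x (fst p)))"
    have S [measurable]: "?S \<in> sets lebesgue"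
    proof -
      have "open ?S" by (intro open_Collect_less continuous_intros)
      then show ?thesis by simp
    qed
    note [measurable] = Lp_measurable[OF b2[OF p]]
    have Km: "(\<lambda>(x, y). K x y) \<in> borel_measurable (lebesgue \<Otimes>\<^sub>M lebesgue)"
    proof -
      have "(\<lambda>z. \<Sum>i\<in>I. u i (fst z) * v i (snd z)) \<in> borel_measurable (lebesgue \<Otimes>\<^sub>M lebesgue)"
      proof (intro borel_measurable_sum borel_measurable_times)
        fix i assume i: "i \<in> I"
        show "(\<lambda>z. u i (fst z)) \<in> borel_measurable (lebesgue \<Otimes>\<^sub>M lebesgue)" by (rule measurable_compose[OF measurable_fst u[OF i]])
        show "(\<lambda>z. v i (snd z)) \<in> borel_measurable (lebesgue \<Otimes>\<^sub>M lebesgue)" by (rule measurable_compose[OF measurable_snd Lp_measurable[OF v[OF i]]])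
      qed
      then show ?thesis by (simp add: K[abs_def] case_prod_unfold)
    qed
    have Kx: "(\<lambda>x. K x y) \<in> borel_measurable lebesgue" for y unfolding K by (intro borel_measurable_sum borel_measurable_times u) auto
    have Dm: "(\<lambda>(x, y). ?D x y * ennreal (norm (b p y)) * indicator ?S x) \<in> borel_measurable (lebesgue \<Otimes>\<^sub>M lebesgue)"
    proof -
      have "(\<lambda>z. K (fst z) (snd z) - K (fst z) (fst p)) \<in> borel_measurable (lebesgue \<Otimes>\<^sub>M lebesgue)"
        using Km measurable_compose[OF measurable_fst Kx] by (intro borel_measurable_diff) (auto simp: case_prod_unfold)
      then show ?thesis unfolding case_prod_unfold by measurable
    qed
    have pt: "ennreal (norm (T (b p) x)) \<le> (\<integral>\<^sup>+y. ?D x y * ennreal (norm (b p y)) \<partial>lebesgue)" for x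
    proof -
      have i1: "integrable lebesgue (\<lambda>y. K x (fst p) * b p y)" using b1[OF p] by (intro integrable_mult_right) (simp add: Lp_1_iff')
      have "T (b p) x = (LINT y|lebesgue. K x y * b p y) - (LINT y|lebesgue. K x (fst p) * b p y)"
        using b0[OF p] by (simp add: T_def)
      also have "\<dots> = (LINT y|lebesgue. (K x y - K x (fst p)) * b p y)"
        unfolding left_diff_distrib by (rule Bochner_Integration.integral_diff[symmetric]) (rule Kint[OF b2[OF p]], rule i1)
      finally have eq: "T (b p) x = (LINT y|lebesgue. (K x y - K x (fst p)) * b p y)" .
      have "integrable lebesgue (\<lambda>y. (K x y - K x (fst p)) * b p y)"
        unfolding left_diff_distrib by (intro Bochner_Integration.integrable_diff Kint[OF b2[OF p]] i1)
      from integral_norm_bound_ennreal[OF this] show ?thesis unfolding eq by (simp add: norm_mult ennreal_mult)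
    qed
    have "(\<integral>\<^sup>+x. ennreal (norm (T (b p) x)) * indicator ?S x \<partial>lebesgue)
       \<le> (\<integral>\<^sup>+x. (\<integral>\<^sup>+y. ?D x y * ennreal (norm (b p y)) * indicator ?S x \<partial>lebesgue) \<partial>lebesgue)"
    proof (rule nn_integral_mono)
      fix x show "ennreal (norm (T (b p) x)) * indicator ?S x \<le> (\<integral>\<^sup>+y. ?D x y * ennreal (norm (b p y)) * indicator ?S x \<partial>lebesgue)"
        using pt[of x] by (cases "x \<in> ?S") auto
    qed
    also have "\<dots> = (\<integral>\<^sup>+y. (\<integral>\<^sup>+x. ?D x y * ennreal (norm (b p y)) * indicator ?S x \<partial>lebesgue) \<partial>lebesgue)"
      using LL.Fubini'[OF Dm] by simp
    also have "\<dots> \<le> (\<integral>\<^sup>+y. ennreal A1 * ennreal (norm (b p y)) \<partial>lebesgue)"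
    proof (rule nn_integral_mono)
      fix y
      show "(\<integral>\<^sup>+x. ?D x y * ennreal (norm (b p y)) * indicator ?S x \<partial>lebesgue) \<le> ennreal A1 * ennreal (norm (b p y))"
      proof (cases "y \<in> Q p")
        case True
        have "norm (y - fst p) \<le> r p"
          unfolding r_def using True corner_in_cube[OF pos[OF p]] by (intro norm_le_cube) (auto simp: Q_def)
        from Hoer[OF r[OF p] this]
        have H: "(\<integral>\<^sup>+x. ?D x y * indicator ?S x \<partial>lebesgue) \<le> ennreal A1" .
        have dm: "(\<lambda>x. ?D x y * indicator ?S x) \<in> borel_measurable lebesgue"
          using Kx by measurable
        have "(\<integral>\<^sup>+x. ?D x y * ennreal (norm (b p y)) * indicator ?S x \<partial>lebesgue) = (\<integral>\<^sup>+x. (?D x y * indicator ?S x) * ennreal (norm (b p y)) \<partial>lebesgue)"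
          by (intro nn_integral_cong) (simp only: mult_ac)
        also have "\<dots> = (\<integral>\<^sup>+x. ?D x y * indicator ?S x \<partial>lebesgue) * ennreal (norm (b p y))"
          by (rule nn_integral_multc[OF dm])
        also have "\<dots> \<le> ennreal A1 * ennreal (norm (b p y))" by (rule mult_right_mono[OF H]) simp
        finally show ?thesis .
      next
        case False
        then have "b p y = 0" by (simp add: b_def)
        then show ?thesis by simp
      qed
    qed
    also have "\<dots> = ennreal A1 * (\<integral>\<^sup>+y. ennreal (norm (b p y)) \<partial>lebesgue)" by (rule nn_integral_cmult) measurable
    also have "(\<integral>\<^sup>+y. ennreal (norm (b p y)) \<partial>lebesgue) = ennreal (LINT y|lebesgue. norm (b p y))"
      by (rule nn_integral_eq_integral[OF bint[OF p]]) simp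
    also have "ennreal A1 * \<dots> \<le> ennreal A1 * ennreal (2 * M p)" by (intro mult_left_mono ennreal_leI bnorm[OF p]) simp
    also have "\<dots> = ennreal (2 * A1 * M p)" using A by (subst ennreal_mult[symmetric]) (auto simp: M_def mult_ac)
    finally show ?thesis .
  qed
  have bad: "emeasure lebesgue {x \<in> - \<Omega>. t / 2 < norm (\<Sum>p\<in>F. T (b p) x)} \<le> ennreal (4 * A1 * N / t)"
  proof -
    have "emeasure lebesgue {x \<in> - \<Omega>. t / 2 < norm (\<Sum>p\<in>F. T (b p) x)}
       \<le> ennreal (1 / (t / 2) ^ 1) * (\<integral>\<^sup>+x. ennreal (norm (\<Sum>p\<in>F. T (b p) x) ^ 1) * indicator (- \<Omega>) x \<partial>lebesgue)"
    proof (rule weak_Markov)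
      show "(\<lambda>x. \<Sum>p\<in>F. T (b p) x) \<in> borel_measurable lebesgue" by (intro borel_measurable_sum Tm b2)
      show "- \<Omega> \<in> sets lebesgue" using \<Omega>m by (simp add: Compl_in_sets_lebesgue)
    qed (use t in auto)
    also have "ennreal (1 / (t / 2) ^ 1) * (\<integral>\<^sup>+x. ennreal (norm (\<Sum>p\<in>F. T (b p) x) ^ 1) * indicator (- \<Omega>) x \<partial>lebesgue)
       \<le> ennreal (1 / (t / 2) ^ 1) * (\<integral>\<^sup>+x. (\<Sum>p\<in>F. ennreal (norm (T (b p) x)) * indicator {x. 2 * r p < norm (x - fst p)} x) \<partial>lebesgue)"
    proof (intro mult_left_mono nn_integral_mono)
      fix x
      show "ennreal (norm (\<Sum>p\<in>F. T (b p) x) ^ 1) * indicator (- \<Omega>) x \<le> (\<Sum>p\<in>F. ennreal (norm (T (b p) x)) * indicator {x. 2 * r p < norm (x - fst p)} x)"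
      proof (cases "x \<in> \<Omega>")
        case False
        then have far: "2 * r p < norm (x - fst p)" if "p \<in> F" for p
          using that unfolding \<Omega>_def by (auto simp: dist_norm norm_minus_commute not_le)
        have "ennreal (norm (\<Sum>p\<in>F. T (b p) x)) \<le> ennreal (\<Sum>p\<in>F. norm (T (b p) x))" by (intro ennreal_leI norm_sum)
        also have "\<dots> = (\<Sum>p\<in>F. ennreal (norm (T (b p) x)))" by (rule sum_ennreal[symmetric]) simp
        also have "\<dots> = (\<Sum>p\<in>F. ennreal (norm (T (b p) x)) * indicator {x. 2 * r p < norm (x - fst p)} x)"
          using far by (intro sum.cong) auto
        finally show ?thesis using False by simp
      qed simp
    qed simp
    also have "(\<integral>\<^sup>+x. (\<Sum>p\<in>F. ennreal (norm (T (b p) x)) * indicator {x. 2 * r p < norm (x - fst p)} x) \<partial>lebesgue)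
       = (\<Sum>p\<in>F. \<integral>\<^sup>+x. ennreal (norm (T (b p) x)) * indicator {x. 2 * r p < norm (x - fst p)} x \<partial>lebesgue)"
    proof (rule nn_integral_sum)
      fix p assume p: "p \<in> F"
      have "open {x. 2 * r p < norm (x - fst p)}" by (intro open_Collect_less continuous_intros)
      then have [measurable]: "{x. 2 * r p < norm (x - fst p)} \<in> sets lebesgue" by simp
      show "(\<lambda>x. ennreal (norm (T (b p) x)) * indicator {x. 2 * r p < norm (x - fst p)} x) \<in> borel_measurable lebesgue"
        using Tm[OF b2[OF p]] by measurable
    qed
    also have "ennreal (1 / (t / 2) ^ 1) * (\<Sum>p\<in>F. \<integral>\<^sup>+x. ennreal (norm (T (b p) x)) * indicator {x. 2 * r p < norm (x - fst p)} x \<partial>lebesgue)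
       \<le> ennreal (1 / (t / 2) ^ 1) * (\<Sum>p\<in>F. ennreal (2 * A1 * M p))"
      by (intro mult_left_mono sum_mono badp) auto
    also have "(\<Sum>p\<in>F. ennreal (2 * A1 * M p)) = ennreal (\<Sum>p\<in>F. 2 * A1 * M p)"
      using A by (intro sum_ennreal) (auto simp: M_def intro!: mult_nonneg_nonneg)
    also have "ennreal (1 / (t / 2) ^ 1) * ennreal (\<Sum>p\<in>F. 2 * A1 * M p) = ennreal (1 / (t / 2) ^ 1 * (\<Sum>p\<in>F. 2 * A1 * M p))"
      using A t by (intro ennreal_mult[symmetric]) (auto simp: M_def intro!: sum_nonneg mult_nonneg_nonneg)
    also have "\<dots> \<le> ennreal (4 * A1 * N / t)"
    proof (rule ennreal_leI)
      have "1 / (t / 2) ^ 1 * (\<Sum>p\<in>F. 2 * A1 * M p) = 4 * A1 / t * (\<Sum>p\<in>F. M p)"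
        by (simp add: sum_distrib_left[symmetric])
      also have "\<dots> \<le> 4 * A1 / t * N" using A t by (intro mult_left_mono sumM) auto
      finally show "1 / (t / 2) ^ 1 * (\<Sum>p\<in>F. 2 * A1 * M p) \<le> 4 * A1 * N / t" by simp
    qed
    finally show ?thesis .
  qed
  have "{x. t < norm (T f x)} \<subseteq> {x \<in> UNIV. t / 2 < norm (T g x)} \<union> (\<Omega> \<union> {x \<in> - \<Omega>. t / 2 < norm (\<Sum>p\<in>F. T (b p) x)})"
  proof
    fix x assume "x \<in> {x. t < norm (T f x)}"
    then have "t < norm (T g x) + norm (\<Sum>p\<in>F. T (b p) x)"
      using norm_triangle_ineq[of "T g x" "\<Sum>p\<in>F. T (b p) x"] Tsplit[of x] by simp
    then show "x \<in> {x \<in> UNIV. t / 2 < norm (T g x)} \<union> (\<Omega> \<union> {x \<in> - \<Omega>. t / 2 < norm (\<Sum>p\<in>F. T (b p) x)})" by auto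
  qed
  moreover have "(\<lambda>x. \<Sum>p\<in>F. T (b p) x) \<in> borel_measurable lebesgue" by (intro borel_measurable_sum Tm b2)
  then have "{x \<in> - \<Omega>. t / 2 < norm (\<Sum>p\<in>F. T (b p) x)} \<in> sets lebesgue"
    by (rule level_set_measurable) (simp add: \<Omega>m Compl_in_sets_lebesgue)
  then have m: "{x \<in> UNIV. t / 2 < norm (T g x)} \<in> sets lebesgue" "\<Omega> \<in> sets lebesgue"
      "{x \<in> - \<Omega>. t / 2 < norm (\<Sum>p\<in>F. T (b p) x)} \<in> sets lebesgue"
    using level_set_measurable[OF Tm[OF g2], where A = UNIV and c = "t / 2"] \<Omega>m by simp_all
  ultimately have "emeasure lebesgue {x. t < norm (T f x)} \<le> emeasure lebesgue ({x \<in> UNIV. t / 2 < norm (T g x)} \<union> (\<Omega> \<union> {x \<in> - \<Omega>. t / 2 < norm (\<Sum>p\<in>F. T (b p) x)}))"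
    by (intro emeasure_mono sets.Un m)
  also have "\<dots> \<le> emeasure lebesgue {x \<in> UNIV. t / 2 < norm (T g x)} + (emeasure lebesgue \<Omega> + emeasure lebesgue {x \<in> - \<Omega>. t / 2 < norm (\<Sum>p\<in>F. T (b p) x)})"
    by (rule order_trans[OF emeasure_subadditive add_left_mono[OF emeasure_subadditive]]) (intro sets.Un m)+
  also have "\<dots> \<le> ennreal (24 * 2 ^ ?n * A2 * N / t) + (ennreal (?v * N / t) + ennreal (4 * A1 * N / t))"
    by (intro add_mono good exc bad)
  also have "\<dots> = ennreal (24 * 2 ^ ?n * A2 * N / t + (?v * N / t + 4 * A1 * N / t))"
    using A N0 t v0 by (simp only: ennreal_plus[symmetric] divide_nonneg_pos mult_nonneg_nonneg add_nonneg_nonneg zero_le_numeral zero_le_power)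
  also have "24 * 2 ^ ?n * A2 * N / t + (?v * N / t + 4 * A1 * N / t) = (24 * 2 ^ ?n * A2 + ?v + 4 * A1) / t * N"
    by (simp add: add_divide_distrib distrib_right)
  finally show ?thesis unfolding T_def N_def .
qed

text \<open>
  The function is approximated by \<open>\<phi> \<in> C\<^sub>c\<close> in \<open>L\<^sup>1\<close> and \<open>L\<^sup>2\<close> at once. The error is controlled by Chebyshev's
  inequality and the \<open>L\<^sup>2\<close> bound; splitting the level \<open>t\<close> in halves costs the factor \<open>2\<close>.
\<close>

theorem weak_type_extend:
  fixes T :: "('a::euclidean_space \<Rightarrow> complex) \<Rightarrow> 'a \<Rightarrow> complex"
  assumes T2: "\<And>f. f \<in> Lp 2 \<Longrightarrow> T f \<in> Lp 2" "\<And>f. f \<in> Lp 2 \<Longrightarrow> L2_sq (T f) \<le> A * L2_sq f" and A: "A \<ge> 0"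
    and diff: "\<And>f g x. f \<in> Lp 2 \<Longrightarrow> g \<in> Lp 2 \<Longrightarrow> T (\<lambda>x. f x - g x) x = T f x - T g x"
    and weak: "\<And>\<phi> t. Cc \<phi> \<Longrightarrow> t > 0 \<Longrightarrow> emeasure lebesgue {x. t < norm (T \<phi> x)} \<le> ennreal (C / t * (LINT x|lebesgue. norm (\<phi> x)))"
    and C: "C \<ge> 0" and f: "f \<in> Lp 1" "f \<in> Lp 2" and t: "t > 0"
  shows "emeasure lebesgue {x. t < norm (T f x)} \<le> ennreal (2 * C / t * (LINT x|lebesgue. norm (f x)))"
proof (rule ennreal_le_epsilon)
  let ?N = "LINT x|lebesgue. norm (f x)"
  have N0: "?N \<ge> 0" by simp
  fix e :: real assume e: "e > 0"
  \<comment> \<open>The summand \<open>1\<close> only ensures \<open>\<kappa> > 0\<close>; the others are the factors with which the two errors enter.\<close>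
  define \<kappa> where "\<kappa> = 2 * C / t + 4 * A / t ^ 2 + 1"
  have \<kappa>: "\<kappa> > 0" unfolding \<kappa>_def using C A t by (intro add_nonneg_pos add_nonneg_nonneg) auto
  have "\<exists>\<phi>. Cc \<phi> \<and> (\<forall>p\<in>{1, 2}. (LINT x|lebesgue. norm (f x - \<phi> x) powr p) < e / \<kappa>)"
    by (rule Cc_dense) (use f e \<kappa> Lp_measurable in auto)
  then obtain \<phi> where \<phi>: "Cc \<phi>" and d1: "(LINT x|lebesgue. norm (f x - \<phi> x)) < e / \<kappa>" and d2: "L2_sq (\<lambda>x. f x - \<phi> x) < e / \<kappa>" by auto
  have p1: "\<phi> \<in> Lp 1" and p2: "\<phi> \<in> Lp 2" by (auto intro: Cc_Lp[OF \<phi>])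
  let ?h = "\<lambda>x. f x - \<phi> x"
  have h2: "?h \<in> Lp 2" and h1: "?h \<in> Lp 1" using f p1 p2 by (auto intro: Lp_diff)
  let ?A = "{x \<in> UNIV. t / 2 < norm (T \<phi> x)}" and ?B = "{x \<in> UNIV. t / 2 < norm (T ?h x)}"
  have m: "?A \<in> sets lebesgue" "?B \<in> sets lebesgue"
    using level_set_measurable[OF Lp_measurable[OF T2(1)[OF p2]], where A = UNIV and c = "t / 2"] level_set_measurable[OF Lp_measurable[OF T2(1)[OF h2]], where A = UNIV and c = "t / 2"]
    by simp_all
  have "{x. t < norm (T f x)} \<subseteq> ?A \<union> ?B"
  proof
    fix x assume "x \<in> {x. t < norm (T f x)}"
    moreover have "norm (T f x) \<le> norm (T \<phi> x) + norm (T ?h x)"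
      using diff[OF f(2) p2, of x] norm_triangle_ineq[of "T \<phi> x" "T ?h x"] by simp
    ultimately show "x \<in> ?A \<union> ?B" by auto
  qed
  then have "emeasure lebesgue {x. t < norm (T f x)} \<le> emeasure lebesgue (?A \<union> ?B)" by (rule emeasure_mono) (intro sets.Un m)
  also have "\<dots> \<le> emeasure lebesgue ?A + emeasure lebesgue ?B" by (rule emeasure_subadditive[OF m])
  also have "\<dots> \<le> ennreal (2 * C / t * (?N + e / \<kappa>)) + ennreal (4 * A / t ^ 2 * (e / \<kappa>))"
  proof (rule add_mono)
    have "emeasure lebesgue ?A \<le> ennreal (C / (t / 2) * (LINT x|lebesgue. norm (\<phi> x)))"
      using weak[OF \<phi>, of "t / 2"] t by simp
    also have "\<dots> \<le> ennreal (2 * C / t * (?N + e / \<kappa>))"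
    proof (rule ennreal_leI)
      have "(LINT x|lebesgue. norm (\<phi> x)) \<le> (LINT x|lebesgue. norm (f x) + norm (?h x))"
      proof (rule integral_mono)
        show "norm (\<phi> x) \<le> norm (f x) + norm (?h x)" for x
          using norm_triangle_ineq4[of "f x" "?h x"] by simp
      qed (use f p1 h1 in \<open>auto simp: Lp_1_iff\<close>)
      also have "\<dots> = ?N + (LINT x|lebesgue. norm (?h x))" using f h1 by (simp add: Lp_1_iff)
      also have "\<dots> \<le> ?N + e / \<kappa>" using d1 by simp
      finally have "2 * C / t * (LINT x|lebesgue. norm (\<phi> x)) \<le> 2 * C / t * (?N + e / \<kappa>)"
        using C t by (intro mult_left_mono) auto
      then show "C / (t / 2) * (LINT x|lebesgue. norm (\<phi> x)) \<le> 2 * C / t * (?N + e / \<kappa>)" by (simp add: mult_ac)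
    qed
    finally show "emeasure lebesgue ?A \<le> ennreal (2 * C / t * (?N + e / \<kappa>))" .
    have "emeasure lebesgue ?B \<le> ennreal (1 / (t / 2) ^ 2) * (\<integral>\<^sup>+x. ennreal (norm (T ?h x) ^ 2) * indicator UNIV x \<partial>lebesgue)"
      by (rule weak_Markov) (use t Lp_measurable[OF T2(1)[OF h2]] in auto)
    also have "(\<integral>\<^sup>+x. ennreal (norm (T ?h x) ^ 2) * indicator UNIV x \<partial>lebesgue) = ennreal (L2_sq (T ?h))"
      using nn_integral_L2_sq[OF T2(1)[OF h2]] by simp
    also have "ennreal (1 / (t / 2) ^ 2) * ennreal (L2_sq (T ?h)) = ennreal (1 / (t / 2) ^ 2 * L2_sq (T ?h))"
      using L2_sq_nonneg by (intro ennreal_mult[symmetric]) auto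
    also have "\<dots> \<le> ennreal (4 * A / t ^ 2 * (e / \<kappa>))"
    proof (rule ennreal_leI)
      have "1 / (t / 2) ^ 2 * L2_sq (T ?h) \<le> 1 / (t / 2) ^ 2 * (A * (e / \<kappa>))"
        using T2(2)[OF h2] mult_left_mono[OF less_imp_le[OF d2] A] by (intro mult_left_mono) auto
      then show "1 / (t / 2) ^ 2 * L2_sq (T ?h) \<le> 4 * A / t ^ 2 * (e / \<kappa>)" by (simp add: power_divide)
    qed
    finally show "emeasure lebesgue ?B \<le> ennreal (4 * A / t ^ 2 * (e / \<kappa>))" .
  qed
  also have "\<dots> = ennreal (2 * C / t * (?N + e / \<kappa>) + 4 * A / t ^ 2 * (e / \<kappa>))"
    using C A t e \<kappa> N0 by (intro ennreal_plus[symmetric] mult_nonneg_nonneg add_nonneg_nonneg divide_nonneg_pos) auto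
  also have "\<dots> \<le> ennreal (2 * C / t * ?N + e)"
  proof (rule ennreal_leI)
    have \<kappa>1: "\<kappa> - 1 = 2 * C / t + 4 * A / t ^ 2" by (simp add: \<kappa>_def)
    have "2 * C / t * (?N + e / \<kappa>) + 4 * A / t ^ 2 * (e / \<kappa>) = 2 * C / t * ?N + (\<kappa> - 1) * (e / \<kappa>)"
      unfolding \<kappa>1 by (simp only: distrib_left distrib_right add.assoc)
    also have "(\<kappa> - 1) * (e / \<kappa>) \<le> \<kappa> * (e / \<kappa>)" using e \<kappa> by (intro mult_right_mono) auto
    also have "\<kappa> * (e / \<kappa>) = e" using \<kappa> by simp
    finally show "2 * C / t * (?N + e / \<kappa>) + 4 * A / t ^ 2 * (e / \<kappa>) \<le> 2 * C / t * ?N + e" by simp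
  qed
  also have "\<dots> = ennreal (2 * C / t * ?N) + ennreal e"
    using C t N0 e by (intro ennreal_plus mult_nonneg_nonneg divide_nonneg_pos) auto
  finally show "emeasure lebesgue {x. t < norm (T f x)} \<le> ennreal (2 * C / t * ?N) + ennreal e" .
qed

section \<open>Marcinkiewicz interpolation\<close>

text \<open>
  Both sums are geometric, with their largest term next to \<open>a\<close>. Up to a constant, each term is dominated by an increment of
  \<open>min a s powr q\<close>, or of \<open>max a s powr (- q)\<close> in the second lemma, so the sums telescope.
\<close>

lemma dyadic_sum_below:
  fixes a h q :: real
  assumes a: "a > 0" and h: "h > 0" and q: "q > 0"
  shows "(\<Sum>k<K. if h * 2 ^ k < a then (h * 2 ^ k) powr q else 0) \<le> a powr q / (1 - 2 powr (- q))"
proof -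
  \<comment> \<open>Halved, so that the \<open>k\<close>-th height is the upper end of the \<open>k\<close>-th increment.\<close>
  define s where "s k = h * 2 ^ k / 2" for k :: nat
  let ?c = "1 - 2 powr (- q)"
  have c: "?c > 0" using powr_less_mono[of "- q" 0 2] q by simp
  have s: "s k > 0" "s (Suc k) = h * 2 ^ k" "s (Suc k) = 2 * s k" for k using h by (auto simp: s_def)
  have step: "?c * (if h * 2 ^ k < a then (h * 2 ^ k) powr q else 0) \<le> min a (s (Suc k)) powr q - min a (s k) powr q" for k
  proof (cases "h * 2 ^ k < a")
    case True
    then have m: "min a (s (Suc k)) = s (Suc k)" "min a (s k) = s k" using s[of k] by (auto simp: min_def)
    have "s k powr q = 2 powr (- q) * s (Suc k) powr q"
      unfolding s(3) using s(1)[of k] by (simp add: powr_mult powr_minus field_simps)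
    then show ?thesis unfolding m using True by (simp add: s(2) algebra_simps)
  next
    case False
    have "min a (s k) \<le> min a (s (Suc k))" using s[of k] by (auto simp: min_def)
    then have "min a (s k) powr q \<le> min a (s (Suc k)) powr q" using s[of k] a q by (intro powr_mono2) auto
    then show ?thesis using False by simp
  qed
  have "?c * (\<Sum>k<K. if h * 2 ^ k < a then (h * 2 ^ k) powr q else 0) \<le> (\<Sum>k<K. min a (s (Suc k)) powr q - min a (s k) powr q)"
    unfolding sum_distrib_left by (intro sum_mono step)
  also have "\<dots> = min a (s K) powr q - min a (s 0) powr q" by (rule sum_lessThan_telescope)
  also have "\<dots> \<le> min a (s K) powr q" by simp
  also have "\<dots> \<le> a powr q" using a s(1)[of K] q by (intro powr_mono2) auto
  finally show ?thesis using c by (simp add: field_simps)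
qed

lemma dyadic_sum_above:
  fixes a h q :: real
  assumes a: "a > 0" and h: "h > 0" and q: "q > 0"
  shows "(\<Sum>k<K. if a \<le> h * 2 ^ k then (h * 2 ^ k) powr (- q) else 0) \<le> a powr (- q) / (1 - 2 powr (- q))"
proof -
  define s where "s k = h * 2 ^ k" for k :: nat
  let ?c = "1 - 2 powr (- q)"
  have c: "?c > 0" using powr_less_mono[of "- q" 0 2] q by simp
  have s: "s k > 0" "s (Suc k) = 2 * s k" for k using h by (auto simp: s_def)
  have step: "?c * (if a \<le> s k then s k powr (- q) else 0) \<le> max a (s k) powr (- q) - max a (s (Suc k)) powr (- q)" for k
  proof (cases "a \<le> s k")
    case True
    then have m: "max a (s (Suc k)) = s (Suc k)" "max a (s k) = s k" using s[of k] by (auto simp: max_def)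
    have "s (Suc k) powr (- q) = 2 powr (- q) * s k powr (- q)"
      unfolding s(2) using s(1)[of k] by (simp add: powr_mult)
    then show ?thesis unfolding m using True by (simp add: algebra_simps)
  next
    case False
    have "max a (s k) \<le> max a (s (Suc k))" using s[of k] by (auto simp: max_def)
    then have "max a (s (Suc k)) powr (- q) \<le> max a (s k) powr (- q)" using s[of k] a q by (intro powr_mono2') auto
    then show ?thesis using False by simp
  qed
  have "?c * (\<Sum>k<K. if a \<le> s k then s k powr (- q) else 0) \<le> (\<Sum>k<K. max a (s k) powr (- q) - max a (s (Suc k)) powr (- q))"
    unfolding sum_distrib_left by (intro sum_mono step)
  also have "\<dots> = max a (s 0) powr (- q) - max a (s K) powr (- q)" by (rule sum_lessThan_telescope')
  also have "\<dots> \<le> max a (s 0) powr (- q)" by simp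
  also have "\<dots> \<le> a powr (- q)" using a q by (intro powr_mono2') auto
  finally show ?thesis using c unfolding s_def by (simp add: field_simps)
qed

text \<open>
  The distributional inequality at height \<open>s\<close> is what a weak type \<open>(1,1)\<close> bound for the part of \<open>f\<close> above \<open>s\<close> and
  an \<open>L\<^sup>2\<close> bound for the part below \<open>s\<close> give. It is summed with the weight \<open>s\<^sup>p\<close> over the heights \<open>h 2\<^sup>k\<close>. At a
  point \<open>x\<close> the first part contributes the heights below \<open>\<bar>f x\<bar>\<close> and the second those above, and both
  geometric sums are comparable to \<open>\<bar>f x\<bar>\<^sup>p\<close>. Discrete heights replace the layer-cake formula.
\<close>

theorem Marcinkiewicz_dyadic:
  fixes f g :: "'a::euclidean_space \<Rightarrow> complex"
  assumes f: "f \<in> borel_measurable lebesgue" and g: "g \<in> borel_measurable lebesgue" and p: "1 < p" "p < 2" and C: "B1 \<ge> 0" "B2 \<ge> 0"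
    and distr: "\<And>s. s > 0 \<Longrightarrow> emeasure lebesgue {x. 3 * s < norm (g x)} \<le>
      ennreal (B1 / s) * (\<integral>\<^sup>+x. ennreal (norm (f x)) * indicator {x. s < norm (f x)} x \<partial>lebesgue)
      + ennreal (B2 / s\<^sup>2) * (\<integral>\<^sup>+x. ennreal ((norm (f x))\<^sup>2) * indicator {x. norm (f x) \<le> s} x \<partial>lebesgue)"
  shows "(\<integral>\<^sup>+x. ennreal (norm (g x) powr p) \<partial>lebesgue) \<le>
    ennreal (6 powr p * (B1 / (1 - 2 powr (- (p - 1))) + B2 / (1 - 2 powr (- (2 - p))))) * (\<integral>\<^sup>+x. ennreal (norm (f x) powr p) \<partial>lebesgue)"
proof -
  note [measurable] = f g
  let ?D = "6 powr p * (B1 / (1 - 2 powr (- (p - 1))) + B2 / (1 - 2 powr (- (2 - p))))"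
  have c1: "1 - 2 powr (- (p - 1)) > 0" using powr_less_mono[of "- (p - 1)" 0 2] p by simp
  have c2: "1 - 2 powr (- (2 - p)) > 0" using powr_less_mono[of "- (2 - p)" 0 2] p by simp
  have D0: "?D \<ge> 0" using c1 c2 C by (intro mult_nonneg_nonneg add_nonneg_nonneg divide_nonneg_pos) auto
  have m1 [measurable]: "{x. s < norm (f x)} \<in> sets lebesgue" "{x. norm (f x) \<le> s} \<in> sets lebesgue" for s
  proof -
    have "{x \<in> space lebesgue. s < norm (f x)} \<in> sets lebesgue" "{x \<in> space lebesgue. norm (f x) \<le> s} \<in> sets lebesgue" by measurable
    then show "{x. s < norm (f x)} \<in> sets lebesgue" "{x. norm (f x) \<le> s} \<in> sets lebesgue" by simp_all
  qed
  have m2 [measurable]: "{x. s < norm (g x)} \<in> sets lebesgue" for s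
  proof -
    have "{x \<in> space lebesgue. s < norm (g x)} \<in> sets lebesgue" by measurable
    then show ?thesis by simp
  qed
  have m3 [measurable]: "{x. a < norm (g x) \<and> norm (g x) \<le> b} \<in> sets lebesgue" for a b
  proof -
    have "{x \<in> space lebesgue. a < norm (g x) \<and> norm (g x) \<le> b} \<in> sets lebesgue" by measurable
    then show ?thesis by simp
  qed
  have main: "(\<integral>\<^sup>+x. ennreal (norm (g x) powr p) * indicator {x. 3 * h < norm (g x) \<and> norm (g x) \<le> 3 * (h * 2 ^ K)} x \<partial>lebesgue)
      \<le> ennreal ?D * (\<integral>\<^sup>+x. ennreal (norm (f x) powr p) \<partial>lebesgue)" if h: "h > 0" for h and K :: nat
  proof -
    define s where "s k = h * 2 ^ k" for k :: nat
    have s: "s k > 0" "s (Suc k) = 2 * s k" for k using h by (auto simp: s_def)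
    have 1: "ennreal (norm (g x) powr p) * indicator {x. 3 * h < norm (g x) \<and> norm (g x) \<le> 3 * (h * 2 ^ K)} x
       \<le> (\<Sum>k<K. ennreal ((6 * s k) powr p) * indicator {x. 3 * s k < norm (g x)} x)" for x
    proof (cases "3 * h < norm (g x) \<and> norm (g x) \<le> 3 * (h * 2 ^ K)")
      case True
      define P where "P k \<longleftrightarrow> norm (g x) \<le> 3 * s k" for k
      have "P K" using True by (simp add: P_def s_def)
      define j where "j = (LEAST k. P k)"
      have Pj: "P j" unfolding j_def using \<open>P K\<close> by (rule LeastI)
      have jK: "j \<le> K" unfolding j_def using \<open>P K\<close> by (rule Least_le)
      have "\<not> P 0" using True by (simp add: P_def s_def)
      then obtain k where j: "j = Suc k" using Pj by (cases j) auto
      have "\<not> P k" using j unfolding j_def by (metis lessI not_less_Least)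
      then have k: "3 * s k < norm (g x)" by (simp add: P_def)
      have "norm (g x) \<le> 6 * s k" using Pj unfolding j P_def s(2) by simp
      then have "ennreal (norm (g x) powr p) \<le> ennreal ((6 * s k) powr p) * indicator {x. 3 * s k < norm (g x)} x"
        using k p by (auto intro!: ennreal_leI powr_mono2)
      also have "\<dots> \<le> (\<Sum>k<K. ennreal ((6 * s k) powr p) * indicator {x. 3 * s k < norm (g x)} x)"
        using jK j by (intro member_le_sum[of k]) auto
      finally show ?thesis using True by simp
    qed simp
    have "(\<integral>\<^sup>+x. ennreal (norm (g x) powr p) * indicator {x. 3 * h < norm (g x) \<and> norm (g x) \<le> 3 * (h * 2 ^ K)} x \<partial>lebesgue)
       \<le> (\<integral>\<^sup>+x. (\<Sum>k<K. ennreal ((6 * s k) powr p) * indicator {x. 3 * s k < norm (g x)} x) \<partial>lebesgue)"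
      by (intro nn_integral_mono 1)
    also have "\<dots> = (\<Sum>k<K. ennreal ((6 * s k) powr p) * emeasure lebesgue {x. 3 * s k < norm (g x)})"
      by (subst nn_integral_sum) (auto simp: nn_integral_cmult_indicator intro!: borel_measurable_times_ennreal)
    also have "\<dots> \<le> (\<Sum>k<K. ennreal ((6 * s k) powr p) *
        (ennreal (B1 / s k) * (\<integral>\<^sup>+x. ennreal (norm (f x)) * indicator {x. s k < norm (f x)} x \<partial>lebesgue)
         + ennreal (B2 / (s k)\<^sup>2) * (\<integral>\<^sup>+x. ennreal ((norm (f x))\<^sup>2) * indicator {x. norm (f x) \<le> s k} x \<partial>lebesgue)))"
      by (intro sum_mono mult_left_mono distr s) auto
    also have "\<dots> = (\<Sum>k<K. \<integral>\<^sup>+x. ennreal ((6 * s k) powr p) * (ennreal (B1 / s k) * (ennreal (norm (f x)) * indicator {x. s k < norm (f x)} x)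
         + ennreal (B2 / (s k)\<^sup>2) * (ennreal ((norm (f x))\<^sup>2) * indicator {x. norm (f x) \<le> s k} x)) \<partial>lebesgue)"
      by (intro sum.cong refl) (simp add: nn_integral_cmult nn_integral_add)
    also have "\<dots> = (\<integral>\<^sup>+x. (\<Sum>k<K. ennreal ((6 * s k) powr p) * (ennreal (B1 / s k) * (ennreal (norm (f x)) * indicator {x. s k < norm (f x)} x)
         + ennreal (B2 / (s k)\<^sup>2) * (ennreal ((norm (f x))\<^sup>2) * indicator {x. norm (f x) \<le> s k} x))) \<partial>lebesgue)"
      by (rule nn_integral_sum[symmetric]) measurable
    also have "\<dots> \<le> (\<integral>\<^sup>+x. ennreal ?D * ennreal (norm (f x) powr p) \<partial>lebesgue)"
    proof (rule nn_integral_mono)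
      fix x
      let ?a = "norm (f x)"
      define A1 where "A1 k = (if s k < ?a then s k powr (p - 1) else 0)" for k
      define A2 where "A2 k = (if ?a \<le> s k then s k powr (- (2 - p)) else 0)" for k
      have AE: "ennreal ((6 * s k) powr p) * (ennreal (B1 / s k) * (ennreal ?a * indicator {x. s k < norm (f x)} x)
         + ennreal (B2 / (s k)\<^sup>2) * (ennreal (?a\<^sup>2) * indicator {x. norm (f x) \<le> s k} x)) = ennreal (6 powr p * (B1 * ?a * A1 k + B2 * ?a\<^sup>2 * A2 k))" for k
      proof -
        have p1: "s k powr p / s k = s k powr (p - 1)" using s(1)[of k] by (simp add: powr_diff)
        have p2: "s k powr p / (s k)\<^sup>2 = s k powr (- (2 - p))"
        proof -
          have "s k powr (- (2 - p)) = s k powr (p - 2)" by simp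
          also have "\<dots> = s k powr p / s k powr 2" by (rule powr_diff)
          also have "s k powr 2 = (s k)\<^sup>2" using s(1)[of k] by simp
          finally show ?thesis ..
        qed
        have six: "(6 * s k) powr p = 6 powr p * s k powr p" using s(1)[of k] by (simp add: powr_mult)
        show ?thesis
        proof (cases "s k < ?a")
          case True
          have "(6 * s k) powr p * (B1 / s k * ?a) = 6 powr p * (B1 * ?a * (s k powr p / s k))" unfolding six by simp
          then have "(6 * s k) powr p * (B1 / s k * ?a) = 6 powr p * (B1 * ?a * A1 k + B2 * ?a\<^sup>2 * A2 k)"
            unfolding p1 using True by (simp add: A1_def A2_def)
          then show ?thesis using True C s(1)[of k] by (simp add: ennreal_mult[symmetric])
        next
          case False
          have "(6 * s k) powr p * (B2 / (s k)\<^sup>2 * ?a\<^sup>2) = 6 powr p * (B2 * ?a\<^sup>2 * (s k powr p / (s k)\<^sup>2))" unfolding six by simp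
          then have "(6 * s k) powr p * (B2 / (s k)\<^sup>2 * ?a\<^sup>2) = 6 powr p * (B1 * ?a * A1 k + B2 * ?a\<^sup>2 * A2 k)"
            unfolding p2 using False by (simp add: A1_def A2_def)
          then show ?thesis using False C s(1)[of k] by (simp add: ennreal_mult[symmetric])
        qed
      qed
      have A0: "A1 k \<ge> 0" "A2 k \<ge> 0" for k by (auto simp: A1_def A2_def)
      have "(\<Sum>k<K. 6 powr p * (B1 * ?a * A1 k + B2 * ?a\<^sup>2 * A2 k)) \<le> ?D * ?a powr p"
      proof (cases "?a = 0")
        case False
        then have a: "?a > 0" by simp
        have S1: "(\<Sum>k<K. A1 k) \<le> ?a powr (p - 1) / (1 - 2 powr (- (p - 1)))"
          unfolding A1_def s_def by (rule dyadic_sum_below[OF a h]) (use p in simp)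
        have S2: "(\<Sum>k<K. A2 k) \<le> ?a powr (- (2 - p)) / (1 - 2 powr (- (2 - p)))"
          unfolding A2_def s_def by (rule dyadic_sum_above[OF a h]) (use p in simp)
        have a1: "?a * ?a powr (p - 1) = ?a powr p" using a by (simp add: powr_diff)
        have a2: "?a\<^sup>2 * ?a powr (- (2 - p)) = ?a powr p"
        proof -
          have "?a powr 2 * ?a powr (- (2 - p)) = ?a powr p" unfolding powr_add[symmetric] by simp
          then show ?thesis using a by simp
        qed
        have "(\<Sum>k<K. 6 powr p * (B1 * ?a * A1 k + B2 * ?a\<^sup>2 * A2 k)) = 6 powr p * (B1 * ?a * (\<Sum>k<K. A1 k) + B2 * ?a\<^sup>2 * (\<Sum>k<K. A2 k))"
          by (simp only: sum_distrib_left sum.distrib distrib_left)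
        also have "\<dots> \<le> 6 powr p * (B1 * ?a * (?a powr (p - 1) / (1 - 2 powr (- (p - 1)))) + B2 * ?a\<^sup>2 * (?a powr (- (2 - p)) / (1 - 2 powr (- (2 - p)))))"
          using C by (intro mult_left_mono add_mono S1 S2) auto
        also have "\<dots> = 6 powr p * (B1 * (?a * ?a powr (p - 1)) / (1 - 2 powr (- (p - 1))) + B2 * (?a\<^sup>2 * ?a powr (- (2 - p))) / (1 - 2 powr (- (2 - p))))"
          by (simp only: mult.assoc times_divide_eq_right)
        also have "\<dots> = ?D * ?a powr p" unfolding a1 a2 by (simp only: distrib_right distrib_left mult.assoc times_divide_eq_left)
        finally show ?thesis .
      qed (use p in simp)
      moreover have "(\<Sum>k<K. ennreal (6 powr p * (B1 * ?a * A1 k + B2 * ?a\<^sup>2 * A2 k))) = ennreal (\<Sum>k<K. 6 powr p * (B1 * ?a * A1 k + B2 * ?a\<^sup>2 * A2 k))"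
        using C A0 by (intro sum_ennreal mult_nonneg_nonneg add_nonneg_nonneg) auto
      ultimately show "(\<Sum>k<K. ennreal ((6 * s k) powr p) * (ennreal (B1 / s k) * (ennreal ?a * indicator {x. s k < norm (f x)} x)
         + ennreal (B2 / (s k)\<^sup>2) * (ennreal (?a\<^sup>2) * indicator {x. norm (f x) \<le> s k} x))) \<le> ennreal ?D * ennreal (?a powr p)"
        unfolding AE using D0 by (simp only: ennreal_mult[symmetric] powr_ge_zero ennreal_leI)
    qed
    also have "\<dots> = ennreal ?D * (\<integral>\<^sup>+x. ennreal (norm (f x) powr p) \<partial>lebesgue)" by (rule nn_integral_cmult) measurable
    finally show ?thesis .
  qed
  \<comment> \<open>The range of heights, from \<open>2\<^sup>-\<^sup>N\<close> to \<open>2\<^sup>N\<close>, exhausts the positive numbers.\<close>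
  define G where "G N x = ennreal (norm (g x) powr p) * indicator {x. 3 * (1 / 2 ^ N) < norm (g x) \<and> norm (g x) \<le> 3 * (1 / 2 ^ N * 2 ^ (2 * N))} x" for N x
  have Gle: "(\<integral>\<^sup>+x. G N x \<partial>lebesgue) \<le> ennreal ?D * (\<integral>\<^sup>+x. ennreal (norm (f x) powr p) \<partial>lebesgue)" for N
    unfolding G_def by (rule main) simp
  have eq: "(1 / 2 ^ N * 2 ^ (2 * N) :: real) = 2 ^ N" for N :: nat
    by (simp add: mult_2 power_add)
  have inc: "incseq G"
  proof (rule incseq_SucI, rule le_funI)
    fix N x
    have "3 * (1 / 2 ^ Suc N) \<le> 3 * (1 / 2 ^ N :: real)" "3 * 2 ^ N \<le> 3 * (2 ^ Suc N :: real)" by (auto simp: field_simps)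
    then have "3 * (1 / 2 ^ Suc N) < norm (g x) \<and> norm (g x) \<le> 3 * 2 ^ Suc N" if "3 * (1 / 2 ^ N) < norm (g x) \<and> norm (g x) \<le> 3 * 2 ^ N"
      using that by linarith
    then show "G N x \<le> G (Suc N) x" unfolding G_def eq indicator_def mem_Collect_eq by (auto split: if_split simp del: power_Suc)
  qed
  have lim: "(\<lambda>N. G N x) \<longlonglongrightarrow> ennreal (norm (g x) powr p)" for x
  proof (cases "g x = 0")
    case True then show ?thesis using p by (simp add: G_def)
  next
    case False
    then have a: "norm (g x) > 0" by simp
    obtain N1 where N1: "3 / norm (g x) < 2 ^ N1" using real_arch_pow[of 2] by auto
    obtain N2 where N2: "norm (g x) < 2 ^ N2" using real_arch_pow[of 2] by auto
    have "G N x = ennreal (norm (g x) powr p)" if N: "N \<ge> max N1 N2" for N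
    proof -
      have "(2::real) ^ N1 \<le> 2 ^ N" "(2::real) ^ N2 \<le> 2 ^ N" using N by (auto intro!: power_increasing)
      then have "3 / norm (g x) < 2 ^ N" "norm (g x) < 2 ^ N" using N1 N2 by linarith+
      then have "3 * (1 / 2 ^ N) < norm (g x)" "norm (g x) \<le> 3 * 2 ^ N" using a by (simp add: field_simps, linarith)
      then show ?thesis unfolding G_def eq by simp
    qed
    then show ?thesis by (intro tendsto_eventually eventually_sequentiallyI)
  qed
  have "(\<lambda>N. \<integral>\<^sup>+x. G N x \<partial>lebesgue) \<longlonglongrightarrow> (\<integral>\<^sup>+x. ennreal (norm (g x) powr p) \<partial>lebesgue)"
  proof (rule nn_integral_LIMSEQ[OF inc _ lim])
    show "G N \<in> borel_measurable lebesgue" for N unfolding G_def[abs_def] by measurable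
  qed
  then show ?thesis by (rule LIMSEQ_le_const2) (use Gle in auto)
qed

section \<open>Square-integrable Hermite expansions\<close>

lemma L2_sq_hermite_comb:
  assumes A: "finite A"
  shows "L2_sq (hermite_comb A c) = (\<Sum>\<alpha>\<in>A. (norm (c \<alpha>))\<^sup>2)"
proof -
  let ?g = "hermite_comb A c"
  have g: "?g \<in> Lp 2" unfolding hermite_comb_def by (rule hermite_comb_Lp2)
  have "complex_of_real (L2_sq ?g) = L2_inner ?g ?g"
    unfolding L2_inner_def integral_complex_of_real[symmetric] by (simp only: complex_norm_square)
  also have "\<dots> = (\<Sum>\<alpha>\<in>A. cnj (c \<alpha>) * hermite_coeff \<alpha> ?g)" by (rule L2_inner_hermite_comb[OF g])
  also have "\<dots> = (\<Sum>\<alpha>\<in>A. complex_of_real ((norm (c \<alpha>))\<^sup>2))"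
  proof (rule sum.cong[OF refl])
    fix \<alpha> assume "\<alpha> \<in> A"
    then have "hermite_coeff \<alpha> ?g = c \<alpha>" unfolding hermite_comb_def by (simp add: hermite_coeff_comb[OF A])
    then show "cnj (c \<alpha>) * hermite_coeff \<alpha> ?g = complex_of_real ((norm (c \<alpha>))\<^sup>2)"
      by (simp only: complex_norm_square mult.commute)
  qed
  finally show ?thesis unfolding of_real_sum[symmetric] of_real_eq_iff .
qed

lemma hermite_Bessel:
  assumes f: "f \<in> Lp 2" and A: "finite A"
  shows "(\<Sum>\<alpha>\<in>A. (norm (hermite_coeff \<alpha> f))\<^sup>2) \<le> L2_sq f"
proof -
  let ?s = "hermite_comb A (\<lambda>\<alpha>. hermite_coeff \<alpha> f)" and ?S = "\<Sum>\<alpha>\<in>A. (norm (hermite_coeff \<alpha> f))\<^sup>2"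
  have s: "?s \<in> Lp 2" unfolding hermite_comb_def by (rule hermite_comb_Lp2)
  have "(\<lambda>x. cnj (?s x)) \<in> borel_measurable lebesgue"
    by (rule measurable_compose[OF Lp_measurable[OF s]]) (intro borel_measurable_continuous_onI continuous_intros)
  then have cs: "(\<lambda>x. cnj (?s x)) \<in> Lp 2" by (rule Lp_bound[OF s]) auto
  have S0: "?S \<ge> 0" by (intro sum_nonneg) auto
  have "(LINT x|lebesgue. f x * cnj (?s x)) = complex_of_real ?S"
    using L2_inner_hermite_comb[OF f, of A "\<lambda>\<alpha>. hermite_coeff \<alpha> f"]
    unfolding L2_inner_def of_real_sum complex_norm_square by (simp add: mult.commute)
  then have "?S\<^sup>2 \<le> L2_sq f * L2_sq (\<lambda>x. cnj (?s x))"
    using L2_Cauchy_Schwarz[OF f cs] by (simp only: norm_of_real power2_abs)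
  also have "L2_sq (\<lambda>x. cnj (?s x)) = ?S" by (simp add: L2_sq_hermite_comb[OF A])
  finally have "?S * ?S \<le> L2_sq f * ?S" by (simp add: power2_eq_square)
  then show ?thesis using S0 L2_sq_nonneg[of f] by (cases "?S = 0") (auto simp: mult_le_cancel_right)
qed

lemma hermite_sum_eq_comb: "hermite_sum R G f = hermite_comb {\<alpha>. sum \<alpha> UNIV < R} (\<lambda>\<alpha>. G (sum \<alpha> UNIV) * hermite_coeff \<alpha> f)"
  by (auto simp: hermite_sum_def hermite_comb_def)

lemma hermite_sum_contraction:
  assumes f: "f \<in> Lp 2" and G: "\<And>k. norm (G k) \<le> 1"
  shows "L2_sq (hermite_sum R G f) \<le> L2_sq f"
proof -
  have "L2_sq (hermite_sum R G f) = (\<Sum>\<alpha> | sum \<alpha> UNIV < R. (norm (G (sum \<alpha> UNIV)))\<^sup>2 * (norm (hermite_coeff \<alpha> f))\<^sup>2)"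
    unfolding hermite_sum_eq_comb by (simp add: L2_sq_hermite_comb finite_multiindices norm_mult power_mult_distrib)
  also have "\<dots> \<le> (\<Sum>\<alpha> | sum \<alpha> UNIV < R. 1 * (norm (hermite_coeff \<alpha> f))\<^sup>2)"
    by (intro sum_mono mult_right_mono) (auto simp: power_le_one G)
  also have "\<dots> \<le> L2_sq f" using hermite_Bessel[OF f, of "{\<alpha>. sum \<alpha> UNIV < R}"] by (simp add: finite_multiindices)
  finally show ?thesis .
qed

lemma hermite_coeff_tendsto:
  assumes f: "\<And>i. f i \<in> Lp 2" and h: "h \<in> Lp 2" and lim: "(\<lambda>i. L2_sq (\<lambda>x. f i x - h x)) \<longlonglongrightarrow> 0"
  shows "(\<lambda>i. hermite_coeff \<beta> (f i)) \<longlonglongrightarrow> hermite_coeff \<beta> h"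
proof -
  let ?H = "\<lambda>x. complex_of_real (hermite \<beta> x)"
  have d: "(\<lambda>x. f i x - h x) \<in> Lp 2" for i by (intro Lp_diff f h) simp
  have "(norm (hermite_coeff \<beta> (f i) - hermite_coeff \<beta> h))\<^sup>2 \<le> L2_sq (\<lambda>x. f i x - h x) * L2_sq ?H" for i
    using L2_Cauchy_Schwarz[OF d hermite_Lp2, of i \<beta>] unfolding hermite_coeff_diff[OF f h, symmetric] unfolding hermite_coeff_def .
  note le = this
  have "(\<lambda>i. L2_sq (\<lambda>x. f i x - h x) * L2_sq ?H) \<longlonglongrightarrow> 0" by (rule tendsto_mult_left_zero[OF lim])
  then have "(\<lambda>i. (norm (hermite_coeff \<beta> (f i) - hermite_coeff \<beta> h))\<^sup>2) \<longlonglongrightarrow> 0"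
    by (rule tendsto_sandwich[OF always_eventually always_eventually tendsto_const, rotated 2]) (intro allI zero_le_power2 le)+
  then have "(\<lambda>i. sqrt ((norm (hermite_coeff \<beta> (f i) - hermite_coeff \<beta> h))\<^sup>2)) \<longlonglongrightarrow> sqrt 0" by (rule tendsto_real_sqrt)
  then show ?thesis by (simp add: LIM_zero_iff tendsto_norm_zero_iff)
qed

lemma hermite_kernel_restrict:
  assumes "R' \<le> R" "\<And>k. k \<ge> R' \<Longrightarrow> G k = 0"
  shows "hermite_kernel R G x y = hermite_kernel R' G x y"
  unfolding hermite_kernel_def
  by (rule sum.mono_neutral_right) (use assms finite_multiindices in \<open>auto simp: not_less\<close>)

lemma hermite_kernel_sum:
  "hermite_kernel R (\<lambda>k. \<Sum>i\<in>I. G i k) x y = (\<Sum>i\<in>I. hermite_kernel R (G i) x y)"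
  unfolding hermite_kernel_def sum_distrib_right by (rule sum.swap)

text \<open>
  Each term is at most six times the increment of \<open>v / (1 + v)\<close> from \<open>v\<close> to \<open>2 v\<close>, so the sum telescopes.
\<close>

lemma sum_min_dyadic:
  fixes u :: real
  assumes u: "u > 0"
  shows "(\<Sum>p\<le>J. min (u * 2 ^ p) (1 / (u * 2 ^ p))) \<le> 6"
proof -
  define f :: "real \<Rightarrow> real" where "f v = v / (1 + v)" for v
  have step: "min v (1 / v) \<le> 6 * (f (2 * v) - f v)" if v: "v > 0" for v
  proof -
    have eq: "f (2 * v) - f v = v / ((1 + v) * (1 + 2 * v))"
      unfolding f_def using v by (simp add: field_simps)
    show ?thesis
    proof (cases "v \<le> 1")
      case True
      have "(1 + v) * (1 + 2 * v) \<le> 2 * 3" using True v by (intro mult_mono) auto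
      then have "v / 6 \<le> v / ((1 + v) * (1 + 2 * v))" using v by (intro divide_left_mono) auto
      then have "v \<le> 6 * (f (2 * v) - f v)" unfolding eq by (simp add: mult.commute)
      then show ?thesis by (rule order_trans[OF min.cobounded1])
    next
      case False
      have "(1 + v) * (1 + 2 * v) \<le> (2 * v) * (3 * v)" using False v by (intro mult_mono) auto
      then have "v / ((2 * v) * (3 * v)) \<le> v / ((1 + v) * (1 + 2 * v))" using v by (intro divide_left_mono) auto
      also have "v / ((2 * v) * (3 * v)) = (1 / v) / 6" using v by (simp add: field_simps)
      finally have "1 / v \<le> 6 * (f (2 * v) - f v)" unfolding eq by simp
      then show ?thesis by (rule order_trans[OF min.cobounded2])
    qed
  qed
  have "(\<Sum>p\<le>J. min (u * 2 ^ p) (1 / (u * 2 ^ p))) \<le> (\<Sum>p\<le>J. 6 * (f (u * 2 ^ Suc p) - f (u * 2 ^ p)))"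
  proof (rule sum_mono)
    fix p show "min (u * 2 ^ p) (1 / (u * 2 ^ p)) \<le> 6 * (f (u * 2 ^ Suc p) - f (u * 2 ^ p))"
      using step[of "u * 2 ^ p"] u by (simp add: mult_ac)
  qed
  also have "\<dots> = 6 * (f (u * 2 ^ Suc J) - f u)"
    unfolding sum_distrib_left[symmetric] using sum_lessThan_telescope[of "\<lambda>p. f (u * 2 ^ p)" "Suc J"]
    by (simp add: lessThan_Suc_atMost)
  also have "\<dots> \<le> 6 * 1"
  proof (intro mult_left_mono)
    have "f v \<le> 1" "0 \<le> f v" if "v \<ge> 0" for v using that by (auto simp: f_def field_simps)
    from this(1)[of "u * 2 ^ Suc J"] this(2)[of u] show "f (u * 2 ^ Suc J) - f u \<le> 1" using u by simp
  qed simp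
  finally show ?thesis by simp
qed

lemma Abel_summation:
  fixes \<phi> d :: "nat \<Rightarrow> 'a::comm_ring"
  shows "(\<Sum>k<R. \<phi> k * d k) = (\<Sum>k<R. (\<phi> k - \<phi> (Suc k)) * (\<Sum>i<Suc k. d i)) + \<phi> R * (\<Sum>i<R. d i)"
  by (induction R) (auto simp: algebra_simps)

lemma norm_convex_comb_sq_le:
  fixes z :: "nat \<Rightarrow> complex"
  assumes w: "\<And>k. k < R \<Longrightarrow> w k \<ge> 0" and 1: "(\<Sum>k<R. w k) = 1"
  shows "(norm (\<Sum>k<R. of_real (w k) * z k))\<^sup>2 \<le> (\<Sum>k<R. w k * (norm (z k))\<^sup>2)"
proof -
  have "norm (\<Sum>k<R. of_real (w k) * z k) \<le> (\<Sum>k<R. sqrt (w k) * (sqrt (w k) * norm (z k)))"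
  proof (rule order_trans[OF norm_sum], rule sum_mono)
    fix k assume "k \<in> {..<R}"
    then have "w k \<ge> 0" using w by simp
    then show "norm (of_real (w k) * z k) \<le> sqrt (w k) * (sqrt (w k) * norm (z k))"
      by (simp add: norm_mult mult.assoc[symmetric])
  qed
  then have "(norm (\<Sum>k<R. of_real (w k) * z k))\<^sup>2 \<le> (\<Sum>k<R. sqrt (w k) * (sqrt (w k) * norm (z k)))\<^sup>2"
    by (intro power_mono) auto
  also have "\<dots> \<le> (\<Sum>k<R. (sqrt (w k))\<^sup>2) * (\<Sum>k<R. (sqrt (w k) * norm (z k))\<^sup>2)" by (rule Cauchy_Schwarz_ineq_sum)
  also have "(\<Sum>k<R. (sqrt (w k))\<^sup>2) = (\<Sum>k<R. w k)" using w by (intro sum.cong) auto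
  also have "(\<Sum>k<R. (sqrt (w k) * norm (z k))\<^sup>2) = (\<Sum>k<R. w k * (norm (z k))\<^sup>2)"
    using w by (intro sum.cong) (auto simp: power_mult_distrib)
  finally show ?thesis unfolding 1 by simp
qed

section \<open>Smooth truncations of the pseudo-multiplier\<close>

text \<open>
  The hypotheses on \<open>m\<close>, with the bounds on the differences already transferred to the sequence
  \<open>k \<mapsto> m(x,2k+n)\<close> of values along the spectrum.
\<close>

locale hermite_multiplier =
  fixes m :: "real^'n::finite \<Rightarrow> nat \<Rightarrow> complex" and B A D :: real
  assumes symbol_bounded: "\<And>x k. norm (m x k) \<le> B"
    and dense: "dense_in_Lp 2 (Domain (hermite_pseudo_multiplier m))"
    and L2_bound: "\<And>f g. (f, g) \<in> hermite_pseudo_multiplier m \<Longrightarrow> L2_sq g \<le> A * L2_sq f" and A0: "A \<ge> 0"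
    and differences: "\<And>x l k. l \<le> CARD('n) + 1 \<Longrightarrow>
      norm ((fdiff ^^ l) (\<lambda>k. m x (2 * k + CARD('n))) k) \<le> D / real (k + 1) ^ l" and D0: "D \<ge> 0"
begin

definition symbol :: "real^'n \<Rightarrow> nat \<Rightarrow> complex" where
  "symbol x k = m x (2 * k + CARD('n))"

definition mult :: "nat \<Rightarrow> (nat \<Rightarrow> complex) \<Rightarrow> (real^'n \<Rightarrow> complex) \<Rightarrow> real^'n \<Rightarrow> complex" where
  "mult R G f x = hermite_sum R (\<lambda>k. symbol x k * G k) f x"

lemma norm_symbol: "norm (symbol x k) \<le> B"
  unfolding symbol_def by (rule symbol_bounded)

lemma mult_eq:
  assumes f: "f \<in> Lp 2"
  shows "mult R G f x = (\<Sum>k<R. G k * (symbol x k * hermite_proj k f x))"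
proof -
  let ?S = "{\<alpha> :: 'n \<Rightarrow> nat. sum \<alpha> UNIV < R}"
  let ?h = "\<lambda>\<alpha>. symbol x (sum \<alpha> UNIV) * G (sum \<alpha> UNIV) * hermite_coeff \<alpha> f * of_real (hermite \<alpha> x)"
  have "mult R G f x = sum ?h ?S" by (simp add: mult_def hermite_sum_def)
  also have "\<dots> = (\<Sum>k<R. sum ?h {\<alpha> \<in> ?S. sum \<alpha> UNIV = k})"
    by (rule sum.group[symmetric]) (auto simp: finite_multiindices)
  also have "\<dots> = (\<Sum>k<R. G k * (symbol x k * hermite_proj k f x))"
  proof (rule sum.cong[OF refl])
    fix k assume "k \<in> {..<R}"
    then have "{\<alpha> \<in> ?S. sum \<alpha> UNIV = k} = {\<alpha>. sum \<alpha> UNIV = k}" by auto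
    then show "sum ?h {\<alpha> \<in> ?S. sum \<alpha> UNIV = k} = G k * (symbol x k * hermite_proj k f x)"
      unfolding hermite_proj_eq[OF f] hermite_comb_def by (simp add: sum_distrib_left mult_ac)
  qed
  finally show ?thesis .
qed

lemma pseudo_mult_sum_eq:
  assumes f: "f \<in> Lp 2"
  shows "pseudo_mult_sum m N f x = (\<Sum>k<N. symbol x k * hermite_proj k f x)" "pseudo_mult_sum m N f x = mult N (\<lambda>_. 1) f x"
  unfolding mult_eq[OF f] by (simp_all add: pseudo_mult_sum_def symbol_def)

text \<open>
  Measurability of \<open>m(\<sqdot>,2k+n) h\<^sub>\<alpha>\<close>, \<open>k = \<bar>\<alpha>\<bar>\<close>, is a consequence of the dense domain. If \<open>f\<^sub>i\<close> in the domain tends to \<open>h\<^sub>\<alpha>\<close> in \<open>L\<^sup>2\<close>, then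
  \<open>m P\<^sub>k f\<^sub>i\<close> is a difference of two partial sums, which are measurable, and it converges pointwise to \<open>m h\<^sub>\<alpha>\<close>
  because \<open>P\<^sub>k f\<^sub>i\<close> is determined by finitely many coefficients.
\<close>

lemma symbol_hermite_measurable:
  "(\<lambda>x. symbol x (sum \<alpha> UNIV) * of_real (hermite \<alpha> x)) \<in> borel_measurable lebesgue"
proof -
  let ?k = "sum \<alpha> UNIV" and ?h = "\<lambda>x. complex_of_real (hermite \<alpha> x)"
  have h: "?h \<in> Lp 2" by (rule hermite_Lp2)
  have "\<exists>f. f \<in> Domain (hermite_pseudo_multiplier m) \<and> f \<in> Lp 2 \<and> Lp_norm 2 (\<lambda>x. ?h x - f x) < 1 / real (Suc i)" (is "?P i") for i
  proof -
    have "0 < 1 / real (Suc i)" by simp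
    from dense[unfolded dense_in_Lp_def, rule_format, OF h this] show ?thesis by blast
  qed
  then have "\<forall>i. ?P i" by (rule allI)
  from choice[OF this] obtain f where f: "\<And>i. f i \<in> Domain (hermite_pseudo_multiplier m)" "\<And>i. f i \<in> Lp 2"
      "\<And>i. Lp_norm 2 (\<lambda>x. ?h x - f i x) < 1 / real (Suc i)" by blast
  have "(\<lambda>i. sqrt (L2_sq (\<lambda>x. f i x - ?h x))) \<longlonglongrightarrow> 0"
  proof (rule tendsto_sandwich[OF _ _ tendsto_const LIMSEQ_Suc[OF lim_1_over_n]])
    show "\<forall>\<^sub>F i in sequentially. sqrt (L2_sq (\<lambda>x. f i x - ?h x)) \<le> 1 / of_nat (Suc i)"
      using f(3) by (intro always_eventually allI less_imp_le) (simp add: Lp_norm_2 norm_minus_commute)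
  qed simp
  then have "(\<lambda>i. (sqrt (L2_sq (\<lambda>x. f i x - ?h x)))\<^sup>2) \<longlonglongrightarrow> 0\<^sup>2" by (rule tendsto_power)
  then have lim: "(\<lambda>i. L2_sq (\<lambda>x. f i x - ?h x)) \<longlonglongrightarrow> 0" by simp
  show ?thesis
  proof (rule borel_measurable_LIMSEQ_metric)
    fix i
    have "pseudo_mult_sum m N (f i) \<in> Lp 2" for N
      using f(1)[of i] unfolding hermite_pseudo_multiplier_def by auto
    then have "(\<lambda>x. pseudo_mult_sum m (Suc ?k) (f i) x - pseudo_mult_sum m ?k (f i) x) \<in> borel_measurable lebesgue"
      by (intro borel_measurable_diff Lp_measurable)
    also have "(\<lambda>x. pseudo_mult_sum m (Suc ?k) (f i) x - pseudo_mult_sum m ?k (f i) x) = (\<lambda>x. symbol x ?k * hermite_proj ?k (f i) x)"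
      by (simp add: pseudo_mult_sum_eq(1)[OF f(2)])
    finally show "(\<lambda>x. symbol x ?k * hermite_proj ?k (f i) x) \<in> borel_measurable lebesgue" .
  next
    fix x
    have fin: "finite {\<beta> :: 'n \<Rightarrow> nat. sum \<beta> UNIV = ?k}" by (rule finite_multiindices_eq)
    have "(\<lambda>i. symbol x ?k * (\<Sum>\<beta> | sum \<beta> UNIV = ?k. hermite_coeff \<beta> (f i) * of_real (hermite \<beta> x)))
        \<longlonglongrightarrow> symbol x ?k * (\<Sum>\<beta> | sum \<beta> UNIV = ?k. hermite_coeff \<beta> ?h * of_real (hermite \<beta> x))"
      by (intro tendsto_mult[OF tendsto_const] tendsto_sum tendsto_mult[OF _ tendsto_const] hermite_coeff_tendsto[OF f(2) h lim])
    also have "(\<Sum>\<beta> | sum \<beta> UNIV = ?k. hermite_coeff \<beta> ?h * of_real (hermite \<beta> x)) = ?h x"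
      using fin by (subst sum.remove[of _ \<alpha>]) (auto simp: hermite_coeff_hermite)
    finally show "(\<lambda>i. symbol x ?k * hermite_proj ?k (f i) x) \<longlonglongrightarrow> symbol x ?k * ?h x"
      unfolding hermite_proj_eq[OF f(2)] hermite_comb_def .
  qed
qed

lemma symbol_hermite_Lp2: "(\<lambda>x. symbol x (sum \<alpha> UNIV) * of_real (hermite \<alpha> x)) \<in> Lp 2"
proof (rule Lp_bound[OF Lp_cmult[OF hermite_Lp2, of "of_real B"] symbol_hermite_measurable])
  fix x
  have "\<bar>B\<bar> \<ge> B" by simp
  then show "norm (symbol x (sum \<alpha> UNIV) * of_real (hermite \<alpha> x)) \<le> norm (complex_of_real B * of_real (hermite \<alpha> x))"
    unfolding norm_mult norm_of_real using norm_symbol[of x] by (intro mult_right_mono order_trans[OF norm_symbol]) auto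
qed simp

lemma mult_Lp2: "mult R G f \<in> Lp 2"
proof -
  have "mult R G f = (\<lambda>x. \<Sum>\<alpha> | sum \<alpha> UNIV < R. (G (sum \<alpha> UNIV) * hermite_coeff \<alpha> f) * (symbol x (sum \<alpha> UNIV) * of_real (hermite \<alpha> x)))"
    by (auto simp: mult_def hermite_sum_def mult_ac)
  moreover have "\<dots> \<in> Lp 2" by (intro Lp_sum Lp_cmult symbol_hermite_Lp2) simp
  ultimately show ?thesis by simp
qed

lemma kernel_measurable:
  "(\<lambda>x. hermite_kernel R (\<lambda>k. symbol x k * G k) x y) \<in> borel_measurable lebesgue"
proof -
  have "(\<lambda>x. hermite_kernel R (\<lambda>k. symbol x k * G k) x y)
     = (\<lambda>x. \<Sum>\<alpha> | sum \<alpha> UNIV < R. (G (sum \<alpha> UNIV) * of_real (hermite \<alpha> y)) * (symbol x (sum \<alpha> UNIV) * of_real (hermite \<alpha> x)))"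
    by (auto simp: hermite_kernel_def mult_ac)
  moreover have "\<dots> \<in> borel_measurable lebesgue"
    by (intro borel_measurable_sum borel_measurable_times borel_measurable_const symbol_hermite_measurable)
  ultimately show ?thesis by simp
qed

text \<open>
  The truncated operator is \<open>m(x,H)\<close> applied to a finite Hermite expansion. This gives both the \<open>L\<^sup>2\<close> bound for
  the truncations and a rich supply of functions in the domain.
\<close>

lemma mult_in_graph: "(hermite_sum R G f, mult R G f) \<in> hermite_pseudo_multiplier m"
proof -
  let ?f = "hermite_sum R G f"
  have f: "?f \<in> Lp 2" by (rule hermite_sum_Lp2)
  have coeff: "hermite_coeff \<alpha> ?f = (if sum \<alpha> UNIV < R then G (sum \<alpha> UNIV) * hermite_coeff \<alpha> f else 0)" for \<alpha>
    unfolding hermite_sum_eq_comb hermite_comb_def by (subst hermite_coeff_comb) (auto simp: finite_multiindices)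
  have "pseudo_mult_sum m N ?f x = mult R G f x" if "N \<ge> R" for N x
  proof -
    have "pseudo_mult_sum m N ?f x = (\<Sum>\<alpha> | sum \<alpha> UNIV < N. symbol x (sum \<alpha> UNIV) * hermite_coeff \<alpha> ?f * of_real (hermite \<alpha> x))"
      unfolding pseudo_mult_sum_eq(2)[OF f] by (simp add: mult_def hermite_sum_def)
    also have "\<dots> = (\<Sum>\<alpha> | sum \<alpha> UNIV < R. symbol x (sum \<alpha> UNIV) * hermite_coeff \<alpha> ?f * of_real (hermite \<alpha> x))"
      by (rule sum.mono_neutral_right) (use that in \<open>auto simp: finite_multiindices coeff\<close>)
    also have "\<dots> = (\<Sum>\<alpha> | sum \<alpha> UNIV < R. symbol x (sum \<alpha> UNIV) * (G (sum \<alpha> UNIV) * hermite_coeff \<alpha> f) * of_real (hermite \<alpha> x))"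
      by (rule sum.cong) (auto simp: coeff)
    also have "\<dots> = mult R G f x" by (simp add: mult_def hermite_sum_def mult.assoc)
    finally show ?thesis .
  qed
  then have "Lp_norm 2 (\<lambda>x. pseudo_mult_sum m N ?f x - mult R G f x) = 0" if "N \<ge> R" for N
    using that by (simp add: Lp_norm_2)
  then have "(\<lambda>N. Lp_norm 2 (\<lambda>x. pseudo_mult_sum m N ?f x - mult R G f x)) \<longlonglongrightarrow> 0"
    by (intro tendsto_eventually) (auto simp: eventually_sequentially)
  moreover have "pseudo_mult_sum m N ?f \<in> Lp 2" for N
  proof -
    have "pseudo_mult_sum m N ?f = mult N (\<lambda>_. 1) ?f" by (rule ext) (rule pseudo_mult_sum_eq(2)[OF f])
    then show ?thesis by (simp add: mult_Lp2)
  qed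
  ultimately show ?thesis unfolding hermite_pseudo_multiplier_def using f mult_Lp2 by simp
qed

lemma mult_L2_bound:
  assumes "f \<in> Lp 2" "\<And>k. norm (G k) \<le> 1"
  shows "L2_sq (mult R G f) \<le> A * L2_sq f"
  by (rule order_trans[OF L2_bound[OF mult_in_graph]]) (intro mult_left_mono hermite_sum_contraction assms A0)

text \<open>
  The operators \<open>T\<^sub>J\<close>: the symbol is multiplied by the cutoff that is \<open>1\<close> below \<open>4\<^sup>J\<close>.
\<close>

definition truncation :: "nat \<Rightarrow> (real^'n \<Rightarrow> complex) \<Rightarrow> real^'n \<Rightarrow> complex" where
  "truncation J f = mult ((CARD('n) + 2) * 4 ^ J) (smooth_symbol (CARD('n) + 1) (4 ^ J)) f"

lemma truncation_Lp2: "truncation J f \<in> Lp 2"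
  unfolding truncation_def by (rule mult_Lp2)

lemma truncation_L2_bound: "f \<in> Lp 2 \<Longrightarrow> L2_sq (truncation J f) \<le> A * L2_sq f"
  unfolding truncation_def
  by (rule mult_L2_bound) (auto simp: smooth_symbol_def cutoff_range)

lemma truncation_diff:
  "f \<in> Lp 2 \<Longrightarrow> g \<in> Lp 2 \<Longrightarrow> truncation J (\<lambda>x. f x - g x) x = truncation J f x - truncation J g x"
  unfolding truncation_def mult_def hermite_sum_def
  by (simp add: hermite_coeff_diff sum_subtractf[symmetric] algebra_simps)

text \<open>
  Summation by parts writes \<open>T\<^sub>J f\<close> as an average of the partial sums of \<open>m(x,H) f\<close> with weights
  \<open>\<phi>(k) - \<phi>(k+1)\<close>. The weights are nonnegative with sum one, and they vanish for \<open>k + 1 < 4\<^sup>J\<close>; by convexity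
  \<open>T\<^sub>J f\<close> is as close to \<open>g\<close> in \<open>L\<^sup>2\<close> as the partial sums from \<open>4\<^sup>J\<close> on.
\<close>

lemma truncation_tendsto:
  assumes fg: "(f, g) \<in> hermite_pseudo_multiplier m"
  shows "(\<lambda>J. L2_sq (\<lambda>x. truncation J f x - g x)) \<longlonglongrightarrow> 0"
proof -
  have f: "f \<in> Lp 2" and g: "g \<in> Lp 2" and s: "\<And>N. pseudo_mult_sum m N f \<in> Lp 2"
    and lim: "(\<lambda>N. Lp_norm 2 (\<lambda>x. pseudo_mult_sum m N f x - g x)) \<longlonglongrightarrow> 0"
    using fg unfolding hermite_pseudo_multiplier_def by auto
  define E where "E N = L2_sq (\<lambda>x. pseudo_mult_sum m N f x - g x)" for N
  have E0: "E N \<ge> 0" for N unfolding E_def by (rule L2_sq_nonneg)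
  have "(\<lambda>N. (sqrt (E N))\<^sup>2) \<longlonglongrightarrow> 0\<^sup>2" using tendsto_power[OF lim, of 2] unfolding Lp_norm_2 E_def .
  then have Elim: "E \<longlonglongrightarrow> 0" using E0 by simp
  have sg: "(\<lambda>x. pseudo_mult_sum m N f x - g x) \<in> Lp 2" for N by (intro Lp_diff s g) simp
  have tg: "(\<lambda>x. truncation J f x - g x) \<in> Lp 2" for J by (intro Lp_diff truncation_Lp2 g) simp
  have key: "L2_sq (\<lambda>x. truncation J f x - g x) \<le> e" if e: "\<And>N. N \<ge> 4 ^ J \<Longrightarrow> E N \<le> e" for J e
  proof -
    define R where "R = (CARD('n) + 2) * 4 ^ J"
    define \<phi> where "\<phi> = cutoff (CARD('n) + 1) (4 ^ J)"
    define w where "w k = \<phi> k - \<phi> (Suc k)" for k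
    have w0: "w k \<ge> 0" for k unfolding w_def \<phi>_def using cutoff_antimono by (simp add: antimono_def)
    have wz: "w k = 0" if "Suc k < 4 ^ J" for k unfolding w_def \<phi>_def using that by (simp add: cutoff_eq_1)
    have R0: "\<phi> R = 0" unfolding \<phi>_def R_def by (rule cutoff_eq_0) simp
    have "\<phi> 0 = 1" unfolding \<phi>_def by (rule cutoff_eq_1) auto
    then have w1: "(\<Sum>k<R. w k) = 1" unfolding w_def sum_lessThan_telescope' using R0 by simp
    have pt: "(norm (truncation J f x - g x))\<^sup>2 \<le> (\<Sum>k<R. w k * (norm (pseudo_mult_sum m (Suc k) f x - g x))\<^sup>2)" for x
    proof -
      have "truncation J f x = (\<Sum>k<R. of_real (\<phi> k) * (symbol x k * hermite_proj k f x))"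
        unfolding truncation_def mult_eq[OF f] R_def \<phi>_def smooth_symbol_def ..
      also have "\<dots> = (\<Sum>k<R. (of_real (\<phi> k) - of_real (\<phi> (Suc k))) * (\<Sum>i<Suc k. symbol x i * hermite_proj i f x))"
        unfolding Abel_summation[of "\<lambda>k. of_real (\<phi> k)"] R0 by simp
      also have "\<dots> = (\<Sum>k<R. of_real (w k) * pseudo_mult_sum m (Suc k) f x)"
        unfolding pseudo_mult_sum_eq(1)[OF f] w_def of_real_diff ..
      finally have "truncation J f x - g x = (\<Sum>k<R. of_real (w k) * (pseudo_mult_sum m (Suc k) f x - g x))"
        using w1 by (simp add: right_diff_distrib sum_subtractf sum_distrib_right[symmetric] of_real_sum[symmetric] del: of_real_sum)
      then show ?thesis using norm_convex_comb_sq_le[of R w, OF w0 w1] by simp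
    qed
    have int: "integrable lebesgue (\<lambda>x. (norm (pseudo_mult_sum m N f x - g x))\<^sup>2)" for N using sg by (simp add: Lp_2_iff)
    have "L2_sq (\<lambda>x. truncation J f x - g x) \<le> (LINT x|lebesgue. (\<Sum>k<R. w k * (norm (pseudo_mult_sum m (Suc k) f x - g x))\<^sup>2))"
      by (rule integral_mono[OF _ _ pt]) (use tg in \<open>auto simp: Lp_2_iff intro!: int\<close>)
    also have "\<dots> = (\<Sum>k<R. w k * E (Suc k))" unfolding E_def by (simp add: int)
    also have "\<dots> \<le> (\<Sum>k<R. w k * e)"
    proof (rule sum_mono)
      fix k show "w k * E (Suc k) \<le> w k * e"
        using e[of "Suc k"] wz[of k] w0[of k] by (cases "Suc k < 4 ^ J") (auto intro: mult_left_mono)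
    qed
    also have "\<dots> = e" using w1 by (simp add: sum_distrib_right[symmetric])
    finally show ?thesis .
  qed
  show ?thesis
  proof (rule LIMSEQ_I)
    fix r :: real assume r: "r > 0"
    then obtain N0 where N0: "\<And>N. N \<ge> N0 \<Longrightarrow> E N < r / 2" using LIMSEQ_D[OF Elim, of "r / 2"] E0 by auto
    have "norm (L2_sq (\<lambda>x. truncation J f x - g x) - 0) < r" if "J \<ge> N0" for J
    proof -
      have "J < 4 ^ J" by (induction J) auto
      then have "L2_sq (\<lambda>x. truncation J f x - g x) \<le> r / 2" using that N0 by (intro key) (auto intro!: less_imp_le)
      then show ?thesis using r L2_sq_nonneg[of "\<lambda>x. truncation J f x - g x"] by simp
    qed
    then show "\<exists>no. \<forall>J\<ge>no. norm (L2_sq (\<lambda>x. truncation J f x - g x) - 0) < r" by blast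
  qed
qed

section \<open>The kernels of the truncations\<close>

definition kernel :: "nat \<Rightarrow> real^'n \<Rightarrow> real^'n \<Rightarrow> complex" where
  "kernel J x y = hermite_kernel ((CARD('n) + 2) * 4 ^ J) (\<lambda>k. symbol x k * smooth_symbol (CARD('n) + 1) (4 ^ J) k) x y"

definition piece :: "nat \<Rightarrow> real^'n \<Rightarrow> real^'n \<Rightarrow> complex" where
  "piece p x y = hermite_kernel ((CARD('n) + 2) * 4 ^ p) (\<lambda>k. symbol x k * of_real (cutoff_piece (CARD('n) + 1) p k)) x y"

lemma truncation_eq_kernel:
  "f \<in> Lp 2 \<Longrightarrow> truncation J f x = (LINT y|lebesgue. kernel J x y * f y)"
  unfolding truncation_def mult_def kernel_def by (rule hermite_sum_eq_kernel(2))

lemma kernel_eq_pieces: "kernel J x y = (\<Sum>p\<le>J. piece p x y)"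
proof -
  have "kernel J x y = hermite_kernel ((CARD('n) + 2) * 4 ^ J) (\<lambda>k. \<Sum>p\<le>J. symbol x k * of_real (cutoff_piece (CARD('n) + 1) p k)) x y"
    unfolding kernel_def smooth_symbol_def sum_cutoff_piece[symmetric] of_real_sum sum_distrib_left ..
  also have "\<dots> = (\<Sum>p\<le>J. hermite_kernel ((CARD('n) + 2) * 4 ^ J) (\<lambda>k. symbol x k * of_real (cutoff_piece (CARD('n) + 1) p k)) x y)"
    by (rule hermite_kernel_sum)
  also have "\<dots> = (\<Sum>p\<le>J. piece p x y)"
  proof (rule sum.cong[OF refl])
    fix p assume "p \<in> {..J}"
    then have le: "(CARD('n) + 2) * 4 ^ p \<le> (CARD('n) + 2) * 4 ^ J" by (intro mult_le_mono2 power_increasing) auto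
    show "hermite_kernel ((CARD('n) + 2) * 4 ^ J) (\<lambda>k. symbol x k * of_real (cutoff_piece (CARD('n) + 1) p k)) x y = piece p x y"
      unfolding piece_def by (rule hermite_kernel_restrict[OF le]) (simp add: cutoff_piece_eq_0(1))
  qed
  finally show ?thesis .
qed

text \<open>
  The square root of the height \<open>(n + 2) 4\<^sup>p\<close> at which the \<open>p\<close>-th piece of the symbol ends.
\<close>

definition scale :: "nat \<Rightarrow> real" where "scale p = sqrt (real (CARD('n) + 2)) * 2 ^ p"

lemma scale_eq: "sqrt (real ((CARD('n) + 2) * 4 ^ p)) = scale p"
proof -
  have "sqrt (4 ^ p) = 2 ^ p" by (simp add: real_sqrt_power)
  then show ?thesis by (simp only: scale_def real_sqrt_mult of_nat_mult of_nat_power of_nat_numeral)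
qed

lemma scale_pos: "scale p > 0"
  by (simp add: scale_def)

lemma piece_bounds:
  obtains C where "C \<ge> 0" "\<And>p x y. norm (piece p x y) \<le> C * bump (scale p) (x - y)"
    "\<And>p x y y' r. norm (y' - y) \<le> r \<Longrightarrow> 2 * r < norm (x - y) \<Longrightarrow>
       norm (piece p x y' - piece p x y) \<le> C * (scale p * r) * bump (scale p) (x - y)"
proof -
  obtain C where C: "C \<ge> 0"
     "\<And>R A G x y :: real^'n. R \<ge> 1 \<Longrightarrow> (\<And>k. k \<ge> R \<Longrightarrow> G k = 0) \<Longrightarrow>
       (\<And>l k. l \<le> CARD('n) + 1 \<Longrightarrow> norm ((fdiff ^^ l) G k) \<le> A / real R ^ l) \<Longrightarrow>
       norm (hermite_kernel R G x y) \<le> C * A * bump (sqrt (real R)) (x - y)"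
     "\<And>R A G x y y' r. R \<ge> 1 \<Longrightarrow> (\<And>k. k \<ge> R \<Longrightarrow> G k = 0) \<Longrightarrow>
       (\<And>l k. l \<le> CARD('n) + 1 \<Longrightarrow> norm ((fdiff ^^ l) G k) \<le> A / real R ^ l) \<Longrightarrow>
       norm (y' - y) \<le> r \<Longrightarrow> 2 * r < norm (x - y) \<Longrightarrow>
        norm (hermite_kernel R G x y' - hermite_kernel R G x y) \<le> C * A * (sqrt (real R) * r) * bump (sqrt (real R)) (x - (y :: real^'n))"
    apply (rule hermite_kernel_boundsE[where 'n = 'n])
    subgoal premises p for C by (rule p(1)[OF p(2)], (rule p(3); blast), (rule p(4); blast))
    done
  define A' where "A' = 2 * D * (16 * real (CARD('n) + 1 + 1) ^ 2) ^ (CARD('n) + 1)"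
  have A': "A' \<ge> 0" unfolding A'_def using D0 by simp
  have R: "(CARD('n) + 2) * 4 ^ p \<ge> 1" for p :: nat
  proof -
    have "0 < (CARD('n) + 2) * 4 ^ p" by (intro mult_pos_pos) auto
    then show ?thesis by linarith
  qed
  have Z: "symbol x k * of_real (cutoff_piece (CARD('n) + 1) p k) = 0" if "k \<ge> (CARD('n) + 2) * 4 ^ p" for x k p
    using that by (simp add: cutoff_piece_eq_0(1))
  have F: "norm ((fdiff ^^ l) (\<lambda>k. symbol x k * of_real (cutoff_piece (CARD('n) + 1) p k)) k) \<le> A' / real ((CARD('n) + 2) * 4 ^ p) ^ l"
    if "l \<le> CARD('n) + 1" for x l k p
  proof -
    have "CARD('n) + 2 = CARD('n) + 1 + 1" by simp
    then show ?thesis unfolding A'_def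
      using cutoff_piece_mult[of "CARD('n) + 1" "symbol x" D l p k, OF _ that] differences[of _ x] unfolding symbol_def by presburger
  qed
  show ?thesis
  proof (rule that[of "C * A'"])
    show "C * A' \<ge> 0" using C(1) A' by simp
    show "norm (piece p x y) \<le> C * A' * bump (scale p) (x - y)" for p x y
      unfolding piece_def scale_eq[symmetric] by (rule C(2)[OF R Z F])
    show "norm (piece p x y' - piece p x y) \<le> C * A' * (scale p * r) * bump (scale p) (x - y)"
      if "norm (y' - y) \<le> r" "2 * r < norm (x - y)" for p x y y' r
      unfolding piece_def scale_eq[symmetric] by (rule C(3)[OF R Z F that])
  qed
qed

text \<open>
  If \<open>scale p \<sqdot> r\<close> is small, the difference bound is used on the whole space. If it is large, both terms are
  bounded separately, and only the tails of the bumps enter, as \<open>x\<close> is further than \<open>r\<close> from \<open>y\<close> and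
  \<open>y'\<close>.
\<close>

lemma piece_Hoermander:
  obtains H where "H \<ge> 0" "\<And>p y y' r. r > 0 \<Longrightarrow> norm (y' - y) \<le> r \<Longrightarrow>
       (\<integral>\<^sup>+x. ennreal (norm (piece p x y' - piece p x y)) * indicator {x. 2 * r < norm (x - y)} x \<partial>lebesgue)
       \<le> ennreal (H * min (scale p * r) (1 / (scale p * r)))"
proof -
  obtain C where C: "C \<ge> 0" "\<And>p x y. norm (piece p x y) \<le> C * bump (scale p) (x - y)"
    "\<And>p x y y' r. norm (y' - y) \<le> r \<Longrightarrow> 2 * r < norm (x - y) \<Longrightarrow>
       norm (piece p x y' - piece p x y) \<le> C * (scale p * r) * bump (scale p) (x - y)"
    by (rule piece_bounds) (rule that, assumption+)
  obtain b where b: "b > 0" "\<And>q y::real^'n. q > 0 \<Longrightarrow> (\<integral>\<^sup>+x. ennreal (bump q (x - y)) \<partial>lebesgue) \<le> ennreal b"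
     "\<And>q r y::real^'n. q > 0 \<Longrightarrow> r > 0 \<Longrightarrow> (\<integral>\<^sup>+x. ennreal (bump q (x - y)) * indicator {x. r < norm (x - y)} x \<partial>lebesgue) \<le> ennreal (b / (q * r))"
    by (rule bump_integralsE) (rule that, assumption+)
  show ?thesis
  proof (rule that[of "2 * C * b"])
    show "2 * C * b \<ge> 0" using C(1) b(1) by simp
    fix p and y y' :: "real^'n" and r :: real assume r: "r > 0" and yy: "norm (y' - y) \<le> r"
    let ?q = "scale p"
    have q: "?q > 0" by (rule scale_pos)
    let ?I = "\<integral>\<^sup>+x. ennreal (norm (piece p x y' - piece p x y)) * indicator {x. 2 * r < norm (x - y)} x \<partial>lebesgue"
    have near: "?I \<le> ennreal (2 * C * b * (?q * r))"
    proof -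
      have "?I \<le> (\<integral>\<^sup>+x. ennreal (C * (?q * r)) * ennreal (bump ?q (x - y)) \<partial>lebesgue)"
      proof (rule nn_integral_mono)
        fix x
        show "ennreal (norm (piece p x y' - piece p x y)) * indicator {x. 2 * r < norm (x - y)} x \<le> ennreal (C * (?q * r)) * ennreal (bump ?q (x - y))"
          using C(3)[OF yy, of x p] C(1) q r
          by (cases "2 * r < norm (x - y)") (auto simp: ennreal_mult[symmetric] bump_nonneg intro: ennreal_leI)
      qed
      also have "\<dots> = ennreal (C * (?q * r)) * (\<integral>\<^sup>+x. ennreal (bump ?q (x - y)) \<partial>lebesgue)"
        by (rule nn_integral_cmult[OF bump_shift_measurable(1)])
      also have "\<dots> \<le> ennreal (C * (?q * r)) * ennreal b" by (intro mult_left_mono b(2)[OF q]) simp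
      also have "\<dots> = ennreal (C * (?q * r) * b)" using C(1) q r b(1) by (intro ennreal_mult[symmetric]) auto
      also have "\<dots> \<le> ennreal (2 * C * b * (?q * r))"
      proof (rule ennreal_leI)
        have "0 \<le> C * (?q * r) * b" using C(1) q r b(1) by simp
        then show "C * (?q * r) * b \<le> 2 * C * b * (?q * r)" by (simp add: mult_ac)
      qed
      finally show ?thesis .
    qed
    have far: "?I \<le> ennreal (2 * C * b * (1 / (?q * r)))"
    proof -
      let ?B = "\<lambda>z x. ennreal (bump ?q (x - z)) * indicator {x. r < norm (x - z)} x"
      have "?I \<le> (\<integral>\<^sup>+x. ennreal C * (?B y' x + ?B y x) \<partial>lebesgue)"
      proof (rule nn_integral_mono)
        fix x
        show "ennreal (norm (piece p x y' - piece p x y)) * indicator {x. 2 * r < norm (x - y)} x \<le> ennreal C * (?B y' x + ?B y x)"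
        proof (cases "2 * r < norm (x - y)")
          case True
          have "norm (x - y) \<le> norm (x - y') + norm (y' - y)" using norm_triangle_ineq[of "x - y'" "y' - y"] by simp
          then have "r < norm (x - y')" "r < norm (x - y)" using True yy r by auto
          moreover have "norm (piece p x y' - piece p x y) \<le> C * (bump ?q (x - y') + bump ?q (x - y))"
            using norm_triangle_ineq4[of "piece p x y'" "piece p x y"] C(2)[of p x y'] C(2)[of p x y] by (simp add: distrib_left)
          then have "ennreal (norm (piece p x y' - piece p x y)) \<le> ennreal C * (ennreal (bump ?q (x - y')) + ennreal (bump ?q (x - y)))"
            using C(1) by (simp add: ennreal_plus[symmetric] ennreal_mult[symmetric] bump_nonneg less_imp_le[OF q] ennreal_leI del: ennreal_plus)
          ultimately show ?thesis using True by simp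
        qed simp
      qed
      also have "\<dots> = ennreal C * ((\<integral>\<^sup>+x. ?B y' x \<partial>lebesgue) + (\<integral>\<^sup>+x. ?B y x \<partial>lebesgue))"
        by (subst nn_integral_cmult[OF borel_measurable_add[OF bump_shift_measurable(2) bump_shift_measurable(2)]])
          (simp only: nn_integral_add[OF bump_shift_measurable(2) bump_shift_measurable(2)])
      also have "\<dots> \<le> ennreal C * (ennreal (b / (?q * r)) + ennreal (b / (?q * r)))"
        by (intro mult_left_mono add_mono b(3)[OF q r]) simp
      also have "\<dots> = ennreal (2 * C * b * (1 / (?q * r)))"
        using C(1) b(1) q r by (simp add: ennreal_plus[symmetric] ennreal_mult[symmetric] mult_ac del: ennreal_plus)
      finally show ?thesis .
    qed
    show "?I \<le> ennreal (2 * C * b * min (?q * r) (1 / (?q * r)))"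
      using near far by (cases "?q * r \<le> 1 / (?q * r)") (simp_all only: min_def if_True if_False)
  qed
qed

lemma kernel_Hoermander:
  obtains H where "H \<ge> 0" "\<And>J y y' r. r > 0 \<Longrightarrow> norm (y' - y) \<le> r \<Longrightarrow>
       (\<integral>\<^sup>+x. ennreal (norm (kernel J x y' - kernel J x y)) * indicator {x. 2 * r < norm (x - y)} x \<partial>lebesgue) \<le> ennreal H"
proof -
  obtain H where H: "H \<ge> 0" "\<And>p y y' r. r > 0 \<Longrightarrow> norm (y' - y) \<le> r \<Longrightarrow>
       (\<integral>\<^sup>+x. ennreal (norm (piece p x y' - piece p x y)) * indicator {x. 2 * r < norm (x - y)} x \<partial>lebesgue)
       \<le> ennreal (H * min (scale p * r) (1 / (scale p * r)))"
    by (rule piece_Hoermander) (rule that, assumption+)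
  show ?thesis
  proof (rule that[of "H * 6"])
    show "H * 6 \<ge> 0" using H(1) by simp
    fix J and y y' :: "real^'n" and r :: real assume r: "r > 0" and yy: "norm (y' - y) \<le> r"
    let ?d = "\<lambda>p x. ennreal (norm (piece p x y' - piece p x y)) * indicator {x. 2 * r < norm (x - y)} x"
    have "open {x. 2 * r < norm (x - y)}" by (intro open_Collect_less continuous_intros)
    then have S [measurable]: "{x. 2 * r < norm (x - y)} \<in> sets lebesgue" by simp
    have pm [measurable]: "(\<lambda>x. piece p x z) \<in> borel_measurable lebesgue" for p z
      unfolding piece_def by (rule kernel_measurable)
    have "(\<integral>\<^sup>+x. ennreal (norm (kernel J x y' - kernel J x y)) * indicator {x. 2 * r < norm (x - y)} x \<partial>lebesgue)
       \<le> (\<integral>\<^sup>+x. (\<Sum>p\<le>J. ?d p x) \<partial>lebesgue)"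
    proof (rule nn_integral_mono)
      fix x
      have "norm (kernel J x y' - kernel J x y) \<le> (\<Sum>p\<le>J. norm (piece p x y' - piece p x y))"
        unfolding kernel_eq_pieces sum_subtractf[symmetric] by (rule norm_sum)
      then have "ennreal (norm (kernel J x y' - kernel J x y)) \<le> (\<Sum>p\<le>J. ennreal (norm (piece p x y' - piece p x y)))"
        by (simp add: sum_ennreal ennreal_leI)
      then show "ennreal (norm (kernel J x y' - kernel J x y)) * indicator {x. 2 * r < norm (x - y)} x \<le> (\<Sum>p\<le>J. ?d p x)"
        unfolding sum_distrib_right[symmetric] by (rule mult_right_mono) simp
    qed
    also have "\<dots> = (\<Sum>p\<le>J. \<integral>\<^sup>+x. ?d p x \<partial>lebesgue)"
      by (rule nn_integral_sum) measurable
    also have "\<dots> \<le> (\<Sum>p\<le>J. ennreal (H * min (scale p * r) (1 / (scale p * r))))"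
      by (intro sum_mono H(2) r yy)
    also have "\<dots> = ennreal (\<Sum>p\<le>J. H * min (scale p * r) (1 / (scale p * r)))"
      using H(1) r scale_pos by (intro sum_ennreal mult_nonneg_nonneg) (auto intro!: less_imp_le)
    also have "\<dots> \<le> ennreal (H * 6)"
    proof (rule ennreal_leI)
      have "(\<Sum>p\<le>J. H * min (scale p * r) (1 / (scale p * r))) = H * (\<Sum>p\<le>J. min (scale 0 * r * 2 ^ p) (1 / (scale 0 * r * 2 ^ p)))"
        unfolding sum_distrib_left scale_def by (simp add: mult_ac)
      also have "\<dots> \<le> H * 6" by (intro mult_left_mono sum_min_dyadic H(1) mult_pos_pos scale_pos r)
      finally show "(\<Sum>p\<le>J. H * min (scale p * r) (1 / (scale p * r))) \<le> H * 6" .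
    qed
    finally show "(\<integral>\<^sup>+x. ennreal (norm (kernel J x y' - kernel J x y)) * indicator {x. 2 * r < norm (x - y)} x \<partial>lebesgue) \<le> ennreal (H * 6)" .
  qed
qed

text \<open>
  The kernel of \<open>T\<^sub>J\<close> has finite rank, satisfies Hoermander's condition uniformly in \<open>J\<close>, and has a uniform \<open>L\<^sup>2\<close>
  bound; hence \<open>W\<close> can be chosen independently of \<open>J\<close>.
\<close>

lemma truncation_weak_type:
  obtains W where "W \<ge> 0" "\<And>J f t. f \<in> Lp 1 \<Longrightarrow> f \<in> Lp 2 \<Longrightarrow> t > 0 \<Longrightarrow>
    emeasure lebesgue {x. t < norm (truncation J f x)} \<le> ennreal (W / t * (LINT x|lebesgue. norm (f x)))"
proof -
  obtain H where H: "H \<ge> 0" "\<And>J y y' r. r > 0 \<Longrightarrow> norm (y' - y) \<le> r \<Longrightarrow>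
       (\<integral>\<^sup>+x. ennreal (norm (kernel J x y' - kernel J x y)) * indicator {x. 2 * r < norm (x - y)} x \<partial>lebesgue) \<le> ennreal H"
    by (rule kernel_Hoermander) (rule that, assumption+)
  define W where "W = 24 * 2 ^ CARD('n) * A + unit_ball_vol (real CARD('n)) * (2 * real CARD('n)) ^ CARD('n) + 4 * H"
  have W: "W \<ge> 0" unfolding W_def using A0 H(1) by (intro add_nonneg_nonneg mult_nonneg_nonneg) auto
  have Cc_bound: "emeasure lebesgue {x. t < norm (truncation J \<phi> x)} \<le> ennreal (W / t * (LINT x|lebesgue. norm (\<phi> x)))"
    if \<phi>: "Cc \<phi>" and t: "t > 0" for J \<phi> t
  proof -
    have "\<phi> \<in> Lp 2" by (rule Cc_Lp[OF \<phi>]) simp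
    then have eq: "truncation J \<phi> = (\<lambda>x. LINT y|lebesgue. kernel J x y * \<phi> y)" by (auto simp: truncation_eq_kernel)
    show ?thesis unfolding eq W_def
    proof (rule Calderon_Zygmund_weak_type_Cc[where I = "{\<alpha>. sum \<alpha> UNIV < (CARD('n) + 2) * 4 ^ J}"
        and u = "\<lambda>\<alpha> x. symbol x (sum \<alpha> UNIV) * of_real (hermite \<alpha> x)"
        and v = "\<lambda>\<alpha> y. smooth_symbol (CARD('n) + 1) (4 ^ J) (sum \<alpha> UNIV) * of_real (hermite \<alpha> y)"])
      show "kernel J x y = (\<Sum>\<alpha> | sum \<alpha> UNIV < (CARD('n) + 2) * 4 ^ J. symbol x (sum \<alpha> UNIV) * of_real (hermite \<alpha> x) *
          (smooth_symbol (CARD('n) + 1) (4 ^ J) (sum \<alpha> UNIV) * of_real (hermite \<alpha> y)))" for x y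
        unfolding kernel_def hermite_kernel_def of_real_mult by (rule sum.cong) (simp_all only: mult_ac)
      show "(\<lambda>x. symbol x (sum \<alpha> UNIV) * of_real (hermite \<alpha> x)) \<in> borel_measurable lebesgue" for \<alpha>
        by (rule symbol_hermite_measurable)
      show "(\<lambda>y. smooth_symbol (CARD('n) + 1) (4 ^ J) (sum \<alpha> UNIV) * of_real (hermite \<alpha> y)) \<in> Lp 2" for \<alpha>
        by (intro Lp_cmult hermite_Lp2)
      show "(\<lambda>x. LINT y|lebesgue. kernel J x y * f y) \<in> Lp 2 \<and> L2_sq (\<lambda>x. LINT y|lebesgue. kernel J x y * f y) \<le> A * L2_sq f"
        if "f \<in> Lp 2" for f
        using truncation_Lp2[of J f] truncation_L2_bound[OF that, of J] unfolding truncation_eq_kernel[OF that, symmetric] by simp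
    qed (use H A0 \<phi> t in auto)
  qed
  show ?thesis
  proof (rule that[of "2 * W"])
    show "2 * W \<ge> 0" using W by simp
    fix J and f :: "real^'n \<Rightarrow> complex" and t :: real assume f: "f \<in> Lp 1" "f \<in> Lp 2" and t: "t > 0"
    show "emeasure lebesgue {x. t < norm (truncation J f x)} \<le> ennreal (2 * W / t * (LINT x|lebesgue. norm (f x)))"
      by (rule weak_type_extend[OF truncation_Lp2 truncation_L2_bound A0 truncation_diff Cc_bound W f t])
  qed
qed

section \<open>Passage to the pseudo-multiplier\<close>

text \<open>
  Convergence in \<open>L\<^sup>2\<close> implies convergence in measure, at the expense of raising the level by an arbitrary
  \<open>s' > 0\<close>.
\<close>

lemma graph_level_set:
  assumes fg: "(f, g) \<in> hermite_pseudo_multiplier m" and s: "s' > 0"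
    and le: "\<And>J. emeasure lebesgue {x. s < norm (truncation J f x)} \<le> a"
  shows "emeasure lebesgue {x. s + s' < norm (g x)} \<le> a"
proof (rule ennreal_le_epsilon)
  fix e :: real assume e: "e > 0"
  have g: "g \<in> Lp 2" using fg unfolding hermite_pseudo_multiplier_def by auto
  obtain J where J: "L2_sq (\<lambda>x. truncation J f x - g x) < e * s'\<^sup>2"
  proof -
    have "e * s'\<^sup>2 > 0" using e s by simp
    from LIMSEQ_D[OF truncation_tendsto[OF fg] this] that show thesis using L2_sq_nonneg by auto
  qed
  let ?d = "\<lambda>x. truncation J f x - g x"
  have d: "?d \<in> Lp 2" by (intro Lp_diff truncation_Lp2 g) simp
  let ?A = "{x \<in> UNIV. s < norm (truncation J f x)}" and ?B = "{x \<in> UNIV. s' < norm (?d x)}"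
  have m: "?A \<in> sets lebesgue" "?B \<in> sets lebesgue"
    by (intro level_set_measurable Lp_measurable[OF truncation_Lp2] Lp_measurable[OF d]; simp)+
  have "{x. s + s' < norm (g x)} \<subseteq> ?A \<union> ?B"
  proof
    fix x assume "x \<in> {x. s + s' < norm (g x)}"
    moreover have "norm (g x) \<le> norm (truncation J f x) + norm (?d x)"
      using norm_triangle_ineq4[of "truncation J f x" "?d x"] by simp
    ultimately show "x \<in> ?A \<union> ?B" by auto
  qed
  then have "emeasure lebesgue {x. s + s' < norm (g x)} \<le> emeasure lebesgue (?A \<union> ?B)" by (rule emeasure_mono) (intro sets.Un m)
  also have "\<dots> \<le> emeasure lebesgue ?A + emeasure lebesgue ?B" by (rule emeasure_subadditive[OF m])
  also have "\<dots> \<le> a + ennreal e"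
  proof (rule add_mono)
    show "emeasure lebesgue ?A \<le> a" using le[of J] by simp
    have "emeasure lebesgue ?B \<le> ennreal (1 / s' ^ 2) * (\<integral>\<^sup>+x. ennreal (norm (?d x) ^ 2) * indicator UNIV x \<partial>lebesgue)"
      by (rule weak_Markov) (use s Lp_measurable[OF d] in auto)
    also have "(\<integral>\<^sup>+x. ennreal (norm (?d x) ^ 2) * indicator UNIV x \<partial>lebesgue) = ennreal (L2_sq ?d)"
      using nn_integral_L2_sq[OF d] by simp
    also have "ennreal (1 / s' ^ 2) * ennreal (L2_sq ?d) = ennreal (1 / s' ^ 2 * L2_sq ?d)"
      using L2_sq_nonneg by (intro ennreal_mult[symmetric]) auto
    also have "\<dots> \<le> ennreal e" using J s by (intro ennreal_leI) (simp add: field_simps)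
    finally show "emeasure lebesgue ?B \<le> ennreal e" .
  qed
  finally show "emeasure lebesgue {x. s + s' < norm (g x)} \<le> a + ennreal e" .
qed

lemma graph_dense:
  assumes p: "p \<ge> 1"
  shows "dense_in_Lp p (Domain (hermite_pseudo_multiplier m))"
  unfolding dense_in_Lp_def
proof (intro ballI allI impI)
  fix f :: "real^'n \<Rightarrow> complex" and e :: real assume f: "f \<in> Lp p" and e: "e > 0"
  define \<delta> where "\<delta> = e powr p / (4 * 2 powr p)"
  have \<delta>: "\<delta> > 0" unfolding \<delta>_def using e by simp
  have "\<exists>\<phi>. Cc \<phi> \<and> (\<forall>p\<in>{p}. (LINT x|lebesgue. norm (f x - \<phi> x) powr p) < \<delta>)"
    by (rule Cc_dense) (use f p \<delta> Lp_measurable[OF f] in auto)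
  then obtain \<phi> where \<phi>: "Cc \<phi>" and d1: "(LINT x|lebesgue. norm (f x - \<phi> x) powr p) < \<delta>" by auto
  have \<phi>p: "\<phi> \<in> Lp p" by (rule Cc_Lp[OF \<phi>]) (use p in simp)
  obtain R where "norm ((LINT x|lebesgue. norm (\<phi> x - smooth_sum (Suc R) \<phi> x) powr p) - 0) < \<delta>"
    using LIMSEQ_D[OF smooth_sum_tendsto(1)[OF \<phi> p] \<delta>] by blast
  then have d2: "(LINT x|lebesgue. norm (\<phi> x - smooth_sum (Suc R) \<phi> x) powr p) < \<delta>" by simp
  let ?S = "smooth_sum (Suc R) \<phi>"
  have S: "?S \<in> Lp p" by (rule smooth_sum_tendsto(2)[OF \<phi> p])
  have D: "?S \<in> Domain (hermite_pseudo_multiplier m)" unfolding smooth_sum_def using mult_in_graph by blast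
  have p0: "p \<ge> 0" using p by simp
  have i1: "integrable lebesgue (\<lambda>x. norm (f x - \<phi> x) powr p)" using Lp_diff[OF f \<phi>p p0] by (simp add: Lp_def)
  have i2: "integrable lebesgue (\<lambda>x. norm (\<phi> x - ?S x) powr p)" using Lp_diff[OF \<phi>p S p0] by (simp add: Lp_def)
  have i3: "integrable lebesgue (\<lambda>x. norm (f x - ?S x) powr p)" using Lp_diff[OF f S p0] by (simp add: Lp_def)
  have "(LINT x|lebesgue. norm (f x - ?S x) powr p) \<le> (LINT x|lebesgue. 2 powr p * (norm (f x - \<phi> x) powr p + norm (\<phi> x - ?S x) powr p))"
  proof (rule integral_mono[OF i3])
    fix x
    have "norm (f x - ?S x) \<le> norm (f x - \<phi> x) + norm (\<phi> x - ?S x)"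
      using norm_triangle_ineq[of "f x - \<phi> x" "\<phi> x - ?S x"] by simp
    then have "norm (f x - ?S x) powr p \<le> (norm (f x - \<phi> x) + norm (\<phi> x - ?S x)) powr p" using p0 by (intro powr_mono2) auto
    also have "\<dots> \<le> 2 powr p * (norm (f x - \<phi> x) powr p + norm (\<phi> x - ?S x) powr p)" by (rule add_powr_le) (use p0 in auto)
    finally show "norm (f x - ?S x) powr p \<le> 2 powr p * (norm (f x - \<phi> x) powr p + norm (\<phi> x - ?S x) powr p)" .
  qed (use i1 i2 in auto)
  also have "\<dots> = 2 powr p * ((LINT x|lebesgue. norm (f x - \<phi> x) powr p) + (LINT x|lebesgue. norm (\<phi> x - ?S x) powr p))"
    using i1 i2 by simp
  also have "\<dots> < 2 powr p * (\<delta> + \<delta>)" using d1 d2 by (intro mult_strict_left_mono add_strict_mono) auto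
  also have "\<dots> = e powr p / 2" unfolding \<delta>_def by simp
  also have "\<dots> < e powr p" using e by simp
  finally have "Lp_norm p (\<lambda>x. f x - ?S x) < (e powr p) powr (1 / p)"
    unfolding Lp_norm_def using p by (intro powr_less_mono2) auto
  also have "\<dots> = e" using e p by (simp add: powr_powr)
  finally show "\<exists>h\<in>Domain (hermite_pseudo_multiplier m) \<inter> Lp p. Lp_norm p (\<lambda>x. f x - h x) < e" using D S by blast
qed

text \<open>
  The split \<open>f = f1 + f2\<close> at height \<open>s\<close> is made in \<open>T\<^sub>J f\<close> and not in \<open>g\<close>, since \<open>f1\<close> and \<open>f2\<close> may lie outside the
  domain of \<open>m(x,H)\<close>, while \<open>T\<^sub>J\<close> is defined on all of \<open>L\<^sup>2\<close>. The level \<open>3 s\<close> accounts for \<open>T\<^sub>J f1\<close>, \<open>T\<^sub>J f2\<close> and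
  \<open>g - T\<^sub>J f\<close>.
\<close>

lemma graph_distribution:
  assumes W: "W \<ge> 0" "\<And>J f t. f \<in> Lp 1 \<Longrightarrow> f \<in> Lp 2 \<Longrightarrow> t > 0 \<Longrightarrow>
      emeasure lebesgue {x. t < norm (truncation J f x)} \<le> ennreal (W / t * (LINT x|lebesgue. norm (f x)))"
    and fg: "(f, g) \<in> hermite_pseudo_multiplier m" and s: "s > 0"
  shows "emeasure lebesgue {x. 3 * s < norm (g x)} \<le>
      ennreal (W / s) * (\<integral>\<^sup>+x. ennreal (norm (f x)) * indicator {x. s < norm (f x)} x \<partial>lebesgue)
      + ennreal (A / s\<^sup>2) * (\<integral>\<^sup>+x. ennreal ((norm (f x))\<^sup>2) * indicator {x. norm (f x) \<le> s} x \<partial>lebesgue)" (is "_ \<le> ?a1 + ?a2")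
proof -
  have f: "f \<in> Lp 2" using fg unfolding hermite_pseudo_multiplier_def by auto
  note [measurable] = Lp_measurable[OF f]
  define f1 where "f1 x = (if s < norm (f x) then f x else 0)" for x
  define f2 where "f2 x = f x - f1 x" for x
  have f1m [measurable]: "f1 \<in> borel_measurable lebesgue" unfolding f1_def[abs_def] by measurable
  have f1: "f1 \<in> Lp 2" by (rule Lp_bound[OF f f1m]) (auto simp: f1_def)
  have f2: "f2 \<in> Lp 2" unfolding f2_def[abs_def] by (rule Lp_diff[OF f f1]) simp
  have f1': "f1 \<in> Lp 1"
  proof -
    have "integrable lebesgue (\<lambda>x. (norm (f x))\<^sup>2 / s)" using f by (simp add: Lp_2_iff)
    then have "integrable lebesgue (\<lambda>x. norm (f1 x))"
    proof (rule Bochner_Integration.integrable_bound)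
      show "AE x in lebesgue. norm (norm (f1 x)) \<le> norm ((norm (f x))\<^sup>2 / s)"
      proof (rule AE_I2)
        fix x
        have "norm (f x) * s \<le> norm (f x) * norm (f x)" if "s < norm (f x)" using that by (intro mult_left_mono) auto
        then show "norm (norm (f1 x)) \<le> norm ((norm (f x))\<^sup>2 / s)"
          using s by (auto simp: f1_def power2_eq_square field_simps)
      qed
    qed measurable
    then show ?thesis by (simp add: Lp_1_iff)
  qed
  have "emeasure lebesgue {x. 2 * s < norm (truncation J f x)} \<le> ?a1 + ?a2" for J
  proof -
    let ?A = "{x \<in> UNIV. s < norm (truncation J f1 x)}" and ?B = "{x \<in> UNIV. s < norm (truncation J f2 x)}"
    have m: "?A \<in> sets lebesgue" "?B \<in> sets lebesgue"
      by (intro level_set_measurable Lp_measurable[OF truncation_Lp2]; simp)+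
    have "{x. 2 * s < norm (truncation J f x)} \<subseteq> ?A \<union> ?B"
    proof
      fix x assume "x \<in> {x. 2 * s < norm (truncation J f x)}"
      moreover have "norm (truncation J f x) \<le> norm (truncation J f1 x) + norm (truncation J f2 x)"
        using norm_triangle_ineq[of "truncation J f1 x" "truncation J f2 x"] truncation_diff[OF f f1, of J x]
        unfolding f2_def[abs_def] by simp
      ultimately show "x \<in> ?A \<union> ?B" by auto
    qed
    then have "emeasure lebesgue {x. 2 * s < norm (truncation J f x)} \<le> emeasure lebesgue (?A \<union> ?B)" by (rule emeasure_mono) (intro sets.Un m)
    also have "\<dots> \<le> emeasure lebesgue ?A + emeasure lebesgue ?B" by (rule emeasure_subadditive[OF m])
    also have "\<dots> \<le> ?a1 + ?a2"
    proof (rule add_mono)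
      have "emeasure lebesgue ?A \<le> ennreal (W / s * (LINT x|lebesgue. norm (f1 x)))" using W(2)[OF f1' f1 s, of J] by simp
      also have "\<dots> = ennreal (W / s) * ennreal (LINT x|lebesgue. norm (f1 x))" using W(1) s by (intro ennreal_mult) auto
      also have "ennreal (LINT x|lebesgue. norm (f1 x)) = (\<integral>\<^sup>+x. ennreal (norm (f1 x)) \<partial>lebesgue)"
        using f1' by (intro nn_integral_eq_integral[symmetric]) (auto simp: Lp_1_iff)
      also have "\<dots> = (\<integral>\<^sup>+x. ennreal (norm (f x)) * indicator {x. s < norm (f x)} x \<partial>lebesgue)"
        by (intro nn_integral_cong) (simp add: f1_def)
      finally show "emeasure lebesgue ?A \<le> ?a1" .
      have "emeasure lebesgue ?B \<le> ennreal (1 / s ^ 2) * (\<integral>\<^sup>+x. ennreal (norm (truncation J f2 x) ^ 2) * indicator UNIV x \<partial>lebesgue)"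
        by (rule weak_Markov) (use s Lp_measurable[OF truncation_Lp2] in auto)
      also have "(\<integral>\<^sup>+x. ennreal (norm (truncation J f2 x) ^ 2) * indicator UNIV x \<partial>lebesgue) = ennreal (L2_sq (truncation J f2))"
        using nn_integral_L2_sq[OF truncation_Lp2] by simp
      also have "ennreal (1 / s ^ 2) * ennreal (L2_sq (truncation J f2)) \<le> ennreal (1 / s ^ 2) * ennreal (A * L2_sq f2)"
        by (intro mult_left_mono ennreal_leI truncation_L2_bound f2) simp
      also have "\<dots> = ennreal (1 / s ^ 2 * (A * L2_sq f2))" using A0 L2_sq_nonneg[of f2] by (intro ennreal_mult[symmetric]) auto
      also have "1 / s ^ 2 * (A * L2_sq f2) = A / s\<^sup>2 * L2_sq f2" by simp
      also have "ennreal (A / s\<^sup>2 * L2_sq f2) = ennreal (A / s\<^sup>2) * ennreal (L2_sq f2)" using A0 L2_sq_nonneg[of f2] by (intro ennreal_mult) auto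
      also have "ennreal (L2_sq f2) = (\<integral>\<^sup>+x. ennreal ((norm (f x))\<^sup>2) * indicator {x. norm (f x) \<le> s} x \<partial>lebesgue)"
        unfolding nn_integral_L2_sq[OF f2, symmetric] by (intro nn_integral_cong) (auto simp: f2_def f1_def)
      finally show "emeasure lebesgue ?B \<le> ?a2" .
    qed
    finally show ?thesis .
  qed
  from graph_level_set[OF fg s this] show ?thesis by simp
qed

theorem multiplier_weak_type_1_1: "weak_type_1_1 (hermite_pseudo_multiplier m)"
proof -
  obtain W where W: "W \<ge> 0" "\<And>J f t. f \<in> Lp 1 \<Longrightarrow> f \<in> Lp 2 \<Longrightarrow> t > 0 \<Longrightarrow>
    emeasure lebesgue {x. t < norm (truncation J f x)} \<le> ennreal (W / t * (LINT x|lebesgue. norm (f x)))"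
    by (rule truncation_weak_type) (rule that, assumption+)
  have "emeasure lebesgue {x. norm (g x) > t} \<le> ennreal (2 * W / t * Lp_norm 1 f)"
    if fg: "(f, g) \<in> hermite_pseudo_multiplier m" and f: "f \<in> Lp 1" and t: "t > 0" for f g t
  proof -
    have f2: "f \<in> Lp 2" using fg unfolding hermite_pseudo_multiplier_def by auto
    have "emeasure lebesgue {x. t / 2 + t / 2 < norm (g x)} \<le> ennreal (W / (t / 2) * (LINT x|lebesgue. norm (f x)))"
      by (rule graph_level_set[OF fg _ W(2)[OF f f2]]) (use t in auto)
    moreover have "Lp_norm 1 f = (LINT x|lebesgue. norm (f x))" by (simp add: Lp_norm_def)
    ultimately show ?thesis by (simp add: mult.commute)
  qed
  moreover have "g \<in> borel_measurable lebesgue" if "(f, g) \<in> hermite_pseudo_multiplier m" for f g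
    using that Lp_measurable unfolding hermite_pseudo_multiplier_def by auto
  ultimately show ?thesis unfolding weak_type_1_1_def using graph_dense[of 1] by (intro conjI exI[of _ "2 * W"]) auto
qed

theorem multiplier_bounded_on_Lp:
  assumes p: "1 < p" "p < 2"
  shows "bounded_on_Lp p (hermite_pseudo_multiplier m)"
proof -
  obtain W where W: "W \<ge> 0" "\<And>J f t. f \<in> Lp 1 \<Longrightarrow> f \<in> Lp 2 \<Longrightarrow> t > 0 \<Longrightarrow>
    emeasure lebesgue {x. t < norm (truncation J f x)} \<le> ennreal (W / t * (LINT x|lebesgue. norm (f x)))"
    by (rule truncation_weak_type) (rule that, assumption+)
  define E where "E = \<bar>6 powr p * (W / (1 - 2 powr (- (p - 1))) + A / (1 - 2 powr (- (2 - p))))\<bar>"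
  have E0: "E \<ge> 0" by (simp add: E_def)
  have "g \<in> Lp p \<and> Lp_norm p g \<le> E powr (1 / p) * Lp_norm p f"
    if fg: "(f, g) \<in> hermite_pseudo_multiplier m" and f: "f \<in> Lp p" for f g
  proof -
    have g: "g \<in> borel_measurable lebesgue" using fg Lp_measurable unfolding hermite_pseudo_multiplier_def by auto
    have fi: "integrable lebesgue (\<lambda>x. norm (f x) powr p)" using f by (simp add: Lp_def)
    let ?N = "LINT x|lebesgue. norm (f x) powr p"
    have N0: "?N \<ge> 0" by simp
    have "(\<integral>\<^sup>+x. ennreal (norm (g x) powr p) \<partial>lebesgue)
       \<le> ennreal (6 powr p * (W / (1 - 2 powr (- (p - 1))) + A / (1 - 2 powr (- (2 - p))))) * (\<integral>\<^sup>+x. ennreal (norm (f x) powr p) \<partial>lebesgue)"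
      by (rule Marcinkiewicz_dyadic[OF Lp_measurable[OF f] g p W(1) A0 graph_distribution[OF W fg]])
    also have "\<dots> \<le> ennreal E * (\<integral>\<^sup>+x. ennreal (norm (f x) powr p) \<partial>lebesgue)"
      unfolding E_def by (intro mult_right_mono ennreal_leI abs_ge_self) simp
    also have "(\<integral>\<^sup>+x. ennreal (norm (f x) powr p) \<partial>lebesgue) = ennreal ?N" by (rule nn_integral_eq_integral[OF fi]) simp
    also have "ennreal E * ennreal ?N = ennreal (E * ?N)" using E0 by (intro ennreal_mult[symmetric]) auto
    finally have le: "(\<integral>\<^sup>+x. ennreal (norm (g x) powr p) \<partial>lebesgue) \<le> ennreal (E * ?N)" .
    have gi: "integrable lebesgue (\<lambda>x. norm (g x) powr p)"
    proof (rule integrableI_bounded)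
      show "(\<lambda>x. norm (g x) powr p) \<in> borel_measurable lebesgue" using g by measurable
      show "(\<integral>\<^sup>+x. ennreal (norm (norm (g x) powr p)) \<partial>lebesgue) < \<infinity>"
        using le_less_trans[OF le, of \<infinity>] by simp
    qed
    have "(LINT x|lebesgue. norm (g x) powr p) \<le> E * ?N"
      using le unfolding nn_integral_eq_integral[OF gi AE_I2[OF powr_ge_zero]] using E0 by (simp add: ennreal_le_iff)
    then have "Lp_norm p g \<le> (E * ?N) powr (1 / p)" unfolding Lp_norm_def using p by (intro powr_mono2) auto
    also have "\<dots> = E powr (1 / p) * Lp_norm p f" unfolding Lp_norm_def by (rule powr_mult)
    finally show ?thesis using g gi by (simp add: Lp_def)
  qed
  then show ?thesis unfolding bounded_on_Lp_def using graph_dense[of p] p by (intro conjI exI[of _ "E powr (1 / p)"]) auto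
qed

end

section \<open>The symbol along the spectrum\<close>

lemma fin_diff_iterate: "(fin_diff ^^ j) m x = (fdiff ^^ j) (m x)"
  by (induction j) (auto simp: fin_diff_def fdiff_def)

lemma fdiff_pow_bounded:
  fixes f :: "nat \<Rightarrow> complex"
  assumes "\<And>k. norm (f k) \<le> b"
  shows "norm ((fdiff ^^ j) f k) \<le> 2 ^ j * b"
proof (induction j arbitrary: k)
  case (Suc j)
  have "norm ((fdiff ^^ Suc j) f k) \<le> norm ((fdiff ^^ j) f (Suc k)) + norm ((fdiff ^^ j) f k)"
    by (simp add: fdiff_def norm_triangle_ineq4)
  also have "\<dots> \<le> 2 ^ j * b + 2 ^ j * b" by (intro add_mono Suc)
  finally show ?case by (simp add: mult_ac)
qed (use assms in simp)

text \<open>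
  Passing to every second index replaces the difference by \<open>a(j+2) - a(j)\<close>, the sum of two consecutive
  differences. So each order costs a factor \<open>2\<close>.
\<close>

lemma fdiff_pow_double:
  fixes a :: "nat \<Rightarrow> complex"
  assumes "\<And>j. j \<ge> 2 * k + c \<Longrightarrow> norm ((fdiff ^^ l) a j) \<le> b"
  shows "norm ((fdiff ^^ l) (\<lambda>k. a (2 * k + c)) k) \<le> 2 ^ l * b"
  using assms
proof (induction l arbitrary: a b)
  case (Suc l)
  define a' where "a' j = fdiff a j + fdiff a (j + 1)" for j
  have "fdiff (\<lambda>k. a (2 * k + c)) = (\<lambda>k. a' (2 * k + c))" by (auto simp: fdiff_def a'_def)
  moreover have "norm ((fdiff ^^ l) (\<lambda>k. a' (2 * k + c)) k) \<le> 2 ^ l * (b + b)"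
  proof (rule Suc.IH)
    fix j assume j: "j \<ge> 2 * k + c"
    have "(fdiff ^^ l) a' j = (fdiff ^^ Suc l) a j + (fdiff ^^ Suc l) a (j + 1)"
      unfolding a'_def[abs_def] fdiff_pow_add fdiff_pow_shift fdiff_pow_Suc ..
    also have "norm \<dots> \<le> b + b"
      using order_trans[OF norm_triangle_ineq add_mono[OF Suc.prems[of j] Suc.prems[of "j + 1"]]] j by simp
    finally show "norm ((fdiff ^^ l) a' j) \<le> b + b" .
  qed
  ultimately show ?case unfolding fdiff_pow_Suc by simp
qed simp

theorem theorem1p2:
  fixes m :: "real ^ 'n \<Rightarrow> nat \<Rightarrow> complex"
  assumes n_ge_2: "CARD('n) \<ge> 2"
    and m_bounded: "\<exists>B. \<forall>x k. norm (m x k) \<le> B"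
    and L2_bounded: "bounded_on_Lp 2 (hermite_pseudo_multiplier m)"
    and differences: "\<forall>j \<le> CARD('n) + 1. \<exists>C::real. \<forall>k.
          (SUP x. norm ((fin_diff ^^ j) m x k)) \<le> C / real (2 * k + CARD('n)) ^ j"
  shows "weak_type_1_1 (hermite_pseudo_multiplier m) \<and>
         (\<forall>p. 1 < p \<and> p < 2 \<longrightarrow> bounded_on_Lp p (hermite_pseudo_multiplier m))"
proof -
  obtain B where B: "\<And>x k. norm (m x k) \<le> B" using m_bounded by blast
  obtain c where c: "\<And>f g. (f, g) \<in> hermite_pseudo_multiplier m \<Longrightarrow> f \<in> Lp 2 \<Longrightarrow> Lp_norm 2 g \<le> c * Lp_norm 2 f"
    using L2_bounded unfolding bounded_on_Lp_def by blast
  have L2: "L2_sq g \<le> c\<^sup>2 * L2_sq f" if fg: "(f, g) \<in> hermite_pseudo_multiplier m" for f g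
  proof -
    have "f \<in> Lp 2" using fg unfolding hermite_pseudo_multiplier_def by auto
    then have "sqrt (L2_sq g) \<le> c * sqrt (L2_sq f)" using c[OF fg] unfolding Lp_norm_2 by simp
    then have "(sqrt (L2_sq g))\<^sup>2 \<le> (c * sqrt (L2_sq f))\<^sup>2" by (rule power_mono) (simp add: L2_sq_nonneg)
    then show ?thesis by (simp add: power_mult_distrib L2_sq_nonneg)
  qed
  have "\<forall>j. \<exists>C. j \<le> CARD('n) + 1 \<longrightarrow> (\<forall>k. (SUP x. norm ((fin_diff ^^ j) m x k)) \<le> C / real (2 * k + CARD('n)) ^ j)"
    using differences by blast
  then obtain C where C: "\<And>j k. j \<le> CARD('n) + 1 \<Longrightarrow> (SUP x. norm ((fin_diff ^^ j) m x k)) \<le> C j / real (2 * k + CARD('n)) ^ j"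
    by metis
  have diff: "norm ((fdiff ^^ j) (m x) k) \<le> C j / real (2 * k + CARD('n)) ^ j" if "j \<le> CARD('n) + 1" for x j k
  proof -
    \<comment> \<open>Boundedness of \<open>m\<close> makes the supremum over \<open>x\<close> a genuine one.\<close>
    have "bdd_above (range (\<lambda>x. norm ((fin_diff ^^ j) m x k)))"
      unfolding fin_diff_iterate by (rule bdd_aboveI2[of _ _ "2 ^ j * B"]) (rule fdiff_pow_bounded[OF B])
    then have "norm ((fin_diff ^^ j) m x k) \<le> (SUP x. norm ((fin_diff ^^ j) m x k))" by (rule cSUP_upper[OF UNIV_I])
    also have "\<dots> \<le> C j / real (2 * k + CARD('n)) ^ j" by (rule C[OF that])
    finally show ?thesis unfolding fin_diff_iterate .
  qed
  define D where "D = (\<Sum>j\<le>CARD('n) + 1. 2 ^ j * \<bar>C j\<bar>)"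
  have D0: "D \<ge> 0" unfolding D_def by (intro sum_nonneg) auto
  have symb: "norm ((fdiff ^^ l) (\<lambda>k. m x (2 * k + CARD('n))) k) \<le> D / real (k + 1) ^ l" if l: "l \<le> CARD('n) + 1" for x l k
  proof -
    have "norm ((fdiff ^^ l) (\<lambda>k. m x (2 * k + CARD('n))) k) \<le> 2 ^ l * (\<bar>C l\<bar> / real (k + 1) ^ l)"
    proof (rule fdiff_pow_double)
      fix j assume j: "j \<ge> 2 * k + CARD('n)"
      have "k + 1 \<le> 2 * j + CARD('n)" using j n_ge_2 by linarith
      then have le: "real (k + 1) ^ l \<le> real (2 * j + CARD('n)) ^ l" by (intro power_mono) linarith+
      have "norm ((fdiff ^^ l) (m x) j) \<le> C l / real (2 * j + CARD('n)) ^ l" by (rule diff[OF l])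
      also have "\<dots> \<le> \<bar>C l\<bar> / real (2 * j + CARD('n)) ^ l" by (intro divide_right_mono) auto
      also have "\<dots> \<le> \<bar>C l\<bar> / real (k + 1) ^ l" using n_ge_2 by (intro divide_left_mono le mult_pos_pos zero_less_power) auto
      finally show "norm ((fdiff ^^ l) (m x) j) \<le> \<bar>C l\<bar> / real (k + 1) ^ l" .
    qed
    also have "\<dots> = 2 ^ l * \<bar>C l\<bar> / real (k + 1) ^ l" by simp
    also have "\<dots> \<le> D / real (k + 1) ^ l"
      unfolding D_def using l by (intro divide_right_mono member_le_sum[of l]) auto
    finally show ?thesis .
  qed
  interpret hermite_multiplier m B "c\<^sup>2" D
    by unfold_locales (use B L2_bounded L2 symb D0 in \<open>auto simp: bounded_on_Lp_def\<close>)
  show ?thesis using multiplier_weak_type_1_1 multiplier_bounded_on_Lp by blast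
qed

end
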